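(* Let $G=(A\cup P,E)$ be a bipartite graph in which every applicant $a\in A$ ranks its neighbours in $P$ in a preference list (ties allowed) and can be matched to at most one post, and every post $p\in P$ has a positive integer quota $q(p)$ and a classification $\mathcal{C}_p$ over $N(p)$ that is a laminar family, each class $C\in\mathcal{C}_p$ having a quota $q(C)$. Then there is an algorithm running in time $O(|A|\,|E|)$ that outputs a matching that is popular among all feasible matchings of $G$ if such a matching exists, and reports that none exists otherwise.
   Context: A matching is a set $M\subseteq E$ in which each applicant has at most one incident edge; $M(u)$ denotes the set of partners of $u$ and $M(a)$ the post of $a$ (if any). $M$ is feasible if for every post $p$, $|M(p)|\le q(p)$ and $|M(p)\cap C|\le q(C)$ for every $C\in\mathcal{C}_p$. For two feasible matchings $M,M'$, an applicant $a$ prefers $M$ to $M'$ if $a$ ranks $M(a)$ strictly better than $M'(a)$, where being matched to any neighbour is strictly better than being unmatched and posts of equal rank are tied. $M$ is more popular than $M'$ if more applicants prefer $M$ to $M'$ than prefer $M'$ to $M$. A feasible matching $M$ is popular among feasible matchings if no feasible matching is more popular than $M$. A family of sets is laminar if any two members are either nested or disjoint. *)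

theory Defs
  imports Main
begin

section \<open>Instances and popular matchings\<close>

text \<open>
  The bipartition is tagged: an edge is an ordered pair of an applicant and a post, so applicants
  and posts may share a type. A smaller rank is better and equal ranks are ties. The quota
  \<open>cquota G p C\<close> of a class takes the post as an argument because the same set of applicants may be
  a class of several posts.
\<close>

record ('a, 'p) inst =
  appl :: "'a set"
  posts :: "'p set"
  edges :: "('a \<times> 'p) set"
  rank :: "'a \<Rightarrow> 'p \<Rightarrow> nat"
  quota :: "'p \<Rightarrow> nat"
  classes :: "'p \<Rightarrow> 'a set set"
  cquota :: "'p \<Rightarrow> 'a set \<Rightarrow> nat"

definition laminar :: "'a set set \<Rightarrow> bool" where
  "laminar F \<longleftrightarrow> (\<forall>X\<in>F. \<forall>Y\<in>F. X \<subseteq> Y \<or> Y \<subseteq> X \<or> X \<inter> Y = {})"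

definition well_formed :: "('a, 'p) inst \<Rightarrow> bool" where
  "well_formed G \<longleftrightarrow>
     finite (appl G) \<and> finite (posts G) \<and> edges G \<subseteq> appl G \<times> posts G \<and>
     (\<forall>p\<in>posts G. 0 < quota G p \<and>
        (\<forall>C\<in>classes G p. C \<subseteq> {a. (a, p) \<in> edges G}) \<and> laminar (classes G p))"

definition matching :: "('a, 'p) inst \<Rightarrow> ('a \<times> 'p) set \<Rightarrow> bool" where
  "matching G M \<longleftrightarrow>
     M \<subseteq> edges G \<and> (\<forall>a p p'. (a, p) \<in> M \<longrightarrow> (a, p') \<in> M \<longrightarrow> p = p')"

definition feasible :: "('a, 'p) inst \<Rightarrow> ('a \<times> 'p) set \<Rightarrow> bool" where
  "feasible G M \<longleftrightarrow> matching G M \<and>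
     (\<forall>p\<in>posts G. card {a. (a, p) \<in> M} \<le> quota G p \<and>
        (\<forall>C\<in>classes G p. card ({a. (a, p) \<in> M} \<inter> C) \<le> cquota G p C))"

definition prefers :: "('a, 'p) inst \<Rightarrow> 'a \<Rightarrow> ('a \<times> 'p) set \<Rightarrow> ('a \<times> 'p) set \<Rightarrow> bool" where
  "prefers G a M M' \<longleftrightarrow>
     (\<exists>p. (a, p) \<in> M \<and> (\<forall>p'. (a, p') \<in> M' \<longrightarrow> rank G a p < rank G a p'))"

definition more_popular :: "('a, 'p) inst \<Rightarrow> ('a \<times> 'p) set \<Rightarrow> ('a \<times> 'p) set \<Rightarrow> bool" where
  "more_popular G M M' \<longleftrightarrow>
     card {a \<in> appl G. prefers G a M M'} > card {a \<in> appl G. prefers G a M' M}"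

definition popular :: "('a, 'p) inst \<Rightarrow> ('a \<times> 'p) set \<Rightarrow> bool" where
  "popular G M \<longleftrightarrow> feasible G M \<and> \<not> (\<exists>M'. feasible G M' \<and> more_popular G M' M)"


section \<open>Algorithms and their running time\<close>

text \<open>
  Algorithms are programs of a random access machine in structured form: finitely many registers
  and finitely many unbounded arrays of natural numbers, with addition, truncated subtraction,
  comparison and indirect addressing as the only operations. Every assignment, every store and
  every evaluated test costs one unit. The expressions occurring in a program have bounded size, so
  charging for each operation separately would change the running time of a fixed program only by
  a constant factor.
\<close>

type_synonym vname = string

record state =
  var :: "vname \<Rightarrow> nat"
  arr :: "vname \<Rightarrow> nat \<Rightarrow> nat"

datatype aexp =
    Const nat
  | Var vname
  | Read vname aexp
  | Plus aexp aexp
  | Minus aexp aexp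

datatype bexp =
    Less aexp aexp
  | Eq aexp aexp
  | Not bexp
  | And bexp bexp

datatype com =
    Skip
  | Assign vname aexp
  | Store vname aexp aexp
  | Seq com com
  | If bexp com com
  | While bexp com

primrec aval :: "aexp \<Rightarrow> state \<Rightarrow> nat" where
  "aval (Const n) s = n"
| "aval (Var x) s = var s x"
| "aval (Read x e) s = arr s x (aval e s)"
| "aval (Plus e e') s = aval e s + aval e' s"
| "aval (Minus e e') s = aval e s - aval e' s"

primrec bval :: "bexp \<Rightarrow> state \<Rightarrow> bool" where
  "bval (Less e e') s \<longleftrightarrow> aval e s < aval e' s"
| "bval (Eq e e') s \<longleftrightarrow> aval e s = aval e' s"
| "bval (Not b) s \<longleftrightarrow> \<not> bval b s"
| "bval (And b b') s \<longleftrightarrow> bval b s \<and> bval b' s"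

text \<open>\<open>exec c s t s'\<close>: started in \<open>s\<close>, the program \<open>c\<close> halts after \<open>t\<close> steps in \<open>s'\<close>.\<close>

inductive exec :: "com \<Rightarrow> state \<Rightarrow> nat \<Rightarrow> state \<Rightarrow> bool" where
  Skip: "exec Skip s 1 s"
| Assign: "exec (Assign x e) s 1 (s\<lparr>var := (var s)(x := aval e s)\<rparr>)"
| Store: "exec (Store x i e) s 1
            (s\<lparr>arr := (arr s)(x := (arr s x)(aval i s := aval e s))\<rparr>)"
| Seq: "exec c1 s1 t1 s2 \<Longrightarrow> exec c2 s2 t2 s3 \<Longrightarrow> exec (Seq c1 c2) s1 (t1 + t2) s3"
| IfTrue: "bval b s \<Longrightarrow> exec c1 s t s' \<Longrightarrow> exec (If b c1 c2) s (1 + t) s'"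
| IfFalse: "\<not> bval b s \<Longrightarrow> exec c2 s t s' \<Longrightarrow> exec (If b c1 c2) s (1 + t) s'"
| WhileFalse: "\<not> bval b s \<Longrightarrow> exec (While b c) s 1 s"
| WhileTrue: "bval b s1 \<Longrightarrow> exec c s1 t1 s2 \<Longrightarrow> exec (While b c) s2 t2 s3 \<Longrightarrow>
    exec (While b c) s1 (1 + t1 + t2) s3"

inductive_cases exec_SkipE: "exec Skip s t s'"
inductive_cases exec_AssignE: "exec (Assign x e) s t s'"
inductive_cases exec_StoreE: "exec (Store x i e) s t s'"
inductive_cases exec_SeqE: "exec (Seq c1 c2) s t s'"
inductive_cases exec_IfE: "exec (If b c1 c2) s t s'"
inductive_cases exec_WhileE: "exec (While b c) s t s'"

lemma exec_deterministic:
  "exec c s t s' \<Longrightarrow> exec c s u s'' \<Longrightarrow> u = t \<and> s'' = s'"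
proof (induction arbitrary: u s'' rule: exec.induct)
  case (Seq c1 s1 t1 s2 c2 t2 s3)
  from Seq.prems show ?case by (rule exec_SeqE) (auto dest!: Seq.IH)
next
  case (IfTrue b s c1 t s' c2)
  from IfTrue.prems show ?case by (rule exec_IfE) (auto dest!: IfTrue.IH simp: IfTrue.hyps(1))+
next
  case (IfFalse b s c2 t s' c1)
  from IfFalse.prems show ?case by (rule exec_IfE) (auto dest!: IfFalse.IH simp: IfFalse.hyps(1))+
next
  case (WhileFalse b s c)
  from WhileFalse.prems show ?case by (rule exec_WhileE) (auto simp: WhileFalse.hyps(1))+
next
  case (WhileTrue b s1 c t1 s2 t2 s3)
  from WhileTrue.prems show ?case by (rule exec_WhileE) (auto dest!: WhileTrue.IH simp: WhileTrue.hyps(1))+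
qed (erule exec_SkipE exec_AssignE exec_StoreE; simp)+


section \<open>Input and output format\<close>

text \<open>
  Block \<open>i\<close> of an array whose blocks are laid out consecutively, delimited by the offsets stored
  in the array \<open>off\<close>.
\<close>

definition block :: "state \<Rightarrow> vname \<Rightarrow> nat \<Rightarrow> nat set" where
  "block s off i = {arr s off i ..< arr s off (Suc i)}"

definition class_members :: "state \<Rightarrow> nat \<Rightarrow> nat set" where
  "class_members s k = arr s ''member'' ` block s ''moff'' k"

text \<open>
  \<open>encodes G av pv s\<close>: the memory \<open>s\<close> holds the instance \<open>G\<close> and is zero otherwise. Applicants and
  posts are numbered from 0 by \<open>av\<close> and \<open>pv\<close>. Block \<open>i\<close> of \<open>post\<close> lists the neighbours of
  applicant \<open>i\<close>, each once and with its rank in the same position of \<open>rank\<close>; the order within a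
  block is arbitrary. The classes of post \<open>j\<close> are numbered by block \<open>j\<close> of \<open>coff\<close>, each class once,
  and block \<open>k\<close> of \<open>member\<close> lists the members of class \<open>k\<close>, each once.
\<close>

definition encodes ::
  "('a, 'p) inst \<Rightarrow> (nat \<Rightarrow> 'a) \<Rightarrow> (nat \<Rightarrow> 'p) \<Rightarrow> state \<Rightarrow> bool" where
  "encodes G av pv s \<longleftrightarrow>
     bij_betw av {..<var s ''nA''} (appl G) \<and>
     bij_betw pv {..<var s ''nP''} (posts G) \<and>
     arr s ''off'' 0 = 0 \<and> arr s ''coff'' 0 = 0 \<and> arr s ''moff'' 0 = 0 \<and>
     (\<forall>i<var s ''nA''.
        arr s ''off'' i \<le> arr s ''off'' (Suc i) \<and>
        inj_on (arr s ''post'') (block s ''off'' i) \<and>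
        arr s ''post'' ` block s ''off'' i =
          {j. j < var s ''nP'' \<and> (av i, pv j) \<in> edges G} \<and>
        (\<forall>e\<in>block s ''off'' i. arr s ''rank'' e = rank G (av i) (pv (arr s ''post'' e)))) \<and>
     (\<forall>j<var s ''nP''.
        arr s ''quota'' j = quota G (pv j) \<and>
        arr s ''coff'' j \<le> arr s ''coff'' (Suc j) \<and>
        bij_betw (\<lambda>k. av ` class_members s k) (block s ''coff'' j) (classes G (pv j)) \<and>
        (\<forall>k\<in>block s ''coff'' j.
           arr s ''cquota'' k = cquota G (pv j) (av ` class_members s k) \<and>
           arr s ''moff'' k \<le> arr s ''moff'' (Suc k) \<and>
           inj_on (arr s ''member'') (block s ''moff'' k) \<and>
           class_members s k \<subseteq> {..<var s ''nA''})) \<and>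
     (\<forall>x. x \<notin> {''nA'', ''nP''} \<longrightarrow> var s x = 0) \<and>
     (\<forall>x i. x \<notin> {''off'', ''post'', ''rank'', ''quota'', ''coff'', ''cquota'', ''moff'', ''member''}
        \<longrightarrow> arr s x i = 0)"

text \<open>
  Entry \<open>i\<close> of the array \<open>mate\<close> is 0 if applicant \<open>i\<close> is unmatched, and \<open>Suc j\<close> if it is matched
  to post \<open>j\<close>.
\<close>

definition output_matching ::
  "('a, 'p) inst \<Rightarrow> (nat \<Rightarrow> 'a) \<Rightarrow> (nat \<Rightarrow> 'p) \<Rightarrow> state \<Rightarrow> ('a \<times> 'p) set" where
  "output_matching G av pv s =
     {(av i, pv j) | i j. i < card (appl G) \<and> arr s ''mate'' i = Suc j}"

end

theory Submission
  imports Defs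
begin

text \<open>
  Give every applicant a last resort and direct its edges into the forest of the classes of a post,
  each post being the root above its classes and the sink lying above all roots; laminarity makes this a
  network whose integral flows are the feasible matchings. Take a maximum flow \<open>F1\<close> that uses only
  best edges among those not blocked by a quota \<open>0\<close>, and let \<open>T\<close> be the set of nodes that reach the sink in its
  residual graph. The forest arcs entering \<open>T\<close> are full and those leaving \<open>T\<close> are empty, in \<open>F1\<close> as in every
  other maximum flow of best edges.

  A matching is popular if and only if all applicants are served, every crossing arc carries the load it has in
  \<open>F1\<close>, and each applicant uses either a best edge (that does not leave \<open>T\<close>) or an edge that is best among
  those ending in \<open>T\<close>. Sufficiency is a count: an applicant that improves must move to an edge that ends
  outside \<open>T\<close>, and the capacity of the crossing arcs allows no more such edges than the given matching uses.
  Necessity: a matching that violates one of the conditions admits a residual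
  cycle with a positive balance of votes. Hence a popular matching exists if and only if a second flow, started at
  \<open>F1\<close> with the crossing arcs frozen, can be augmented until it serves all applicants. Both flows need
  at most \<open>|A|\<close> augmentations of cost \<open>O(|E|)\<close>, because a laminar family over
  \<open>N(p)\<close> has at most \<open>2 |N(p)|\<close> nonempty members.
\<close>

section \<open>Popular flows in a forest network\<close>

text \<open>Necessity is a balance of single votes. From every class not blocked by a quota 0 the
  sink is reached at the price of at most one vote: climb, and at the first full class send some
  applicant that loads it to a last resort. An applicant of a popular matching \<open>M\<close> that
  is off its best edges wins one vote by switching to one, which pays for this eviction. So residual
  walks to the sink in the best-edge part \<open>M \<inter> E1\<close> lift to walks of nonnegative
  weight in \<open>M\<close>. The sink in turn is joined at no cost to every applicant, so a strict
  improvement along an edge ending on such a walk would close a positive cycle. Hence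
  \<open>M \<inter> E1\<close> is itself a maximum best-edge flow, and complementary slackness
  between two cuts of equal value transfers \<open>T\<close> from \<open>F1\<close> to
  \<open>M\<close>. Quotas 0 are the obstacle: a full class of quota 0 holds nobody who could be
  evicted, so best edges are taken among unblocked ones only. In the second flow a crossing arc has
  to keep its load in both directions, so it is removed from the residual graph.\<close>

text \<open>
  Node \<open>0\<close> is the sink, \<open>A\<close> are the applicants and \<open>V\<close> the classes, with parent \<open>par\<close> (\<open>0\<close> for a root). An edge \<open>e\<close>
  runs from \<open>own e\<close> to the innermost class \<open>leaf e\<close> containing it; an edge with \<open>leaf e = 0\<close> stands for remaining unmatched.
\<close>

locale net =
  fixes A V Ed :: "nat set" and own rk leaf par cap :: "nat \<Rightarrow> nat"
  assumes finA: "finite A" and finV: "finite V" and finE: "finite Ed"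
    and zero_A: "0 \<notin> A" and zero_V: "0 \<notin> V" and disj: "A \<inter> V = {}"
    and own: "e \<in> Ed \<Longrightarrow> own e \<in> A"
    and leaf: "e \<in> Ed \<Longrightarrow> leaf e \<in> insert 0 V"
    and par: "v \<in> V \<Longrightarrow> par v = 0 \<or> par v \<in> V \<and> v < par v"
    and dummy: "a \<in> A \<Longrightarrow> \<exists>e\<in>Ed. own e = a \<and> leaf e = 0"
begin

definition anc :: "nat \<Rightarrow> nat set" where
  "anc u = {v \<in> V. (u, v) \<in> {(w, par w) | w. w \<in> V}\<^sup>*}"

definition load :: "nat set \<Rightarrow> nat \<Rightarrow> nat" where
  "load F v = card {e \<in> F. v \<in> anc (leaf e)}"

definition feas :: "nat set \<Rightarrow> bool" where
  "feas F \<longleftrightarrow> F \<subseteq> Ed \<and> inj_on own F \<and> (\<forall>v\<in>V. load F v \<le> cap v)"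

definition perf :: "nat set \<Rightarrow> bool" where
  "perf F \<longleftrightarrow> feas F \<and> own ` F = A"

definition better :: "nat set \<Rightarrow> nat set \<Rightarrow> nat" where
  "better F F' = card {a \<in> A. \<exists>e\<in>F. \<exists>e'\<in>F'. own e = a \<and> own e' = a \<and> rk e < rk e'}"

definition pop :: "nat set \<Rightarrow> bool" where
  "pop F \<longleftrightarrow> perf F \<and> (\<forall>F'. perf F' \<longrightarrow> better F' F \<le> better F F')"

definition live :: "nat \<Rightarrow> bool" where
  "live e \<longleftrightarrow> (\<forall>v\<in>anc (leaf e). 0 < cap v)"

definition best :: "nat set \<Rightarrow> nat set" where
  "best X = {e \<in> X. \<forall>e'\<in>X. own e' = own e \<longrightarrow> rk e \<le> rk e'}"

definition E1 :: "nat set" where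
  "E1 = best {e \<in> Ed. live e}"

text \<open>
  The nodes from which the sink can be reached in the residual graph of \<open>F\<close> restricted to the edges \<open>H\<close>, with
  the forest arcs above the nodes in \<open>B\<close> removed.
\<close>

inductive_set RT :: "nat set \<Rightarrow> nat set \<Rightarrow> nat set \<Rightarrow> nat set" for H B F where
  sink: "0 \<in> RT H B F"
| up: "v \<in> V \<Longrightarrow> v \<notin> B \<Longrightarrow> load F v < cap v \<Longrightarrow> par v \<in> RT H B F \<Longrightarrow> v \<in> RT H B F"
| down: "v \<in> V \<Longrightarrow> v \<notin> B \<Longrightarrow> 0 < load F v \<Longrightarrow> v \<in> RT H B F \<Longrightarrow> par v \<in> RT H B F"
| asg: "e \<in> H \<Longrightarrow> leaf e \<in> RT H B F \<Longrightarrow> own e \<in> RT H B F"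
| una: "e \<in> F \<Longrightarrow> own e \<in> RT H B F \<Longrightarrow> leaf e \<in> RT H B F"

section \<open>Ancestors, loads and cuts in the forest\<close>

lemma anc_notin_V: "u \<notin> V \<Longrightarrow> anc u = {}"
  unfolding anc_def by (auto elim: converse_rtranclE)

lemma anc_subset: "anc u \<subseteq> V"
  unfolding anc_def by auto

lemma finite_anc: "finite (anc u)"
  using anc_subset finV finite_subset by blast

lemma anc_par: "u \<in> V \<Longrightarrow> anc u = insert u (anc (par u))"
  unfolding anc_def by (auto elim: converse_rtranclE intro: converse_rtrancl_into_rtrancl)

lemma anc_le: "v \<in> anc u \<Longrightarrow> u \<le> v"
proof -
  have "(u, v) \<in> {(w, par w) | w. w \<in> V}\<^sup>* \<Longrightarrow> v \<in> V \<Longrightarrow> u \<le> v"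
  proof (induction rule: converse_rtrancl_induct)
    case (step y z)
    then have "z \<le> v" and y: "y \<in> V" "z = par y" by auto
    moreover have "z \<noteq> 0 \<longrightarrow> y < z" using par[of y] y by auto
    moreover have "z \<noteq> 0"
    proof
      assume "z = 0"
      with step(2) have "v = 0" using zero_V by (auto elim: converse_rtranclE)
      then show False using step.prems zero_V by simp
    qed
    ultimately show ?case by simp
  qed simp
  then show "v \<in> anc u \<Longrightarrow> u \<le> v" unfolding anc_def by auto
qed

lemma notin_anc_par: "u \<in> V \<Longrightarrow> u \<notin> anc (par u)"
proof
  assume u: "u \<in> V" "u \<in> anc (par u)"
  then have "par u \<noteq> 0" using anc_notin_V[of 0] zero_V by (metis empty_iff)
  then show False using u par[of u] anc_le[of u "par u"] by simp
qed

text \<open>Induction from the sink down the forest. It is well founded since a parent in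
  \<open>V\<close> has a larger number than its child and \<open>V\<close> is finite.\<close>

lemma up_induct [consumes 1, case_names zero par]:
  assumes "u \<in> insert 0 V" and "P 0" and "\<And>v. v \<in> V \<Longrightarrow> P (par v) \<Longrightarrow> P v"
  shows "P u"
proof -
  define m where "m = Max (insert 0 V)"
  have m: "v \<le> m" if "v \<in> insert 0 V" for v using that finV m_def by simp
  have "u \<in> insert 0 V \<Longrightarrow> P u" for u
  proof (induction "m - u" arbitrary: u rule: less_induct)
    case less
    show ?case
    proof (cases "u = 0")
      case False
      then have u: "u \<in> V" using less.prems by simp
      from par[OF u] have "P (par u)"
      proof
        assume p: "par u \<in> V \<and> u < par u"
        then have "par u \<le> m" using m by simp
        then have "m - par u < m - u" using p by linarith
        then show ?thesis using less.hyps p by blast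
      qed (simp add: assms(2))
      then show ?thesis using assms(3) u by blast
    qed (simp add: assms(2))
  qed
  then show ?thesis using assms(1) .
qed

lemma anc_step: "u \<in> V \<Longrightarrow> (of_bool (v \<in> anc u) :: int) = of_bool (v \<in> anc (par u)) + of_bool (u = v)"
  using anc_par[of u] notin_anc_par[of u] by auto

text \<open>On the way from \<open>u\<close> up to the sink each arc contributes the change of
  membership in the complement of \<open>Z\<close>. The sum telescopes because the path ends at
  \<open>0\<close>, inside \<open>Z\<close>.\<close>

lemma anc_telescope:
  assumes "u \<in> insert 0 V" and "0 \<in> Z"
  shows "(of_bool (u \<notin> Z) :: int) = (\<Sum>v\<in>anc u. of_bool (v \<notin> Z) - of_bool (par v \<notin> Z))"
  using assms(1)
proof (induction rule: up_induct)
  case zero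
  then show ?case using assms(2) anc_notin_V zero_V by simp
next
  case (par v)
  then show ?case using finite_anc notin_anc_par by (simp add: anc_par)
qed

text \<open>Every unit that enters the forest outside \<open>Z\<close> has to cross into
  \<open>Z\<close> before it reaches the sink; \<open>kap Z\<close> is the capacity available for
  this.\<close>

definition out :: "nat set \<Rightarrow> nat set \<Rightarrow> nat" where
  "out Z F = card {e \<in> F. leaf e \<notin> Z}"

definition kap :: "nat set \<Rightarrow> nat" where
  "kap Z = (\<Sum>v | v \<in> V \<and> v \<notin> Z \<and> par v \<in> Z. cap v)"

text \<open>Complementary slackness for the cut \<open>Z\<close>.\<close>

definition tight :: "nat set \<Rightarrow> nat set \<Rightarrow> bool" where
  "tight Z F \<longleftrightarrow> (\<forall>v\<in>V. (v \<notin> Z \<longrightarrow> par v \<in> Z \<longrightarrow> load F v = cap v) \<and> (v \<in> Z \<longrightarrow> par v \<notin> Z \<longrightarrow> load F v = 0))"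

lemma load_sum:
  assumes "F \<subseteq> Ed" shows "int (load F v) = (\<Sum>e\<in>F. of_bool (v \<in> anc (leaf e)))"
proof -
  have "finite F" using assms finE finite_subset by blast
  then show ?thesis unfolding load_def by (simp add: of_bool_def sum.If_cases Int_def)
qed

text \<open>Conservation at the cut: flow into \<open>Z\<close> minus flow out of \<open>Z\<close>.
  It results from summing \<open>anc_telescope\<close> over the edges and exchanging the
  sums.\<close>

lemma out_cross:
  assumes "F \<subseteq> Ed" and "0 \<in> Z"
  shows "int (out Z F) = (\<Sum>v\<in>V. (of_bool (v \<notin> Z) - of_bool (par v \<notin> Z)) * int (load F v))"
proof -
  have finF: "finite F" using assms finE finite_subset by blast
  have "int (out Z F) = (\<Sum>e\<in>F. of_bool (leaf e \<notin> Z))"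
    unfolding out_def using finF by (simp add: of_bool_def sum.If_cases Int_def)
  also have "\<dots> = (\<Sum>e\<in>F. \<Sum>v\<in>anc (leaf e). of_bool (v \<notin> Z) - of_bool (par v \<notin> Z))"
    using assms leaf by (intro sum.cong[OF refl] anc_telescope) blast+
  also have "\<dots> = (\<Sum>e\<in>F. \<Sum>v\<in>V. (of_bool (v \<notin> Z) - of_bool (par v \<notin> Z)) * of_bool (v \<in> anc (leaf e)))"
  proof (rule sum.cong[OF refl])
    fix e
    show "(\<Sum>v\<in>anc (leaf e). of_bool (v \<notin> Z) - of_bool (par v \<notin> Z)) =
      (\<Sum>v\<in>V. (of_bool (v \<notin> Z) - of_bool (par v \<notin> Z)) * (of_bool (v \<in> anc (leaf e))::int))"
      using anc_subset by (intro sum.mono_neutral_cong_left finV) auto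
  qed
  also have "\<dots> = (\<Sum>v\<in>V. \<Sum>e\<in>F. (of_bool (v \<notin> Z) - of_bool (par v \<notin> Z)) * of_bool (v \<in> anc (leaf e)))"
    by (rule sum.swap)
  also have "\<dots> = (\<Sum>v\<in>V. (of_bool (v \<notin> Z) - of_bool (par v \<notin> Z)) * int (load F v))"
    by (simp add: load_sum[OF assms(1)] sum_distrib_left)
  finally show ?thesis .
qed

lemma kap_sum: "int (kap Z) = (\<Sum>v\<in>V. of_bool (v \<notin> Z \<and> par v \<in> Z) * int (cap v))"
  unfolding kap_def using finV by (simp add: of_bool_def sum.If_cases Int_def if_distrib[of "\<lambda>x. x * _"] conj_ac cong: if_cong)

lemma kap_minus_out:
  assumes "F \<subseteq> Ed" and "0 \<in> Z"
  shows "int (kap Z) - int (out Z F) =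
    (\<Sum>v\<in>V. of_bool (v \<notin> Z \<and> par v \<in> Z) * (int (cap v) - int (load F v)) + of_bool (v \<in> Z \<and> par v \<notin> Z) * int (load F v))"
  unfolding kap_sum out_cross[OF assms] sum_subtractf[symmetric] by (intro sum.cong) auto

text \<open>The difference is a sum of nonnegative slacks, one for each crossing arc, and vanishes
  exactly when all of them do.\<close>

lemma out_le:
  assumes "feas F" and "0 \<in> Z"
  shows "out Z F \<le> kap Z" and "out Z F = kap Z \<longleftrightarrow> tight Z F"
proof -
  let ?f = "\<lambda>v. of_bool (v \<notin> Z \<and> par v \<in> Z) * (int (cap v) - int (load F v)) + of_bool (v \<in> Z \<and> par v \<notin> Z) * int (load F v)"
  have F: "F \<subseteq> Ed" "\<forall>v\<in>V. load F v \<le> cap v" using assms by (auto simp: feas_def)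
  have nn: "\<forall>v\<in>V. 0 \<le> ?f v" using F(2) by auto
  then have "0 \<le> (\<Sum>v\<in>V. ?f v)" by (intro sum_nonneg) auto
  with kap_minus_out[OF F(1) assms(2)] show "out Z F \<le> kap Z" by linarith
  have "out Z F = kap Z \<longleftrightarrow> (\<Sum>v\<in>V. ?f v) = 0" using kap_minus_out[OF F(1) assms(2)] by linarith
  also have "\<dots> \<longleftrightarrow> (\<forall>v\<in>V. ?f v = 0)" using nn finV by (intro sum_nonneg_eq_0_iff) auto
  also have "\<dots> \<longleftrightarrow> tight Z F" unfolding tight_def by (rule ball_cong) (auto split: if_splits)
  finally show "out Z F = kap Z \<longleftrightarrow> tight Z F" .
qed

lemma feas_finite: "feas F \<Longrightarrow> finite F"
  unfolding feas_def using finE finite_subset by blast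

text \<open>Weak duality: an edge of \<open>I\<close> ending in \<open>Z\<close> is charged to its
  applicant, which lies in \<open>Z\<close> by closure, and any other edge to the capacity into
  \<open>Z\<close>. Equality forces both charges to be exact.\<close>

lemma cut_le:
  assumes "feas I" "I \<subseteq> H" and Z: "0 \<in> Z" "\<And>e. e \<in> H \<Longrightarrow> leaf e \<in> Z \<Longrightarrow> own e \<in> Z"
  shows "card I \<le> card (A \<inter> Z) + kap Z"
    and "card I = card (A \<inter> Z) + kap Z \<Longrightarrow> tight Z I \<and> A \<inter> Z = own ` {e \<in> I. leaf e \<in> Z}"
proof -
  let ?J = "{e \<in> I. leaf e \<in> Z}"
  have fin: "finite I" using assms feas_finite by blast
  have inj: "inj_on own ?J" using assms(1) unfolding feas_def by (auto intro: inj_on_subset)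
  have sub: "own ` ?J \<subseteq> A \<inter> Z" using assms own unfolding feas_def by auto
  have cJ: "card (own ` ?J) = card ?J" using inj by (rule card_image)
  have le: "card ?J \<le> card (A \<inter> Z)" using card_mono[OF _ sub] finA cJ by simp
  have split: "card I = card ?J + out Z I"
    unfolding out_def using fin by (subst card_Un_disjoint[symmetric]) (auto intro: arg_cong[of _ _ card])
  show "card I \<le> card (A \<inter> Z) + kap Z" using le split out_le[OF assms(1) Z(1)] by linarith
  assume eq: "card I = card (A \<inter> Z) + kap Z"
  then have "card ?J = card (A \<inter> Z)" "out Z I = kap Z" using le split out_le[OF assms(1) Z(1)] by linarith+
  then show "tight Z I \<and> A \<inter> Z = own ` ?J"
    using out_le[OF assms(1) Z(1)] card_subset_eq[OF _ sub] finA cJ by auto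
qed

text \<open>Complementary slackness makes both charges in \<open>cut_le\<close> exact, so the bound
  is attained. Together the two lemmas certify that a flow is maximum.\<close>

lemma cut_eq:
  assumes "feas I" and Z: "0 \<in> Z" and "tight Z I" and "A \<inter> Z \<subseteq> own ` I"
    and "\<And>e. e \<in> I \<Longrightarrow> own e \<in> Z \<longleftrightarrow> leaf e \<in> Z"
  shows "card I = card (A \<inter> Z) + kap Z"
proof -
  let ?J = "{e \<in> I. leaf e \<in> Z}"
  have fin: "finite I" using assms feas_finite by blast
  have inj: "inj_on own ?J" using assms(1) unfolding feas_def by (auto intro: inj_on_subset)
  have "own ` ?J = A \<inter> Z" using assms own unfolding feas_def by auto
  then have "card ?J = card (A \<inter> Z)" using card_image[OF inj] by simp
  moreover have "card I = card ?J + out Z I"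
    unfolding out_def using fin by (subst card_Un_disjoint[symmetric]) (auto intro: arg_cong[of _ _ card])
  ultimately show ?thesis using out_le[OF assms(1) Z] assms(3) by simp
qed

text \<open>A crossing arc with residual capacity into the reachable set would enlarge that
  set.\<close>

lemma RT_tight: "feas F \<Longrightarrow> tight (RT H {} F) F"
  unfolding tight_def feas_def by (metis RT.up RT.down empty_iff le_neq_implies_less neq0_conv)


section \<open>Residual walks weighted by votes\<close>

definition vt :: "nat \<Rightarrow> nat \<Rightarrow> int" where
  "vt e e' = (if rk e < rk e' then 1 else if rk e' < rk e then - 1 else 0)"

text \<open>
  Each residual arc is weighted by the vote of the applicant that is moved along it, so that the weight of a closed walk is the
  margin by which the modified matching wins.
\<close>

inductive res_step :: "nat set \<Rightarrow> nat \<Rightarrow> int \<Rightarrow> nat \<Rightarrow> bool" for F where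
  up: "v \<in> V \<Longrightarrow> load F v < cap v \<Longrightarrow> res_step F v 0 (par v)"
| down: "v \<in> V \<Longrightarrow> 0 < load F v \<Longrightarrow> res_step F (par v) 0 v"
| asg: "e \<in> Ed \<Longrightarrow> e' \<in> F \<Longrightarrow> own e = own e' \<Longrightarrow> res_step F (own e) (vt e e') (leaf e)"
| una: "e \<in> F \<Longrightarrow> res_step F (leaf e) 0 (own e)"

inductive walk :: "nat set \<Rightarrow> nat \<Rightarrow> int \<Rightarrow> nat \<Rightarrow> bool" for F where
  refl: "walk F u 0 u"
| step: "walk F u c v \<Longrightarrow> res_step F v d w \<Longrightarrow> walk F u (c + d) w"

lemma walk_trans: "walk F v d w \<Longrightarrow> walk F u c v \<Longrightarrow> walk F u (c + d) w"
proof (induction rule: walk.induct)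
  case (step v d x d' w)
  then show ?case using walk.step[of F u "c + d" x d' w] by (simp add: add.assoc)
qed simp

lemma walk_step: "res_step F u c v \<Longrightarrow> walk F u c v"
  using walk.step[OF walk.refl] by simp

text \<open>With an indexed walk, a repeated node can be located and the closed piece between its
  two visits cut out.\<close>

lemma walk_seq:
  "walk F u c v \<Longrightarrow> \<exists>k p w. (\<forall>i<k. res_step F (p i) (w i) (p (Suc i))) \<and> p 0 = u \<and> p k = v \<and> (\<Sum>i<k. w i) = c"
proof (induction rule: walk.induct)
  case (refl u)
  then show ?case by (intro exI[of _ 0] exI[of _ "\<lambda>_. u"]) auto
next
  case (step u c v d x)
  then obtain k p w where "\<forall>i<k. res_step F (p i) (w i) (p (Suc i))" "p 0 = u" "p k = v" "(\<Sum>i<k. w i) = c"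
    by blast
  then show ?case using step(2)
    by (intro exI[of _ "Suc k"] exI[of _ "p(Suc k := x)"] exI[of _ "w(k := d)"]) (auto simp: less_Suc_eq)
qed

text \<open>A perfect set gives every applicant exactly one edge, so both ballots can be read off
  the choice functions \<open>n\<close> (new edge) and \<open>f\<close> (old edge).\<close>

lemma net_votes:
  assumes "perf F" and F': "own ` n ` A = A" "F' = n ` A" and n: "\<And>a. a \<in> A \<Longrightarrow> own (n a) = a"
    and f: "\<And>a. a \<in> A \<Longrightarrow> f a \<in> F \<and> own (f a) = a"
  shows "int (better F' F) - int (better F F') = (\<Sum>a\<in>A. vt (n a) (f a))"
proof -
  have inj: "inj_on own F" using assms(1) unfolding perf_def feas_def by auto
  have fu: "e = f a" if "e \<in> F" "own e = a" "a \<in> A" for e a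
    using inj f[OF that(3)] that unfolding inj_on_def by auto
  have e1: "{a \<in> A. \<exists>e\<in>F'. \<exists>e'\<in>F. own e = a \<and> own e' = a \<and> rk e < rk e'} = {a \<in> A. rk (n a) < rk (f a)}"
  proof (intro set_eqI iffI)
    fix a assume "a \<in> {a \<in> A. rk (n a) < rk (f a)}"
    then show "a \<in> {a \<in> A. \<exists>e\<in>F'. \<exists>e'\<in>F. own e = a \<and> own e' = a \<and> rk e < rk e'}" using f n F' by blast
  qed (use fu n F' in auto)
  have e2: "{a \<in> A. \<exists>e\<in>F. \<exists>e'\<in>F'. own e = a \<and> own e' = a \<and> rk e < rk e'} = {a \<in> A. rk (f a) < rk (n a)}"
  proof (intro set_eqI iffI)
    fix a assume "a \<in> {a \<in> A. rk (f a) < rk (n a)}"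
    then show "a \<in> {a \<in> A. \<exists>e\<in>F. \<exists>e'\<in>F'. own e = a \<and> own e' = a \<and> rk e < rk e'}" using f n F' by blast
  qed (use fu n F' in auto)
  have "(\<Sum>a\<in>A. vt (n a) (f a)) = (\<Sum>a\<in>A. of_bool (rk (n a) < rk (f a)) - of_bool (rk (f a) < rk (n a)))"
    by (intro sum.cong) (auto simp: vt_def)
  also have "\<dots> = int (better F' F) - int (better F F')"
    unfolding better_def e1 e2 using finA by (simp add: sum_subtractf of_bool_def sum.If_cases Int_def)
  finally show ?thesis by simp
qed

lemma res_step_weight: "res_step F u c v \<Longrightarrow> u \<notin> A \<Longrightarrow> F \<subseteq> Ed \<Longrightarrow> c = 0"
  using own by (auto elim!: res_step.cases)

text \<open>Only the steps that leave an applicant change the matching; a forest arc on the cycle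
  merely testifies that a load may move by one. As the nodes of the cycle are distinct, each load
  grows by at most one, and only where an upward arc has shown that there is room.\<close>

lemma push_cycle:
  assumes perf: "perf F"
    and st: "\<And>i. i < k \<Longrightarrow> res_step F (p i) (w i) (p (Suc i))"
    and cl: "p k = p 0" and inj: "inj_on p {..<k}" and pos: "0 < (\<Sum>i<k. w i)"
  shows "\<exists>F'. perf F' \<and> better F F' < better F' F"
proof -
  have FE: "F \<subseteq> Ed" and injF: "inj_on own F" and oF: "own ` F = A" and ld: "\<And>v. v \<in> V \<Longrightarrow> load F v \<le> cap v"
    using perf unfolding perf_def feas_def by auto
  define f where "f = the_inv_into F own"
  have f: "f a \<in> F" "own (f a) = a" if "a \<in> A" for a
    using injF oF that by (auto simp: f_def the_inv_into_into f_the_inv_into_f)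
  have fo: "f (own e) = e" if "e \<in> F" for e using injF that by (simp add: f_def the_inv_into_f_f)
  have leafA: "leaf e \<notin> A" if "e \<in> Ed" for e using leaf[OF that] zero_A disj by auto
  \<comment> \<open>The steps at which the cycle leaves an applicant; the edge \<open>g i\<close>
    taken there replaces the old one.\<close>
  define J where "J = {i. i < k \<and> p i \<in> A}"
  have injJ: "inj_on p J" using inj unfolding J_def by (auto intro: inj_on_subset)
  have g0: "\<exists>e. e \<in> Ed \<and> own e = p i \<and> leaf e = p (Suc i) \<and> w i = vt e (f (p i))" if "i \<in> J" for i
  proof -
    have i: "i < k" "p i \<in> A" using that J_def by auto
    have pA: "p i \<notin> V" "p i \<noteq> 0" using i disj zero_A by auto
    from st[OF i(1)] show ?thesis
    proof cases
      case down then show ?thesis using pA par[of "p (Suc i)"] by auto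
    next
      case (asg e e') then show ?thesis using fo by auto
    next
      case (una e) then show ?thesis using i leafA[of e] FE by auto
    qed (use pA in auto)
  qed
  then obtain g where g: "\<And>i. i \<in> J \<Longrightarrow> g i \<in> Ed \<and> own (g i) = p i \<and> leaf (g i) = p (Suc i) \<and> w i = vt (g i) (f (p i))"
    by metis
  define ix where "ix = the_inv_into J p"
  have ix: "ix (p i) = i" if "i \<in> J" for i using injJ that by (simp add: ix_def the_inv_into_f_f)
  define n where "n a = (if a \<in> p ` J then g (ix a) else f a)" for a
  have nJ: "n (p i) = g i" if "i \<in> J" for i using that ix by (simp add: n_def)
  have n: "n a \<in> Ed" "own (n a) = a" if "a \<in> A" for a
    using that g ix f FE unfolding n_def by auto
  define F' where "F' = n ` A"
  have pJA: "p ` J \<subseteq> A" unfolding J_def by auto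
  have injF': "inj_on own F'" unfolding F'_def inj_on_def using n by auto
  have oF': "own ` F' = A" unfolding F'_def using n by (force simp: image_iff)
  have injn: "inj_on n A" by (metis inj_onI n(2))
  have injf: "inj_on f A" by (metis inj_onI f(2))
  have fA: "F = f ` A" using f fo oF by force
  have split: "(\<Sum>a\<in>A. \<phi> (n a) (f a)) = (\<Sum>i\<in>J. \<phi> (g i) (f (p i))) + (\<Sum>a\<in>A - p ` J. \<phi> (f a) (f a))"
    for \<phi> :: "nat \<Rightarrow> nat \<Rightarrow> int"
  proof -
    have "(\<Sum>a\<in>A. \<phi> (n a) (f a)) = (\<Sum>a\<in>p ` J. \<phi> (n a) (f a)) + (\<Sum>a\<in>A - p ` J. \<phi> (n a) (f a))"
      using finA pJA by (metis add.commute sum.subset_diff)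
    also have "(\<Sum>a\<in>p ` J. \<phi> (n a) (f a)) = (\<Sum>i\<in>J. \<phi> (g i) (f (p i)))"
      using nJ by (simp add: sum.reindex[OF injJ])
    also have "(\<Sum>a\<in>A - p ` J. \<phi> (n a) (f a)) = (\<Sum>a\<in>A - p ` J. \<phi> (f a) (f a))"
      by (intro sum.cong) (auto simp: n_def)
    finally show ?thesis .
  qed
  have feasF': "load F' v \<le> cap v" if v: "v \<in> V" for v
  proof -
    \<comment> \<open>A potential on the nodes: 1 where a unit entering the forest would pass
      \<open>v\<close>.\<close>
    define h where "h u = (of_bool (v \<in> anc u) :: int)" for u
    have hA: "h a = 0" if "a \<in> A" for a using that disj anc_notin_V[of a] by (auto simp: h_def)
    have "F' \<subseteq> Ed" using n F'_def by auto
    then have "int (load F' v) = (\<Sum>a\<in>A. h (leaf (n a)))"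
      by (simp add: load_sum F'_def sum.reindex[OF injn] h_def)
    moreover have "int (load F v) = (\<Sum>a\<in>A. h (leaf (f a)))"
      using load_sum[OF FE, of v] fA by (simp add: sum.reindex[OF injf] h_def)
    ultimately have "int (load F' v) - int (load F v) = (\<Sum>a\<in>A. h (leaf (n a)) - h (leaf (f a)))"
      by (simp add: sum_subtractf)
    also have "\<dots> = (\<Sum>i\<in>J. h (leaf (g i)) - h (leaf (f (p i))))"
      by (subst split[of "\<lambda>x y. h (leaf x) - h (leaf y)"]) simp
    finally have diff: "int (load F' v) - int (load F v) = (\<Sum>i\<in>J. h (leaf (g i))) - (\<Sum>i\<in>J. h (leaf (f (p i))))"
      by (simp add: sum_subtractf)
    \<comment> \<open>\<open>\<alpha>\<close> counts new units through \<open>v\<close> at steps out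
      of an applicant, \<open>\<beta>\<close> withdrawn units at steps into an applicant, and
      \<open>\<gamma>\<close> the permitted use of the upward arc at \<open>v\<close>.\<close>
    define \<alpha> where "\<alpha> i = (if p i \<in> A then h (p (Suc i)) else 0)" for i
    define \<beta> where "\<beta> i = (if p (Suc i) \<in> A then h (p i) else 0)" for i
    define \<gamma> where "\<gamma> i = (of_bool (p i = v \<and> load F v < cap v) :: int)" for i
    have a: "(\<Sum>i\<in>J. h (leaf (g i))) = (\<Sum>i<k. \<alpha> i)"
    proof -
      have "(\<Sum>i<k. \<alpha> i) = (\<Sum>i\<in>J. h (p (Suc i)))"
        unfolding \<alpha>_def J_def by (simp add: sum.If_cases Int_def)
      then show ?thesis using g by simp
    qed
    define q where "q i = (if p i \<in> A then h (leaf (f (p i))) else 0)" for i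
    have b: "(\<Sum>i\<in>J. h (leaf (f (p i)))) = (\<Sum>i<k. q i)"
      unfolding q_def J_def by (simp add: sum.If_cases Int_def)
    \<comment> \<open>The cycle is closed, so a withdrawn unit may be counted at the arrival in its
      applicant instead of at the departure.\<close>
    have "(\<Sum>i<k. q i) = (\<Sum>i<k. q (Suc i))"
    proof -
      have "q k = q 0" using cl by (simp add: q_def)
      then show ?thesis using sum.lessThan_Suc_shift[of q k] sum.lessThan_Suc[of q k] by simp
    qed
    also have "\<dots> = (\<Sum>i<k. \<beta> i)"
    proof (rule sum.cong[OF HOL.refl])
      fix i assume "i \<in> {..<k}"
      then have s: "res_step F (p i) (w i) (p (Suc i))" using st by simp
      show "q (Suc i) = \<beta> i"
      proof (cases "p (Suc i) \<in> A")
        case True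
        then have pV: "p (Suc i) \<notin> V" "p (Suc i) \<noteq> 0" using disj zero_A by auto
        from s have "p i = leaf (f (p (Suc i)))"
        proof cases
          case up then show ?thesis using pV par[of "p i"] by auto
        next
          case (asg e e') then show ?thesis using True leafA by auto
        next
          case (una e) then show ?thesis using fo by auto
        qed (use pV in auto)
        then show ?thesis using True by (simp add: q_def \<beta>_def)
      qed (simp add: q_def \<beta>_def)
    qed
    finally have b: "(\<Sum>i\<in>J. h (leaf (f (p i)))) = (\<Sum>i<k. \<beta> i)" using b by simp
    \<comment> \<open>The balance of each arc is bounded by the change of potential. Only the upward
      arc at \<open>v\<close> lowers \<open>h\<close> without changing an assignment, and
      \<open>\<gamma>\<close> makes up for that.\<close>
    have "\<alpha> i - \<beta> i \<le> h (p (Suc i)) - h (p i) + \<gamma> i" if "i < k" for i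
      using st[OF that]
    proof cases
      case up
      then have "p i \<notin> A" "p (Suc i) \<notin> A" using par[of "p i"] disj zero_A by auto
      then show ?thesis using up anc_step[of "p i" v] by (auto simp: \<alpha>_def \<beta>_def \<gamma>_def h_def)
    next
      case down
      then have "p i \<notin> A" "p (Suc i) \<notin> A" using par[of "p (Suc i)"] disj zero_A by auto
      then show ?thesis using down anc_step[of "p (Suc i)" v] by (auto simp: \<alpha>_def \<beta>_def \<gamma>_def h_def)
    next
      case (asg e e')
      then have "p i \<in> A" "p (Suc i) \<notin> A" using own[of e] leafA by auto
      then show ?thesis using hA by (auto simp: \<alpha>_def \<beta>_def \<gamma>_def)
    next
      case (una e)
      then have "p i \<notin> A" "p (Suc i) \<in> A" using own leafA FE by auto
      then show ?thesis using hA by (auto simp: \<alpha>_def \<beta>_def \<gamma>_def)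
    qed
    then have "(\<Sum>i<k. \<alpha> i - \<beta> i) \<le> (\<Sum>i<k. h (p (Suc i)) - h (p i) + \<gamma> i)" by (intro sum_mono) auto
    also have "\<dots> = (\<Sum>i<k. \<gamma> i)"
      using cl by (simp add: sum.distrib sum_lessThan_telescope[of "\<lambda>i. h (p i)"])
    also have "\<dots> \<le> of_bool (load F v < cap v)"
    proof -
      have "card {i. i < k \<and> p i = v} \<le> 1"
        using inj by (auto simp: card_le_Suc0_iff_eq inj_on_def)
      then show ?thesis
        by (cases "load F v < cap v") (auto simp: \<gamma>_def of_bool_def sum.If_cases Int_def)
    qed
    finally have "(\<Sum>i<k. \<alpha> i) - (\<Sum>i<k. \<beta> i) \<le> of_bool (load F v < cap v)" by (simp add: sum_subtractf)
    then show ?thesis using diff a b ld[OF v] by (cases "load F v < cap v") simp_all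
  qed
  have "F' \<subseteq> Ed" using n F'_def by auto
  then have perfF': "perf F'" unfolding perf_def feas_def using injF' oF' feasF' by auto
  have "int (better F' F) - int (better F F') = (\<Sum>a\<in>A. vt (n a) (f a))"
    using perf oF' f n F'_def by (intro net_votes) auto
  also have "\<dots> = (\<Sum>i\<in>J. vt (g i) (f (p i)))" by (subst split[of vt]) (simp add: vt_def)
  also have "\<dots> = (\<Sum>i\<in>J. w i)" using g by simp
  also have "\<dots> = (\<Sum>i<k. w i)"
    using res_step_weight[OF st _ FE] by (intro sum.mono_neutral_left) (auto simp: J_def)
  finally show ?thesis using pos perfF' by (intro exI[of _ F']) auto
qed

text \<open>A shortest closed walk of positive weight repeats no node: otherwise it splits into two
  shorter closed walks, one of them positive. Then \<open>push_cycle\<close> applies.\<close>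

lemma no_positive_cycle:
  assumes "pop F" and "walk F u c u" shows "c \<le> 0"
proof (rule ccontr)
  assume "\<not> c \<le> 0"
  define P where "P k \<longleftrightarrow> (\<exists>p w. (\<forall>i<k. res_step F (p i) (w i) (p (Suc i))) \<and> p k = p 0 \<and> 0 < (\<Sum>i<k. w i))" for k
  from walk_seq[OF assms(2)] \<open>\<not> c \<le> 0\<close> have "\<exists>k. P k" unfolding P_def by (metis not_le)
  then obtain k where k: "P k" "\<And>k'. k' < k \<Longrightarrow> \<not> P k'" using exists_least_iff[of P] by blast
  then obtain p w where pw: "\<And>i. i < k \<Longrightarrow> res_step F (p i) (w i) (p (Suc i))" "p k = p 0" "0 < (\<Sum>i<k. w i)"
    unfolding P_def by blast
  have "False" if ij: "i < j" "j < k" "p i = p j" for i j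
  proof -
    \<comment> \<open>Both maps skip the loop between the visits \<open>i\<close> and
      \<open>j\<close>. They differ only at \<open>i\<close>, where \<open>p i = p j\<close>:
      \<open>q\<close> indexes the arrival at a node and \<open>q'\<close> the departure from
      it.\<close>
    define q where "q t = (if t \<le> i then t else t + (j - i))" for t
    define q' where "q' t = (if t < i then t else t + (j - i))" for t
    have "\<not> P (j - i)" using k(2) ij by auto
    moreover have "(\<forall>t<j - i. res_step F (p (t + i)) (w (t + i)) (p (Suc t + i)))" using pw(1) ij by auto
    ultimately have s1: "(\<Sum>t<j - i. w (t + i)) \<le> 0"
      unfolding P_def using ij by (auto dest!: spec[of _ "\<lambda>t. p (t + i)"] spec[of _ "\<lambda>t. w (t + i)"])
    have s1': "(\<Sum>t<j - i. w (t + i)) = (\<Sum>t=i..<j. w t)"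
      using sum.shift_bounds_nat_ivl[of w 0 i "j - i"] ij by (simp add: atLeast0LessThan)
    have pq: "p (q t) = p (q' t)" for t using ij by (auto simp: q_def q'_def)
    have qs: "q (Suc t) = Suc (q' t)" for t using ij by (auto simp: q_def q'_def)
    have "\<not> P (k - (j - i))" using k(2) ij by auto
    moreover have "\<forall>t<k - (j - i). res_step F (p (q t)) (w (q' t)) (p (q (Suc t)))"
      unfolding pq qs using pw(1) ij by (auto simp: q'_def)
    moreover have "p (q (k - (j - i))) = p (q 0)" unfolding pq using pw(2) ij by (auto simp: q'_def)
    ultimately have s2: "(\<Sum>t<k - (j - i). w (q' t)) \<le> 0"
      unfolding P_def by (auto dest!: spec[of _ "\<lambda>t. p (q t)"] spec[of _ "\<lambda>t. w (q' t)"])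
    have "(\<Sum>t<k - (j - i). w (q' t)) = (\<Sum>t<i. w (q' t)) + (\<Sum>t=i..<k - (j - i). w (q' t))"
      using ij by (metis (no_types, lifting) add_diff_inverse_nat diff_le_mono2 less_diff_conv lessThan_atLeast0 less_imp_le_nat nat_less_le not_less sum.atLeastLessThan_concat zero_le le_diff_conv2 add_le_cancel_left le_add_diff_inverse diff_add_inverse2)
    also have "(\<Sum>t=i..<k - (j - i). w (q' t)) = (\<Sum>t=j..<k. w t)"
    proof -
      have "(\<Sum>t=i..<k - (j - i). w (q' t)) = (\<Sum>t=i..<k - (j - i). w (t + (j - i)))" by (intro sum.cong) (auto simp: q'_def)
      then show ?thesis using sum.shift_bounds_nat_ivl[of w i "j - i" "k - (j - i)"] ij by simp
    qed
    also have "(\<Sum>t<i. w (q' t)) = (\<Sum>t<i. w t)" by (intro sum.cong) (auto simp: q'_def)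
    finally have "(\<Sum>t<i. w t) + (\<Sum>t=j..<k. w t) \<le> 0" using s2 by simp
    moreover have "(\<Sum>t<k. w t) = (\<Sum>t<i. w t) + (\<Sum>t=i..<j. w t) + (\<Sum>t=j..<k. w t)"
      using ij by (simp add: lessThan_atLeast0 sum.atLeastLessThan_concat)
    ultimately show False using s1 s1' pw(3) by linarith
  qed
  then have "inj_on p {..<k}" by (metis inj_onI lessThan_iff linorder_neqE_nat)
  from push_cycle[OF _ pw(1) pw(2) this pw(3)] assms(1) show False unfolding pop_def by (metis leD)
qed


section \<open>Walks with a bounded loss of votes\<close>

lemma load_pos: "e \<in> F \<Longrightarrow> F \<subseteq> Ed \<Longrightarrow> v \<in> anc (leaf e) \<Longrightarrow> 0 < load F v"
  unfolding load_def using finE by (auto simp: card_gt_0_iff dest: finite_subset)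

lemma load_mono: "F \<subseteq> F' \<Longrightarrow> F' \<subseteq> Ed \<Longrightarrow> load F v \<le> load F' v"
  unfolding load_def using finE by (intro card_mono) (auto dest: finite_subset)

text \<open>A blocked edge would put load on a class of quota 0.\<close>

lemma feas_live: "feas F \<Longrightarrow> e \<in> F \<Longrightarrow> live e"
  unfolding live_def feas_def using load_pos anc_subset by (metis gr0I le_0_eq less_irrefl subsetD)

lemma feas_subset: "feas F \<Longrightarrow> I \<subseteq> F \<Longrightarrow> feas I"
  unfolding feas_def using load_mono by (meson inj_on_subset le_trans subset_trans)

lemma walk_step0:
  assumes "res_step F u 0 v" and "\<exists>c\<ge>k. walk F v c w" shows "\<exists>c\<ge>k. walk F u c w"
  using assms walk_trans[OF _ walk_step] by (metis add_0)

lemma walk_down: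
  assumes "x \<in> insert 0 V" and "\<And>v. v \<in> anc x \<Longrightarrow> 0 < load F v" and "u \<in> insert 0 (anc x)"
  shows "walk F u 0 x"
  using assms
proof (induction arbitrary: u rule: up_induct)
  case zero
  then show ?case using anc_notin_V zero_V by (auto intro: walk.refl)
next
  case (par x)
  show ?case
  proof (cases "u = x")
    case False
    then have "walk F u 0 (par x)" using par anc_par[of x] by (intro par.IH) auto
    moreover have "res_step F (par x) 0 x" using par anc_par[of x] by (intro res_step.down) auto
    ultimately show ?thesis using walk.step[of F u 0 "par x" 0 x] by simp
  qed (simp add: walk.refl)
qed

text \<open>An edge of \<open>F\<close> loads all its ancestors, so the downward arcs to its leaf
  are present, even from the sink. Walks that end in the sink are closed in this way at no
  cost.\<close>

lemma walk_to_edge: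
  assumes "perf F" and "e \<in> F" and "u \<in> insert 0 (anc (leaf e))"
  shows "walk F u 0 (own e)"
proof -
  have "F \<subseteq> Ed" using assms(1) by (simp add: perf_def feas_def)
  then have "walk F u 0 (leaf e)" using assms leaf load_pos by (intro walk_down) auto
  then show ?thesis using walk.step[OF _ res_step.una[OF assms(2)], of u 0] by simp
qed

text \<open>Climbing is free up to a full class. Its quota is positive, so it holds an edge of
  \<open>F\<close>; moving the owner of that edge to a last resort, which ends in the sink, loses at
  most one vote.\<close>

lemma walk_climb:
  assumes "perf F" and "x \<in> insert 0 V" and "\<And>v. v \<in> anc x \<Longrightarrow> 0 < cap v"
  shows "\<exists>c\<ge>-1. walk F x c 0"
  using assms(2,3)
proof (induction rule: up_induct)
  case zero
  then show ?case using walk.refl[of F 0] by (intro exI[of _ 0]) auto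
next
  case (par x)
  have F: "F \<subseteq> Ed" "load F x \<le> cap x" using assms(1) par by (auto simp: perf_def feas_def)
  show ?case
  proof (cases "load F x < cap x")
    case True
    show ?thesis
      using walk_step0[OF res_step.up[OF par.hyps True]] par anc_par[of x] by auto
  next
    case False
    then have "0 < load F x" using par F anc_par[of x] by auto
    then obtain e where e: "e \<in> F" "x \<in> anc (leaf e)" unfolding load_def by (auto simp: card_gt_0_iff)
    then have w: "walk F x 0 (own e)" using walk_to_edge[OF assms(1)] by blast
    obtain d where d: "d \<in> Ed" "own d = own e" "leaf d = 0" using dummy own e F by blast
    then have "res_step F (own e) (vt d e) 0" using res_step.asg[of d e F] e by auto
    then have "walk F x (0 + vt d e) 0" using w walk.step by blast
    moreover have "vt d e \<ge> -1" by (simp add: vt_def)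
    ultimately show ?thesis by auto
  qed
qed

lemma dummy_live: "leaf d = 0 \<Longrightarrow> live d"
  using anc_notin_V zero_V by (auto simp: live_def)

lemma E1_exists:
  assumes "a \<in> A" shows "\<exists>e\<in>E1. own e = a"
proof -
  let ?X = "{e \<in> Ed. live e \<and> own e = a}"
  obtain d where "d \<in> ?X" using dummy[OF assms] dummy_live by auto
  then obtain e where "e \<in> ?X" "\<And>e'. e' \<in> ?X \<Longrightarrow> rk e \<le> rk e'"
    using ex_has_least_nat[of "\<lambda>e. e \<in> ?X" d rk] by blast
  then show ?thesis unfolding E1_def best_def by auto
qed

lemma E1_rk_le: "e \<in> E1 \<Longrightarrow> e' \<in> Ed \<Longrightarrow> live e' \<Longrightarrow> own e' = own e \<Longrightarrow> rk e \<le> rk e'"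
  unfolding E1_def best_def by auto

lemma E1_subset: "E1 \<subseteq> Ed" "e \<in> E1 \<Longrightarrow> live e" unfolding E1_def best_def by auto

lemma E1_rk_less: "e \<in> E1 \<Longrightarrow> e' \<in> Ed \<Longrightarrow> live e' \<Longrightarrow> own e' = own e \<Longrightarrow> e' \<notin> E1 \<Longrightarrow> rk e < rk e'"
  unfolding E1_def best_def by force

text \<open>The vote won by switching to a best edge pays for the vote that climbing from its leaf
  may lose.\<close>

lemma walk_not_E1:
  assumes "perf F" and "e \<in> F" and "e \<notin> E1"
  shows "\<exists>c\<ge>0. walk F (own e) c 0"
proof -
  have F: "F \<subseteq> Ed" "live e" using assms feas_live by (auto simp: perf_def feas_def)
  then obtain e1 where e1: "e1 \<in> E1" "own e1 = own e" using E1_exists own assms(2) by blast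
  have "rk e1 < rk e" using E1_rk_less[OF e1(1)] e1 F assms by auto
  then have "vt e1 e = 1" by (simp add: vt_def)
  then have "res_step F (own e) 1 (leaf e1)" using res_step.asg[of e1 e F] e1 E1_subset assms by auto
  moreover obtain c where c: "c \<ge> -1" "walk F (leaf e1) c 0"
    using walk_climb[OF assms(1) leaf[of e1]] E1_subset(1) E1_subset(2)[OF e1(1)] e1 unfolding live_def by blast
  ultimately have "walk F (own e) (1 + c) 0" using walk_trans walk_step by blast
  then show ?thesis using c by (intro exI[of _ "1 + c"]) auto
qed

text \<open>The free descent from the sink to the owner of \<open>e\<close> closes the walk, and a
  cycle of weight \<open>1 + c\<close> cannot be positive.\<close>

lemma no_gain:
  assumes "pop F" and "e \<in> F" and "e' \<in> Ed" "own e' = own e" "rk e' < rk e" and "walk F (leaf e') c 0"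
  shows "c < 0"
proof -
  have perf: "perf F" using assms by (simp add: pop_def)
  have "res_step F (own e) 1 (leaf e')" using res_step.asg[of e' e F] assms by (simp add: vt_def)
  then have "walk F (own e) (1 + c) 0" using walk_trans assms(6) walk_step by blast
  then have "walk F (own e) (1 + c + 0) (own e)" using walk_trans walk_to_edge[OF perf assms(2)] by blast
  then have "1 + c + 0 \<le> 0" using no_positive_cycle[OF assms(1)] by blast
  then show ?thesis by simp
qed

text \<open>The best-edge part has residual arcs that \<open>F\<close> lacks: upward ones at classes
  that are full only because of edges outside \<open>E1\<close>. From such a class the owner of one
  of these edges is reached for free and continues with \<open>walk_not_E1\<close>.\<close>

lemma RT_E1_walk:
  assumes perf: "perf F" and "u \<in> RT E1 {} (F \<inter> E1)"
  shows "\<exists>c\<ge>0. walk F u c 0"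
  using assms(2)
proof (induction rule: RT.induct)
  have FE: "F \<subseteq> Ed" using perf by (auto simp: perf_def feas_def)
  case sink
  then show ?case using walk.refl[of F 0] by (intro exI[of _ 0]) auto
next
  case (up v)
  have FE: "F \<subseteq> Ed" "load F v \<le> cap v" using perf up by (auto simp: perf_def feas_def)
  show ?case
  proof (cases "load F v < cap v")
    case True
    show ?thesis using walk_step0[OF res_step.up[OF up(1) True]] up by auto
  next
    case False
    then have less: "load (F \<inter> E1) v < load F v" using up FE by auto
    obtain e where "e \<in> F" "e \<notin> E1" "v \<in> anc (leaf e)"
    proof (rule ccontr)
      assume "\<not> thesis"
      then have "{e \<in> F. v \<in> anc (leaf e)} = {e \<in> F \<inter> E1. v \<in> anc (leaf e)}" using that by auto
      then show False using less by (simp add: load_def)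
    qed
    then show ?thesis using walk_not_E1[OF perf] walk_to_edge[OF perf] walk_trans
      by (metis add_0 insertCI)
  qed
next
  case (down v)
  then have "0 < load F v" using load_mono[of "F \<inter> E1" F v] perf by (auto simp: perf_def feas_def)
  then show ?case using walk_step0[OF res_step.down[OF down(1)]] down by auto
next
  case (asg e)
  have eE: "e \<in> Ed" using asg E1_subset by auto
  then obtain e' where e': "e' \<in> F" "own e' = own e" using own perf unfolding perf_def by (metis imageE)
  have "live e'" "e' \<in> Ed" using feas_live e' perf by (auto simp: perf_def feas_def)
  then have "rk e \<le> rk e'" using E1_rk_le asg e' by auto
  then have "0 \<le> vt e e'" by (simp add: vt_def)
  moreover have "walk F (own e) (vt e e') (leaf e)" using walk_step res_step.asg eE e' by metis
  ultimately show ?case using asg walk_trans by (metis add_increasing)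
next
  case (una e)
  then show ?case using walk_step0[OF res_step.una[of e F]] by auto
qed

section \<open>The characterization of popular matchings\<close>

definition cross :: "nat set \<Rightarrow> nat set" where
  "cross T = {v \<in> V. (v \<in> T) \<noteq> (par v \<in> T)}"

text \<open>An edge of \<open>E1\<close> that leaves \<open>T\<close> is used by no maximum flow of
  best edges. The second part lets applicants fall back on the best that ends inside
  \<open>T\<close>.\<close>

definition E2 :: "nat set \<Rightarrow> nat set" where
  "E2 T = {e \<in> E1. own e \<in> T \<longrightarrow> leaf e \<in> T} \<union> best {e \<in> Ed. live e \<and> leaf e \<in> T}"

text \<open>The last condition on \<open>F1\<close> expresses maximality: no unserved applicant
  reaches the sink. \<open>F2\<close> stands for the outcome of the second flow, with the crossing
  loads frozen.\<close>

context
  fixes F1 F2 T :: "nat set"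
  assumes T: "T = RT E1 {} F1"
    and F1: "feas F1" "F1 \<subseteq> E1" "A \<inter> T \<subseteq> own ` F1"
    and F2: "feas F2" "F2 \<subseteq> E2 T" "\<And>v. v \<in> cross T \<Longrightarrow> load F2 v = load F1 v"
begin

lemma zero_T: "0 \<in> T" using T RT.sink by simp

lemma tight_cong:
  assumes "\<And>v. v \<in> cross T \<Longrightarrow> load F v = load F' v" and "tight T F'"
  shows "tight T F"
  using assms unfolding tight_def cross_def by auto

text \<open>\<open>F2\<close> saturates the cut at \<open>T\<close>, so a rival \<open>N\<close>
  uses no more edges ending outside \<open>T\<close>. An applicant that gains must exchange an edge
  ending in \<open>T\<close> for one ending outside, and the opposite exchange always loses.\<close>

lemma popular_of_perfect:
  assumes A: "own ` F2 = A" shows "pop F2"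
  unfolding pop_def
proof (intro conjI allI impI)
  show perf: "perf F2" using A F2 by (simp add: perf_def)
  fix N assume N: "perf N"
  have tT: "tight T F2" using tight_cong F2(3) RT_tight F1 T by blast
  define f where "f = the_inv_into F2 own"
  define n where "n = the_inv_into N own"
  have injs: "inj_on own F2" "inj_on own N" "own ` N = A" "feas N" "F2 \<subseteq> Ed" "N \<subseteq> Ed"
    using perf N by (auto simp: perf_def feas_def)
  have f: "f a \<in> F2" "own (f a) = a" if "a \<in> A" for a
    using injs A that by (auto simp: f_def the_inv_into_into f_the_inv_into_f)
  have fo: "f (own e) = e" if "e \<in> F2" for e using injs that by (simp add: f_def the_inv_into_f_f)
  have n: "n a \<in> N" "own (n a) = a" if "a \<in> A" for a
    using injs that by (auto simp: n_def the_inv_into_into f_the_inv_into_f)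
  have no: "n (own e) = e" if "e \<in> N" for e using injs that by (simp add: n_def the_inv_into_f_f)
  define X where "X = {a \<in> A. leaf (f a) \<notin> T}"
  define Y where "Y = {a \<in> A. leaf (n a) \<notin> T}"
  have XY: "finite X" "finite Y" using finA by (auto simp: X_def Y_def)
  have "card X = out T F2" unfolding out_def
  proof (rule bij_betw_same_card[of f])
    show "bij_betw f X {e \<in> F2. leaf e \<notin> T}"
      unfolding X_def using f fo own injs by (intro bij_betw_byWitness[where f' = own]) auto
  qed
  moreover have "card Y = out T N" unfolding out_def
  proof (rule bij_betw_same_card[of n])
    show "bij_betw n Y {e \<in> N. leaf e \<notin> T}"
      unfolding Y_def using n no own injs by (intro bij_betw_byWitness[where f' = own]) auto
  qed
  ultimately have "card Y \<le> card X" using out_le[OF injs(4) zero_T] out_le[OF F2(1) zero_T] tT by auto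
  then have le: "card (Y - X) \<le> card (X - Y)" using XY
    by (metis card_le_sym_Diff)
  have nl: "live (n a)" "n a \<in> Ed" if "a \<in> A" for a using n[OF that] feas_live[OF injs(4)] injs by auto
  have fE: "f a \<in> E1 \<and> (a \<in> T \<longrightarrow> leaf (f a) \<in> T) \<or> f a \<in> best {e \<in> Ed. live e \<and> leaf e \<in> T}" if "a \<in> A" for a
    using f[OF that] F2(2) unfolding E2_def by auto
  have "{a \<in> A. \<exists>e\<in>N. \<exists>e'\<in>F2. own e = a \<and> own e' = a \<and> rk e < rk e'} \<subseteq> Y - X"
  proof
    fix a assume "a \<in> {a \<in> A. \<exists>e\<in>N. \<exists>e'\<in>F2. own e = a \<and> own e' = a \<and> rk e < rk e'}"
    then obtain e e' where "e \<in> N" "e' \<in> F2" "own e = a" "own e' = a" "rk e < rk e'" and a: "a \<in> A" by auto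
    then have a: "a \<in> A" "rk (n a) < rk (f a)" using fo[of e'] no[of e] by auto
    then have "f a \<notin> E1" using E1_rk_le[of "f a" "n a"] nl f n by auto
    then have b: "f a \<in> best {e \<in> Ed. live e \<and> leaf e \<in> T}" using fE a by auto
    then have "leaf (f a) \<in> T" by (simp add: best_def)
    moreover have "leaf (n a) \<notin> T" 
    proof
      assume "leaf (n a) \<in> T"
      then have "n a \<in> {e \<in> Ed. live e \<and> leaf e \<in> T}" "own (n a) = own (f a)" using nl[OF a(1)] f[OF a(1)] n[OF a(1)] by auto
      then have "rk (f a) \<le> rk (n a)" using b unfolding best_def by blast
      then show False using a by simp
    qed
    ultimately show "a \<in> Y - X" using a by (simp add: X_def Y_def)
  qed
  then have "better N F2 \<le> card (Y - X)" unfolding better_def using XY by (intro card_mono) auto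
  moreover have "X - Y \<subseteq> {a \<in> A. \<exists>e\<in>F2. \<exists>e'\<in>N. own e = a \<and> own e' = a \<and> rk e < rk e'}"
  proof
    fix a assume "a \<in> X - Y"
    then have a: "a \<in> A" "leaf (f a) \<notin> T" "leaf (n a) \<in> T" by (auto simp: X_def Y_def)
    then have "f a \<in> E1" "a \<notin> T" using fE by (auto simp: best_def)
    moreover have "n a \<notin> E1" using a n[OF a(1)] \<open>a \<notin> T\<close> T RT.asg[of "n a" E1 "{}" F1] by auto
    ultimately have "rk (f a) < rk (n a)" using E1_rk_less[of "f a" "n a"] nl f n a by auto
    then show "a \<in> {a \<in> A. \<exists>e\<in>F2. \<exists>e'\<in>N. own e = a \<and> own e' = a \<and> rk e < rk e'}" using f n a by blast
  qed
  then have "card (X - Y) \<le> better F2 N" unfolding better_def using finA by (intro card_mono) auto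
  ultimately show "better N F2 \<le> better F2 N" using le by linarith
qed

text \<open>The best-edge part \<open>I\<close> of \<open>M\<close> is a maximum flow, so its cut
  has the value of the cut at \<open>T\<close>. Hence \<open>M\<close> obeys the constraints of the
  second flow, and an applicant left over by \<open>F2\<close> would contradict a cut count against
  \<open>M\<close>.\<close>

lemma perfect_of_popular:
  assumes pop: "pop M" and T2: "A \<inter> RT (E2 T) (cross T) F2 \<subseteq> own ` F2"
  shows "own ` F2 = A"
proof -
  define I where "I = M \<inter> E1"
  define Q where "Q = RT E1 {} I"
  have perf: "perf M" using pop by (simp add: pop_def)
  then have fM: "feas M" and ME: "M \<subseteq> Ed" and injM: "inj_on own M" and oM: "own ` M = A"
    by (auto simp: perf_def feas_def)
  have fI: "feas I" using fM I_def feas_subset by blast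
  have Qw: "\<exists>c\<ge>0. walk M u c 0" if "u \<in> Q" for u using RT_E1_walk[OF perf] that by (simp add: Q_def I_def)
  have z: "0 \<in> Q" using RT.sink by (simp add: Q_def)
  \<comment> \<open>An applicant of \<open>Q\<close> off its best edges could improve along an edge
    ending in \<open>Q\<close>, from where the sink is reached without loss.\<close>
  have AQ: "A \<inter> Q \<subseteq> own ` I"
  proof
    fix a assume a: "a \<in> A \<inter> Q"
    then obtain e where e: "e \<in> M" "own e = a" using oM by auto
    have "e \<in> E1"
    proof (rule ccontr)
      assume ne: "e \<notin> E1"
      have aV: "a \<notin> V" "a \<noteq> 0" using a disj zero_A by auto
      from a have "a \<in> RT E1 {} I" by (simp add: Q_def)
      then obtain e1 where e1: "e1 \<in> E1" "own e1 = a" "leaf e1 \<in> Q"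
      proof cases
        case (down v) then show ?thesis using aV par[of v] by auto
      next
        case (asg e) then show ?thesis using that by (auto simp: Q_def)
      next
        case (una e) then show ?thesis using aV leaf[of e] E1_subset by (auto simp: I_def)
      qed (use aV in auto)
      have "rk e1 < rk e" using E1_rk_less[OF e1(1)] e e1 ne ME feas_live[OF fM] by auto
      moreover obtain c where "c \<ge> 0" "walk M (leaf e1) c 0" using Qw[OF e1(3)] by blast
      ultimately show False using no_gain[OF pop e(1), of e1 c] e e1 E1_subset by auto
    qed
    then show "a \<in> own ` I" using e by (auto simp: I_def)
  qed
  have cI: "card I = card (A \<inter> Q) + kap Q"
    using fI z AQ RT_tight Q_def by (intro cut_eq) (auto simp: I_def intro: RT.asg RT.una)
  have cF: "card F1 = card (A \<inter> T) + kap T"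
    using F1 zero_T RT_tight T by (intro cut_eq) (auto intro: RT.asg RT.una)
  have asgQ: "\<And>e. e \<in> E1 \<Longrightarrow> leaf e \<in> Q \<Longrightarrow> own e \<in> Q" and asgT: "\<And>e. e \<in> E1 \<Longrightarrow> leaf e \<in> T \<Longrightarrow> own e \<in> T"
    using RT.asg by (auto simp: Q_def T)
  have IE: "I \<subseteq> E1" by (simp add: I_def)
  \<comment> \<open>Each flow is bounded by the cut that the other one attains, so both cuts have
    the same value.\<close>
  note c1 = cut_le[OF F1(1,2) z asgQ] and c2 = cut_le[OF fI IE zero_T asgT]
  have eqs: "card F1 = card (A \<inter> Q) + kap Q" "card I = card (A \<inter> T) + kap T" using c1(1) c2(1) cI cF by auto
  have tF: "tight Q F1" "A \<inter> Q = own ` {e \<in> F1. leaf e \<in> Q}" using c1(2) eqs by auto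
  have tI: "tight T I" "A \<inter> T = own ` {e \<in> I. leaf e \<in> T}" using c2(2) eqs by auto
  have injF1: "inj_on own F1" using F1 by (simp add: feas_def)
  \<comment> \<open>\<open>F1\<close> is tight on \<open>Q\<close>, so none of its residual arcs
    enters \<open>Q\<close> from outside and the search that defines \<open>T\<close> stays inside
    \<open>Q\<close>.\<close>
  have TQ: "u \<in> Q" if "u \<in> T" for u
    using that unfolding T
  proof (induction rule: RT.induct)
    case (up v)
    then show ?case using tF(1) unfolding tight_def by force
  next
    case (down v)
    then show ?case using tF(1) unfolding tight_def by force
  next
    case (una e)
    then have "own e \<in> A \<inter> Q" using own F1 E1_subset by auto
    then obtain e' where "e' \<in> F1" "leaf e' \<in> Q" "own e' = own e" using tF(2) by auto
    then show ?case using injF1 una by (metis inj_onD)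
  qed (use z asgQ in auto)
  have oI: "out T I = kap T" using out_le[OF fI zero_T] tI by simp
  have finM: "finite M" using fM feas_finite by blast
  \<comment> \<open>\<open>I\<close> alone exhausts the capacity into \<open>T\<close>, so
    \<open>M\<close> has no further edge ending outside \<open>T\<close>.\<close>
  have outs: "{e \<in> I. leaf e \<notin> T} = {e \<in> M. leaf e \<notin> T}"
    using out_le(1)[OF fM zero_T] oI finM unfolding out_def by (intro card_seteq) (auto simp: I_def)
  then have "out T M = kap T" using oI by (simp add: out_def)
  then have tM: "tight T M" using out_le[OF fM zero_T] by simp
  have ME2: "M \<subseteq> E2 T"
  proof
    fix e assume e: "e \<in> M"
    show "e \<in> E2 T"
    proof (cases "e \<in> E1")
      case True
      have "leaf e \<in> T" if "own e \<in> T"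
      proof -
        have "own e \<in> A \<inter> T" using that own e ME by auto
        then obtain e' where "e' \<in> I" "leaf e' \<in> T" "own e' = own e" using tI(2) by auto
        then show ?thesis using injM e by (metis I_def IntD1 inj_onD)
      qed
      then show ?thesis using True by (simp add: E2_def)
    next
      case False
      then have lT: "leaf e \<in> T" using outs e by (auto simp: I_def)
      have "rk e \<le> rk e'" if e': "e' \<in> Ed" "live e'" "leaf e' \<in> T" "own e' = own e" for e'
      proof (rule ccontr)
        assume "\<not> rk e \<le> rk e'"
        moreover obtain c where "c \<ge> 0" "walk M (leaf e') c 0" using Qw[OF TQ[OF e'(3)]] by blast
        ultimately show False using no_gain[OF pop e, of e' c] e' by auto
      qed
      then show ?thesis using e ME feas_live[OF fM e] lT by (auto simp: E2_def best_def)
    qed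
  qed
  have loads: "load M v = load F2 v" if "v \<in> cross T" for v
  proof -
    have "tight T F1" using RT_tight F1 T by blast
    then show ?thesis using tM F2(3)[OF that] that unfolding tight_def cross_def by auto
  qed
  show ?thesis
  proof (rule ccontr)
    assume "own ` F2 \<noteq> A"
    moreover have oF2: "own ` F2 \<subseteq> A" using F2 own by (auto simp: feas_def)
    ultimately obtain a0 where a0: "a0 \<in> A" "a0 \<notin> own ` F2" by auto
    define Z where "Z = RT (E2 T) (cross T) F2"
    have zZ: "0 \<in> Z" by (simp add: Z_def RT.sink)
    have F2E: "F2 \<subseteq> Ed" "inj_on own F2" using F2 by (auto simp: feas_def)
    \<comment> \<open>On frozen arcs the loads agree. On the other arcs across the border of
      \<open>Z\<close>, \<open>F2\<close> is full inwards and empty outwards, since \<open>Z\<close>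
      is closed under its residual arcs.\<close>
    have "int (out Z M) \<le> int (out Z F2)"
      unfolding out_cross[OF ME zZ] out_cross[OF F2E(1) zZ]
    proof (rule sum_mono)
      fix v assume v: "v \<in> V"
      have le: "load M v \<le> cap v" "load F2 v \<le> cap v" using fM F2 v by (auto simp: feas_def)
      show "(of_bool (v \<notin> Z) - of_bool (par v \<notin> Z)) * int (load M v) \<le> (of_bool (v \<notin> Z) - of_bool (par v \<notin> Z)) * int (load F2 v)"
      proof (cases "v \<in> cross T")
        case False
        then have "v \<notin> Z \<Longrightarrow> par v \<in> Z \<Longrightarrow> load F2 v = cap v" "v \<in> Z \<Longrightarrow> par v \<notin> Z \<Longrightarrow> load F2 v = 0"
          using v le RT.up[of v "cross T" F2 "E2 T"] RT.down[of v "cross T" F2 "E2 T"] unfolding Z_def by force+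
        then show ?thesis using le by (cases "v \<in> Z"; cases "par v \<in> Z") auto
      qed (simp add: loads)
    qed
    \<comment> \<open>\<open>M\<close> serves all applicants outside \<open>Z\<close>, and closure
      under assignment keeps their edges from ending in \<open>Z\<close>.\<close>
    moreover have "card (A - Z) \<le> out Z M"
    proof -
      have "A - Z \<subseteq> own ` {e \<in> M. leaf e \<notin> Z}"
      proof
        fix a assume a: "a \<in> A - Z"
        then obtain e where e: "e \<in> M" "own e = a" using oM by auto
        then have "leaf e \<notin> Z" using a ME2 RT.asg[of e "E2 T" "cross T" F2] by (auto simp: Z_def)
        then show "a \<in> own ` {e \<in> M. leaf e \<notin> Z}" using e by auto
      qed
      then have "card (A - Z) \<le> card (own ` {e \<in> M. leaf e \<notin> Z})" using finM by (intro card_mono) auto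
      also have "\<dots> \<le> card {e \<in> M. leaf e \<notin> Z}" using finM by (intro card_image_le) auto
      finally show ?thesis by (simp add: out_def)
    qed
    \<comment> \<open>The edges of \<open>F2\<close> ending outside \<open>Z\<close> belong to
      applicants outside \<open>Z\<close>, and \<open>a0\<close> is one of these that has no
      edge.\<close>
    moreover have "out Z F2 < card (A - Z)"
    proof -
      have "own ` {e \<in> F2. leaf e \<notin> Z} \<subset> A - Z"
      proof
        show "own ` {e \<in> F2. leaf e \<notin> Z} \<subseteq> A - Z" using oF2 RT.una[of _ F2 "E2 T" "cross T"] by (auto simp: Z_def)
        show "own ` {e \<in> F2. leaf e \<notin> Z} \<noteq> A - Z" using a0 T2 by (auto simp: Z_def)
      qed
      then have "card (own ` {e \<in> F2. leaf e \<notin> Z}) < card (A - Z)" using finA by (intro psubset_card_mono) auto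
      moreover have "inj_on own {e \<in> F2. leaf e \<notin> Z}" using F2E(2) by (rule inj_on_subset) auto
      ultimately show ?thesis unfolding out_def using card_image by metis
    qed
    ultimately show False by linarith
  qed
qed

end
end

section \<open>Programs with running time\<close>

definition setv :: "vname \<Rightarrow> nat \<Rightarrow> state \<Rightarrow> state" where
  "setv x n s = s\<lparr>var := (var s)(x := n)\<rparr>"

definition seta :: "vname \<Rightarrow> nat \<Rightarrow> nat \<Rightarrow> state \<Rightarrow> state" where
  "seta x i n s = s\<lparr>arr := (arr s)(x := (arr s x)(i := n))\<rparr>"

lemma set_simps [simp]:
  "var (setv x n s) y = (if y = x then n else var s y)" "arr (setv x n s) = arr s"
  "var (seta x i n s) = var s" "arr (seta x i n s) y = (if y = x then (arr s x)(i := n) else arr s y)"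
  by (simp_all add: setv_def seta_def)

section \<open>Total correctness with step counts\<close>

definition wp :: "com \<Rightarrow> (nat \<Rightarrow> state \<Rightarrow> bool) \<Rightarrow> state \<Rightarrow> bool" where
  "wp c Q s \<longleftrightarrow> (\<exists>t s'. exec c s t s' \<and> Q t s')"

lemma wp_mono: "wp c P s \<Longrightarrow> (\<And>t s'. P t s' \<Longrightarrow> Q t s') \<Longrightarrow> wp c Q s"
  unfolding wp_def by blast

lemma wp_Skip [simp]: "wp Skip Q s \<longleftrightarrow> Q 1 s"
  unfolding wp_def by (metis exec_SkipE exec.Skip)

lemma wp_Assign [simp]: "wp (Assign x e) Q s \<longleftrightarrow> Q 1 (setv x (aval e s) s)"
  unfolding wp_def setv_def by (metis exec_AssignE exec.Assign)

lemma wp_Store [simp]: "wp (Store x i e) Q s \<longleftrightarrow> Q 1 (seta x (aval i s) (aval e s) s)"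
  unfolding wp_def seta_def by (metis exec_StoreE exec.Store)

lemma wp_Seq [simp]: "wp (Seq c1 c2) Q s \<longleftrightarrow> wp c1 (\<lambda>t1 s1. wp c2 (\<lambda>t2. Q (t1 + t2)) s1) s"
  unfolding wp_def by (blast elim: exec_SeqE intro: exec.Seq)

lemma wp_If [simp]:
  "wp (If b c1 c2) Q s \<longleftrightarrow> (if bval b s then wp c1 (\<lambda>t. Q (1 + t)) s else wp c2 (\<lambda>t. Q (1 + t)) s)"
proof (cases "bval b s")
  case True
  then show ?thesis unfolding wp_def by (auto elim!: exec_IfE) (blast intro: exec.IfTrue[OF True, simplified])
next
  case False
  then show ?thesis unfolding wp_def by (auto elim!: exec_IfE) (blast intro: exec.IfFalse[OF False, simplified])
qed

primrec modv :: "com \<Rightarrow> vname set" where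
  "modv Skip = {}"
| "modv (Assign x e) = {x}"
| "modv (Store x i e) = {}"
| "modv (Seq c1 c2) = modv c1 \<union> modv c2"
| "modv (If b c1 c2) = modv c1 \<union> modv c2"
| "modv (While b c) = modv c"

primrec moda :: "com \<Rightarrow> vname set" where
  "moda Skip = {}"
| "moda (Assign x e) = {}"
| "moda (Store x i e) = {x}"
| "moda (Seq c1 c2) = moda c1 \<union> moda c2"
| "moda (If b c1 c2) = moda c1 \<union> moda c2"
| "moda (While b c) = moda c"

definition same :: "vname set \<Rightarrow> vname set \<Rightarrow> state \<Rightarrow> state \<Rightarrow> bool" where
  "same X Y s s' \<longleftrightarrow> (\<forall>x. x \<notin> X \<longrightarrow> var s' x = var s x) \<and> (\<forall>y. y \<notin> Y \<longrightarrow> arr s' y = arr s y)"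

lemma same_var: "same X Y s s' \<Longrightarrow> x \<notin> X \<Longrightarrow> var s' x = var s x"
  and same_arr: "same X Y s s' \<Longrightarrow> y \<notin> Y \<Longrightarrow> arr s' y = arr s y"
  unfolding same_def by auto

lemma same_refl: "same X Y s s" unfolding same_def by simp

lemma same_trans: "same X Y s s' \<Longrightarrow> same X' Y' s' s'' \<Longrightarrow> same (X \<union> X') (Y \<union> Y') s s''"
  unfolding same_def by auto

lemma exec_same: "exec c s t s' \<Longrightarrow> same (modv c) (moda c) s s'"
  by (induction rule: exec.induct) (auto simp: same_def)

text \<open>The frame of \<open>c\<close> becomes available when a specification is used, so
  specifications need to speak only of what changes.\<close>

lemma wp_same:
  assumes "wp c P s" and "\<And>t s'. P t s' \<Longrightarrow> same (modv c) (moda c) s s' \<Longrightarrow> Q t s'"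
  shows "wp c Q s"
  using assms exec_same unfolding wp_def by blast

text \<open>\<open>k\<close> is a time credit carried by the invariant: each iteration pays for its
  body and its test, and unspent credit sharpens the bound on exit. The final \<open>+ 1\<close> is
  the failed test.\<close>

lemma wp_while:
  assumes "I k s"
    and step: "\<And>k s1. I k s1 \<Longrightarrow> same (modv c) (moda c) s s1 \<Longrightarrow> bval b s1 \<Longrightarrow>
      wp c (\<lambda>t s2. \<exists>k'. I k' s2 \<and> k' + t + 1 \<le> k) s1"
    and post: "\<And>k' t s'. I k' s' \<Longrightarrow> same (modv c) (moda c) s s' \<Longrightarrow> \<not> bval b s' \<Longrightarrow> t + k' \<le> k + 1 \<Longrightarrow> Q t s'"
  shows "wp (While b c) Q s"
proof -
  have "I k s1 \<Longrightarrow> same (modv c) (moda c) s s1 \<Longrightarrow>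
    \<exists>t s' k'. exec (While b c) s1 t s' \<and> I k' s' \<and> same (modv c) (moda c) s s' \<and> \<not> bval b s' \<and> t + k' \<le> k + 1" for s1
  proof (induction k arbitrary: s1 rule: less_induct)
    case (less k)
    show ?case
    proof (cases "bval b s1")
      case True
      from step[OF less.prems True] obtain t s2 k' where a: "exec c s1 t s2" "I k' s2" "k' + t + 1 \<le> k"
        unfolding wp_def by blast
      have s2: "same (modv c) (moda c) s s2" using same_trans[OF less.prems(2) exec_same[OF a(1)]] by simp
      have "k' < k" using a(3) by simp
      from less.IH[OF this a(2) s2] obtain t' s' k'' where b: "exec (While b c) s2 t' s'" "I k'' s'"
        "same (modv c) (moda c) s s'" "\<not> bval b s'" "t' + k'' \<le> k' + 1" by blast
      have "exec (While b c) s1 (1 + t + t') s'" using exec.WhileTrue[OF True a(1) b(1)] .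
      then show ?thesis using a b by (intro exI[of _ "1 + t + t'"] exI[of _ s'] exI[of _ k'']) auto
    next
      case False
      then show ?thesis using less.prems exec.WhileFalse[OF False] by fastforce
    qed
  qed
  from this[OF assms(1) same_refl] show ?thesis unfolding wp_def using post by blast
qed

text \<open>The upper bound is evaluated anew at each test, which is why the rules below ask that it
  keep its value.\<close>

definition For :: "vname \<Rightarrow> aexp \<Rightarrow> aexp \<Rightarrow> com \<Rightarrow> com" where
  "For x lo hi c = Seq (Assign x lo) (While (Less (Var x) hi) (Seq c (Assign x (Plus (Var x) (Const 1)))))"

lemma mod_For [simp]: "modv (For x lo hi c) = insert x (modv c)" "moda (For x lo hi c) = moda c"
  by (auto simp: For_def)

text \<open>The 2 added to each \<open>\<tau> k\<close> is for the test and the increment, the last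
  2 for the initial assignment and the failed test.\<close>

lemma wp_for:
  assumes x: "x \<notin> modv c"
    and L: "aval lo s = L" and LH: "L \<le> H"
    and hi: "\<And>s1. same (insert x (modv c)) (moda c) s s1 \<Longrightarrow> aval hi s1 = H"
    and init: "I L (setv x L s)"
    and step: "\<And>k s1. L \<le> k \<Longrightarrow> k < H \<Longrightarrow> I k s1 \<Longrightarrow> var s1 x = k \<Longrightarrow> same (insert x (modv c)) (moda c) s s1 \<Longrightarrow>
      wp c (\<lambda>t s2. I (Suc k) (setv x (Suc k) s2) \<and> t \<le> \<tau> k) s1"
    and post: "\<And>t s1. I H s1 \<Longrightarrow> var s1 x = H \<Longrightarrow> same (insert x (modv c)) (moda c) s s1 \<Longrightarrow>
      t \<le> (\<Sum>k=L..<H. \<tau> k + 2) + 2 \<Longrightarrow> Q t s1"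
  shows "wp (For x lo hi c) Q s"
proof -
  let ?c = "Seq c (Assign x (Plus (Var x) (Const 1)))"
  define J where "J k s1 \<longleftrightarrow> same (insert x (modv c)) (moda c) s s1 \<and>
    (\<exists>j. L \<le> j \<and> j \<le> H \<and> var s1 x = j \<and> I j s1 \<and> k = (\<Sum>k=j..<H. \<tau> k + 2))" for k s1
  have "wp (While (Less (Var x) hi) ?c) (\<lambda>t. Q (1 + t)) (setv x L s)"
  proof (rule wp_while[of J])
    show "J (\<Sum>k=L..<H. \<tau> k + 2) (setv x L s)"
      unfolding J_def using init LH by (auto simp: same_def)
  next
    fix k s1 assume J: "J k s1" and b: "bval (Less (Var x) hi) s1"
    then obtain j where j: "L \<le> j" "j \<le> H" "var s1 x = j" "I j s1" "k = (\<Sum>k=j..<H. \<tau> k + 2)"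
      and sm: "same (insert x (modv c)) (moda c) s s1" unfolding J_def by blast
    have jH: "j < H" using b hi[OF sm] j by simp
    have k: "k = (\<Sum>k=Suc j..<H. \<tau> k + 2) + (\<tau> j + 2)" using j(5) jH by (simp add: sum.atLeast_Suc_lessThan)
    have "wp c (\<lambda>t s2. \<exists>k'. J k' (setv x (Suc j) s2) \<and> k' + (t + 1) + 1 \<le> k \<and> var s2 x = j) s1"
      using step[OF j(1) jH j(4,3) sm]
    proof (rule wp_same)
      fix t s2 assume h: "I (Suc j) (setv x (Suc j) s2) \<and> t \<le> \<tau> j" "same (modv c) (moda c) s1 s2"
      have "same (insert x (modv c)) (moda c) s (setv x (Suc j) s2)"
        using same_trans[OF sm h(2)] by (auto simp: same_def)
      then show "\<exists>k'. J k' (setv x (Suc j) s2) \<and> k' + (t + 1) + 1 \<le> k \<and> var s2 x = j"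
        unfolding J_def using h k jH j x
        by (intro exI[of _ "\<Sum>k=Suc j..<H. \<tau> k + 2"]) (auto simp: same_def)
    qed
    then show "wp ?c (\<lambda>t s2. \<exists>k'. J k' s2 \<and> k' + t + 1 \<le> k) s1"
      by simp (erule wp_mono, auto)
  next
    fix k' t s' assume h: "J k' s'" "\<not> bval (Less (Var x) hi) s'" "t + k' \<le> (\<Sum>k=L..<H. \<tau> k + 2) + 1"
    then obtain j where j: "j \<le> H" "var s' x = j" "I j s'"
      and sm: "same (insert x (modv c)) (moda c) s s'" unfolding J_def by blast
    then have "j = H" using h(2) hi[OF sm] by simp
    then show "Q (1 + t) s'" using post[of s' "1 + t"] j sm h(3) by simp
  qed
  then show ?thesis unfolding For_def using L by simp
qed

lemma wp_for_const:
  assumes x: "x \<notin> modv c"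
    and L: "aval lo s = L" and LH: "L \<le> H"
    and hi: "\<And>s1. same (insert x (modv c)) (moda c) s s1 \<Longrightarrow> aval hi s1 = H"
    and init: "I L (setv x L s)"
    and step: "\<And>k s1. L \<le> k \<Longrightarrow> k < H \<Longrightarrow> I k s1 \<Longrightarrow> var s1 x = k \<Longrightarrow> same (insert x (modv c)) (moda c) s s1 \<Longrightarrow>
      wp c (\<lambda>t s2. I (Suc k) (setv x (Suc k) s2) \<and> t \<le> K) s1"
    and post: "\<And>t s1. I H s1 \<Longrightarrow> var s1 x = H \<Longrightarrow> same (insert x (modv c)) (moda c) s s1 \<Longrightarrow>
      t \<le> (K + 2) * (H - L) + 2 \<Longrightarrow> Q t s1"
  shows "wp (For x lo hi c) Q s"
  by (rule wp_for[OF x L LH hi init step post]) (auto simp: algebra_simps)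

text \<open>What a list head holds after \<open>k\<close> insertions: the last matching position
  shifted by one, with \<open>0\<close> for the empty list.\<close>

primrec lastix :: "(nat \<Rightarrow> nat) \<Rightarrow> nat \<Rightarrow> nat \<Rightarrow> nat" where
  "lastix f v 0 = 0"
| "lastix f v (Suc k) = (if f k = v then Suc k else lastix f v k)"

lemma lastix_Suc: "lastix f v k = Suc i \<Longrightarrow> i < k \<and> f i = v"
  by (induction k) (auto split: if_splits)

lemma lastix_gap: "lastix f v k \<le> j \<Longrightarrow> j < k \<Longrightarrow> f j \<noteq> v"
  by (induction k) (auto split: if_splits simp: less_Suc_eq)

definition cnt :: "(nat \<Rightarrow> nat) \<Rightarrow> nat \<Rightarrow> nat \<Rightarrow> nat" where
  "cnt f v k = card {j. j < k \<and> f j = v}"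

lemma cnt_Suc: "cnt f v (Suc k) = cnt f v k + (if f k = v then 1 else 0)"
proof -
  have "{j. j < Suc k \<and> f j = v} = (if f k = v then insert k {j. j < k \<and> f j = v} else {j. j < k \<and> f j = v})"
    by (auto simp: less_Suc_eq)
  then show ?thesis by (simp add: cnt_def)
qed

lemma cnt_0 [simp]: "cnt f v 0 = 0" by (simp add: cnt_def)

text \<open>Only positions with other values are skipped between \<open>k\<close> and the list
  entry, so the count is the length of the remaining list.\<close>

lemma cnt_lastix: "cnt f v (lastix f v k) = cnt f v k"
  by (induction k) (auto simp: cnt_Suc)

section \<open>Maximum flow by breadth-first search from the sink\<close>

text \<open>
  Arc \<open>i\<close> has tail \<open>tl\<close>, head \<open>hd\<close>, residual capacity \<open>rs\<close> and reverse arc \<open>pt\<close>, and is usable if \<open>en\<close> is \<open>1\<close>. The arcs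
  entering \<open>v\<close> are linked by \<open>fs\<close> and \<open>nt\<close>, whose entries are shifted by one so that \<open>0\<close> ends a list. A node is
  visited if its \<open>vis\<close> equals the stamp \<open>st\<close>, which saves clearing the array before each search; \<open>mt\<close> marks
  the applicants that are served.
\<close>

definition bfs_body :: com where
  "bfs_body =
    Seq (Assign ''i'' (Minus (Var ''p'') (Const 1)))
    (Seq (Assign ''u'' (Read ''tl'' (Var ''i'')))
    (Seq (If (And (And (Eq (Read ''en'' (Var ''i'')) (Const 1)) (Less (Const 0) (Read ''rs'' (Var ''i''))))
               (Not (Eq (Read ''vis'' (Var ''u'')) (Var ''st''))))
         (Seq (Store ''vis'' (Var ''u'') (Var ''st''))
         (Seq (Store ''na'' (Var ''u'') (Var ''i''))
         (Seq (Store ''q'' (Var ''qt'') (Var ''u''))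
         (Seq (Assign ''qt'' (Plus (Var ''qt'') (Const 1)))
              (If (And (Less (Var ''u'') (Plus (Var ''nA'') (Const 1))) (Eq (Read ''mt'' (Var ''u'')) (Const 0)))
                 (Assign ''tg'' (Var ''u'')) Skip)))))
         Skip)
      (Assign ''p'' (Read ''nt'' (Var ''i'')))))"

lemma mod_bfs_body [simp]:
  "modv bfs_body = {''i'', ''u'', ''qt'', ''tg'', ''p''}" "moda bfs_body = {''vis'', ''na'', ''q''}"
  by (auto simp: bfs_body_def)

definition bfs_outer_body :: com where
  "bfs_outer_body = Seq (Assign ''v'' (Read ''q'' (Var ''qh'')))
      (Seq (Assign ''qh'' (Plus (Var ''qh'') (Const 1)))
      (Seq (Assign ''p'' (Read ''fs'' (Var ''v'')))
      (While (Less (Const 0) (Var ''p'')) bfs_body)))"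

lemma mod_bfs_outer_body [simp]:
  "modv bfs_outer_body = {''v'', ''qh'', ''i'', ''u'', ''qt'', ''tg'', ''p''}" "moda bfs_outer_body = {''vis'', ''na'', ''q''}"
  by (auto simp: bfs_outer_body_def)

definition bfs :: com where
  "bfs = Seq (Assign ''st'' (Plus (Var ''st'') (Const 1)))
    (Seq (Store ''vis'' (Const 0) (Var ''st''))
    (Seq (Store ''q'' (Const 0) (Const 0))
    (Seq (Assign ''qh'' (Const 0))
    (Seq (Assign ''qt'' (Const 1))
    (Seq (Assign ''tg'' (Const 0))
    (While (Less (Var ''qh'') (Var ''qt'')) bfs_outer_body))))))"

lemma mod_bfs [simp]:
  "modv bfs = {''st'', ''v'', ''qh'', ''i'', ''u'', ''qt'', ''tg'', ''p''}" "moda bfs = {''vis'', ''na'', ''q''}"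
  by (auto simp: bfs_def)

definition arc_ok :: "state \<Rightarrow> nat \<Rightarrow> bool" where
  "arc_ok s i \<longleftrightarrow> arr s ''en'' i = 1 \<and> 0 < arr s ''rs'' i"

definition lists_ok :: "nat \<Rightarrow> state \<Rightarrow> bool" where
  "lists_ok M s \<longleftrightarrow> (\<forall>v. arr s ''fs'' v = lastix (arr s ''hd'') v M) \<and>
     (\<forall>i<M. arr s ''nt'' i = lastix (arr s ''hd'') (arr s ''hd'' i) i)"

definition seen :: "state \<Rightarrow> nat set" where
  "seen s = arr s ''q'' ` {..<var s ''qt''}"

text \<open>The queue doubles as a search tree, since the arc \<open>na\<close> of an entry leads to
  an earlier entry. The value \<open>0\<close> of \<open>tg\<close> can mean that no unserved
  applicant has been seen because node \<open>0\<close> is the sink.\<close>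

definition bfs_base :: "nat \<Rightarrow> state \<Rightarrow> bool" where
  "bfs_base M s \<longleftrightarrow> 0 < var s ''qt'' \<and> arr s ''q'' 0 = 0 \<and> inj_on (arr s ''q'') {..<var s ''qt''} \<and>
     (\<forall>v. arr s ''vis'' v \<le> var s ''st'') \<and>
     (\<forall>v. arr s ''vis'' v = var s ''st'' \<longleftrightarrow> v \<in> seen s) \<and>
     (\<forall>k. 0 < k \<longrightarrow> k < var s ''qt'' \<longrightarrow> arr s ''na'' (arr s ''q'' k) < M \<and> arc_ok s (arr s ''na'' (arr s ''q'' k)) \<and>
        arr s ''tl'' (arr s ''na'' (arr s ''q'' k)) = arr s ''q'' k \<and>
        arr s ''hd'' (arr s ''na'' (arr s ''q'' k)) \<in> arr s ''q'' ` {..<k}) \<and>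
     (var s ''tg'' = 0 \<longrightarrow> (\<forall>v\<in>seen s. 0 < v \<longrightarrow> v \<le> var s ''nA'' \<longrightarrow> arr s ''mt'' v \<noteq> 0)) \<and>
     (var s ''tg'' \<noteq> 0 \<longrightarrow> var s ''tg'' \<in> seen s \<and> var s ''tg'' \<le> var s ''nA'' \<and> arr s ''mt'' (var s ''tg'') = 0)"

lemma seen_setv: "x \<noteq> ''qt'' \<Longrightarrow> seen (setv x n s) = seen s"
  and arc_ok_setv: "arc_ok (setv x n s) = arc_ok s"
  by (simp_all add: seen_def arc_ok_def[abs_def])

lemma bfs_base_setv:
  "''qt'' \<noteq> x \<Longrightarrow> ''st'' \<noteq> x \<Longrightarrow> ''tg'' \<noteq> x \<Longrightarrow> ''nA'' \<noteq> x \<Longrightarrow> bfs_base M (setv x n s) = bfs_base M s"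
  by (simp add: bfs_base_def seen_def arc_ok_def)

definition closed_upto :: "nat \<Rightarrow> nat \<Rightarrow> state \<Rightarrow> bool" where
  "closed_upto M n s \<longleftrightarrow> (\<forall>i<M. arc_ok s i \<longrightarrow> arr s ''hd'' i \<in> arr s ''q'' ` {..<n} \<longrightarrow> arr s ''tl'' i \<in> seen s)"

lemma bfs_push:
  assumes "bfs_base M s" and i: "i < M" "arc_ok s i" "arr s ''hd'' i \<in> seen s" and u: "u = arr s ''tl'' i" "u \<notin> seen s"
    and s': "s' = setv ''qt'' (Suc (var s ''qt'')) (seta ''q'' (var s ''qt'') u (seta ''na'' u i (seta ''vis'' u (var s ''st'') s)))"
    and s'': "s'' = (if u \<le> var s ''nA'' \<and> arr s ''mt'' u = 0 then setv ''tg'' u s' else s')"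
  shows "bfs_base M s''" and "seen s'' = insert u (seen s)"
proof -
  have q: "arr s'' ''q'' = (arr s ''q'')(var s ''qt'' := u)" "var s'' ''qt'' = Suc (var s ''qt'')"
    "arr s'' ''na'' = (arr s ''na'')(u := i)" "arr s'' ''vis'' = (arr s ''vis'')(u := var s ''st'')"
    "arr s'' ''tl'' = arr s ''tl''" "arr s'' ''hd'' = arr s ''hd''" "arr s'' ''mt'' = arr s ''mt''" "var s'' ''nA'' = var s ''nA''"
    "var s'' ''st'' = var s ''st''" "arr s'' ''en'' = arr s ''en''" "arr s'' ''rs'' = arr s ''rs''"
    and tg: "var s'' ''tg'' = (if u \<le> var s ''nA'' \<and> arr s ''mt'' u = 0 then u else var s ''tg'')"
    unfolding s'' s' by simp_all
  have img: "arr s'' ''q'' ` {..<k} = arr s ''q'' ` {..<k}" if "k \<le> var s ''qt''" for k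
    using that unfolding q by (intro image_cong) auto
  show sn: "seen s'' = insert u (seen s)"
    using img[OF order.refl] unfolding seen_def q(2) lessThan_Suc image_insert by (simp only: q(1) fun_upd_same)
  have a: "arc_ok s'' j = arc_ok s j" for j unfolding arc_ok_def q ..
  have b: "0 < var s ''qt''" "arr s ''q'' 0 = 0" "inj_on (arr s ''q'') {..<var s ''qt''}"
     "\<forall>v. arr s ''vis'' v \<le> var s ''st''"
     "\<And>v. arr s ''vis'' v = var s ''st'' \<longleftrightarrow> v \<in> seen s"
     "\<And>k. 0 < k \<Longrightarrow> k < var s ''qt'' \<Longrightarrow> arr s ''na'' (arr s ''q'' k) < M \<and> arc_ok s (arr s ''na'' (arr s ''q'' k)) \<and>
        arr s ''tl'' (arr s ''na'' (arr s ''q'' k)) = arr s ''q'' k \<and>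
        arr s ''hd'' (arr s ''na'' (arr s ''q'' k)) \<in> arr s ''q'' ` {..<k}"
     "(var s ''tg'' = 0 \<longrightarrow> (\<forall>v\<in>seen s. 0 < v \<longrightarrow> v \<le> var s ''nA'' \<longrightarrow> arr s ''mt'' v \<noteq> 0))"
     "(var s ''tg'' \<noteq> 0 \<longrightarrow> var s ''tg'' \<in> seen s \<and> var s ''tg'' \<le> var s ''nA'' \<and> arr s ''mt'' (var s ''tg'') = 0)"
    using assms(1) unfolding bfs_base_def by auto
  have nu: "arr s ''q'' k \<noteq> u" if "k < var s ''qt''" for k using u(2) that unfolding seen_def by auto
  have u0: "u \<noteq> 0" using nu[OF b(1)] b(2) by simp
  have inj: "inj_on (arr s'' ''q'') {..<var s'' ''qt''}"
  proof (rule inj_onI)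
    fix x y assume xy: "x \<in> {..<var s'' ''qt''}" "y \<in> {..<var s'' ''qt''}" "arr s'' ''q'' x = arr s'' ''q'' y"
    show "x = y"
      using xy inj_onD[OF b(3), of x y] nu[of x] nu[of y]
      by (cases "x = var s ''qt''"; cases "y = var s ''qt''") (auto simp: q)
  qed
  have na: "arr s'' ''na'' (arr s'' ''q'' k) < M \<and> arc_ok s'' (arr s'' ''na'' (arr s'' ''q'' k)) \<and>
        arr s'' ''tl'' (arr s'' ''na'' (arr s'' ''q'' k)) = arr s'' ''q'' k \<and>
        arr s'' ''hd'' (arr s'' ''na'' (arr s'' ''q'' k)) \<in> arr s'' ''q'' ` {..<k}"
    if "0 < k" "k < var s'' ''qt''" for k
  proof (cases "k = var s ''qt''")
    case True
    then show ?thesis unfolding img[OF eq_imp_le[OF True]] a using i u by (simp add: q seen_def)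
  next
    case False
    then have k: "k < var s ''qt''" using that q by simp
    then show ?thesis unfolding img[OF less_imp_le[OF k]] a using b(6)[OF that(1) k] nu[OF k] by (simp add: q)
  qed
  show "bfs_base M s''"
    unfolding bfs_base_def
  proof (intro conjI allI impI)
    show "arr s'' ''vis'' v \<le> var s'' ''st''" for v using b(4) by (simp add: q)
    show "arr s'' ''vis'' v = var s'' ''st'' \<longleftrightarrow> v \<in> seen s''" for v using b(5) by (simp add: q sn)
    show "\<forall>v\<in>seen s''. 0 < v \<longrightarrow> v \<le> var s'' ''nA'' \<longrightarrow> arr s'' ''mt'' v \<noteq> 0" if "var s'' ''tg'' = 0"
      using that b(7) u0 unfolding tg sn q by (auto split: if_splits)
    assume t: "var s'' ''tg'' \<noteq> 0"
    show "var s'' ''tg'' \<in> seen s''" "var s'' ''tg'' \<le> var s'' ''nA''" "arr s'' ''mt'' (var s'' ''tg'') = 0"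
      using t b(8) unfolding tg sn q by (auto split: if_splits)
  qed (use inj na b nu[OF b(1)] in \<open>auto simp: q\<close>)
qed

text \<open>As list entries are shifted by one, the arcs into \<open>v\<close> numbered
  \<open>p\<close> or more are those already scanned. Each remaining arc holds credit 11, ten steps
  of the body and a test, and room for one queue entry.\<close>

definition inner_inv :: "nat \<Rightarrow> nat \<Rightarrow> nat \<Rightarrow> nat \<Rightarrow> state \<Rightarrow> bool" where
  "inner_inv M v Q k s \<longleftrightarrow> bfs_base M s \<and> v \<in> seen s \<and>
     (\<exists>j\<le>M. var s ''p'' = lastix (arr s ''hd'') v j) \<and>
     (\<forall>i<M. var s ''p'' \<le> i \<longrightarrow> arr s ''hd'' i = v \<longrightarrow> arc_ok s i \<longrightarrow> arr s ''tl'' i \<in> seen s) \<and>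
     var s ''qt'' + cnt (arr s ''hd'') v (var s ''p'') \<le> Q \<and>
     k = 11 * cnt (arr s ''hd'') v (var s ''p'')"

definition grows :: "state \<Rightarrow> state \<Rightarrow> bool" where
  "grows s s' \<longleftrightarrow> var s ''qt'' \<le> var s' ''qt'' \<and> (\<forall>k<var s ''qt''. arr s' ''q'' k = arr s ''q'' k)"

lemma grows_seen: "grows s s' \<Longrightarrow> seen s \<subseteq> seen s'"
  unfolding grows_def seen_def by (metis (no_types, lifting) image_cong image_mono lessThan_iff lessThan_subset_iff)

lemma bfs_inner_wp:
  assumes lists: "lists_ok M s" and base: "bfs_base M s" and v: "v \<in> seen s"
    and p: "var s ''p'' = lastix (arr s ''hd'') v M"
  shows "wp (While (Less (Const 0) (Var ''p'')) bfs_body) (\<lambda>t s'. t \<le> 11 * cnt (arr s ''hd'') v M + 1 \<and> bfs_base M s' \<and> grows s s' \<and>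
     (\<forall>i<M. arr s ''hd'' i = v \<longrightarrow> arc_ok s i \<longrightarrow> arr s ''tl'' i \<in> seen s') \<and>
     var s' ''qt'' \<le> var s ''qt'' + cnt (arr s ''hd'') v M) s"
proof (rule wp_while[where I = "\<lambda>k s'. inner_inv M v (var s ''qt'' + cnt (arr s ''hd'') v M) k s' \<and> grows s s'"])
  show "inner_inv M v (var s ''qt'' + cnt (arr s ''hd'') v M) (11 * cnt (arr s ''hd'') v M) s \<and> grows s s"
    using base v p lastix_gap[of "arr s ''hd''" v M] unfolding inner_inv_def grows_def by (auto simp: cnt_lastix)
next
  fix k s1 let ?Q = "var s ''qt'' + cnt (arr s ''hd'') v M"
  assume inv: "inner_inv M v ?Q k s1 \<and> grows s s1" and sm: "same (modv bfs_body) (moda bfs_body) s s1"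
    and b: "bval (Less (Const 0) (Var ''p'')) s1"
  note fr = same_arr[OF sm, simplified] same_var[OF sm, simplified]
  obtain i where i: "var s1 ''p'' = Suc i" using b by (auto simp: gr0_conv_Suc)
  obtain j where j: "j \<le> M" "Suc i = lastix (arr s1 ''hd'') v j" using inv i unfolding inner_inv_def by auto
  have ij: "i < j" "arr s1 ''hd'' i = v" using lastix_Suc[OF j(2)[symmetric]] by auto
  have iM: "i < M" using ij j by simp
  have nt: "arr s1 ''nt'' i = lastix (arr s1 ''hd'') v i"
    using lists iM ij fr unfolding lists_ok_def by auto
  have base1: "bfs_base M s1" and vs: "v \<in> seen s1" using inv by (auto simp: inner_inv_def)
  let ?u = "arr s1 ''tl'' i"
  let ?s2 = "setv ''u'' ?u (setv ''i'' i s1)"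
  have base2: "bfs_base M ?s2" and seen2: "seen ?s2 = seen s1" and arc2: "arc_ok ?s2 = arc_ok s1"
    using base1 by (simp_all add: bfs_base_setv seen_setv arc_ok_setv)
  have vis: "arr s1 ''vis'' ?u = var s1 ''st'' \<longleftrightarrow> ?u \<in> seen s1" using base1 unfolding bfs_base_def by blast
  have cn: "cnt (arr s1 ''hd'') v (Suc i) = cnt (arr s1 ''hd'') v (lastix (arr s1 ''hd'') v i) + 1"
    using ij by (simp add: cnt_Suc cnt_lastix)
  \<comment> \<open>The common end of both cases: after a possible push, \<open>p\<close> moves on
    along the list.\<close>
  have fin: "\<exists>k'. (inner_inv M v ?Q k' (setv ''p'' (lastix (arr s1 ''hd'') v i) s3) \<and> grows s (setv ''p'' (lastix (arr s1 ''hd'') v i) s3)) \<and> k' + t + 1 \<le> k"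
    if h: "bfs_base M s3" "seen s1 \<subseteq> seen s3" "arc_ok s1 i \<Longrightarrow> ?u \<in> seen s3" "arr s3 ''hd'' = arr s1 ''hd''" "arr s3 ''tl'' = arr s1 ''tl''"
      "arc_ok s3 = arc_ok s1" "var s3 ''qt'' \<le> var s1 ''qt'' + 1" "grows s1 s3" "t \<le> 10" for s3 t
  proof -
    let ?s4 = "setv ''p'' (lastix (arr s1 ''hd'') v i) s3"
    have *: "bfs_base M ?s4" "seen ?s4 = seen s3" "arc_ok ?s4 = arc_ok s1"
      using h by (simp_all add: bfs_base_setv seen_setv arc_ok_setv)
    have "arr s1 ''tl'' i' \<in> seen s3"
      if c: "i' < M" "lastix (arr s1 ''hd'') v i \<le> i'" "arr s1 ''hd'' i' = v" "arc_ok s1 i'" for i'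
    proof -
      have "i \<le> i'" using lastix_gap[OF c(2)] c(3) by (meson not_le)
      then consider "i' = i" | "Suc i \<le> i'" by linarith
      then show ?thesis
      proof cases
        case 1 then show ?thesis using h(3) c by simp
      next
        case 2 then show ?thesis using inv c h(2) i unfolding inner_inv_def by auto
      qed
    qed
    then have "inner_inv M v ?Q (11 * cnt (arr s1 ''hd'') v (lastix (arr s1 ''hd'') v i)) ?s4"
      using * h inv vs i cn j ij unfolding inner_inv_def
      by (auto intro!: exI[of _ i])
    moreover have "grows s ?s4" using inv h(8) unfolding grows_def by auto
    moreover have "11 * cnt (arr s1 ''hd'') v (lastix (arr s1 ''hd'') v i) + t + 1 \<le> k"
      using inv i cn h(9) unfolding inner_inv_def by simp
    ultimately show ?thesis by blast
  qed
  show "wp bfs_body (\<lambda>t s2. \<exists>k'. (inner_inv M v ?Q k' s2 \<and> grows s s2) \<and> k' + t + 1 \<le> k) s1"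
  proof (cases "arc_ok s1 i \<and> ?u \<notin> seen s1")
    case True
    let ?s' = "setv ''qt'' (Suc (var ?s2 ''qt'')) (seta ''q'' (var ?s2 ''qt'') ?u (seta ''na'' ?u i (seta ''vis'' ?u (var ?s2 ''st'') ?s2)))"
    define s3 where "s3 = (if ?u \<le> var ?s2 ''nA'' \<and> arr ?s2 ''mt'' ?u = 0 then setv ''tg'' ?u ?s' else ?s')"
    have pushed: "bfs_base M s3" "seen s3 = insert ?u (seen ?s2)"
      using True ij vs by (intro bfs_push[OF base2 iM _ _ _ _ refl s3_def]; simp add: seen2 arc2)+
    have "\<exists>k'. (inner_inv M v ?Q k' (setv ''p'' (lastix (arr s1 ''hd'') v i) s3) \<and> grows s (setv ''p'' (lastix (arr s1 ''hd'') v i) s3)) \<and> k' + 10 + 1 \<le> k"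
      using pushed by (intro fin) (auto simp: s3_def arc_ok_def[abs_def] grows_def seen2)
    then obtain k' where k': "inner_inv M v ?Q k' (setv ''p'' (lastix (arr s1 ''hd'') v i) s3)" "grows s (setv ''p'' (lastix (arr s1 ''hd'') v i) s3)" "k' + 10 + 1 \<le> k" by blast
    show ?thesis unfolding bfs_body_def using True vis nt i k' unfolding s3_def by (auto simp: arc_ok_def intro!: exI[of _ k'] split: if_splits)
  next
    case False
    have "\<exists>k'. (inner_inv M v ?Q k' (setv ''p'' (lastix (arr s1 ''hd'') v i) ?s2) \<and> grows s (setv ''p'' (lastix (arr s1 ''hd'') v i) ?s2)) \<and> k' + 10 + 1 \<le> k"
      using base2 False by (intro fin) (auto simp: seen2 arc2 grows_def)
    then obtain k' where k': "inner_inv M v ?Q k' (setv ''p'' (lastix (arr s1 ''hd'') v i) ?s2)" "grows s (setv ''p'' (lastix (arr s1 ''hd'') v i) ?s2)" "k' + 10 + 1 \<le> k" by blast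
    show ?thesis unfolding bfs_body_def using False vis nt i k' by (auto simp: arc_ok_def intro!: exI[of _ k'] split: if_splits)
  qed
next
  fix k' t s' assume inv: "inner_inv M v (var s ''qt'' + cnt (arr s ''hd'') v M) k' s' \<and> grows s s'"
    and sm: "same (modv bfs_body) (moda bfs_body) s s'"
    and b: "\<not> bval (Less (Const 0) (Var ''p'')) s'" and t: "t + k' \<le> 11 * cnt (arr s ''hd'') v M + 1"
  note fr = same_arr[OF sm, simplified] same_var[OF sm, simplified]
  show "t \<le> 11 * cnt (arr s ''hd'') v M + 1 \<and> bfs_base M s' \<and> grows s s' \<and>
     (\<forall>i<M. arr s ''hd'' i = v \<longrightarrow> arc_ok s i \<longrightarrow> arr s ''tl'' i \<in> seen s') \<and>
     var s' ''qt'' \<le> var s ''qt'' + cnt (arr s ''hd'') v M"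
    using inv b t fr unfolding inner_inv_def arc_ok_def by auto
qed


lemma cnt_outside:
  "finite X \<Longrightarrow> v \<notin> X \<Longrightarrow> card {i. i < M \<and> f i \<notin> X} = card {i. i < M \<and> f i \<notin> insert v X} + cnt f v M" for f :: "nat \<Rightarrow> nat"
proof -
  assume "v \<notin> X"
  then have "{i. i < M \<and> f i \<notin> X} = {i. i < M \<and> f i \<notin> insert v X} \<union> {i. i < M \<and> f i = v}" by auto
  moreover have "{i. i < M \<and> f i \<notin> insert v X} \<inter> {i. i < M \<and> f i = v} = {}" by auto
  ultimately show ?thesis unfolding cnt_def by (simp add: card_Un_disjoint)
qed

text \<open>Of the credit 16 of an arc whose head is not yet expanded, 11 pays for scanning it and 5
  for the queue entry it may create. The 5 of an entry covers three assignments, the failed inner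
  test and the outer test.\<close>

definition outer_inv :: "nat \<Rightarrow> nat \<Rightarrow> state \<Rightarrow> bool" where
  "outer_inv M k s \<longleftrightarrow> bfs_base M s \<and> var s ''qh'' \<le> var s ''qt'' \<and> closed_upto M (var s ''qh'') s \<and>
     k = 16 * card {i. i < M \<and> arr s ''hd'' i \<notin> arr s ''q'' ` {..<var s ''qh''}} + 5 * (var s ''qt'' - var s ''qh'')"

lemma bfs_wp:
  assumes lists: "lists_ok M s" and vis: "\<And>v. arr s ''vis'' v \<le> var s ''st''"
  shows "wp bfs (\<lambda>t s'. t \<le> 16 * M + 12 \<and> bfs_base M s' \<and> closed_upto M (var s' ''qt'') s') s"
proof -
  let ?s = "setv ''tg'' 0 (setv ''qt'' 1 (setv ''qh'' 0 (seta ''q'' 0 0 (seta ''vis'' 0 (Suc (var s ''st'')) (setv ''st'' (Suc (var s ''st'')) s)))))"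
  let ?k = "16 * M + 5"
  have "wp (While (Less (Var ''qh'') (Var ''qt'')) bfs_outer_body)
    (\<lambda>t s'. 6 + t \<le> 16 * M + 12 \<and> bfs_base M s' \<and> closed_upto M (var s' ''qt'') s') ?s"
  proof (rule wp_while[of "outer_inv M"])
    have v: "arr s ''vis'' v \<le> Suc (var s ''st'')" "arr s ''vis'' v \<noteq> Suc (var s ''st'')" for v using vis[of v] by auto
    show "outer_inv M ?k ?s"
      using v unfolding outer_inv_def bfs_base_def closed_upto_def seen_def by (auto simp: lessThan_Suc)
  next
    fix k s1 assume inv: "outer_inv M k s1" and sm: "same (modv bfs_outer_body) (moda bfs_outer_body) ?s s1"
      and b: "bval (Less (Var ''qh'') (Var ''qt'')) s1"
    note fr = same_arr[OF sm, simplified] same_var[OF sm, simplified]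
    let ?qh = "var s1 ''qh''" and ?hd = "arr s1 ''hd''"
    let ?v = "arr s1 ''q'' ?qh"
    let ?s2 = "setv ''p'' (arr s1 ''fs'' ?v) (setv ''qh'' (Suc ?qh) (setv ''v'' ?v s1))"
    have base1: "bfs_base M s1" and cl1: "closed_upto M ?qh s1" using inv by (auto simp: outer_inv_def)
    have qh: "?qh < var s1 ''qt''" using b by simp
    have base2: "bfs_base M ?s2" and seen2: "seen ?s2 = seen s1" and arc2: "arc_ok ?s2 = arc_ok s1"
      using base1 by (simp_all add: bfs_base_setv seen_setv arc_ok_setv)
    have l1: "lists_ok M s1" using lists fr unfolding lists_ok_def by simp
    have l2: "lists_ok M ?s2" using l1 unfolding lists_ok_def by simp
    have vs: "?v \<in> seen s1" using qh unfolding seen_def by auto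
    have "?v \<notin> arr s1 ''q'' ` {..<?qh}"
    proof
      assume "?v \<in> arr s1 ''q'' ` {..<?qh}"
      then obtain j where j: "j < ?qh" "arr s1 ''q'' j = ?v" by auto
      have "inj_on (arr s1 ''q'') {..<var s1 ''qt''}" using base1 unfolding bfs_base_def by blast
      from inj_onD[OF this j(2)] show False using j(1) qh by simp
    qed
    then have un: "card {i. i < M \<and> ?hd i \<notin> arr s1 ''q'' ` {..<?qh}} =
        card {i. i < M \<and> ?hd i \<notin> insert ?v (arr s1 ''q'' ` {..<?qh})} + cnt ?hd ?v M"
      by (intro cnt_outside) auto
    have "wp (While (Less (Const 0) (Var ''p'')) bfs_body)
       (\<lambda>t s2. \<exists>k'. outer_inv M k' s2 \<and> k' + (3 + t) + 1 \<le> k) ?s2"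
    proof (rule wp_same[OF bfs_inner_wp[OF l2 base2, of ?v]])
      show "?v \<in> seen ?s2" using vs seen2 by simp
      show "var ?s2 ''p'' = lastix (arr ?s2 ''hd'') ?v M" using l1 unfolding lists_ok_def by simp
    next
      fix t s' assume h: "t \<le> 11 * cnt (arr ?s2 ''hd'') ?v M + 1 \<and> bfs_base M s' \<and> grows ?s2 s' \<and>
         (\<forall>i<M. arr ?s2 ''hd'' i = ?v \<longrightarrow> arc_ok ?s2 i \<longrightarrow> arr ?s2 ''tl'' i \<in> seen s') \<and>
         var s' ''qt'' \<le> var ?s2 ''qt'' + cnt (arr ?s2 ''hd'') ?v M"
        and sm': "same (modv (While (Less (Const 0) (Var ''p'')) bfs_body)) (moda (While (Less (Const 0) (Var ''p'')) bfs_body)) ?s2 s'"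
      note fr' = same_arr[OF sm', simplified] same_var[OF sm', simplified]
      have e: "arr s' ''hd'' = ?hd" "arr s' ''tl'' = arr s1 ''tl''" "arr s' ''en'' = arr s1 ''en''" "arr s' ''rs'' = arr s1 ''rs''"
        "var s' ''qh'' = Suc ?qh" by (simp_all add: fr')
      have gr: "var s1 ''qt'' \<le> var s' ''qt''" "\<And>k. k < var s1 ''qt'' \<Longrightarrow> arr s' ''q'' k = arr s1 ''q'' k"
        using h by (auto simp: grows_def)
      have img: "arr s' ''q'' ` {..<Suc ?qh} = insert ?v (arr s1 ''q'' ` {..<?qh})"
        using gr(2) qh by (auto simp: lessThan_Suc image_iff)
      have ss: "seen s1 \<subseteq> seen s'" using h grows_seen[of ?s2 s'] seen2 by simp
      have cl: "closed_upto M (Suc ?qh) s'"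
        using h cl1 ss unfolding closed_upto_def img e arc_ok_def by auto
      let ?k' = "16 * card {i. i < M \<and> ?hd i \<notin> insert ?v (arr s1 ''q'' ` {..<?qh})} + 5 * (var s' ''qt'' - Suc ?qh)"
      have "outer_inv M ?k' s'" unfolding outer_inv_def e img using h cl gr qh by simp
      moreover have "?k' + (3 + t) + 1 \<le> k"
      proof -
        have k: "k = 16 * (card {i. i < M \<and> ?hd i \<notin> insert ?v (arr s1 ''q'' ` {..<?qh})} + cnt ?hd ?v M) + 5 * (var s1 ''qt'' - ?qh)"
          using inv un unfolding outer_inv_def by simp
        have "t \<le> 11 * cnt ?hd ?v M + 1" "var s' ''qt'' \<le> var s1 ''qt'' + cnt ?hd ?v M" using h by auto
        moreover from this(2) have "(var s' ''qt'' - Suc ?qh) + 1 \<le> (var s1 ''qt'' - ?qh) + cnt ?hd ?v M" using qh by simp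
        ultimately show ?thesis unfolding k by (simp add: algebra_simps)
      qed
      ultimately show "\<exists>k'. outer_inv M k' s' \<and> k' + (3 + t) + 1 \<le> k" by blast
    qed
    then show "wp bfs_outer_body (\<lambda>t s2. \<exists>k'. outer_inv M k' s2 \<and> k' + t + 1 \<le> k) s1"
      unfolding bfs_outer_body_def by simp (erule wp_mono, auto)
  next
    fix k' t s' assume inv: "outer_inv M k' s'" and b: "\<not> bval (Less (Var ''qh'') (Var ''qt'')) s'" and t: "t + k' \<le> ?k + 1"
    have "var s' ''qh'' = var s' ''qt''" using inv b by (auto simp: outer_inv_def)
    then show "6 + t \<le> 16 * M + 12 \<and> bfs_base M s' \<and> closed_upto M (var s' ''qt'') s'"
      using inv t by (auto simp: outer_inv_def)
  qed
  then show ?thesis unfolding bfs_def by simp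
qed

section \<open>Augmentation along the search tree\<close>

definition aug_body :: com where
  "aug_body = Seq (Assign ''i'' (Read ''na'' (Var ''u'')))
    (Seq (Store ''rs'' (Var ''i'') (Minus (Read ''rs'' (Var ''i'')) (Const 1)))
    (Seq (Store ''rs'' (Read ''pt'' (Var ''i'')) (Plus (Read ''rs'' (Read ''pt'' (Var ''i''))) (Const 1)))
         (Assign ''u'' (Read ''hd'' (Var ''i'')))))"

lemma mod_aug_body [simp]: "modv aug_body = {''i'', ''u''}" "moda aug_body = {''rs''}"
  by (auto simp: aug_body_def)

definition aug :: com where
  "aug = Seq (Assign ''u'' (Var ''tg'')) (Seq (Store ''mt'' (Var ''tg'') (Const 1)) (While (Less (Const 0) (Var ''u'')) aug_body))"

lemma mod_aug [simp]: "modv aug = {''i'', ''u''}" "moda aug = {''mt'', ''rs''}"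
  by (auto simp: aug_def)

definition maxflow_body :: com where
  "maxflow_body = Seq bfs (If (Eq (Var ''tg'') (Const 0)) (Assign ''go'' (Const 0)) aug)"

lemma mod_maxflow_body [simp]:
  "modv maxflow_body = {''go'', ''st'', ''v'', ''qh'', ''i'', ''u'', ''qt'', ''tg'', ''p''}"
  "moda maxflow_body = {''vis'', ''na'', ''q'', ''mt'', ''rs''}"
  by (auto simp: maxflow_body_def)

definition maxflow :: com where
  "maxflow = Seq (Assign ''go'' (Const 1)) (While (Less (Const 0) (Var ''go'')) maxflow_body)"

lemma mod_maxflow [simp]:
  "modv maxflow = {''go'', ''st'', ''v'', ''qh'', ''i'', ''u'', ''qt'', ''tg'', ''p''}"
  "moda maxflow = {''vis'', ''na'', ''q'', ''mt'', ''rs''}"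
  by (auto simp: maxflow_def)

text \<open>Arcs \<open>2 b\<close> and \<open>2 b + 1\<close> are mutually reverse; the residual capacity of the odd one is the flow
  through pair \<open>b\<close>.\<close>

definition pairs_ok :: "nat \<Rightarrow> state \<Rightarrow> bool" where
  "pairs_ok n s \<longleftrightarrow> (\<forall>b<n. arr s ''pt'' (2 * b) = Suc (2 * b) \<and> arr s ''pt'' (Suc (2 * b)) = 2 * b \<and>
     arr s ''tl'' (Suc (2 * b)) = arr s ''hd'' (2 * b) \<and> arr s ''hd'' (Suc (2 * b)) = arr s ''tl'' (2 * b) \<and>
     arr s ''en'' (Suc (2 * b)) = arr s ''en'' (2 * b))"

definition flow_at :: "nat \<Rightarrow> (nat \<Rightarrow> nat) \<Rightarrow> (nat \<Rightarrow> nat) \<Rightarrow> nat \<Rightarrow> nat" where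
  "flow_at n f r v = (\<Sum>b<n. if f (2 * b) = v then r (Suc (2 * b)) else 0)"

definition outflow :: "nat \<Rightarrow> state \<Rightarrow> nat \<Rightarrow> nat" where
  "outflow n s v = flow_at n (arr s ''tl'') (arr s ''rs'') v"

definition inflow :: "nat \<Rightarrow> state \<Rightarrow> nat \<Rightarrow> nat" where
  "inflow n s v = flow_at n (arr s ''hd'') (arr s ''rs'') v"

text \<open>Conservation in the course of an augmentation: \<open>mt\<close> is the supply, and one
  unit is held up at \<open>u\<close>. With \<open>u = 0\<close> there is none, as nothing is
  demanded of the sink.\<close>

definition excess_at :: "nat \<Rightarrow> nat \<Rightarrow> state \<Rightarrow> bool" where
  "excess_at n u s \<longleftrightarrow> (\<forall>v>0. outflow n s v + of_bool (v = u) = inflow n s v + arr s ''mt'' v)"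

text \<open>The second conjunct is what freezes the crossing arcs while the second flow is
  augmented.\<close>

definition same_caps :: "nat \<Rightarrow> state \<Rightarrow> state \<Rightarrow> bool" where
  "same_caps n s s' \<longleftrightarrow> (\<forall>b<n. arr s' ''rs'' (2 * b) + arr s' ''rs'' (Suc (2 * b)) = arr s ''rs'' (2 * b) + arr s ''rs'' (Suc (2 * b))) \<and>
     (\<forall>i<2 * n. arr s ''en'' i \<noteq> 1 \<longrightarrow> arr s' ''rs'' i = arr s ''rs'' i)"

lemma same_caps_trans: "same_caps n s s' \<Longrightarrow> same_caps n s' s'' \<Longrightarrow> arr s' ''en'' = arr s ''en'' \<Longrightarrow> same_caps n s s''"
  unfolding same_caps_def by simp

text \<open>Changing one summand, in a form that avoids truncated subtraction.\<close>

lemma sum_upd: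
  fixes f g :: "nat \<Rightarrow> nat"
  assumes "b < n" and "\<And>j. j \<noteq> b \<Longrightarrow> f j = g j"
  shows "(\<Sum>j<n. f j) + g b = (\<Sum>j<n. g j) + f b"
proof -
  have "(\<Sum>j<n. h j) = h b + (\<Sum>j\<in>{..<n} - {b}. h j)" for h :: "nat \<Rightarrow> nat"
    using assms(1) by (simp add: sum.remove)
  moreover have "(\<Sum>j\<in>{..<n} - {b}. f j) = (\<Sum>j\<in>{..<n} - {b}. g j)" using assms(2) by (intro sum.cong) auto
  ultimately show ?thesis by simp
qed

text \<open>The flow of the pair grows or shrinks by one according to whether \<open>i\<close> is
  its forward or its reverse arc; either way the held unit moves from tail to head. The last claim
  keeps the rest of the path usable.\<close>

lemma push_arc:
  assumes pairs: "pairs_ok n s" and i: "i < 2 * n" "0 < arr s ''rs'' i" "arr s ''en'' i = 1" and ex: "excess_at n (arr s ''tl'' i) s"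
    and s': "arr s' ''rs'' = (arr s ''rs'')(i := arr s ''rs'' i - 1, arr s ''pt'' i := Suc (arr s ''rs'' (arr s ''pt'' i)))"
      "arr s' ''tl'' = arr s ''tl''" "arr s' ''hd'' = arr s ''hd''" "arr s' ''mt'' = arr s ''mt''"
  shows "excess_at n (arr s ''hd'' i) s'" and "same_caps n s s'" and "\<And>j. j \<noteq> i \<Longrightarrow> arr s ''rs'' j \<le> arr s' ''rs'' j"
proof -
  obtain b where b: "b < n" and ib: "i = 2 * b \<or> i = Suc (2 * b)"
    using i(1) by (metis even_two_times_div_two less_mult_imp_div_less mult.commute odd_two_times_div_two_succ Suc_eq_plus1)
  have P: "arr s ''pt'' (2 * b) = Suc (2 * b)" "arr s ''pt'' (Suc (2 * b)) = 2 * b"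
     "arr s ''tl'' (Suc (2 * b)) = arr s ''hd'' (2 * b)" "arr s ''hd'' (Suc (2 * b)) = arr s ''tl'' (2 * b)"
     "arr s ''en'' (Suc (2 * b)) = arr s ''en'' (2 * b)"
    using pairs b unfolding pairs_ok_def by auto
  have ptne: "arr s ''pt'' i \<noteq> i" using ib P by auto
  show "\<And>j. j \<noteq> i \<Longrightarrow> arr s ''rs'' j \<le> arr s' ''rs'' j" unfolding s' by auto
  have oth: "arr s' ''rs'' (2 * c) = arr s ''rs'' (2 * c)" "arr s' ''rs'' (Suc (2 * c)) = arr s ''rs'' (Suc (2 * c))" if "c \<noteq> b" for c
    using that ib P unfolding s'(1) by (auto; presburger)+
  show "same_caps n s s'"
    unfolding same_caps_def
  proof (intro conjI allI impI)
    fix c assume "c < n"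
    show "arr s' ''rs'' (2 * c) + arr s' ''rs'' (Suc (2 * c)) = arr s ''rs'' (2 * c) + arr s ''rs'' (Suc (2 * c))"
      using oth[of c] ib P i(2) unfolding s'(1) by (cases "c = b") auto
  next
    fix j assume "j < 2 * n" "arr s ''en'' j \<noteq> 1"
    then show "arr s' ''rs'' j = arr s ''rs'' j" using ib P i(3) unfolding s'(1) by auto
  qed
  let ?x = "\<lambda>s. arr s ''rs'' (Suc (2 * b))"
  have o: "outflow n s' v + (if arr s ''tl'' (2 * b) = v then ?x s else 0) = outflow n s v + (if arr s ''tl'' (2 * b) = v then ?x s' else 0)" for v
    unfolding outflow_def flow_at_def s'(2) using oth by (intro sum_upd[OF b]) auto
  have n: "inflow n s' v + (if arr s ''hd'' (2 * b) = v then ?x s else 0) = inflow n s v + (if arr s ''hd'' (2 * b) = v then ?x s' else 0)" for v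
    unfolding inflow_def flow_at_def s'(3) using oth by (intro sum_upd[OF b]) auto
  have x: "i = 2 * b \<Longrightarrow> ?x s' = Suc (?x s)" "i = Suc (2 * b) \<Longrightarrow> Suc (?x s') = ?x s"
    using i(2) P unfolding s'(1) by auto
  show "excess_at n (arr s ''hd'' i) s'"
    unfolding excess_at_def s'(4)
  proof (intro allI impI)
    fix v :: nat assume "0 < v"
    then have e: "outflow n s v + of_bool (v = arr s ''tl'' i) = inflow n s v + arr s ''mt'' v" using ex by (simp add: excess_at_def)
    from ib show "outflow n s' v + of_bool (v = arr s ''hd'' i) = inflow n s' v + arr s ''mt'' v"
    proof
      assume i: "i = 2 * b"
      show ?thesis using e o[of v] n[of v] x(1)[OF i] i
        by (cases "arr s ''tl'' (2 * b) = v"; cases "arr s ''hd'' (2 * b) = v") (auto split: if_splits)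
    next
      assume i: "i = Suc (2 * b)"
      show ?thesis using e o[of v] n[of v] x(2)[OF i] i P
        by (cases "arr s ''tl'' (2 * b) = v"; cases "arr s ''hd'' (2 * b) = v") (auto split: if_splits)
    qed
  qed
qed

text \<open>The arcs \<open>na\<close> lead to strictly earlier queue entries, so the path ends at
  the sink and uses each arc once. Pushing along one arc takes no capacity from those further
  on.\<close>

lemma aug_wp:
  assumes pairs: "pairs_ok n s" and base: "bfs_base (2 * n) s" and tg: "var s ''tg'' \<noteq> 0" and ex: "excess_at n 0 s"
  shows "wp aug (\<lambda>t s'. t \<le> 10 * n + 8 \<and> excess_at n 0 s' \<and> same_caps n s s' \<and> arr s' ''mt'' = (arr s ''mt'')(var s ''tg'' := 1)) s"
proof -
  let ?q = "arr s ''q''" and ?na = "arr s ''na''" and ?Q = "var s ''qt''"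
  note B = base[unfolded bfs_base_def]
  have inj: "inj_on ?q {..<?Q}" by (rule B[THEN conjunct2, THEN conjunct2, THEN conjunct1])
  have q0: "?q 0 = 0" by (rule B[THEN conjunct2, THEN conjunct1])
  have na: "?na (?q k) < 2 * n \<and> arc_ok s (?na (?q k)) \<and>
        arr s ''tl'' (?na (?q k)) = ?q k \<and> arr s ''hd'' (?na (?q k)) \<in> ?q ` {..<k}" if "0 < k" "k < ?Q" for k
    by (rule B[THEN conjunct2, THEN conjunct2, THEN conjunct2, THEN conjunct2, THEN conjunct2, THEN conjunct1, THEN spec, THEN mp, THEN mp, OF that])
  note tgc = B[THEN conjunct2, THEN conjunct2, THEN conjunct2, THEN conjunct2, THEN conjunct2, THEN conjunct2, THEN conjunct2, THEN mp, OF tg]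
  have tgs: "var s ''tg'' \<in> seen s" "arr s ''mt'' (var s ''tg'') = 0"
    by (rule tgc[THEN conjunct1], rule tgc[THEN conjunct2, THEN conjunct2])
  \<comment> \<open>Every queue entry except the sink has an arc of its own, which bounds the path
    by the number \<open>2 * n\<close> of arcs.\<close>
  have Qle: "?Q \<le> 2 * n + 1"
  proof -
    have "inj_on (\<lambda>k. ?na (?q k)) {1..<?Q}"
    proof (rule inj_onI)
      fix k k' assume h: "k \<in> {1..<?Q}" "k' \<in> {1..<?Q}" "?na (?q k) = ?na (?q k')"
      have "arr s ''tl'' (?na (?q k)) = ?q k" "arr s ''tl'' (?na (?q k')) = ?q k'" using na[of k] na[of k'] h(1,2) by simp_all
      then have "?q k = ?q k'" using h(3) by metis
      then show "k = k'" using h inj_onD[OF inj, of k k'] by simp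
    qed
    moreover have "(\<lambda>k. ?na (?q k)) ` {1..<?Q} \<subseteq> {..<2 * n}" using na by auto
    ultimately have "card {1..<?Q} \<le> card {..<2 * n}" by (intro card_inj_on_le) auto
    then show ?thesis by simp
  qed
  obtain k0 where k0: "k0 < ?Q" "?q k0 = var s ''tg''" using tgs unfolding seen_def by auto
  let ?s1 = "seta ''mt'' (var s ''tg'') 1 (setv ''u'' (var s ''tg'') s)"
  \<comment> \<open>Credit 5 per queue position: four statements and one test.\<close>
  define I where "I k s' \<longleftrightarrow> (\<exists>j<?Q. k = 5 * j \<and> var s' ''u'' = ?q j \<and> excess_at n (?q j) s' \<and> same_caps n s s' \<and>
     (\<forall>j'\<le>j. 0 < j' \<longrightarrow> 0 < arr s' ''rs'' (?na (?q j'))))" for k and s' :: state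
  have "wp (While (Less (Const 0) (Var ''u'')) aug_body)
    (\<lambda>t s'. 2 + t \<le> 10 * n + 8 \<and> excess_at n 0 s' \<and> same_caps n s s' \<and> arr s' ''mt'' = (arr s ''mt'')(var s ''tg'' := 1)) ?s1"
  proof (rule wp_while[of I])
    have "excess_at n (var s ''tg'') ?s1"
      using ex tg tgs(2) unfolding excess_at_def outflow_def inflow_def by auto
    then show "I (5 * k0) ?s1"
      unfolding I_def using k0 na by (intro exI[of _ k0]) (auto simp: same_caps_def arc_ok_def)
  next
    fix k s1 assume I: "I k s1" and sm: "same (modv aug_body) (moda aug_body) ?s1 s1" and b: "bval (Less (Const 0) (Var ''u'')) s1"
    note fr = same_arr[OF sm, simplified] same_var[OF sm, simplified]
    obtain j where j: "j < ?Q" "k = 5 * j" "var s1 ''u'' = ?q j" "excess_at n (?q j) s1" "same_caps n s s1"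
      "\<And>j'. j' \<le> j \<Longrightarrow> 0 < j' \<Longrightarrow> 0 < arr s1 ''rs'' (?na (?q j'))" using I unfolding I_def by blast
    have j0: "0 < j" using b j(3) q0 by (cases j) auto
    let ?i = "?na (?q j)"
    have ni: "?i < 2 * n" "arr s ''en'' ?i = 1" "arr s ''tl'' ?i = ?q j" "arr s ''hd'' ?i \<in> ?q ` {..<j}"
      using na[OF j0 j(1)] by (auto simp: arc_ok_def)
    then obtain j' where j': "j' < j" "arr s ''hd'' ?i = ?q j'" by auto
    have st: "arr s1 ''tl'' = arr s ''tl''" "arr s1 ''hd'' = arr s ''hd''" "arr s1 ''pt'' = arr s ''pt''" "arr s1 ''en'' = arr s ''en''"
      "arr s1 ''na'' = ?na" by (simp_all add: fr)
    have p1: "pairs_ok n s1" using pairs by (simp add: pairs_ok_def st)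
    define s2 where "s2 = setv ''u'' (?q j') (seta ''rs'' (arr s ''pt'' ?i) (Suc (arr s1 ''rs'' (arr s ''pt'' ?i))) (seta ''rs'' ?i (arr s1 ''rs'' ?i - 1) (setv ''i'' ?i s1)))"
    have ptne: "arr s ''pt'' ?i \<noteq> ?i"
      using pairs ni(1) unfolding pairs_ok_def
      by (metis even_two_times_div_two less_mult_imp_div_less mult.commute n_not_Suc_n odd_two_times_div_two_succ Suc_eq_plus1)
    have push: "excess_at n (arr s1 ''hd'' ?i) s2" "same_caps n s1 s2" "\<And>j. j \<noteq> ?i \<Longrightarrow> arr s1 ''rs'' j \<le> arr s2 ''rs'' j"
      using push_arc[OF p1, of ?i s2] ni j(4) j(6)[OF order.refl j0] st by (auto simp: s2_def)
    have "I (5 * j') s2"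
      unfolding I_def
    proof (intro exI[of _ j'] conjI allI impI)
      show "j' < ?Q" using j' j by simp
      show "var s2 ''u'' = ?q j'" by (simp add: s2_def)
      show "excess_at n (?q j') s2" using push(1) j' st by simp
      show "same_caps n s s2" using same_caps_trans[OF j(5) push(2)] st by simp
      fix l assume l: "l \<le> j'" "0 < l"
      then have lj: "l < ?Q" "l < j" using j' j by auto
      have "?na (?q l) \<noteq> ?i"
      proof
        assume "?na (?q l) = ?i"
        moreover have "arr s ''tl'' (?na (?q l)) = ?q l" using na[OF l(2) lj(1)] by blast
        ultimately have "?q l = ?q j" using ni(3) by metis
        then show False using inj_onD[OF inj, of l j] lj j(1) by simp
      qed
      then show "0 < arr s2 ''rs'' (?na (?q l))" using push(3) j(6)[of l] lj l by (meson less_le_trans less_imp_le_nat)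
    qed simp
    moreover have "5 * j' + 4 + 1 \<le> k" using j' j by simp
    ultimately show "wp aug_body (\<lambda>t s2. \<exists>k'. I k' s2 \<and> k' + t + 1 \<le> k) s1"
      unfolding aug_body_def using j(3) j'(2) ptne by (auto simp: st s2_def fun_upd_twist)
  next
    fix k' t s' assume I: "I k' s'" and sm: "same (modv aug_body) (moda aug_body) ?s1 s'"
      and b: "\<not> bval (Less (Const 0) (Var ''u'')) s'" and t: "t + k' \<le> 5 * k0 + 1"
    have "arr s' ''mt'' = (arr s ''mt'')(var s ''tg'' := 1)" using same_arr[OF sm, of "''mt''"] by simp
    moreover have "excess_at n 0 s' \<and> same_caps n s s'" using I b unfolding I_def by auto
    moreover have "2 + t \<le> 10 * n + 8" using t k0 Qle by simp
    ultimately show "2 + t \<le> 10 * n + 8 \<and> excess_at n 0 s' \<and> same_caps n s s' \<and> arr s' ''mt'' = (arr s ''mt'')(var s ''tg'' := 1)" by simp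
  qed
  then show ?thesis unfolding aug_def by simp
qed

section \<open>The maximum flow loop\<close>

definition flow_inv :: "nat \<Rightarrow> state \<Rightarrow> bool" where
  "flow_inv n s \<longleftrightarrow> lists_ok (2 * n) s \<and> pairs_ok n s \<and> excess_at n 0 s \<and> (\<forall>v. arr s ''vis'' v \<le> var s ''st'') \<and>
     (\<forall>v. arr s ''mt'' v \<le> of_bool (0 < v \<and> v \<le> var s ''nA''))"

definition reached :: "state \<Rightarrow> nat set" where
  "reached s = {v. arr s ''vis'' v = var s ''st''}"

text \<open>Maximality of the flow. Describing the visited nodes as the least closed set pins them
  down exactly, so that they can be identified with \<open>RT\<close> later.\<close>

definition stable :: "nat \<Rightarrow> state \<Rightarrow> bool" where
  "stable n s \<longleftrightarrow> 0 \<in> reached s \<and>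
     (\<forall>i<2 * n. arc_ok s i \<longrightarrow> arr s ''hd'' i \<in> reached s \<longrightarrow> arr s ''tl'' i \<in> reached s) \<and>
     (\<forall>Z. 0 \<in> Z \<longrightarrow> (\<forall>i<2 * n. arc_ok s i \<longrightarrow> arr s ''hd'' i \<in> Z \<longrightarrow> arr s ''tl'' i \<in> Z) \<longrightarrow> reached s \<subseteq> Z) \<and>
     (\<forall>v\<in>reached s. 0 < v \<longrightarrow> v \<le> var s ''nA'' \<longrightarrow> arr s ''mt'' v = 1)"

lemma stable_of_bfs:
  assumes base: "bfs_base (2 * n) s" and cl: "closed_upto (2 * n) (var s ''qt'') s" and tg: "var s ''tg'' = 0"
    and mt: "\<And>v. arr s ''mt'' v \<le> 1"
  shows "stable n s"
proof -
  have sn: "reached s = seen s" using base unfolding bfs_base_def reached_def by auto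
  have q0: "0 < var s ''qt''" "arr s ''q'' 0 = 0" using base by (auto simp: bfs_base_def)
  have "seen s \<subseteq> Z" if Z: "0 \<in> Z" "\<forall>i<2 * n. arc_ok s i \<longrightarrow> arr s ''hd'' i \<in> Z \<longrightarrow> arr s ''tl'' i \<in> Z" for Z
  proof -
    have "k < var s ''qt'' \<Longrightarrow> arr s ''q'' k \<in> Z" for k
    proof (induction k rule: less_induct)
      case (less k)
      show ?case
      proof (cases "k = 0")
        case False
        then have h: "arr s ''na'' (arr s ''q'' k) < 2 * n \<and> arc_ok s (arr s ''na'' (arr s ''q'' k)) \<and>
          arr s ''tl'' (arr s ''na'' (arr s ''q'' k)) = arr s ''q'' k \<and> arr s ''hd'' (arr s ''na'' (arr s ''q'' k)) \<in> arr s ''q'' ` {..<k}"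
          using base less.prems unfolding bfs_base_def by blast
        then obtain k' where k': "k' < k" "arr s ''hd'' (arr s ''na'' (arr s ''q'' k)) = arr s ''q'' k'" by auto
        have "arr s ''q'' k' \<in> Z" using less.IH[OF k'(1)] k'(1) less.prems by simp
        then have "arr s ''tl'' (arr s ''na'' (arr s ''q'' k)) \<in> Z"
          using Z(2)[THEN spec, of "arr s ''na'' (arr s ''q'' k)"] h k'(2) by metis
        then show ?thesis using h by metis
      qed (use q0 Z in simp)
    qed
    then show ?thesis unfolding seen_def by auto
  qed
  moreover have "0 \<in> seen s" using q0 unfolding seen_def by force
  moreover have "arr s ''mt'' v = 1" if "v \<in> seen s" "0 < v" "v \<le> var s ''nA''" for v
    using base tg that mt[of v] unfolding bfs_base_def by (metis One_nat_def le_0_eq le_SucE)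
  ultimately show ?thesis using cl unfolding stable_def sn closed_upto_def seen_def[symmetric] by blast
qed

lemma maxflow_wp:
  assumes inv: "flow_inv n s"
  shows "wp maxflow (\<lambda>t s'. t \<le> (42 * n + 23) * (var s ''nA'' + 1) + 2 \<and> flow_inv n s' \<and> stable n s' \<and> same_caps n s s') s"
proof -
  \<comment> \<open>A round costs at most \<open>32 * n + 12\<close> for the search over
    \<open>2 * n\<close> arcs, \<open>10 * n + 8\<close> for the augmentation and two tests; one
    unit is spare.\<close>
  let ?R = "42 * n + 23"
  define free :: "state \<Rightarrow> nat" where "free s' = card {v. 0 < v \<and> v \<le> var s ''nA'' \<and> arr s' ''mt'' v = 0}" for s'
  \<comment> \<open>The rounds left are one for each unserved applicant and a last search, which
    clears \<open>go\<close>.\<close>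
  define I where "I k s' \<longleftrightarrow> flow_inv n s' \<and> same_caps n s s' \<and> (var s' ''go'' = 0 \<longrightarrow> stable n s') \<and> var s' ''go'' \<le> 1 \<and>
     k = ?R * (free s' + var s' ''go'')" for k and s' :: state
  let ?s1 = "setv ''go'' 1 s"
  have "wp (While (Less (Const 0) (Var ''go'')) maxflow_body)
     (\<lambda>t s'. 1 + t \<le> ?R * (var s ''nA'' + 1) + 2 \<and> flow_inv n s' \<and> stable n s' \<and> same_caps n s s') ?s1"
  proof (rule wp_while[of I])
    show "I (?R * (free ?s1 + 1)) ?s1"
      using inv by (auto simp: I_def flow_inv_def lists_ok_def pairs_ok_def excess_at_def outflow_def inflow_def same_caps_def)
  next
    fix k s1 assume I: "I k s1" and sm: "same (modv maxflow_body) (moda maxflow_body) ?s1 s1" and b: "bval (Less (Const 0) (Var ''go'')) s1"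
    note fr = same_arr[OF sm, simplified] same_var[OF sm, simplified]
    have go: "var s1 ''go'' = 1" using I b by (simp add: I_def)
    have f1: "flow_inv n s1" and caps1: "same_caps n s s1" and k: "k = ?R * (free s1 + 1)" using I go by (auto simp: I_def)
    have l1: "lists_ok (2 * n) s1" and vis1: "\<And>v. arr s1 ''vis'' v \<le> var s1 ''st''" using f1 by (auto simp: flow_inv_def)
    show "wp maxflow_body (\<lambda>t s2. \<exists>k'. I k' s2 \<and> k' + t + 1 \<le> k) s1"
      unfolding maxflow_body_def wp_Seq
    proof (rule wp_same[OF bfs_wp[OF l1 vis1]])
      fix t2 s2 assume h: "t2 \<le> 16 * (2 * n) + 12 \<and> bfs_base (2 * n) s2 \<and> closed_upto (2 * n) (var s2 ''qt'') s2"
        and sm2: "same (modv bfs) (moda bfs) s1 s2"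
      note fr2 = same_arr[OF sm2, simplified] same_var[OF sm2, simplified]
      have f2: "flow_inv n s2"
        using f1 h unfolding flow_inv_def lists_ok_def pairs_ok_def excess_at_def outflow_def inflow_def bfs_base_def by (simp add: fr2)
      have caps2: "same_caps n s s2" using caps1 unfolding same_caps_def by (simp add: fr2)
      have free2: "free s2 = free s1" by (simp add: free_def fr2)
      have mt1: "arr s2 ''mt'' v \<le> 1" for v
      proof -
        have "arr s2 ''mt'' v \<le> of_bool (0 < v \<and> v \<le> var s2 ''nA'')" using f2 unfolding flow_inv_def by blast
        then show ?thesis by (auto simp: of_bool_def split: if_splits)
      qed
      show "wp (If (Eq (Var ''tg'') (Const 0)) (Assign ''go'' (Const 0)) aug) (\<lambda>t s2. \<exists>k'. I k' s2 \<and> k' + (t2 + t) + 1 \<le> k) s2"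
      proof (cases "var s2 ''tg'' = 0")
        case True
        have st: "stable n s2" using stable_of_bfs h True mt1 by blast
        let ?s3 = "setv ''go'' 0 s2"
        have "I (?R * free s2) ?s3"
          using f2 caps2 st unfolding I_def flow_inv_def lists_ok_def pairs_ok_def excess_at_def outflow_def inflow_def same_caps_def stable_def reached_def arc_ok_def free_def
          by auto
        moreover have "?R * free s2 + (t2 + 2) + 1 \<le> k" using h k free2 by simp
        ultimately show ?thesis using True by auto
      next
        case False
        have pr: "pairs_ok n s2" "excess_at n 0 s2" using f2 by (auto simp: flow_inv_def)
        have "wp aug (\<lambda>t s3. \<exists>k'. I k' s3 \<and> k' + (t2 + (1 + t)) + 1 \<le> k) s2"
        proof (rule wp_same[OF aug_wp[OF pr(1) _ False pr(2)]])
          show "bfs_base (2 * n) s2" using h by simp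
          fix t s3 assume g: "t \<le> 10 * n + 8 \<and> excess_at n 0 s3 \<and> same_caps n s2 s3 \<and> arr s3 ''mt'' = (arr s2 ''mt'')(var s2 ''tg'' := 1)"
            and sm3: "same (modv aug) (moda aug) s2 s3"
          note fr3 = same_arr[OF sm3, simplified] same_var[OF sm3, simplified]
          have tg: "var s2 ''tg'' \<le> var s2 ''nA''" "arr s2 ''mt'' (var s2 ''tg'') = 0"
            using h False unfolding bfs_base_def by auto
          have nA: "var s2 ''nA'' = var s ''nA''" by (simp add: fr fr2)
          have f3: "flow_inv n s3"
            using f2 g tg False unfolding flow_inv_def lists_ok_def pairs_ok_def by (auto simp: fr3)
          have en: "arr s2 ''en'' = arr s ''en''" by (simp add: fr fr2)
          have caps3: "same_caps n s s3" using same_caps_trans[OF caps2] g en by blast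
          have i1: "{v. 0 < v \<and> v \<le> var s ''nA'' \<and> arr s2 ''mt'' v = 0} = insert (var s2 ''tg'') {v. 0 < v \<and> v \<le> var s ''nA'' \<and> arr s3 ''mt'' v = 0}"
            using g tg False nA by auto
          have i2: "var s2 ''tg'' \<notin> {v. 0 < v \<and> v \<le> var s ''nA'' \<and> arr s3 ''mt'' v = 0}" using g by auto
          have i3: "finite {v. 0 < v \<and> v \<le> var s ''nA'' \<and> arr s3 ''mt'' v = 0}" by simp
          have fr3': "free s2 = Suc (free s3)" unfolding free_def i1 by (rule card_insert_disjoint[OF i3 i2])
          have go3: "var s3 ''go'' = 1" using go by (simp add: fr3 fr2)
          have "I (?R * (free s3 + 1)) s3" using f3 caps3 go3 by (simp add: I_def)
          moreover have "?R * (free s3 + 1) + (t2 + (1 + t)) + 1 \<le> k" using k free2 fr3' g h by simp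
          ultimately show "\<exists>k'. I k' s3 \<and> k' + (t2 + (1 + t)) + 1 \<le> k" by blast
        qed
        then show ?thesis using False by simp
      qed
    qed
  next
    fix k' t s' assume I: "I k' s'" and b: "\<not> bval (Less (Const 0) (Var ''go'')) s'" and t: "t + k' \<le> ?R * (free ?s1 + 1) + 1"
    have "free ?s1 \<le> card {1..var s ''nA''}" unfolding free_def by (intro card_mono) auto
    then have "free ?s1 \<le> var s ''nA''" by simp
    then have "?R * (free ?s1 + 1) \<le> ?R * (var s ''nA'' + 1)" by (intro mult_le_mono2) simp
    then have "1 + t \<le> ?R * (var s ''nA'' + 1) + 2" using t by linarith
    then show "1 + t \<le> ?R * (var s ''nA'' + 1) + 2 \<and> flow_inv n s' \<and> stable n s' \<and> same_caps n s s'"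
      using I b by (simp add: I_def)
  qed
  then show ?thesis unfolding maxflow_def by simp
qed

text \<open>Deleting \<open>x\<close> from all members loses at most two of them: \<open>{x}\<close>
  becomes empty, and at most one \<open>C\<close> containing \<open>x\<close> collides with a member
  \<open>C - {x}\<close>. Two such sets would be nested, and the smaller shares a point with the
  larger minus \<open>x\<close>; laminarity then puts the larger inside the smaller.\<close>

lemma laminar_card:
  "finite X \<Longrightarrow> laminar F \<Longrightarrow> (\<forall>C\<in>F. C \<subseteq> X \<and> C \<noteq> {}) \<Longrightarrow> card F \<le> 2 * card X"
proof (induction X arbitrary: F rule: finite_induct)
  case empty
  then have "F = {}" by auto
  then show ?case by simp
next
  case (insert x X)
  define F' where "F' = ((\<lambda>C. C - {x}) ` F) - {{}}"
  define D where "D = {C \<in> F. x \<in> C \<and> (C - {x} \<in> F \<or> C = {x})}"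
  have finF: "finite F" using insert.prems(2) insert.hyps(1) finite_subset[of F "Pow (insert x X)"] by auto
  have "laminar F'" unfolding laminar_def
  proof (intro ballI)
    fix U W assume "U \<in> F'" "W \<in> F'"
    then obtain U' W' where "U' \<in> F" "W' \<in> F" "U = U' - {x}" "W = W' - {x}" by (auto simp: F'_def)
    then show "U \<subseteq> W \<or> W \<subseteq> U \<or> U \<inter> W = {}" using insert.prems(1) unfolding laminar_def by blast
  qed
  moreover have "\<forall>C\<in>F'. C \<subseteq> X \<and> C \<noteq> {}" using insert.prems(2) by (auto simp: F'_def)
  ultimately have IH: "card F' \<le> 2 * card X" by (rule insert.IH)
  have uniq: "C = C'" if C: "C \<in> F" "x \<in> C" "C - {x} \<in> F" and C': "C' \<in> F" "x \<in> C'" "C' - {x} \<in> F" for C C'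
  proof -
    have sub: "C' \<subseteq> C" if C: "C \<in> F" "x \<in> C" "C - {x} \<in> F" and C': "x \<in> C'" "C' - {x} \<in> F" and le: "C \<subseteq> C'" for C C'
    proof -
      have "C - {x} \<noteq> {}" using bspec[OF insert.prems(2) C(3)] ..
      then obtain y where y: "y \<in> C" "y \<noteq> x" by auto
      have "C \<subseteq> C' - {x} \<or> C' - {x} \<subseteq> C \<or> C \<inter> (C' - {x}) = {}"
        using insert.prems(1)[unfolded laminar_def, rule_format, OF C(1) C'(2)] .
      moreover have "\<not> C \<subseteq> C' - {x}" using C(2) by auto
      moreover have "y \<in> C \<inter> (C' - {x})" using y le by auto
      ultimately have "C' - {x} \<subseteq> C" by auto
      then show ?thesis using C(2) by auto
    qed
    have "C \<subseteq> C' \<or> C' \<subseteq> C \<or> C \<inter> C' = {}" using insert.prems(1)[unfolded laminar_def, rule_format, OF C(1) C'(1)] .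
    then have "C \<subseteq> C' \<or> C' \<subseteq> C" using C(2) C'(2) by auto
    then show ?thesis using sub[OF C C'(2,3)] sub[OF C' C(2,3)] by auto
  qed
  have "D \<subseteq> {{x}} \<union> {C \<in> F. x \<in> C \<and> C - {x} \<in> F}" by (auto simp: D_def)
  moreover have "card {C \<in> F. x \<in> C \<and> C - {x} \<in> F} \<le> 1"
    using uniq finF by (auto simp: card_le_Suc0_iff_eq)
  moreover have fin: "finite {C \<in> F. x \<in> C \<and> C - {x} \<in> F}" using finF by auto
  ultimately have "card D \<le> 2"
    using card_mono[of "{{x}} \<union> {C \<in> F. x \<in> C \<and> C - {x} \<in> F}" D] card_Un_le[of "{{x}}" "{C \<in> F. x \<in> C \<and> C - {x} \<in> F}"] by auto
  moreover have "card (F - D) \<le> card F'"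
  proof (rule card_inj_on_le)
    show "inj_on (\<lambda>C. C - {x}) (F - D)"
    proof (rule inj_onI)
      fix C C' assume h: "C \<in> F - D" "C' \<in> F - D" "C - {x} = C' - {x}"
      show "C = C'"
      proof (cases "x \<in> C \<longleftrightarrow> x \<in> C'")
        case True then show ?thesis using h(3) by blast
      next
        case False
        then have "(x \<in> C \<and> C - {x} = C') \<or> (x \<in> C' \<and> C' - {x} = C)" using h(3) by auto
        then have "C \<in> D \<or> C' \<in> D"
        proof
          assume "x \<in> C \<and> C - {x} = C'"
          then have "x \<in> C" "C - {x} \<in> F" using h(2) by auto
          then show ?thesis using h(1) by (simp add: D_def)
        next
          assume "x \<in> C' \<and> C' - {x} = C"
          then have "x \<in> C'" "C' - {x} \<in> F" using h(1) by auto
          then show ?thesis using h(2) by (simp add: D_def)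
        qed
        then show ?thesis using h(1,2) by simp
      qed
    qed
    show "(\<lambda>C. C - {x}) ` (F - D) \<subseteq> F'"
    proof (rule image_subsetI)
      fix C assume C: "C \<in> F - D"
      have "C - {x} \<noteq> {}"
      proof
        assume e: "C - {x} = {}"
        have "C \<noteq> {}" using insert.prems(2) C by simp
        then have "C = {x}" using e by auto
        then show False using C by (simp add: D_def)
      qed
      then show "C - {x} \<in> F'" using C unfolding F'_def by blast
    qed
    show "finite F'" using finF by (simp add: F'_def)
  qed
  moreover have "card F \<le> card (F - D) + card D"
    using card_Un_le[of "F - D" D] card_mono[of "(F - D) \<union> D" F] finF by (auto simp: D_def)
  ultimately show ?case using IH insert.hyps by simp
qed

section \<open>The encoded instance\<close>

locale prob =
  fixes G :: "('a, 'p) inst" and av :: "nat \<Rightarrow> 'a" and pv :: "nat \<Rightarrow> 'p" and s0 :: state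
  assumes wf: "well_formed G" and enc: "encodes G av pv s0"
begin

definition "nA = var s0 ''nA''"
definition "nP = var s0 ''nP''"
definition "off = arr s0 ''off''"
definition "post = arr s0 ''post''"
definition "rnk = arr s0 ''rank''"
definition "quo = arr s0 ''quota''"
definition "coff = arr s0 ''coff''"
definition "cquo = arr s0 ''cquota''"
definition "moff = arr s0 ''moff''"
definition "mem = arr s0 ''member''"
definition "m = off nA"
text \<open>The input has no array of owners; the owner of an edge is implicit in the offsets of the
  blocks.\<close>

definition "ow e = (LEAST i. e < off (Suc i))"
definition "mems k = mem ` {moff k..<moff (Suc k)}"
definition "csz k = moff (Suc k) - moff k"
definition "cblk j = {coff j..<coff (Suc j)}"
definition "deg j = card {e. e < m \<and> post e = j}"

lemma av_bij: "bij_betw av {..<nA} (appl G)" and pv_bij: "bij_betw pv {..<nP} (posts G)"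
  using enc by (auto simp: encodes_def nA_def nP_def)

lemma off_0: "off 0 = 0" and off_step: "i < nA \<Longrightarrow> off i \<le> off (Suc i)"
  and post_inj: "i < nA \<Longrightarrow> inj_on post {off i..<off (Suc i)}"
  and post_img: "i < nA \<Longrightarrow> post ` {off i..<off (Suc i)} = {j. j < nP \<and> (av i, pv j) \<in> edges G}"
  and rnk_eq: "i < nA \<Longrightarrow> off i \<le> e \<Longrightarrow> e < off (Suc i) \<Longrightarrow> rnk e = rank G (av i) (pv (post e))"
  using enc by (auto simp: encodes_def nA_def nP_def off_def post_def rnk_def block_def)

lemma quo_eq: "j < nP \<Longrightarrow> quo j = quota G (pv j)" and coff_step: "j < nP \<Longrightarrow> coff j \<le> coff (Suc j)"
  and cls_bij: "j < nP \<Longrightarrow> bij_betw (\<lambda>k. av ` mems k) (cblk j) (classes G (pv j))"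
  and cquo_eq: "j < nP \<Longrightarrow> k \<in> cblk j \<Longrightarrow> cquo k = cquota G (pv j) (av ` mems k)"
  and moff_step: "j < nP \<Longrightarrow> k \<in> cblk j \<Longrightarrow> moff k \<le> moff (Suc k)"
  and mem_inj: "j < nP \<Longrightarrow> k \<in> cblk j \<Longrightarrow> inj_on mem {moff k..<moff (Suc k)}"
  and mems_less: "j < nP \<Longrightarrow> k \<in> cblk j \<Longrightarrow> mems k \<subseteq> {..<nA}"
  using enc by (auto simp: encodes_def nA_def nP_def quo_def coff_def cquo_def moff_def mem_def block_def cblk_def mems_def class_members_def)

lemma init_var: "x \<notin> {''nA'', ''nP''} \<Longrightarrow> var s0 x = 0"
  and init_arr: "x \<notin> {''off'', ''post'', ''rank'', ''quota'', ''coff'', ''cquota'', ''moff'', ''member''} \<Longrightarrow> arr s0 x i = 0"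
  using enc by (simp_all add: encodes_def)

lemma off_mono: "i \<le> i' \<Longrightarrow> i' \<le> nA \<Longrightarrow> off i \<le> off i'"
  by (induction rule: dec_induct) (use off_step in \<open>auto intro: le_trans\<close>)

lemma coff_mono: "i \<le> i' \<Longrightarrow> i' \<le> nP \<Longrightarrow> coff i \<le> coff i'"
  by (induction rule: dec_induct) (use coff_step in \<open>auto intro: le_trans\<close>)

lemma ow: assumes "e < m" shows "ow e < nA" "off (ow e) \<le> e" "e < off (Suc (ow e))"
proof -
  have "nA \<noteq> 0" using assms off_0 by (metis m_def not_less_zero)
  then have ex: "e < off (Suc (nA - 1))" using assms by (simp add: m_def)
  then have le: "ow e \<le> nA - 1" unfolding ow_def by (rule Least_le)
  then show "ow e < nA" using \<open>nA \<noteq> 0\<close> by simp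
  show "e < off (Suc (ow e))" using ex unfolding ow_def by (rule LeastI)
  show "off (ow e) \<le> e"
  proof (cases "ow e")
    case (Suc i)
    then have "\<not> e < off (Suc i)" using not_less_Least[of i "\<lambda>i. e < off (Suc i)"] unfolding ow_def by simp
    then show ?thesis using Suc by simp
  qed (simp add: off_0)
qed

lemma ow_eq: assumes "i < nA" "off i \<le> e" "e < off (Suc i)" shows "ow e = i" "e < m"
proof -
  show "e < m" using assms off_mono[of "Suc i" nA] by (simp add: m_def)
  note o = ow[OF this]
  show "ow e = i"
  proof (rule ccontr)
    assume "ow e \<noteq> i"
    then consider "Suc (ow e) \<le> i" | "Suc i \<le> ow e" by linarith
    then show False using off_mono[of "Suc (ow e)" i] off_mono[of "Suc i" "ow e"] o assms by cases auto
  qed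
qed

lemma post_less: "e < m \<Longrightarrow> post e < nP" and post_edge: "e < m \<Longrightarrow> (av (ow e), pv (post e)) \<in> edges G"
  using ow[of e] post_img[of "ow e"] by force+

lemma edge_ex: "i < nA \<Longrightarrow> j < nP \<Longrightarrow> (av i, pv j) \<in> edges G \<Longrightarrow> \<exists>e<m. ow e = i \<and> post e = j"
proof -
  assume h: "i < nA" "j < nP" "(av i, pv j) \<in> edges G"
  then have "j \<in> post ` {off i..<off (Suc i)}" using post_img by auto
  then show ?thesis using ow_eq[OF h(1)] by force
qed

lemma ow_post_inj: "e < m \<Longrightarrow> e' < m \<Longrightarrow> ow e = ow e' \<Longrightarrow> post e = post e' \<Longrightarrow> e = e'"
  using ow[of e] ow[of e'] inj_onD[OF post_inj[of "ow e"], of e e'] by auto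

lemma edges_eq: "edges G = (\<lambda>e. (av (ow e), pv (post e))) ` {..<m}"
proof (intro set_eqI iffI)
  fix x assume x: "x \<in> edges G"
  then obtain a p where ap: "x = (a, p)" "a \<in> appl G" "p \<in> posts G" using wf by (auto simp: well_formed_def)
  then obtain i j where "i < nA" "a = av i" "j < nP" "p = pv j" 
    using av_bij pv_bij unfolding bij_betw_def by (metis imageE lessThan_iff)
  then show "x \<in> (\<lambda>e. (av (ow e), pv (post e))) ` {..<m}" using edge_ex[of i j] x ap by force
qed (use post_edge in auto)

lemma av_inj: "i < nA \<Longrightarrow> i' < nA \<Longrightarrow> av i = av i' \<Longrightarrow> i = i'"
  and pv_inj: "j < nP \<Longrightarrow> j' < nP \<Longrightarrow> pv j = pv j' \<Longrightarrow> j = j'"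
  using av_bij pv_bij by (auto simp: bij_betw_def inj_on_def)

lemma edge_inj: "inj_on (\<lambda>e. (av (ow e), pv (post e))) {..<m}"
proof (rule inj_onI)
  fix e e' assume h: "e \<in> {..<m}" "e' \<in> {..<m}" "(av (ow e), pv (post e)) = (av (ow e'), pv (post e'))"
  then have "ow e = ow e'" "post e = post e'"
    using av_inj[of "ow e" "ow e'"] pv_inj[of "post e" "post e'"] ow(1) post_less by auto
  then show "e = e'" using ow_post_inj h by auto
qed

lemma card_edges: "card (edges G) = m"
  unfolding edges_eq using card_image[OF edge_inj] by simp

lemma card_appl: "card (appl G) = nA"
  using bij_betw_same_card[OF av_bij] by simp

lemma mems_edge: "j < nP \<Longrightarrow> k \<in> cblk j \<Longrightarrow> a \<in> mems k \<Longrightarrow> \<exists>e<m. ow e = a \<and> post e = j"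
proof -
  assume h: "j < nP" "k \<in> cblk j" "a \<in> mems k"
  then have a: "a < nA" using mems_less by auto
  have "av ` mems k \<in> classes G (pv j)" using cls_bij[OF h(1)] h(2) by (auto simp: bij_betw_def)
  moreover have "pv j \<in> posts G" using pv_bij h(1) by (auto simp: bij_betw_def)
  ultimately have "av ` mems k \<subseteq> {a. (a, pv j) \<in> edges G}" using wf unfolding well_formed_def by blast
  then show ?thesis using edge_ex[OF a h(1)] h(3) by auto
qed

lemma card_mems: "j < nP \<Longrightarrow> k \<in> cblk j \<Longrightarrow> card (mems k) = csz k"
  unfolding mems_def csz_def using mem_inj card_image by fastforce

lemma csz_le: "j < nP \<Longrightarrow> k \<in> cblk j \<Longrightarrow> csz k \<le> nA"
  using card_mems[of j k] card_mono[OF _ mems_less[of j k]] by simp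

lemma mems_laminar:
  assumes j: "j < nP" and k: "k \<in> cblk j" "k' \<in> cblk j"
  shows "mems k \<subseteq> mems k' \<or> mems k' \<subseteq> mems k \<or> mems k \<inter> mems k' = {}" and "mems k = mems k' \<Longrightarrow> k = k'"
proof -
  have P: "pv j \<in> posts G" using pv_bij j by (auto simp: bij_betw_def)
  have c: "av ` mems k \<in> classes G (pv j)" "av ` mems k' \<in> classes G (pv j)" using cls_bij[OF j] k by (auto simp: bij_betw_def)
  have inj: "inj_on av {..<nA}" using av_bij by (simp add: bij_betw_def)
  have ml: "mems k \<subseteq> {..<nA}" "mems k' \<subseteq> {..<nA}" using mems_less j k by auto
  have "laminar (classes G (pv j))" using wf P by (simp add: well_formed_def)
  then have "av ` mems k \<subseteq> av ` mems k' \<or> av ` mems k' \<subseteq> av ` mems k \<or> av ` mems k \<inter> av ` mems k' = {}"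
    using c unfolding laminar_def by simp
  then show "mems k \<subseteq> mems k' \<or> mems k' \<subseteq> mems k \<or> mems k \<inter> mems k' = {}"
  proof (elim disjE)
    have sub: "X \<subseteq> Y" if "X \<subseteq> {..<nA}" "Y \<subseteq> {..<nA}" "av ` X \<subseteq> av ` Y" for X Y
    proof
      fix x assume "x \<in> X"
      then have "x \<in> {..<nA}" "av x \<in> av ` Y" using that by auto
      then show "x \<in> Y" using inj_on_image_mem_iff[OF inj _ that(2)] by simp
    qed
    show ?thesis if "av ` mems k \<subseteq> av ` mems k'" using sub[OF ml that] by simp
    show ?thesis if "av ` mems k' \<subseteq> av ` mems k" using sub[OF ml(2) ml(1) that] by simp
  qed auto
  show "mems k = mems k' \<Longrightarrow> k = k'" using cls_bij[OF j] k by (auto simp: bij_betw_def inj_on_def)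
qed

text \<open>Members of a class are neighbours of the post, so \<open>laminar_card\<close> applies
  over the neighbourhood.\<close>

lemma classes_card:
  assumes j: "j < nP" shows "card {k \<in> cblk j. 0 < csz k} \<le> 2 * deg j"
proof -
  let ?K = "{k \<in> cblk j. 0 < csz k}"
  let ?N = "ow ` {e. e < m \<and> post e = j}"
  have inj: "inj_on mems ?K" using mems_laminar(2)[OF j] by (auto intro!: inj_onI)
  have "laminar (mems ` ?K)" unfolding laminar_def using mems_laminar(1)[OF j] by blast
  moreover have "\<forall>C\<in>mems ` ?K. C \<subseteq> ?N \<and> C \<noteq> {}"
    using mems_edge[OF j] card_mems[OF j] by (auto simp: image_iff) fastforce
  ultimately have "card (mems ` ?K) \<le> 2 * card ?N" by (intro laminar_card) auto
  moreover have "card ?N \<le> deg j" unfolding deg_def by (intro card_image_le) auto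
  ultimately show ?thesis using card_image[OF inj] by simp
qed

text \<open>The empty set may be among the classes of a post, but only once.\<close>

lemma cblk_card:
  assumes j: "j < nP" shows "card (cblk j) \<le> 2 * deg j + 1"
proof -
  have "card {k \<in> cblk j. csz k = 0} \<le> 1"
  proof -
    have "k = k'" if "k \<in> cblk j" "k' \<in> cblk j" "csz k = 0" "csz k' = 0" for k k'
      using mems_laminar(2)[OF j that(1,2)] that by (auto simp: mems_def csz_def)
    then show ?thesis by (auto simp: card_le_Suc0_iff_eq cblk_def)
  qed
  moreover have "cblk j = {k \<in> cblk j. 0 < csz k} \<union> {k \<in> cblk j. csz k = 0}" by auto
  then have "card (cblk j) \<le> card {k \<in> cblk j. 0 < csz k} + card {k \<in> cblk j. csz k = 0}" by (metis card_Un_le)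
  ultimately show ?thesis using classes_card[OF j] by simp
qed

text \<open>The degrees of distinct posts count disjoint sets of edges.\<close>

lemma sum_deg: "(\<Sum>j\<in>post ` {..<e}. deg j) \<le> m" if "e \<le> m"
proof -
  have "(\<Sum>j\<in>post ` {..<m}. deg j) = card {..<m}"
    unfolding deg_def by (subst card_eq_sum, subst sum.image_gen[where g = post]) (auto intro!: sum.cong arg_cong[of _ _ card])
  moreover have "(\<Sum>j\<in>post ` {..<e}. deg j) \<le> (\<Sum>j\<in>post ` {..<m}. deg j)"
    using that by (intro sum_mono2) auto
  ultimately show ?thesis by simp
qed

lemma deg_pos: "e < m \<Longrightarrow> 0 < deg (post e)" unfolding deg_def by (auto simp: card_gt_0_iff)

end

section \<open>Building the class forest\<close>

text \<open>
  For an indexed nested family \<open>c\<close>, whose sets grow with the index, the innermost and the outermost index containing \<open>x\<close>, and the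
  successor of \<open>v\<close> among the indices containing \<open>x\<close>. Index \<open>0\<close> means that there is none.
\<close>

definition LF :: "(nat \<Rightarrow> nat set) \<Rightarrow> nat \<Rightarrow> nat" where
  "LF c x = (if \<exists>v. x \<in> c v then LEAST v. x \<in> c v else 0)"

definition TP :: "(nat \<Rightarrow> nat set) \<Rightarrow> nat \<Rightarrow> nat" where
  "TP c x = Max (insert 0 {v. x \<in> c v})"

definition NX :: "(nat \<Rightarrow> nat set) \<Rightarrow> nat \<Rightarrow> nat \<Rightarrow> nat" where
  "NX c v x = LF (\<lambda>w. if v < w then c w else {}) x"

definition supp :: "nat \<Rightarrow> (nat \<Rightarrow> nat set) \<Rightarrow> bool" where
  "supp n c \<longleftrightarrow> (\<forall>v. c v \<noteq> {} \<longrightarrow> 0 < v \<and> v \<le> n)"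

definition nest :: "(nat \<Rightarrow> nat set) \<Rightarrow> bool" where
  "nest c \<longleftrightarrow> (\<forall>v w. v < w \<longrightarrow> c v \<inter> c w \<noteq> {} \<longrightarrow> c v \<subseteq> c w)"

lemma suppD: "supp n c \<Longrightarrow> x \<in> c v \<Longrightarrow> 0 < v \<and> v \<le> n"
  unfolding supp_def by blast

lemma LF_in: "x \<in> c v \<Longrightarrow> x \<in> c (LF c x) \<and> LF c x \<le> v"
  unfolding LF_def by (auto intro: LeastI Least_le)

lemma LF_zero: "supp n c \<Longrightarrow> LF c x = 0 \<longleftrightarrow> (\<forall>v. x \<notin> c v)"
  using LF_in[of x c] suppD[of n c x] by (metis LF_def less_irrefl)

text \<open>The new index exceeds all others, so it is innermost only where no other set
  applies.\<close>

lemma LF_upd: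
  assumes "supp n c"
  shows "LF (c(Suc n := S)) x = (if \<exists>v. x \<in> c v then LF c x else if x \<in> S then Suc n else 0)"
proof (cases "\<exists>v. x \<in> c v")
  case True
  then obtain v where v: "x \<in> c v" by blast
  let ?l = "LF c x"
  have l: "x \<in> c ?l" "\<And>w. x \<in> c w \<Longrightarrow> ?l \<le> w" using LF_in v by auto
  then have ln: "?l \<le> n" using suppD[OF assms] by blast
  have "(LEAST v. x \<in> (c(Suc n := S)) v) = ?l"
    using l ln by (intro Least_equality) (auto split: if_splits)
  moreover have "\<exists>v. x \<in> (c(Suc n := S)) v" using l ln by (intro exI[of _ ?l]) auto
  ultimately show ?thesis using True unfolding LF_def by simp
next
  case False
  show ?thesis
  proof (cases "x \<in> S")
    case True
    have "(LEAST v. x \<in> (c(Suc n := S)) v) = Suc n"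
      using False True by (intro Least_equality) (auto split: if_splits)
    moreover have "\<exists>v. x \<in> (c(Suc n := S)) v" using True by (intro exI[of _ "Suc n"]) auto
    ultimately show ?thesis using False True unfolding LF_def by simp
  next
    case xS: False
    then have "\<not> (\<exists>v. x \<in> (c(Suc n := S)) v)" using False by auto
    then show ?thesis using False xS unfolding LF_def by simp
  qed
qed

lemma TP_fin: "supp n c \<Longrightarrow> finite {v. x \<in> c v}"
  by (rule finite_subset[of _ "{..n}"]) (auto dest: suppD)

lemma TP_le: "supp n c \<Longrightarrow> x \<in> c v \<Longrightarrow> v \<le> TP c x"
  unfolding TP_def using TP_fin[of n c x] by (intro Max_ge) auto

lemma TP_in: assumes "supp n c" "TP c x \<noteq> 0" shows "x \<in> c (TP c x)"
proof -
  have "TP c x \<in> insert 0 {v. x \<in> c v}" unfolding TP_def using TP_fin[OF assms(1), of x] by (intro Max_in) auto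
  then show ?thesis using assms(2) by simp
qed

lemma TP_upd:
  assumes "supp n c" shows "TP (c(Suc n := S)) x = (if x \<in> S then Suc n else TP c x)"
proof -
  have c0: "c (Suc n) = {}" using assms unfolding supp_def by (metis Suc_n_not_le_n)
  show ?thesis
  proof (cases "x \<in> S")
    case True
    then have e: "{v. x \<in> (c(Suc n := S)) v} = insert (Suc n) {v. x \<in> c v}" using c0 by auto
    have "TP (c(Suc n := S)) x = Suc n"
      unfolding TP_def e using TP_fin[OF assms, of x] suppD[OF assms, of x] by (intro Max_eqI) (auto intro: le_SucI)
    then show ?thesis using True by simp
  next
    case False
    then have "{v. x \<in> (c(Suc n := S)) v} = {v. x \<in> c v}" using c0 by auto
    then show ?thesis using False unfolding TP_def by simp
  qed
qed

lemma supp_cut: "supp n c \<Longrightarrow> supp n (\<lambda>w. if v < w then c w else {})"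
  unfolding supp_def by auto

lemma NX_upd:
  assumes "supp n c" "v \<le> n"
  shows "NX (c(Suc n := S)) v x = (if \<exists>w>v. x \<in> c w then NX c v x else if x \<in> S then Suc n else 0)"
proof -
  have "(\<lambda>w. if v < w then (c(Suc n := S)) w else {}) = (\<lambda>w. if v < w then c w else {})(Suc n := S)"
    using assms(2) by (auto simp: fun_eq_iff)
  then show ?thesis unfolding NX_def using LF_upd[OF supp_cut[OF assms(1)]] by (auto split: if_splits)
qed

lemma NX_0: "supp n c \<Longrightarrow> NX c v x = 0 \<longleftrightarrow> (\<forall>w>v. x \<notin> c w)"
  unfolding NX_def using LF_zero[OF supp_cut] by auto

lemma NX_in: "v < w \<Longrightarrow> x \<in> c w \<Longrightarrow> v < NX c v x \<and> x \<in> c (NX c v x) \<and> NX c v x \<le> w"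
  unfolding NX_def using LF_in[of x "\<lambda>w. if v < w then c w else {}" w] by (auto split: if_splits)

text \<open>In a nested family all elements of a set have the same successor, so \<open>pr\<close>
  may be described through any one of them.\<close>

definition tree_inv :: "(nat \<Rightarrow> nat set) \<Rightarrow> state \<Rightarrow> bool" where
  "tree_inv c s \<longleftrightarrow> (\<forall>x. arr s ''lf'' x = LF c x) \<and> (\<forall>x. arr s ''tp'' x = TP c x) \<and>
     (\<forall>v x. x \<in> c v \<longrightarrow> arr s ''pr'' v = NX c v x) \<and> (\<forall>v. c v = {} \<longrightarrow> arr s ''pr'' v = 0)"

text \<open>A new set that swallows whatever it meets becomes the parent of exactly those sets that
  were outermost for some element of it.\<close>

lemma tree_inv_add:
  assumes inv: "tree_inv c s" and nest: "nest c" and sp: "supp n c"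
    and S: "\<And>v. c v \<inter> S \<noteq> {} \<Longrightarrow> c v \<subseteq> S"
    and lf: "\<And>x. arr s' ''lf'' x = (if x \<in> S \<and> LF c x = 0 then Suc n else LF c x)"
    and tp: "\<And>x. arr s' ''tp'' x = (if x \<in> S then Suc n else TP c x)"
    and pr: "\<And>v. arr s' ''pr'' v = (if v \<noteq> 0 \<and> (\<exists>x\<in>S. TP c x = v) then Suc n else arr s ''pr'' v)"
  shows "tree_inv (c(Suc n := S)) s'" and "nest (c(Suc n := S))" and "supp (Suc n) (c(Suc n := S))"
proof -
  have c0: "c (Suc n) = {}" using sp unfolding supp_def by (metis Suc_n_not_le_n)
  have TPn: "TP c x \<le> n" for x using TP_in[OF sp] suppD[OF sp] by (metis le0)
  show "supp (Suc n) (c(Suc n := S))" using sp unfolding supp_def by (auto simp: le_SucI)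
  show "nest (c(Suc n := S))"
    unfolding nest_def
  proof (intro allI impI)
    fix v w assume h: "v < w" "(c(Suc n := S)) v \<inter> (c(Suc n := S)) w \<noteq> {}"
    show "(c(Suc n := S)) v \<subseteq> (c(Suc n := S)) w"
    proof (cases "w = Suc n")
      case True
      then show ?thesis using h S[of v] by simp
    next
      case False
      then have "c w \<noteq> {}" using h(2) by auto
      then have "w \<le> n" using sp unfolding supp_def by blast
      then have "v \<noteq> Suc n" using h(1) by simp
      then show ?thesis using h False nest unfolding nest_def by simp
    qed
  qed
  show "tree_inv (c(Suc n := S)) s'"
    unfolding tree_inv_def
  proof (intro conjI allI impI)
    fix x
    show "arr s' ''lf'' x = LF (c(Suc n := S)) x"
      unfolding lf LF_upd[OF sp] using LF_zero[OF sp, of x] by auto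
    show "arr s' ''tp'' x = TP (c(Suc n := S)) x" unfolding tp TP_upd[OF sp] ..
  next
    fix v x assume x: "x \<in> (c(Suc n := S)) v"
    show "arr s' ''pr'' v = NX (c(Suc n := S)) v x"
    proof (cases "v = Suc n")
      case True
      have "\<not> (\<exists>x\<in>S. TP c x = v)" using TPn True by (metis Suc_n_not_le_n)
      then have "arr s' ''pr'' v = 0" unfolding pr using True inv c0 unfolding tree_inv_def by auto
      moreover have "NX (c(Suc n := S)) v x = 0"
      proof -
        have "x \<notin> c w" if "Suc n < w" for w using suppD[OF sp, of x w] that by auto
        then show ?thesis using NX_0[OF \<open>supp (Suc n) (c(Suc n := S))\<close>, of v x] True by auto
      qed
      ultimately show ?thesis by simp
    next
      case False
      then have xv: "x \<in> c v" using x by simp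
      then have v: "0 < v" "v \<le> n" using suppD[OF sp] by auto
      have prv: "arr s ''pr'' v = NX c v x" using inv xv unfolding tree_inv_def by blast
      show ?thesis
      proof (cases "\<exists>w>v. x \<in> c w")
        case True
        then obtain w where w: "v < w" "x \<in> c w" by blast
        then have "c v \<subseteq> c w" using nest xv unfolding nest_def by blast
        \<comment> \<open>A set that already has a successor is outermost for none of its elements,
          so its parent is left alone.\<close>
        have "TP c y \<noteq> v" if "y \<in> S" for y
        proof
          assume "TP c y = v"
          then have "y \<in> c v" using TP_in[OF sp, of y] v by simp
          then have "w \<le> TP c y" using TP_le[OF sp] \<open>c v \<subseteq> c w\<close> by blast
          then show False using w \<open>TP c y = v\<close> by simp
        qed
        then show ?thesis unfolding pr NX_upd[OF sp v(2)] using True prv by auto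
      next
        case nx: False
        then have nx0: "NX c v x = 0" using NX_0[OF sp, of v x] by auto
        have tpx: "TP c x = v"
        proof (rule antisym)
          show "v \<le> TP c x" using TP_le[OF sp xv] .
          have "TP c x \<noteq> 0" using TP_le[OF sp xv] v by simp
          then have "x \<in> c (TP c x)" using TP_in[OF sp] by simp
          then show "TP c x \<le> v" using nx by (meson not_le)
        qed
        show ?thesis
        proof (cases "x \<in> S")
          case True
          then show ?thesis unfolding pr NX_upd[OF sp v(2)] using nx tpx v by auto
        next
          case xS: False
          have "TP c y \<noteq> v" if "y \<in> S" for y
          proof
            assume "TP c y = v"
            then have "y \<in> c v" using TP_in[OF sp, of y] v by simp
            then have "c v \<subseteq> S" using S[of v] that by blast
            then show False using xv xS by auto
          qed
          then show ?thesis unfolding pr NX_upd[OF sp v(2)] using nx xS prv nx0 by auto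
        qed
      qed
    qed
  next
    fix v assume v: "(c(Suc n := S)) v = {}"
    show "arr s' ''pr'' v = 0"
    proof (cases "v = Suc n")
      case True
      then show ?thesis using v c0 inv unfolding pr tree_inv_def by simp
    next
      case False
      then have cv: "c v = {}" using v by simp
      have "\<not> (v \<noteq> 0 \<and> (\<exists>x\<in>S. TP c x = v))" using TP_in[OF sp] cv by blast
      moreover have "arr s ''pr'' v = 0" using inv cv unfolding tree_inv_def by blast
      ultimately show ?thesis unfolding pr by simp
    qed
  qed
qed

text \<open>
  The members of the classes of post \<open>j\<close> have their cells at the offset \<open>bs j\<close>; \<open>lf\<close> and \<open>tp\<close> hold the innermost
  and outermost class seen so far, and \<open>dd\<close> records a class of quota \<open>0\<close>. Since \<open>kloop\<close> is run for increasing
  sizes \<open>g\<close>, a class comes after all classes that it contains.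
\<close>

definition cls_body :: com where
  "cls_body = Seq (Assign ''x'' (Plus (Read ''bs'' (Var ''j'')) (Read ''member'' (Var ''z''))))
    (Seq (If (Eq (Read ''lf'' (Var ''x'')) (Const 0)) (Store ''lf'' (Var ''x'') (Var ''nd''))
           (Store ''pr'' (Read ''tp'' (Var ''x'')) (Var ''nd'')))
    (Seq (Store ''tp'' (Var ''x'') (Var ''nd''))
    (If (Eq (Read ''cquota'' (Var ''k'')) (Const 0)) (Store ''dd'' (Var ''x'') (Const 1)) Skip)))"

lemma mod_cls_body [simp]: "modv cls_body = {''x''}" "moda cls_body = {''lf'', ''pr'', ''tp'', ''dd''}"
  by (auto simp: cls_body_def)

definition cls :: com where
  "cls = Seq (Assign ''nd'' (Plus (Var ''nd'') (Const 1))) (Seq (Store ''nc'' (Var ''nd'') (Read ''cquota'' (Var ''k'')))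
    (For ''z'' (Read ''moff'' (Var ''k'')) (Read ''moff'' (Plus (Var ''k'') (Const 1))) cls_body))"

lemma mod_cls [simp]: "modv cls = {''nd'', ''x'', ''z''}" "moda cls = {''nc'', ''lf'', ''pr'', ''tp'', ''dd''}"
  by (auto simp: cls_def)

definition kloop :: com where
  "kloop = For ''k'' (Read ''coff'' (Var ''j'')) (Read ''coff'' (Plus (Var ''j'') (Const 1)))
    (If (Eq (Minus (Read ''moff'' (Plus (Var ''k'') (Const 1))) (Read ''moff'' (Var ''k''))) (Var ''g'')) cls Skip)"

lemma mod_kloop [simp]: "modv kloop = {''k'', ''nd'', ''x'', ''z''}" "moda kloop = {''nc'', ''lf'', ''pr'', ''tp'', ''dd''}"
  by (auto simp: kloop_def)

text \<open>One pass over the classes for each size replaces sorting; it costs \<open>|A|\<close>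
  times the number of classes, which the bound affords. The sizes start at 1, so empty classes get
  no node, and the root is numbered after all classes.\<close>

definition tree :: com where
  "tree = Seq (For ''g'' (Const 1) (Plus (Var ''nA'') (Const 1)) kloop)
    (Seq (Assign ''nd'' (Plus (Var ''nd'') (Const 1)))
    (Seq (Store ''nc'' (Var ''nd'') (Read ''quota'' (Var ''j'')))
    (Store ''rn'' (Var ''j'') (Var ''nd''))))"

lemma mod_tree [simp]: "modv tree = {''g'', ''k'', ''nd'', ''x'', ''z''}" "moda tree = {''rn'', ''nc'', ''lf'', ''pr'', ''tp'', ''dd''}"
  by (auto simp: tree_def)

text \<open>A base of \<open>0\<close> marks a post not met before. Posts are found through the
  edges, since the bound does not allow time proportional to the number of posts.\<close>

definition forest_body :: com where
  "forest_body = Seq (Assign ''j'' (Read ''post'' (Var ''e'')))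
    (If (Eq (Read ''bs'' (Var ''j'')) (Const 0))
      (Seq (Store ''bs'' (Var ''j'') (Var ''cn'')) (Seq (Assign ''cn'' (Plus (Var ''cn'') (Var ''nA''))) tree)) Skip)"

lemma mod_forest_body [simp]: "modv forest_body = {''j'', ''cn'', ''g'', ''k'', ''nd'', ''x'', ''z''}"
  "moda forest_body = {''bs'', ''rn'', ''nc'', ''lf'', ''pr'', ''tp'', ''dd''}"
  by (auto simp: forest_body_def)

definition forest :: com where
  "forest = Seq (Assign ''cn'' (Var ''nA'')) (Seq (Assign ''nd'' (Var ''nA'')) (For ''e'' (Const 0) (Var ''m'') forest_body))"

lemma mod_forest [simp]: "modv forest = {''e'', ''j'', ''cn'', ''g'', ''k'', ''nd'', ''x'', ''z''}"
  "moda forest = {''bs'', ''rn'', ''nc'', ''lf'', ''pr'', ''tp'', ''dd''}"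
  by (auto simp: forest_def)

definition own_prog :: com where
  "own_prog = For ''i'' (Const 0) (Var ''nA'')
     (For ''e'' (Read ''off'' (Var ''i'')) (Read ''off'' (Plus (Var ''i'') (Const 1))) (Store ''own'' (Var ''e'') (Var ''i'')))"

lemma mod_own_prog [simp]: "modv own_prog = {''i'', ''e''}" "moda own_prog = {''own''}"
  by (auto simp: own_prog_def)

section \<open>Correctness and cost of the forest construction\<close>

context prob
begin

definition inp :: "state \<Rightarrow> bool" where
  "inp s \<longleftrightarrow> var s ''nA'' = nA \<and> var s ''m'' = m \<and> arr s ''off'' = off \<and> arr s ''post'' = post \<and> arr s ''rank'' = rnk \<and>
     arr s ''quota'' = quo \<and> arr s ''coff'' = coff \<and> arr s ''cquota'' = cquo \<and> arr s ''moff'' = moff \<and> arr s ''member'' = mem"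

lemma inp_same:
  "inp s \<Longrightarrow> same X Y s s' \<Longrightarrow> {''nA'', ''m''} \<inter> X = {} \<Longrightarrow>
    {''off'', ''post'', ''rank'', ''quota'', ''coff'', ''cquota'', ''moff'', ''member''} \<inter> Y = {} \<Longrightarrow> inp s'"
  unfolding inp_def same_def by auto

lemma inpD: assumes "inp s" shows "var s ''nA'' = nA" "var s ''m'' = m" "arr s ''off'' = off" "arr s ''post'' = post" "arr s ''rank'' = rnk"
     "arr s ''quota'' = quo" "arr s ''coff'' = coff" "arr s ''cquota'' = cquo" "arr s ''moff'' = moff" "arr s ''member'' = mem"
  using assms unfolding inp_def by auto

lemma sum_off: "n \<le> nA \<Longrightarrow> (\<Sum>i=0..<n. off (Suc i) - off i) = off n"
proof (induction n)
  case (Suc n)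
  then show ?case using off_step[of n] by simp
qed (simp add: off_0)

lemma own_wp:
  assumes inp: "inp s"
  shows "wp own_prog (\<lambda>t s'. (\<forall>e<m. arr s' ''own'' e = ow e) \<and> t \<le> 3 * m + 4 * nA + 2) s"
  unfolding own_prog_def
proof (rule wp_for[where I = "\<lambda>i s1. \<forall>e<off i. arr s1 ''own'' e = ow e" and \<tau> = "\<lambda>i. 3 * (off (Suc i) - off i) + 2" and L = 0 and H = nA])
  fix s1 assume "same (insert ''i'' (modv (For ''e'' (Read ''off'' (Var ''i'')) (Read ''off'' (Plus (Var ''i'') (Const 1))) (Store ''own'' (Var ''e'') (Var ''i'')))))
    (moda (For ''e'' (Read ''off'' (Var ''i'')) (Read ''off'' (Plus (Var ''i'') (Const 1))) (Store ''own'' (Var ''e'') (Var ''i'')))) s s1"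
  from same_var[OF this, of "''nA''"] show "aval (Var ''nA'') s1 = nA" using inpD[OF inp] by simp
next
  fix k s1
  assume k: "k < nA" and I: "\<forall>e<off k. arr s1 ''own'' e = ow e" and vi: "var s1 ''i'' = k"
    and "same (insert ''i'' (modv (For ''e'' (Read ''off'' (Var ''i'')) (Read ''off'' (Plus (Var ''i'') (Const 1))) (Store ''own'' (Var ''e'') (Var ''i'')))))
    (moda (For ''e'' (Read ''off'' (Var ''i'')) (Read ''off'' (Plus (Var ''i'') (Const 1))) (Store ''own'' (Var ''e'') (Var ''i'')))) s s1"
  from inp_same[OF inp this(4)] have inp1: "inp s1" by simp
  note D = inpD[OF inp1]
  show "wp (For ''e'' (Read ''off'' (Var ''i'')) (Read ''off'' (Plus (Var ''i'') (Const 1))) (Store ''own'' (Var ''e'') (Var ''i'')))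
     (\<lambda>t s2. (\<forall>e<off (Suc k). arr (setv ''i'' (Suc k) s2) ''own'' e = ow e) \<and> t \<le> 3 * (off (Suc k) - off k) + 2) s1"
  proof (rule wp_for_const[where I = "\<lambda>n s2. \<forall>e<n. arr s2 ''own'' e = ow e" and L = "off k" and H = "off (Suc k)" and K = 1])
    show "off k \<le> off (Suc k)" using off_step k by simp
  next
    fix s2 assume "same (insert ''e'' (modv (Store ''own'' (Var ''e'') (Var ''i'')))) (moda (Store ''own'' (Var ''e'') (Var ''i''))) s1 s2"
    from same_var[OF this, of "''i''"] same_arr[OF this, of "''off''"] show "aval (Read ''off'' (Plus (Var ''i'') (Const 1))) s2 = off (Suc k)"
      using D vi by simp
  next
    fix n s2 assume n: "off k \<le> n" "n < off (Suc k)" "\<forall>e<n. arr s2 ''own'' e = ow e" "var s2 ''e'' = n"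
      and "same (insert ''e'' (modv (Store ''own'' (Var ''e'') (Var ''i'')))) (moda (Store ''own'' (Var ''e'') (Var ''i''))) s1 s2"
    from same_var[OF this(5), of "''i''"] have "var s2 ''i'' = k" using vi by simp
    then show "wp (Store ''own'' (Var ''e'') (Var ''i'')) (\<lambda>t s3. (\<forall>e<Suc n. arr (setv ''e'' (Suc n) s3) ''own'' e = ow e) \<and> t \<le> 1) s2"
      using n ow_eq(1)[OF k n(1,2)] by (auto simp: less_Suc_eq)
  qed (use D vi I in auto)
next
  fix t s1 assume I: "\<forall>e<off nA. arr s1 ''own'' e = ow e" and t: "t \<le> (\<Sum>k=0..<nA. 3 * (off (Suc k) - off k) + 2 + 2) + 2"
  have "(\<Sum>k=0..<nA. 3 * (off (Suc k) - off k) + 2 + 2) = 3 * (\<Sum>k=0..<nA. off (Suc k) - off k) + 4 * nA"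
    by (simp only: sum.distrib sum_distrib_left sum_constant card_atLeastLessThan) simp
  also have "\<dots> = 3 * m + 4 * nA" using sum_off[of nA] by (simp add: m_def)
  finally show "(\<forall>e<m. arr s1 ''own'' e = ow e) \<and> t \<le> 3 * m + 4 * nA + 2" using I t by (simp add: m_def)
qed (simp_all add: off_0)


text \<open>
  A forest node is named by a pair: \<open>(j, Some k)\<close> is the class \<open>k\<close> of the post \<open>j\<close>, and \<open>(j, None)\<close> is the post itself.
\<close>

definition cells :: "(nat \<Rightarrow> nat) \<Rightarrow> nat \<times> nat option \<Rightarrow> nat set" where
  "cells b p = (case snd p of None \<Rightarrow> {} | Some k \<Rightarrow> (\<lambda>a. b (fst p) + a) ` mems k)"

definition capk :: "nat \<times> nat option \<Rightarrow> nat" where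
  "capk p = (case snd p of None \<Rightarrow> quo (fst p) | Some k \<Rightarrow> cquo k)"

text \<open>Roots own no cells, so the cell arrays describe the classes only; the links to the roots
  are added by \<open>leaves\<close>.\<close>

definition gc :: "(nat \<Rightarrow> nat) \<Rightarrow> nat \<Rightarrow> (nat \<Rightarrow> nat \<times> nat option) \<Rightarrow> nat \<Rightarrow> nat set" where
  "gc b n kd v = (if nA < v \<and> v \<le> n then cells b (kd v) else {})"

lemma cells_simps [simp]: "cells b (j, None) = {}" "cells b (j, Some k) = (\<lambda>a. b j + a) ` mems k"
  "capk (j, None) = quo j" "capk (j, Some k) = cquo k"
  by (simp_all add: cells_def capk_def)

lemma supp_gc: "supp n (gc b n kd)" unfolding supp_def gc_def by auto

lemma cls_wp:
  assumes inp: "inp s" and j: "var s ''j'' = j" "j < nP" and k: "var s ''k'' = k" "k \<in> cblk j"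
    and inv: "tree_inv c s" and nest: "nest c" and sp: "supp n c" and n: "n = var s ''nd''"
    and SS: "S = (\<lambda>a. arr s ''bs'' j + a) ` mems k" and S: "\<And>v. c v \<inter> S \<noteq> {} \<Longrightarrow> c v \<subseteq> S"
  shows "wp cls (\<lambda>t s'. tree_inv (c(Suc n := S)) s' \<and> var s' ''nd'' = Suc n \<and> arr s' ''nc'' = (arr s ''nc'')(Suc n := cquo k) \<and>
     (\<forall>x. arr s' ''dd'' x = (if cquo k = 0 \<and> x \<in> S then 1 else arr s ''dd'' x)) \<and> t \<le> 8 * nA + 4) s"
proof -
  let ?b = "arr s ''bs'' j"
  let ?s1 = "seta ''nc'' (Suc n) (cquo k) (setv ''nd'' (Suc n) s)"
  define P where "P z = (\<lambda>y. ?b + mem y) ` {moff k..<z}" for z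
  have PS: "P (moff (Suc k)) = S" unfolding P_def SS mems_def by (auto simp: image_image)
  define I where "I z s' \<longleftrightarrow> (\<forall>x. arr s' ''lf'' x = (if x \<in> P z \<and> LF c x = 0 then Suc n else LF c x)) \<and>
     (\<forall>x. arr s' ''tp'' x = (if x \<in> P z then Suc n else TP c x)) \<and>
     (\<forall>v. arr s' ''pr'' v = (if v \<noteq> 0 \<and> (\<exists>x\<in>P z. TP c x = v) then Suc n else arr s ''pr'' v)) \<and>
     (\<forall>x. arr s' ''dd'' x = (if cquo k = 0 \<and> x \<in> P z then 1 else arr s ''dd'' x))" for z and s' :: state
  note D = inpD[OF inp]
  have "wp (For ''z'' (Read ''moff'' (Var ''k'')) (Read ''moff'' (Plus (Var ''k'') (Const 1))) cls_body)
    (\<lambda>t s'. tree_inv (c(Suc n := S)) s' \<and> var s' ''nd'' = Suc n \<and> arr s' ''nc'' = (arr s ''nc'')(Suc n := cquo k) \<and>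
     (\<forall>x. arr s' ''dd'' x = (if cquo k = 0 \<and> x \<in> S then 1 else arr s ''dd'' x)) \<and> 2 + t \<le> 8 * nA + 4) ?s1"
  proof (rule wp_for_const[where I = I and L = "moff k" and H = "moff (Suc k)" and K = 6])
    show "moff k \<le> moff (Suc k)" using moff_step j k by blast
    show "I (moff k) (setv ''z'' (moff k) ?s1)"
      using inv unfolding I_def P_def tree_inv_def by simp
  next
    fix s1 assume "same (insert ''z'' (modv cls_body)) (moda cls_body) ?s1 s1"
    from same_var[OF this, of "''k''"] same_arr[OF this, of "''moff''"]
    show "aval (Read ''moff'' (Plus (Var ''k'') (Const 1))) s1 = moff (Suc k)" using D k by simp
  next
    fix z s1 assume z: "moff k \<le> z" "z < moff (Suc k)" and I1: "I z s1" and vz: "var s1 ''z'' = z"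
      and sm: "same (insert ''z'' (modv cls_body)) (moda cls_body) ?s1 s1"
    have e: "var s1 ''j'' = j" "var s1 ''k'' = k" "var s1 ''nd'' = Suc n" "arr s1 ''bs'' = arr s ''bs''" "arr s1 ''member'' = mem" "arr s1 ''cquota'' = cquo"
      using same_var[OF sm, of "''j''"] same_var[OF sm, of "''k''"] same_var[OF sm, of "''nd''"]
        same_arr[OF sm, of "''bs''"] same_arr[OF sm, of "''member''"] same_arr[OF sm, of "''cquota''"] D j k by auto
    let ?x = "?b + mem z"
    \<comment> \<open>The members of a class are listed without repetition, so this cell still has
      its old entries.\<close>
    have xP: "?x \<notin> P z"
    proof
      assume "?x \<in> P z"
      then obtain y where y: "moff k \<le> y" "y < z" "mem y = mem z" by (auto simp: P_def)
      then show False using inj_onD[OF mem_inj[OF j(2) k(2)], of y z] z by simp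
    qed
    have P': "P (Suc z) = insert ?x (P z)" using z unfolding P_def by (auto simp: atLeastLessThanSuc)
    have lfx: "arr s1 ''lf'' ?x = LF c ?x" "arr s1 ''tp'' ?x = TP c ?x" using I1 xP unfolding I_def by auto
    have tp0: "TP c ?x \<noteq> 0" if nz: "LF c ?x \<noteq> 0"
    proof -
      obtain v where "?x \<in> c v" using LF_zero[OF sp, of ?x] nz by blast
      then show ?thesis using TP_le[OF sp, of ?x v] suppD[OF sp, of ?x v] by auto
    qed
    have tp00: "TP c ?x = 0" if z0: "LF c ?x = 0"
    proof (rule ccontr)
      assume "TP c ?x \<noteq> 0"
      then have "?x \<in> c (TP c ?x)" using TP_in[OF sp] by simp
      then show False using LF_zero[OF sp, of ?x] z0 by simp
    qed
    let ?s2 = "setv ''x'' ?x s1"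
    let ?s3 = "if LF c ?x = 0 then seta ''lf'' ?x (Suc n) ?s2 else seta ''pr'' (TP c ?x) (Suc n) ?s2"
    let ?s4 = "seta ''tp'' ?x (Suc n) ?s3"
    let ?s5 = "if cquo k = 0 then seta ''dd'' ?x 1 ?s4 else ?s4"
    have "I (Suc z) (setv ''z'' (Suc z) ?s5)"
      unfolding I_def
    proof (intro conjI allI)
      fix x
      show "arr (setv ''z'' (Suc z) ?s5) ''lf'' x = (if x \<in> P (Suc z) \<and> LF c x = 0 then Suc n else LF c x)"
        using I1 unfolding I_def P' by (cases "x = ?x") auto
      show "arr (setv ''z'' (Suc z) ?s5) ''tp'' x = (if x \<in> P (Suc z) then Suc n else TP c x)"
        using I1 unfolding I_def P' by (cases "x = ?x") auto
      show "arr (setv ''z'' (Suc z) ?s5) ''dd'' x = (if cquo k = 0 \<and> x \<in> P (Suc z) then 1 else arr s ''dd'' x)"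
        using I1 unfolding I_def P' by (cases "x = ?x") auto
      show "arr (setv ''z'' (Suc z) ?s5) ''pr'' x = (if x \<noteq> 0 \<and> (\<exists>y\<in>P (Suc z). TP c y = x) then Suc n else arr s ''pr'' x)"
        using I1 tp0 tp00 unfolding I_def P' by (cases "x = TP c ?x") auto
    qed
    then show "wp cls_body (\<lambda>t s2. I (Suc z) (setv ''z'' (Suc z) s2) \<and> t \<le> 6) s1"
      unfolding cls_body_def using e vz lfx by (auto split: if_splits)
  next
    fix t s1 assume I1: "I (moff (Suc k)) s1" and sm: "same (insert ''z'' (modv cls_body)) (moda cls_body) ?s1 s1"
      and t: "t \<le> (6 + 2) * (moff (Suc k) - moff k) + 2"
    have "tree_inv (c(Suc n := S)) s1"
      using I1 unfolding I_def PS by (intro tree_inv_add(1)[OF inv nest sp S]) auto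
    moreover have "2 + t \<le> 8 * nA + 4" using t csz_le[OF j(2) k(2)] unfolding csz_def by simp
    ultimately show "tree_inv (c(Suc n := S)) s1 \<and> var s1 ''nd'' = Suc n \<and> arr s1 ''nc'' = (arr s ''nc'')(Suc n := cquo k) \<and>
     (\<forall>x. arr s1 ''dd'' x = (if cquo k = 0 \<and> x \<in> S then 1 else arr s ''dd'' x)) \<and> 2 + t \<le> 8 * nA + 4"
      using same_var[OF sm, of "''nd''"] same_arr[OF sm, of "''nc''"] I1 unfolding I_def PS by auto
  qed (use D k in auto)
  then show ?thesis unfolding cls_def using D k n by simp
qed

text \<open>\<open>KS\<close> holds the names of the nodes built so far and \<open>kd\<close> maps
  numbers to names. A root has to follow the classes of its post so that parents get larger
  numbers.\<close>

definition TI :: "(nat \<times> nat option) set \<Rightarrow> (nat \<Rightarrow> nat \<times> nat option) \<Rightarrow> state \<Rightarrow> bool" where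
  "TI KS kd s \<longleftrightarrow> nA \<le> var s ''nd'' \<and> bij_betw kd {nA<..var s ''nd''} KS \<and>
     tree_inv (gc (arr s ''bs'') (var s ''nd'') kd) s \<and> nest (gc (arr s ''bs'') (var s ''nd'') kd) \<and>
     (\<forall>v\<in>{nA<..var s ''nd''}. arr s ''nc'' v = capk (kd v)) \<and>
     (\<forall>x. arr s ''dd'' x = of_bool (\<exists>v. x \<in> gc (arr s ''bs'') (var s ''nd'') kd v \<and> capk (kd v) = 0)) \<and>
     (\<forall>p\<in>KS. fst p < nP \<and> arr s ''bs'' (fst p) \<noteq> 0 \<and> (\<forall>k. snd p = Some k \<longrightarrow> k \<in> cblk (fst p) \<and> 0 < csz k)) \<and>
     (\<forall>v\<in>{nA<..var s ''nd''}. \<forall>w\<in>{nA<..var s ''nd''}. fst (kd v) = fst (kd w) \<longrightarrow> snd (kd v) \<noteq> None \<longrightarrow> snd (kd w) = None \<longrightarrow> v < w) \<and>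
     (\<forall>v\<in>{nA<..var s ''nd''}. snd (kd v) = None \<longrightarrow> arr s ''rn'' (fst (kd v)) = v)"

text \<open>The blocks of cells of different posts are disjoint, so a cell determines its post and
  its applicant.\<close>

definition BS :: "state \<Rightarrow> bool" where
  "BS s \<longleftrightarrow> (\<forall>j j'. arr s ''bs'' j \<noteq> 0 \<longrightarrow> arr s ''bs'' j' \<noteq> 0 \<longrightarrow> j \<noteq> j' \<longrightarrow>
      arr s ''bs'' j + nA \<le> arr s ''bs'' j' \<or> arr s ''bs'' j' + nA \<le> arr s ''bs'' j)"

lemma BS_cell:
  "BS s \<Longrightarrow> arr s ''bs'' j \<noteq> 0 \<Longrightarrow> arr s ''bs'' j' \<noteq> 0 \<Longrightarrow> a < nA \<Longrightarrow> a' < nA \<Longrightarrow>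
    arr s ''bs'' j + a = arr s ''bs'' j' + a' \<Longrightarrow> j = j' \<and> a = a'"
proof -
  assume h: "BS s" "arr s ''bs'' j \<noteq> 0" "arr s ''bs'' j' \<noteq> 0" "a < nA" "a' < nA" "arr s ''bs'' j + a = arr s ''bs'' j' + a'"
  have "j = j'"
  proof (rule ccontr)
    assume "j \<noteq> j'"
    then have "arr s ''bs'' j + nA \<le> arr s ''bs'' j' \<or> arr s ''bs'' j' + nA \<le> arr s ''bs'' j" using h(1-3) unfolding BS_def by blast
    then show False using h(4-6) by linarith
  qed
  then show "j = j' \<and> a = a'" using h(6) by simp
qed

lemma TI_add:
  assumes TI: "TI KS kd s" and p: "p \<notin> KS" "fst p < nP" "arr s ''bs'' (fst p) \<noteq> 0" "\<And>k. snd p = Some k \<Longrightarrow> k \<in> cblk (fst p) \<and> 0 < csz k"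
    and n: "n = var s ''nd''" "var s' ''nd'' = Suc n" and bs: "arr s' ''bs'' = arr s ''bs''"
    and inv': "tree_inv ((gc (arr s ''bs'') n kd)(Suc n := cells (arr s ''bs'') p)) s'"
    and nest': "nest ((gc (arr s ''bs'') n kd)(Suc n := cells (arr s ''bs'') p))"
    and nc: "arr s' ''nc'' = (arr s ''nc'')(Suc n := capk p)"
    and dd: "\<And>x. arr s' ''dd'' x = (if capk p = 0 \<and> x \<in> cells (arr s ''bs'') p then 1 else arr s ''dd'' x)"
    and rn: "arr s' ''rn'' = (if snd p = None then (arr s ''rn'')(fst p := Suc n) else arr s ''rn'')"
    and root: "(fst p, None) \<notin> KS"
  shows "TI (insert p KS) (kd(Suc n := p)) s'"
proof -
  let ?b = "arr s ''bs''" and ?kd = "kd(Suc n := p)"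
  have nn: "nA \<le> n" and bij: "bij_betw kd {nA<..n} KS" and ncs: "\<And>v. nA < v \<Longrightarrow> v \<le> n \<Longrightarrow> arr s ''nc'' v = capk (kd v)"
    and dds: "\<And>x. arr s ''dd'' x = of_bool (\<exists>v. x \<in> gc ?b n kd v \<and> capk (kd v) = 0)"
    and KSs: "\<forall>p\<in>KS. fst p < nP \<and> ?b (fst p) \<noteq> 0 \<and> (\<forall>k. snd p = Some k \<longrightarrow> k \<in> cblk (fst p) \<and> 0 < csz k)"
    and ord: "\<And>v w. nA < v \<Longrightarrow> v \<le> n \<Longrightarrow> nA < w \<Longrightarrow> w \<le> n \<Longrightarrow> fst (kd v) = fst (kd w) \<Longrightarrow> snd (kd v) \<noteq> None \<Longrightarrow> snd (kd w) = None \<Longrightarrow> v < w"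
    and rns: "\<And>v. nA < v \<Longrightarrow> v \<le> n \<Longrightarrow> snd (kd v) = None \<Longrightarrow> arr s ''rn'' (fst (kd v)) = v"
    using TI unfolding TI_def n(1)[symmetric] by auto
  have set: "{nA<..Suc n} = insert (Suc n) {nA<..n}" using nn by auto
  have g: "gc ?b (Suc n) ?kd = (gc ?b n kd)(Suc n := cells ?b p)"
    using nn by (auto simp: gc_def fun_eq_iff)
  have "bij_betw ?kd {nA<..n} KS" using bij by (subst bij_betw_cong[of _ _ kd]) auto
  then have bij': "bij_betw ?kd {nA<..Suc n} (insert p KS)"
    unfolding set using p(1) by (metis (no_types, lifting) fun_upd_same greaterThanAtMost_iff lessI not_le notIn_Un_bij_betw3 bij_betw_singletonI insert_is_Un sup_commute)
  have inKS: "kd v \<in> KS" if "nA < v" "v \<le> n" for v using bij that unfolding bij_betw_def by auto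
  show ?thesis
    unfolding TI_def n(2) bs g
  proof (intro conjI)
    show "nA \<le> Suc n" using nn by simp
    show "\<forall>v\<in>{nA<..Suc n}. arr s' ''nc'' v = capk (?kd v)" unfolding nc using ncs by auto
    show "\<forall>x. arr s' ''dd'' x = of_bool (\<exists>v. x \<in> ((gc ?b n kd)(Suc n := cells ?b p)) v \<and> capk (?kd v) = 0)"
    proof
      fix x
      have "(\<exists>v. x \<in> ((gc ?b n kd)(Suc n := cells ?b p)) v \<and> capk (?kd v) = 0) \<longleftrightarrow>
        (x \<in> cells ?b p \<and> capk p = 0) \<or> (\<exists>v. x \<in> gc ?b n kd v \<and> capk (kd v) = 0)" (is "?L \<longleftrightarrow> ?R")
      proof
        assume ?L
        then obtain v where v: "x \<in> ((gc ?b n kd)(Suc n := cells ?b p)) v" "capk (?kd v) = 0" by blast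
        then show ?R by (cases "v = Suc n") auto
      next
        assume ?R
        then show ?L
        proof
          assume "x \<in> cells ?b p \<and> capk p = 0"
          then show ?L by (intro exI[of _ "Suc n"]) simp
        next
          assume "\<exists>v. x \<in> gc ?b n kd v \<and> capk (kd v) = 0"
          then obtain v where v: "x \<in> gc ?b n kd v" "capk (kd v) = 0" by blast
          then have "v \<noteq> Suc n" by (auto simp: gc_def)
          then show ?L using v by (intro exI[of _ v]) simp
        qed
      qed
      then show "arr s' ''dd'' x = of_bool (\<exists>v. x \<in> ((gc ?b n kd)(Suc n := cells ?b p)) v \<and> capk (?kd v) = 0)"
        using dd[of x] dds[of x] by auto
    qed
    show "\<forall>q\<in>insert p KS. fst q < nP \<and> ?b (fst q) \<noteq> 0 \<and> (\<forall>k. snd q = Some k \<longrightarrow> k \<in> cblk (fst q) \<and> 0 < csz k)"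
      using KSs p by auto
    show "\<forall>v\<in>{nA<..Suc n}. \<forall>w\<in>{nA<..Suc n}. fst (?kd v) = fst (?kd w) \<longrightarrow> snd (?kd v) \<noteq> None \<longrightarrow> snd (?kd w) = None \<longrightarrow> v < w"
    proof (intro ballI impI)
      fix v w assume h: "v \<in> {nA<..Suc n}" "w \<in> {nA<..Suc n}" "fst (?kd v) = fst (?kd w)" "snd (?kd v) \<noteq> None" "snd (?kd w) = None"
      show "v < w"
      proof (cases "w = Suc n")
        case True
        then show ?thesis using h by (cases "v = Suc n") auto
      next
        case False
        then have w: "nA < w" "w \<le> n" "snd (kd w) = None" using h by auto
        have "v \<noteq> Suc n"
        proof
          assume "v = Suc n"
          then have "kd w = (fst p, None)" using h w by (metis False fun_upd_apply prod.collapse)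
          then show False using inKS[OF w(1,2)] root by simp
        qed
        then show ?thesis using ord[of v w] h w by auto
      qed
    qed
    show "\<forall>v\<in>{nA<..Suc n}. snd (?kd v) = None \<longrightarrow> arr s' ''rn'' (fst (?kd v)) = v"
    proof (intro ballI impI)
      fix v assume h: "v \<in> {nA<..Suc n}" "snd (?kd v) = None"
      show "arr s' ''rn'' (fst (?kd v)) = v"
      proof (cases "v = Suc n")
        case True
        then show ?thesis using h rn by simp
      next
        case False
        then have v: "nA < v" "v \<le> n" "snd (kd v) = None" using h by auto
        have "fst (kd v) \<noteq> fst p" using inKS[OF v(1,2)] v(3) root by (metis prod.collapse)
        then show ?thesis using rns[OF v] False rn by simp
      qed
    qed
  qed (use bij' inv' nest' in auto)
qed

text \<open>Classes of a post arrive by increasing size. An earlier one that meets the new class is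
  nested with it by laminarity and is not larger, hence contained in it.\<close>

lemma class_node_wp:
  assumes inp: "inp s" and TI: "TI KS kd s" and BS: "BS s" and j: "var s ''j'' = j" "j < nP" and k: "var s ''k'' = k" "k \<in> cblk j" "0 < csz k"
    and new: "(j, Some k) \<notin> KS" "(j, None) \<notin> KS" and bsj: "arr s ''bs'' j \<noteq> 0"
    and sz: "\<And>k'. (j, Some k') \<in> KS \<Longrightarrow> csz k' \<le> csz k"
  shows "wp cls (\<lambda>t s'. (\<exists>kd'. TI (insert (j, Some k) KS) kd' s') \<and> t \<le> 8 * nA + 4) s"
proof -
  let ?n = "var s ''nd''" and ?b = "arr s ''bs''" and ?p = "(j, Some k)"
  let ?c = "gc ?b ?n kd" and ?S = "(\<lambda>a. ?b j + a) ` mems k"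
  have inv: "tree_inv ?c s" and nest: "nest ?c" and bij: "bij_betw kd {nA<..?n} KS"
    and KSs: "\<And>p. p \<in> KS \<Longrightarrow> fst p < nP \<and> ?b (fst p) \<noteq> 0 \<and> (\<forall>k. snd p = Some k \<longrightarrow> k \<in> cblk (fst p) \<and> 0 < csz k)"
    using TI unfolding TI_def by auto
  have S: "?c v \<subseteq> ?S" if ne: "?c v \<inter> ?S \<noteq> {}" for v
  proof -
    obtain a where a: "a \<in> mems k" "?b j + a \<in> ?c v" using ne by auto
    then have v: "nA < v" "v \<le> ?n" and cv: "?c v = cells ?b (kd v)" by (auto simp: gc_def split: if_splits)
    then have vK: "kd v \<in> KS" using bij unfolding bij_betw_def by auto
    obtain j' k' where kv: "kd v = (j', Some k')" using a(2) cv by (cases "kd v"; cases "snd (kd v)") auto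
    have j': "j' < nP" "?b j' \<noteq> 0" "k' \<in> cblk j'" using KSs[OF vK] kv by auto
    obtain a' where a': "a' \<in> mems k'" "?b j + a = ?b j' + a'" using a(2) cv kv by auto
    have "a < nA" "a' < nA" using mems_less[OF j(2) k(2)] mems_less[OF j'(1,3)] a(1) a'(1) by auto
    then have eq: "j = j'" "a = a'" using BS_cell[OF BS bsj j'(2) _ _ a'(2)] by auto
    have le: "csz k' \<le> csz k" using sz vK kv eq by simp
    have "mems k \<subseteq> mems k' \<or> mems k' \<subseteq> mems k" using mems_laminar(1)[OF j(2) k(2)] j'(3) eq a(1) a'(1) by blast
    moreover have "mems k' \<subseteq> mems k" if sub: "mems k \<subseteq> mems k'"
    proof -
      have "finite (mems k')" unfolding mems_def by simp
      moreover have "card (mems k') \<le> card (mems k)" using le card_mems j(2) k(2) j'(3) eq by simp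
      ultimately show ?thesis using card_seteq[OF _ sub] by simp
    qed
    ultimately have "mems k' \<subseteq> mems k" by blast
    then show ?thesis unfolding cv kv using eq by auto
  qed
  note add = tree_inv_add(2)[OF inv nest supp_gc S]
  have "wp cls (\<lambda>t s'. tree_inv (?c(Suc ?n := ?S)) s' \<and> var s' ''nd'' = Suc ?n \<and> arr s' ''nc'' = (arr s ''nc'')(Suc ?n := cquo k) \<and>
     (\<forall>x. arr s' ''dd'' x = (if cquo k = 0 \<and> x \<in> ?S then 1 else arr s ''dd'' x)) \<and> t \<le> 8 * nA + 4) s"
    by (rule cls_wp[OF inp j k(1,2) inv nest supp_gc refl refl S])
  then show ?thesis
  proof (rule wp_same)
    fix t s' assume h: "tree_inv (?c(Suc ?n := ?S)) s' \<and> var s' ''nd'' = Suc ?n \<and> arr s' ''nc'' = (arr s ''nc'')(Suc ?n := cquo k) \<and>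
     (\<forall>x. arr s' ''dd'' x = (if cquo k = 0 \<and> x \<in> ?S then 1 else arr s ''dd'' x)) \<and> t \<le> 8 * nA + 4" and sm: "same (modv cls) (moda cls) s s'"
    \<comment> \<open>\<open>tree_inv_add\<close> speaks of a successor state; this one is assembled
      so as to have the required arrays.\<close>
    have nest': "nest (?c(Suc ?n := ?S))"
      by (rule tree_inv_add(2)[OF inv nest supp_gc S, where s' = "s\<lparr>arr := (arr s)(''lf'' := (\<lambda>x. if x \<in> ?S \<and> LF ?c x = 0 then Suc ?n else LF ?c x),
         ''tp'' := (\<lambda>x. if x \<in> ?S then Suc ?n else TP ?c x), ''pr'' := (\<lambda>v. if v \<noteq> 0 \<and> (\<exists>x\<in>?S. TP ?c x = v) then Suc ?n else arr s ''pr'' v))\<rparr>"]) auto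
    have "TI (insert ?p KS) (kd(Suc ?n := ?p)) s'"
      using h nest' new j k bsj same_arr[OF sm, of "''bs''"] same_arr[OF sm, of "''rn''"]
      by (intro TI_add[OF TI]) auto
    then show "(\<exists>kd'. TI (insert (j, Some k) KS) kd' s') \<and> t \<le> 8 * nA + 4" using h by blast
  qed
qed


lemma TI_setv: "''nd'' \<noteq> x \<Longrightarrow> TI KS kd (setv x n s) = TI KS kd s"
  unfolding TI_def tree_inv_def by simp

definition cl :: "nat \<Rightarrow> nat \<Rightarrow> (nat \<times> nat option) set" where
  "cl j g = {(j, Some k) | k. k \<in> cblk j \<and> 0 < csz k \<and> csz k < g}"

definition KSof :: "nat set \<Rightarrow> (nat \<times> nat option) set" where
  "KSof J = {(j, Some k) | j k. j \<in> J \<and> k \<in> cblk j \<and> 0 < csz k} \<union> {(j, None) | j. j \<in> J}"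

lemma KSof_fst: "p \<in> KSof J \<Longrightarrow> fst p \<in> J"
  by (auto simp: KSof_def)

definition kt :: "nat \<Rightarrow> nat \<Rightarrow> nat" where
  "kt g k = (if csz k = g then 8 * nA + 5 else 2)"

lemma kloop_wp:
  assumes inp: "inp s" and BS: "BS s" and j: "var s ''j'' = j" "j < nP" and bsj: "arr s ''bs'' j \<noteq> 0" and g: "var s ''g'' = g" "0 < g"
    and TI: "TI (K0 \<union> cl j g) kd s" and K0: "\<And>q. (j, q) \<notin> K0"
  shows "wp kloop (\<lambda>t s'. (\<exists>kd'. TI (K0 \<union> cl j (Suc g)) kd' s') \<and> t \<le> (\<Sum>k=coff j..<coff (Suc j). kt g k + 2) + 2) s"
proof -
  let ?body = "If (Eq (Minus (Read ''moff'' (Plus (Var ''k'') (Const 1))) (Read ''moff'' (Var ''k''))) (Var ''g'')) cls Skip"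
  \<comment> \<open>In round \<open>g\<close>, the classes of size \<open>g\<close> before position
    \<open>k\<close> have joined those of smaller size.\<close>
  define KK where "KK k = K0 \<union> cl j g \<union> {(j, Some k') | k'. k' \<in> cblk j \<and> csz k' = g \<and> k' < k}" for k
  note D = inpD[OF inp]
  have "KK (coff j) = K0 \<union> cl j g" by (auto simp: KK_def cblk_def)
  have last: "KK (coff (Suc j)) = K0 \<union> cl j (Suc g)"
    using g(2) by (auto simp: KK_def cl_def cblk_def less_Suc_eq)
  show ?thesis
    unfolding kloop_def
  proof (rule wp_for[where I = "\<lambda>k s1. \<exists>kd'. TI (KK k) kd' s1" and \<tau> = "kt g" and L = "coff j" and H = "coff (Suc j)"])
    show "coff j \<le> coff (Suc j)" using coff_step j by simp
    show "\<exists>kd'. TI (KK (coff j)) kd' (setv ''k'' (coff j) s)"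
      using TI by (auto simp: TI_setv \<open>KK (coff j) = K0 \<union> cl j g\<close>)
  next
    fix s1 assume sm: "same (insert ''k'' (modv ?body)) (moda ?body) s s1"
    show "aval (Read ''coff'' (Plus (Var ''j'') (Const 1))) s1 = coff (Suc j)"
      using same_var[OF sm, of "''j''"] same_arr[OF sm, of "''coff''"] D j by simp
  next
    fix k s1 assume k: "coff j \<le> k" "k < coff (Suc j)" and I: "\<exists>kd'. TI (KK k) kd' s1" and vk: "var s1 ''k'' = k"
      and sm: "same (insert ''k'' (modv ?body)) (moda ?body) s s1"
    have kj: "k \<in> cblk j" using k by (simp add: cblk_def)
    have inp1: "inp s1" using inp_same[OF inp sm] by simp
    note D1 = inpD[OF inp1]
    have e: "var s1 ''j'' = j" "var s1 ''g'' = g" "arr s1 ''bs'' = arr s ''bs''"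
      using same_var[OF sm, of "''j''"] same_var[OF sm, of "''g''"] same_arr[OF sm, of "''bs''"] j g by auto
    have BS1: "BS s1" using BS e by (simp add: BS_def)
    obtain kd' where TI1: "TI (KK k) kd' s1" using I by blast
    show "wp ?body (\<lambda>t s2. (\<exists>kd'. TI (KK (Suc k)) kd' (setv ''k'' (Suc k) s2)) \<and> t \<le> kt g k) s1"
    proof (cases "csz k = g")
      case True
      have KS: "KK (Suc k) = insert (j, Some k) (KK k)" using True kj by (auto simp: KK_def less_Suc_eq)
      have "wp cls (\<lambda>t s'. (\<exists>kd'. TI (insert (j, Some k) (KK k)) kd' s') \<and> t \<le> 8 * nA + 4) s1"
      proof (rule class_node_wp[OF inp1 TI1 BS1 e(1) j(2) vk kj])
        show "0 < csz k" using True g by simp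
        show "(j, Some k) \<notin> KK k" using K0 True by (auto simp: KK_def cl_def)
        show "(j, None) \<notin> KK k" using K0 by (auto simp: KK_def cl_def)
        show "arr s1 ''bs'' j \<noteq> 0" using e bsj by simp
        show "csz k' \<le> csz k" if "(j, Some k') \<in> KK k" for k' using that K0 True by (auto simp: KK_def cl_def)
      qed
      then have "wp cls (\<lambda>t s'. (\<exists>kd'. TI (KK (Suc k)) kd' (setv ''k'' (Suc k) s')) \<and> 1 + t \<le> kt g k) s1"
        by (rule wp_mono) (auto simp: KS TI_setv kt_def True)
      then show ?thesis using True e D1 vk by (simp add: csz_def)
    next
      case False
      have KS: "KK (Suc k) = KK k" using False by (auto simp: KK_def less_Suc_eq)
      show ?thesis using False e D1 vk TI1 KS by (auto simp: csz_def TI_setv kt_def)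
    qed
  next
    fix t s1 assume "\<exists>kd'. TI (KK (coff (Suc j))) kd' s1" "t \<le> (\<Sum>k=coff j..<coff (Suc j). kt g k + 2) + 2"
    then show "(\<exists>kd'. TI (K0 \<union> cl j (Suc g)) kd' s1) \<and> t \<le> (\<Sum>k=coff j..<coff (Suc j). kt g k + 2) + 2"
      using last by simp
  qed (use D j in \<open>auto simp: kt_def\<close>)
qed

text \<open>A class is built in at most one round. Exchanging the sums separates this cost from that
  of the \<open>nA\<close> scans.\<close>

lemma kt_sum:
  assumes "j < nP"
  shows "(\<Sum>g=1..<Suc nA. (\<Sum>k=coff j..<coff (Suc j). kt g k + 2) + 2 + 2) \<le> nA * (4 * card (cblk j) + 4) + (8 * nA + 5) * card (cblk j)"
proof -
  have "(\<Sum>g=1..<Suc nA. \<Sum>k\<in>cblk j. if csz k = g then 8 * nA + 5 else 0) = (\<Sum>k\<in>cblk j. \<Sum>g=1..<Suc nA. if csz k = g then 8 * nA + 5 else 0)"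
    by (rule sum.swap)
  also have "\<dots> \<le> (\<Sum>k\<in>cblk j. 8 * nA + 5)" by (intro sum_mono) (simp add: sum.delta)
  finally have a: "(\<Sum>g=1..<Suc nA. \<Sum>k\<in>cblk j. if csz k = g then 8 * nA + 5 else 0) \<le> (8 * nA + 5) * card (cblk j)" by (simp add: mult.commute)
  have "(\<Sum>k\<in>cblk j. kt g k + 2) \<le> (\<Sum>k\<in>cblk j. (if csz k = g then 8 * nA + 5 else 0) + 4)" for g
    by (intro sum_mono) (simp add: kt_def)
  moreover have "(\<Sum>k\<in>cblk j. f k + 4) = sum f (cblk j) + 4 * card (cblk j)" for f :: "nat \<Rightarrow> nat"
    by (simp only: sum.distrib sum_constant) simp
  ultimately have "(\<Sum>k\<in>cblk j. kt g k + 2) \<le> (\<Sum>k\<in>cblk j. if csz k = g then 8 * nA + 5 else 0) + 4 * card (cblk j)" for g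
    by metis
  then have "(\<Sum>g=1..<Suc nA. (\<Sum>k\<in>cblk j. kt g k + 2) + 2 + 2) \<le> (\<Sum>g=1..<Suc nA. (\<Sum>k\<in>cblk j. if csz k = g then 8 * nA + 5 else 0) + (4 * card (cblk j) + 4))"
    by (intro sum_mono) (simp add: add_mono)
  also have "\<dots> = (\<Sum>g=1..<Suc nA. \<Sum>k\<in>cblk j. if csz k = g then 8 * nA + 5 else 0) + nA * (4 * card (cblk j) + 4)"
    by (simp only: sum.distrib sum_constant card_atLeastLessThan diff_Suc_1) (simp add: algebra_simps)
  finally show ?thesis using a unfolding cblk_def by linarith
qed

lemma tree_wp:
  assumes inp: "inp s" and BS: "BS s" and j: "var s ''j'' = j" "j < nP" and bsj: "arr s ''bs'' j \<noteq> 0"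
    and TI: "TI K0 kd s" and K0: "\<And>q. (j, q) \<notin> K0"
  shows "wp tree (\<lambda>t s'. (\<exists>kd'. TI (K0 \<union> KSof {j}) kd' s') \<and> t \<le> nA * (4 * card (cblk j) + 4) + (8 * nA + 5) * card (cblk j) + 5) s"
proof -
  note D = inpD[OF inp]
  let ?B = "nA * (4 * card (cblk j) + 4) + (8 * nA + 5) * card (cblk j)"
  have full: "cl j (Suc nA) = {(j, Some k) | k. k \<in> cblk j \<and> 0 < csz k}"
    using csz_le[OF j(2)] by (auto simp: cl_def less_Suc_eq_le)
  have KS: "K0 \<union> KSof {j} = insert (j, None) (K0 \<union> cl j (Suc nA))" unfolding full by (auto simp: KSof_def)
  let ?c2 = "Seq (Assign ''nd'' (Plus (Var ''nd'') (Const 1))) (Seq (Store ''nc'' (Var ''nd'') (Read ''quota'' (Var ''j''))) (Store ''rn'' (Var ''j'') (Var ''nd'')))"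
  show ?thesis
    unfolding tree_def wp_Seq[of "For ''g'' (Const 1) (Plus (Var ''nA'') (Const 1)) kloop"]
  proof (rule wp_for[where I = "\<lambda>g s1. \<exists>kd'. TI (K0 \<union> cl j g) kd' s1" and \<tau> = "\<lambda>g. (\<Sum>k=coff j..<coff (Suc j). kt g k + 2) + 2" and L = 1 and H = "Suc nA"])
    have "cl j 1 = {}" by (auto simp: cl_def)
    then show "\<exists>kd'. TI (K0 \<union> cl j 1) kd' (setv ''g'' 1 s)" using TI by (auto simp: TI_setv)
  next
    fix s1 assume sm: "same (insert ''g'' (modv kloop)) (moda kloop) s s1"
    show "aval (Plus (Var ''nA'') (Const 1)) s1 = Suc nA" using same_var[OF sm, of "''nA''"] D by simp
  next
    fix g s1 assume g: "1 \<le> g" and I: "\<exists>kd'. TI (K0 \<union> cl j g) kd' s1" and vg: "var s1 ''g'' = g" and sm: "same (insert ''g'' (modv kloop)) (moda kloop) s s1"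
    have inp1: "inp s1" using inp_same[OF inp sm] by simp
    have e: "var s1 ''j'' = j" "arr s1 ''bs'' = arr s ''bs''" using same_var[OF sm, of "''j''"] same_arr[OF sm, of "''bs''"] j by auto
    have BS1: "BS s1" using BS e by (simp add: BS_def)
    obtain kd' where TI1: "TI (K0 \<union> cl j g) kd' s1" using I by blast
    have "wp kloop (\<lambda>t s'. (\<exists>kd'. TI (K0 \<union> cl j (Suc g)) kd' s') \<and> t \<le> (\<Sum>k=coff j..<coff (Suc j). kt g k + 2) + 2) s1"
      using e bsj g by (intro kloop_wp[OF inp1 BS1 e(1) j(2) _ vg _ TI1 K0]) auto
    then show "wp kloop (\<lambda>t s2. (\<exists>kd'. TI (K0 \<union> cl j (Suc g)) kd' (setv ''g'' (Suc g) s2)) \<and> t \<le> (\<Sum>k=coff j..<coff (Suc j). kt g k + 2) + 2) s1"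
      by (rule wp_mono) (auto simp: TI_setv)
  next
    fix t s1 assume I: "\<exists>kd'. TI (K0 \<union> cl j (Suc nA)) kd' s1" and sm: "same (insert ''g'' (modv kloop)) (moda kloop) s s1"
      and t: "t \<le> (\<Sum>g=1..<Suc nA. (\<Sum>k=coff j..<coff (Suc j). kt g k + 2) + 2 + 2) + 2"
    obtain kd' where TI1: "TI (K0 \<union> cl j (Suc nA)) kd' s1" using I by blast
    have e: "var s1 ''j'' = j" "arr s1 ''bs'' = arr s ''bs''" "arr s1 ''quota'' = quo"
      using same_var[OF sm, of "''j''"] same_arr[OF sm, of "''bs''"] same_arr[OF sm, of "''quota''"] j D by auto
    let ?n = "var s1 ''nd''"
    let ?s2 = "seta ''rn'' j (Suc ?n) (seta ''nc'' (Suc ?n) (quo j) (setv ''nd'' (Suc ?n) s1))"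
    let ?c = "gc (arr s1 ''bs'') ?n kd'"
    have c: "?c(Suc ?n := {}) = ?c" by (auto simp: gc_def fun_eq_iff)
    have "TI (insert (j, None) (K0 \<union> cl j (Suc nA))) (kd'(Suc ?n := (j, None))) ?s2"
    proof (rule TI_add[OF TI1, where n = ?n])
      have "tree_inv ?c s1" "nest ?c" using TI1 by (auto simp: TI_def)
      then show "tree_inv (?c(Suc ?n := cells (arr s1 ''bs'') (j, None))) ?s2" "nest (?c(Suc ?n := cells (arr s1 ''bs'') (j, None)))"
        unfolding cells_simps c by (simp_all add: tree_inv_def)
    qed (use K0 j e bsj in \<open>auto simp: cl_def\<close>)
    then have "\<exists>kd'. TI (K0 \<union> KSof {j}) kd' ?s2" unfolding KS by blast
    moreover have "t + 3 \<le> ?B + 5" using t kt_sum[OF j(2)] by linarith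
    ultimately show "wp ?c2 (\<lambda>t2 s'. (\<exists>kd'. TI (K0 \<union> KSof {j}) kd' s') \<and> t + t2 \<le> ?B + 5) s1"
      using e by simp
  qed auto
qed

text \<open>A post with an edge has at most three classes per neighbour, so the terms add up to at
  most \<open>36 + 4 + 15 + 5\<close> times \<open>nA * deg (post e)\<close>; 70 is a round
  bound.\<close>

lemma tree_time:
  assumes "e < m" shows "nA * (4 * card (cblk (post e)) + 4) + (8 * nA + 5) * card (cblk (post e)) + 5 \<le> 70 * (nA * deg (post e))"
proof -
  let ?d = "deg (post e)" and ?c = "card (cblk (post e))"
  have d: "1 \<le> ?d" using deg_pos[OF assms] by simp
  have n: "1 \<le> nA" using ow(1)[OF assms] by simp
  have c: "?c \<le> 3 * ?d" using cblk_card[OF post_less[OF assms]] d by linarith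
  have "nA * ?c \<le> nA * (3 * ?d)" using c by (rule mult_le_mono2)
  then have 1: "nA * ?c \<le> 3 * (nA * ?d)" by simp
  have 2: "?d \<le> nA * ?d" "nA \<le> nA * ?d" using n d by simp_all
  have "nA * (4 * ?c + 4) + (8 * nA + 5) * ?c + 5 = 12 * (nA * ?c) + 4 * nA + 5 * ?c + 5" by (simp add: algebra_simps)
  then show ?thesis using 1 2 c d by linarith
qed

text \<open>The cost of the tree of a post is charged to its first edge.\<close>

lemma first_sum:
  "n \<le> m \<Longrightarrow> (\<Sum>e=0..<n. if post e \<in> post ` {..<e} then 0 else deg (post e)) = (\<Sum>j\<in>post ` {..<n}. deg j)"
proof (induction n)
  case (Suc n)
  have "post ` {..<Suc n} = insert (post n) (post ` {..<n})" by (auto simp: lessThan_Suc)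
  then show ?case using Suc by (auto simp: insert_absorb)
qed simp

lemma forest_wp:
  assumes inp: "inp s" and m: "0 < m" and z: "\<And>x i. x \<in> {''bs'', ''lf'', ''tp'', ''pr'', ''dd''} \<Longrightarrow> arr s x i = 0"
  shows "wp forest (\<lambda>t s'. (\<exists>kd'. TI (KSof (post ` {..<m})) kd' s') \<and> BS s' \<and> (\<forall>e<m. arr s' ''bs'' (post e) \<noteq> 0) \<and> t \<le> 70 * (nA * m) + 6 * m + 4) s"
proof -
  note D = inpD[OF inp]
  have nA: "0 < nA" using ow(1)[OF m] by simp
  let ?s1 = "setv ''nd'' nA (setv ''cn'' nA s)"
  define I where "I e s1 \<longleftrightarrow> (\<exists>kd'. TI (KSof (post ` {..<e})) kd' s1) \<and> BS s1 \<and> (\<forall>j. arr s1 ''bs'' j \<noteq> 0 \<longleftrightarrow> j \<in> post ` {..<e}) \<and>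
     (\<forall>j. arr s1 ''bs'' j \<noteq> 0 \<longrightarrow> arr s1 ''bs'' j + nA \<le> var s1 ''cn'') \<and> 0 < var s1 ''cn''" for e and s1 :: state
  define \<tau> where "\<tau> e = 4 + (if post e \<in> post ` {..<e} then 0 else 70 * (nA * deg (post e)))" for e
  have "wp (For ''e'' (Const 0) (Var ''m'') forest_body)
     (\<lambda>t s'. (\<exists>kd'. TI (KSof (post ` {..<m})) kd' s') \<and> BS s' \<and> (\<forall>e<m. arr s' ''bs'' (post e) \<noteq> 0) \<and> 2 + t \<le> 70 * (nA * m) + 6 * m + 4) ?s1"
  proof (rule wp_for[where I = I and \<tau> = \<tau> and L = 0 and H = m])
    have "gc (arr s ''bs'') nA kd = (\<lambda>_. {})" for kd by (rule ext) (auto simp: gc_def)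
    then have "TI {} (\<lambda>_. (0, None)) (setv ''e'' 0 ?s1)"
      using z unfolding TI_def by (simp add: tree_inv_def nest_def LF_def TP_def bij_betw_def)
    moreover have "KSof {} = {}" by (auto simp: KSof_def)
    ultimately show "I 0 (setv ''e'' 0 ?s1)" unfolding I_def using z nA by (auto simp: BS_def)
  next
    fix s1 assume sm: "same (insert ''e'' (modv forest_body)) (moda forest_body) ?s1 s1"
    show "aval (Var ''m'') s1 = m" using same_var[OF sm, of "''m''"] D by simp
  next
    fix e s1 assume e: "e < m" and I1: "I e s1" and ve: "var s1 ''e'' = e" and sm: "same (insert ''e'' (modv forest_body)) (moda forest_body) ?s1 s1"
    have "inp ?s1" using inp unfolding inp_def by simp
    from inp_same[OF this sm] have inp1: "inp s1" by simp
    note D1 = inpD[OF inp1]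
    let ?j = "post e"
    have seen: "arr s1 ''bs'' j \<noteq> 0 \<longleftrightarrow> j \<in> post ` {..<e}" for j using I1 by (simp add: I_def)
    have im: "post ` {..<Suc e} = insert ?j (post ` {..<e})" by (auto simp: lessThan_Suc)
    obtain kd where TI1: "TI (KSof (post ` {..<e})) kd s1" using I1 unfolding I_def by blast
    show "wp forest_body (\<lambda>t s2. I (Suc e) (setv ''e'' (Suc e) s2) \<and> t \<le> \<tau> e) s1"
    proof (cases "arr s1 ''bs'' ?j = 0")
      case False
      then have "post ` {..<Suc e} = post ` {..<e}" using seen im by auto
      then have "I (Suc e) (setv ''e'' (Suc e) (setv ''j'' ?j s1))" using I1 unfolding I_def by (simp add: TI_setv BS_def)
      then show ?thesis unfolding forest_body_def using False D1 ve by (simp add: \<tau>_def)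
    next
      case True
      let ?s2 = "setv ''cn'' (var s1 ''cn'' + nA) (seta ''bs'' ?j (var s1 ''cn'') (setv ''j'' ?j s1))"
      have jn: "?j \<notin> post ` {..<e}" using seen[of ?j] True by simp
      have cn: "0 < var s1 ''cn''" "\<And>j. arr s1 ''bs'' j \<noteq> 0 \<Longrightarrow> arr s1 ''bs'' j + nA \<le> var s1 ''cn''" using I1 by (auto simp: I_def)
      have BS2: "BS ?s2" using I1 cn True unfolding I_def BS_def by auto
      have inp2: "inp ?s2" using inp1 unfolding inp_def by simp
      \<comment> \<open>Giving a base to a new post moves no cell of an existing node, as none of
        these nodes belongs to it.\<close>
      have TI2: "TI (KSof (post ` {..<e})) kd ?s2"
      proof -
        have bij: "bij_betw kd {nA<..var s1 ''nd''} (KSof (post ` {..<e}))" using TI1 by (simp add: TI_def)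
        have "fst (kd v) \<noteq> ?j" if "nA < v" "v \<le> var s1 ''nd''" for v
        proof -
          have "kd v \<in> KSof (post ` {..<e})" using bij that unfolding bij_betw_def by auto
          then have "fst (kd v) \<in> post ` {..<e}" by (rule KSof_fst)
          then show ?thesis using jn by metis
        qed
        then have c: "gc ((arr s1 ''bs'')(?j := var s1 ''cn'')) (var s1 ''nd'') kd = gc (arr s1 ''bs'') (var s1 ''nd'') kd"
          by (auto simp: gc_def cells_def fun_eq_iff split: option.splits)
        show ?thesis using TI1 c cn(1) unfolding TI_def tree_inv_def by auto
      qed
      have "wp tree (\<lambda>t s'. (\<exists>kd'. TI (KSof (post ` {..<e}) \<union> KSof {?j}) kd' s') \<and> t \<le> nA * (4 * card (cblk ?j) + 4) + (8 * nA + 5) * card (cblk ?j) + 5) ?s2"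
      proof (rule tree_wp[OF inp2 BS2 _ post_less[OF e] _ TI2])
        show "(?j, q) \<notin> KSof (post ` {..<e})" for q using KSof_fst[of "(?j, q)" "post ` {..<e}"] jn by auto
      qed (use cn(1) in simp_all)
      then have "wp tree (\<lambda>t s2. I (Suc e) (setv ''e'' (Suc e) s2) \<and> 4 + t \<le> \<tau> e) ?s2"
      proof (rule wp_same)
        fix t s' assume h: "(\<exists>kd'. TI (KSof (post ` {..<e}) \<union> KSof {?j}) kd' s') \<and> t \<le> nA * (4 * card (cblk ?j) + 4) + (8 * nA + 5) * card (cblk ?j) + 5"
          and sm': "same (modv tree) (moda tree) ?s2 s'"
        have e': "arr s' ''bs'' = arr ?s2 ''bs''" "var s' ''cn'' = var ?s2 ''cn''"
          using same_arr[OF sm', of "''bs''"] same_var[OF sm', of "''cn''"] by auto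
        have "KSof (post ` {..<Suc e}) = KSof (post ` {..<e}) \<union> KSof {?j}" unfolding im by (auto simp: KSof_def)
        then have "\<exists>kd'. TI (KSof (post ` {..<Suc e})) kd' (setv ''e'' (Suc e) s')" using h by (auto simp: TI_setv)
        moreover have "BS s'" using BS2 e' by (simp add: BS_def)
        moreover have "(arr s' ''bs'' j \<noteq> 0) = (j \<in> post ` {..<Suc e})" for j
          unfolding e' im using seen[of j] cn(1) by auto
        moreover have "arr s' ''bs'' j + nA \<le> var s' ''cn''" if "arr s' ''bs'' j \<noteq> 0" for j
          using that cn(2)[of j] unfolding e' by (auto split: if_splits)
        moreover have "0 < var s' ''cn''" using cn unfolding e' by simp
        ultimately have "I (Suc e) (setv ''e'' (Suc e) s')" unfolding I_def by (simp add: BS_def)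
        moreover have "4 + t \<le> \<tau> e" using h tree_time[OF e] jn unfolding \<tau>_def by simp
        ultimately show "I (Suc e) (setv ''e'' (Suc e) s') \<and> 4 + t \<le> \<tau> e" by blast
      qed
      then show ?thesis unfolding forest_body_def using True D1 ve by simp (erule wp_mono, simp)
    qed
  next
    fix t s1 assume I1: "I m s1" and t: "t \<le> (\<Sum>k=0..<m. \<tau> k + 2) + 2"
    have "(\<Sum>k=0..<m. \<tau> k + 2) = (\<Sum>k=0..<m. 70 * nA * (if post k \<in> post ` {..<k} then 0 else deg (post k)) + 6)"
      by (intro sum.cong) (auto simp: \<tau>_def)
    also have "\<dots> = 70 * nA * (\<Sum>k=0..<m. if post k \<in> post ` {..<k} then 0 else deg (post k)) + 6 * m"
      by (simp only: sum.distrib sum_distrib_left sum_constant card_atLeastLessThan) simp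
    also have "\<dots> \<le> 70 * nA * m + 6 * m" using first_sum[of m] sum_deg[of m] by simp
    finally have "2 + t \<le> 70 * (nA * m) + 6 * m + 4" using t by simp
    then show "(\<exists>kd'. TI (KSof (post ` {..<m})) kd' s1) \<and> BS s1 \<and> (\<forall>e<m. arr s1 ''bs'' (post e) \<noteq> 0) \<and> 2 + t \<le> 70 * (nA * m) + 6 * m + 4"
      using I1 unfolding I_def by auto
  qed auto
  then show ?thesis unfolding forest_def using D by simp
qed

end

text \<open>The edges attach the roots: the root becomes the parent of the outermost class of the
  edge, or is itself the leaf if no class contains the edge. As \<open>dd\<close> is 0 or 1,
  \<open>lv\<close> is its negation.\<close>

definition leaves_body :: com where
  "leaves_body = Seq (Assign ''j'' (Read ''post'' (Var ''e'')))
    (Seq (Assign ''x'' (Plus (Read ''bs'' (Var ''j'')) (Read ''own'' (Var ''e''))))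
    (Seq (If (Eq (Read ''lf'' (Var ''x'')) (Const 0)) (Store ''le'' (Var ''e'') (Read ''rn'' (Var ''j'')))
       (Seq (Store ''le'' (Var ''e'') (Read ''lf'' (Var ''x''))) (Store ''pr'' (Read ''tp'' (Var ''x'')) (Read ''rn'' (Var ''j'')))))
    (Store ''lv'' (Var ''e'') (Minus (Const 1) (Read ''dd'' (Var ''x''))))))"

lemma mod_leaves_body [simp]: "modv leaves_body = {''j'', ''x''}" "moda leaves_body = {''le'', ''pr'', ''lv''}"
  by (auto simp: leaves_body_def)

definition leaves :: com where
  "leaves = For ''e'' (Const 0) (Var ''m'') leaves_body"

lemma mod_leaves [simp]: "modv leaves = {''e'', ''j'', ''x''}" "moda leaves = {''le'', ''pr'', ''lv''}"
  by (auto simp: leaves_def)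

context prob
begin

text \<open>Tells whether the edge \<open>e\<close> loads the node \<open>v\<close>; a root is
  loaded by all edges of its post.\<close>

definition ES :: "(nat \<Rightarrow> nat \<times> nat option) \<Rightarrow> nat \<Rightarrow> nat \<Rightarrow> bool" where
  "ES kd e v \<longleftrightarrow> fst (kd v) = post e \<and> (case snd (kd v) of None \<Rightarrow> True | Some k \<Rightarrow> ow e \<in> mems k)"

text \<open>The forest as it is left in memory: \<open>pr\<close> and \<open>le\<close> make the nodes containing an edge a path.\<close>

definition forest_ok :: "(nat \<Rightarrow> nat \<times> nat option) \<Rightarrow> nat \<Rightarrow> (nat \<Rightarrow> nat) \<Rightarrow> (nat \<Rightarrow> nat) \<Rightarrow> (nat \<Rightarrow> nat) \<Rightarrow> (nat \<Rightarrow> nat) \<Rightarrow> bool" where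
  "forest_ok kd n pr le nc lv \<longleftrightarrow> nA \<le> n \<and> bij_betw kd {nA<..n} (KSof (post ` {..<m})) \<and>
     (\<forall>v\<in>{nA<..n}. nc v = capk (kd v)) \<and>
     (\<forall>v\<in>{nA<..n}. pr v = 0 \<or> v < pr v \<and> pr v \<le> n) \<and>
     (\<forall>e<m. le e \<in> {nA<..n} \<and> ES kd e (le e) \<and> (\<forall>w\<in>{nA<..n}. ES kd e w \<longrightarrow> le e \<le> w) \<and>
        lv e = of_bool (\<forall>w\<in>{nA<..n}. ES kd e w \<longrightarrow> 0 < nc w)) \<and>
     (\<forall>e<m. \<forall>v\<in>{nA<..n}. ES kd e v \<longrightarrow>
        (pr v = 0 \<and> (\<forall>w\<in>{nA<..n}. v < w \<longrightarrow> \<not> ES kd e w)) \<or>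
        (v < pr v \<and> pr v \<le> n \<and> ES kd e (pr v) \<and> (\<forall>w\<in>{nA<..n}. v < w \<longrightarrow> w < pr v \<longrightarrow> \<not> ES kd e w)))"

lemma quo_pos: "j < nP \<Longrightarrow> 0 < quo j"
proof -
  assume j: "j < nP"
  then have "pv j \<in> posts G" using pv_bij by (auto simp: bij_betw_def)
  then show ?thesis using wf quo_eq[OF j] by (simp add: well_formed_def)
qed

text \<open>An outermost class receives its root as parent. The number of a root exceeds those of
  its classes, so numbers still increase along every path.\<close>

lemma forest_okI:
  assumes TI: "TI (KSof (post ` {..<m})) kd s" and BS: "BS s" and bs: "\<And>e. e < m \<Longrightarrow> arr s ''bs'' (post e) \<noteq> 0"
    and X: "\<And>e. X e = arr s ''bs'' (post e) + ow e"
    and le: "\<And>e. e < m \<Longrightarrow> le e = (if arr s ''lf'' (X e) = 0 then arr s ''rn'' (post e) else arr s ''lf'' (X e))"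
    and lv: "\<And>e. e < m \<Longrightarrow> lv e = 1 - arr s ''dd'' (X e)"
    and pr: "\<And>v. (\<exists>e<m. v \<noteq> 0 \<and> arr s ''tp'' (X e) = v \<and> pr v = arr s ''rn'' (post e)) \<or>
      ((\<forall>e<m. v = 0 \<or> arr s ''tp'' (X e) \<noteq> v) \<and> pr v = arr s ''pr'' v)"
  shows "forest_ok kd (var s ''nd'') pr le (arr s ''nc'') lv"
proof -
  let ?n = "var s ''nd''" and ?b = "arr s ''bs''" and ?KS = "KSof (post ` {..<m})"
  let ?c = "gc ?b ?n kd" and ?V = "{nA<..var s ''nd''}"
  have nn: "nA \<le> ?n" and bij: "bij_betw kd ?V ?KS" and inv: "tree_inv ?c s" and nest: "nest ?c"
    and ncs: "\<forall>v\<in>?V. arr s ''nc'' v = capk (kd v)"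
    and dd: "\<And>x. arr s ''dd'' x = of_bool (\<exists>v. x \<in> ?c v \<and> capk (kd v) = 0)"
    and KSs: "\<And>p. p \<in> ?KS \<Longrightarrow> fst p < nP \<and> ?b (fst p) \<noteq> 0 \<and> (\<forall>k. snd p = Some k \<longrightarrow> k \<in> cblk (fst p) \<and> 0 < csz k)"
    and ord: "\<And>v w. v \<in> ?V \<Longrightarrow> w \<in> ?V \<Longrightarrow> fst (kd v) = fst (kd w) \<Longrightarrow> snd (kd v) \<noteq> None \<Longrightarrow> snd (kd w) = None \<Longrightarrow> v < w"
    and rns: "\<And>v. v \<in> ?V \<Longrightarrow> snd (kd v) = None \<Longrightarrow> arr s ''rn'' (fst (kd v)) = v"
    using TI unfolding TI_def by auto
  note sp = supp_gc[of ?n ?b kd]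
  have lf: "arr s ''lf'' x = LF ?c x" and tp: "arr s ''tp'' x = TP ?c x" for x using inv by (auto simp: tree_inv_def)
  have prc: "arr s ''pr'' v = NX ?c v x" if "x \<in> ?c v" for v x using inv that by (auto simp: tree_inv_def)
  have pr0: "arr s ''pr'' v = 0" if "?c v = {}" for v using inv that by (auto simp: tree_inv_def)
  have cV: "v \<in> ?V" if "x \<in> ?c v" for x v using that by (auto simp: gc_def split: if_splits)
  have kdKS: "kd v \<in> ?KS" if "v \<in> ?V" for v using bij that unfolding bij_betw_def by auto
  \<comment> \<open>Blocks of cells are disjoint, so the cell of \<open>e\<close> belongs to a class
    node exactly when \<open>e\<close> passes it.\<close>
  have inc: "X e \<in> ?c v \<longleftrightarrow> v \<in> ?V \<and> ES kd e v \<and> snd (kd v) \<noteq> None" if e: "e < m" for e v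
  proof (cases "v \<in> ?V")
    case True
    then have cv: "?c v = cells ?b (kd v)" by (simp add: gc_def)
    obtain j q where kv: "kd v = (j, q)" by (cases "kd v")
    show ?thesis
    proof (cases q)
      case None
      then show ?thesis using cv kv by simp
    next
      case (Some k)
      have j: "j < nP" "?b j \<noteq> 0" "k \<in> cblk j" using KSs[OF kdKS[OF True]] kv Some by auto
      have "X e \<in> ?c v \<longleftrightarrow> (\<exists>a\<in>mems k. ?b (post e) + ow e = ?b j + a)" unfolding cv kv Some X by auto
      also have "\<dots> \<longleftrightarrow> j = post e \<and> ow e \<in> mems k"
      proof
        assume "\<exists>a\<in>mems k. ?b (post e) + ow e = ?b j + a"
        then obtain a where a: "a \<in> mems k" "?b (post e) + ow e = ?b j + a" by blast
        then have "a < nA" using mems_less[OF j(1,3)] by auto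
        then show "j = post e \<and> ow e \<in> mems k" using BS_cell[OF BS bs[OF e] j(2) ow(1)[OF e] _ a(2)] a(1) by auto
      qed auto
      finally show ?thesis using True kv Some by (auto simp: ES_def)
    qed
  next
    case False
    then show ?thesis using cV by blast
  qed
  have root: "arr s ''rn'' (post e) \<in> ?V \<and> kd (arr s ''rn'' (post e)) = (post e, None)" if e: "e < m" for e
  proof -
    have "(post e, None) \<in> ?KS" using e by (auto simp: KSof_def)
    then obtain v where v: "v \<in> ?V" "kd v = (post e, None)" using bij unfolding bij_betw_def by (metis imageE)
    then show ?thesis using rns[OF v(1)] by simp
  qed
  have rES: "ES kd e (arr s ''rn'' (post e))" if "e < m" for e using root[OF that] by (simp add: ES_def)
  have runiq: "v = arr s ''rn'' (post e)" if "e < m" "v \<in> ?V" "ES kd e v" "snd (kd v) = None" for e v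
    using rns[OF that(2,4)] that(3) by (simp add: ES_def)
  have rgt: "v < arr s ''rn'' (post e)" if "e < m" "v \<in> ?V" "ES kd e v" "snd (kd v) \<noteq> None" for e v
    using ord[OF that(2), of "arr s ''rn'' (post e)"] root[OF that(1)] that by (simp add: ES_def)
  have A: "le e \<in> ?V \<and> ES kd e (le e) \<and> (\<forall>w\<in>?V. ES kd e w \<longrightarrow> le e \<le> w)" if e: "e < m" for e
  proof (cases "LF ?c (X e) = 0")
    case True
    then have no: "X e \<notin> ?c v" for v using LF_zero[OF sp, of "X e"] by simp
    have "le e = arr s ''rn'' (post e)" using le[OF e] lf True by simp
    moreover have "w = arr s ''rn'' (post e)" if "w \<in> ?V" "ES kd e w" for w
      using runiq[OF e that] inc[OF e, of w] no[of w] that by blast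
    ultimately show ?thesis using root[OF e] rES[OF e] by auto
  next
    case False
    then obtain v where v: "X e \<in> ?c v" using LF_zero[OF sp, of "X e"] by auto
    have l: "X e \<in> ?c (LF ?c (X e))" "\<And>w. X e \<in> ?c w \<Longrightarrow> LF ?c (X e) \<le> w" using LF_in v by auto
    have lee: "le e = LF ?c (X e)" using le[OF e] lf False by simp
    have h: "le e \<in> ?V" "ES kd e (le e)" "snd (kd (le e)) \<noteq> None" using inc[OF e] l(1) lee by auto
    have "le e \<le> w" if w: "w \<in> ?V" "ES kd e w" for w
    proof (cases "snd (kd w) = None")
      case True
      then show ?thesis using runiq[OF e w] rgt[OF e h] by simp
    next
      case False
      then show ?thesis using inc[OF e, of w] w l(2) lee by auto
    qed
    then show ?thesis using h by blast
  qed
  have B: "(pr v = 0 \<and> (\<forall>w\<in>?V. v < w \<longrightarrow> \<not> ES kd e w)) \<or>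
        (v < pr v \<and> pr v \<le> ?n \<and> ES kd e (pr v) \<and> (\<forall>w\<in>?V. v < w \<longrightarrow> w < pr v \<longrightarrow> \<not> ES kd e w))"
    if e: "e < m" and v: "v \<in> ?V" "ES kd e v" for e v
  proof (cases "snd (kd v) = None")
    case True
    have vr: "v = arr s ''rn'' (post e)" using runiq[OF e v True] .
    have cv: "?c v = {}" using True v by (simp add: gc_def cells_def)
    have "TP ?c x \<noteq> v" for x using TP_in[OF sp, of x] cv v(1) by fastforce
    then have "pr v = 0" using pr[of v] pr0[OF cv] tp by auto
    moreover have "\<not> ES kd e w" if "w \<in> ?V" "v < w" for w
    proof
      assume "ES kd e w"
      then show False using runiq[OF e that(1)] rgt[OF e that(1)] vr that by fastforce
    qed
    ultimately show ?thesis by blast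
  next
    case False
    then have xv: "X e \<in> ?c v" using inc[OF e] v by blast
    have v0: "v \<noteq> 0" using v by auto
    show ?thesis
    proof (cases "\<exists>w>v. X e \<in> ?c w")
      case True
      then obtain w where w: "v < w" "X e \<in> ?c w" by blast
      have sub: "?c v \<subseteq> ?c w" using nest w xv unfolding nest_def by blast
      have "TP ?c (X e') \<noteq> v" for e'
      proof
        assume t: "TP ?c (X e') = v"
        then have "X e' \<in> ?c v" using TP_in[OF sp, of "X e'"] v0 by simp
        then have "w \<le> TP ?c (X e')" using TP_le[OF sp] sub by blast
        then show False using w t by simp
      qed
      then have prv: "pr v = NX ?c v (X e)" using pr[of v] tp prc[OF xv] by auto
      have nx: "v < NX ?c v (X e)" "X e \<in> ?c (NX ?c v (X e))" using NX_in[of v w "X e" ?c] w by auto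
      have h: "NX ?c v (X e) \<in> ?V" "ES kd e (NX ?c v (X e))" "snd (kd (NX ?c v (X e))) \<noteq> None" using inc[OF e] nx(2) by auto
      have "\<not> ES kd e u" if u: "u \<in> ?V" "v < u" "u < NX ?c v (X e)" for u
      proof
        assume E: "ES kd e u"
        show False
        proof (cases "snd (kd u) = None")
          case True
          then show ?thesis using runiq[OF e u(1) E] rgt[OF e h] u by simp
        next
          case False
          then have "X e \<in> ?c u" using inc[OF e] u E by blast
          then show ?thesis using NX_in[of v u "X e" ?c] u by simp
        qed
      qed
      then show ?thesis using prv nx h by auto
    next
      case nx: False
      have "TP ?c (X e) = v"
      proof (rule antisym)
        show "v \<le> TP ?c (X e)" using TP_le[OF sp xv] .
        then have "TP ?c (X e) \<noteq> 0" using v0 by simp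
        then have "X e \<in> ?c (TP ?c (X e))" using TP_in[OF sp] by simp
        then show "TP ?c (X e) \<le> v" using nx by (meson not_le)
      qed
      then obtain e' where e': "e' < m" "TP ?c (X e') = v" "pr v = arr s ''rn'' (post e')" using pr[of v] tp e v0 by metis
      have "X e' \<in> ?c v" using TP_in[OF sp, of "X e'"] e'(2) v0 by simp
      then have "post e' = post e" using inc[OF e'(1), of v] v by (simp add: ES_def)
      then have prv: "pr v = arr s ''rn'' (post e)" using e' by simp
      have "\<not> ES kd e u" if u: "u \<in> ?V" "v < u" "u < pr v" for u
      proof
        assume E: "ES kd e u"
        show False
        proof (cases "snd (kd u) = None")
          case True
          then show ?thesis using runiq[OF e u(1) E] prv u by simp
        next
          case False
          then show ?thesis using inc[OF e] u E nx by blast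
        qed
      qed
      then show ?thesis using prv rgt[OF e v False] root[OF e] rES[OF e] by auto
    qed
  qed
  have C: "pr v = 0 \<or> v < pr v \<and> pr v \<le> ?n" if v: "v \<in> ?V" for v
  proof -
    \<comment> \<open>Every node is passed by some edge: empty classes have no node, and trees exist
      only for posts with an edge.\<close>
    have "\<exists>e<m. ES kd e v"
    proof -
      have q: "kd v \<in> ?KS" using kdKS[OF v] .
      obtain j q where kv: "kd v = (j, q)" by (cases "kd v")
      show ?thesis
      proof (cases q)
        case None
        then show ?thesis using q kv by (auto simp: KSof_def ES_def)
      next
        case (Some k)
        have j: "j < nP" "k \<in> cblk j" "0 < csz k" using KSs[OF q] kv Some by auto
        then obtain a where "a \<in> mems k" unfolding mems_def csz_def by force
        then obtain e where "e < m" "ow e = a" "post e = j" using mems_edge[OF j(1,2)] by blast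
        then show ?thesis using kv Some \<open>a \<in> mems k\<close> by (auto simp: ES_def)
      qed
    qed
    then obtain e where "e < m" "ES kd e v" by blast
    then show ?thesis using B[of e v] v by blast
  qed
  have Lv: "lv e = of_bool (\<forall>w\<in>?V. ES kd e w \<longrightarrow> 0 < arr s ''nc'' w)" if e: "e < m" for e
  proof -
    have "(\<exists>v. X e \<in> ?c v \<and> capk (kd v) = 0) \<longleftrightarrow> \<not> (\<forall>w\<in>?V. ES kd e w \<longrightarrow> 0 < arr s ''nc'' w)"
    proof
      assume "\<exists>v. X e \<in> ?c v \<and> capk (kd v) = 0"
      then obtain v where "X e \<in> ?c v" "capk (kd v) = 0" by blast
      then show "\<not> (\<forall>w\<in>?V. ES kd e w \<longrightarrow> 0 < arr s ''nc'' w)" using inc[OF e, of v] ncs by force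
    next
      assume "\<not> (\<forall>w\<in>?V. ES kd e w \<longrightarrow> 0 < arr s ''nc'' w)"
      then obtain w where w: "w \<in> ?V" "ES kd e w" "arr s ''nc'' w = 0" by blast
      then have c0: "capk (kd w) = 0" using ncs by auto
      \<comment> \<open>Quotas of posts are positive, so a node of capacity 0 is a class and has
        been recorded in \<open>dd\<close>.\<close>
      have "snd (kd w) \<noteq> None"
      proof
        assume "snd (kd w) = None"
        then have "capk (kd w) = quo (fst (kd w))" by (simp add: capk_def)
        then show False using c0 quo_pos[of "fst (kd w)"] KSs[OF kdKS[OF w(1)]] by simp
      qed
      then show "\<exists>v. X e \<in> ?c v \<and> capk (kd v) = 0" using inc[OF e] w c0 by blast
    qed
    then show ?thesis using lv[OF e] dd by simp
  qed
  show ?thesis unfolding forest_ok_def using nn bij ncs A B C Lv by blast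
qed

lemma leaves_wp:
  assumes inp: "inp s" and TI: "TI (KSof (post ` {..<m})) kd s" and BS: "BS s" and bs: "\<And>e. e < m \<Longrightarrow> arr s ''bs'' (post e) \<noteq> 0"
    and ow: "\<And>e. e < m \<Longrightarrow> arr s ''own'' e = ow e"
  shows "wp leaves (\<lambda>t s'. forest_ok kd (var s' ''nd'') (arr s' ''pr'') (arr s' ''le'') (arr s' ''nc'') (arr s' ''lv'') \<and> t \<le> 8 * m + 2) s"
proof -
  note D = inpD[OF inp]
  define X where "X e = arr s ''bs'' (post e) + ow e" for e
  define I where "I n s' \<longleftrightarrow> (\<forall>e<n. arr s' ''le'' e = (if arr s ''lf'' (X e) = 0 then arr s ''rn'' (post e) else arr s ''lf'' (X e)) \<and>
      arr s' ''lv'' e = 1 - arr s ''dd'' (X e)) \<and>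
    (\<forall>v. (\<exists>e<n. v \<noteq> 0 \<and> arr s ''tp'' (X e) = v \<and> arr s' ''pr'' v = arr s ''rn'' (post e)) \<or>
      ((\<forall>e<n. v = 0 \<or> arr s ''tp'' (X e) \<noteq> v) \<and> arr s' ''pr'' v = arr s ''pr'' v))" for n and s' :: state
  have inv: "tree_inv (gc (arr s ''bs'') (var s ''nd'') kd) s" using TI by (simp add: TI_def)
  note sp = supp_gc[of "var s ''nd''" "arr s ''bs''" kd]
  have z: "arr s ''lf'' x = 0 \<longleftrightarrow> arr s ''tp'' x = 0" for x
  proof -
    let ?c = "gc (arr s ''bs'') (var s ''nd'') kd"
    have "arr s ''lf'' x = LF ?c x" "arr s ''tp'' x = TP ?c x" using inv by (auto simp: tree_inv_def)
    moreover have "LF ?c x = 0 \<longleftrightarrow> TP ?c x = 0"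
    proof
      assume "LF ?c x = 0"
      then show "TP ?c x = 0" using LF_zero[OF sp, of x] TP_in[OF sp, of x] by blast
    next
      assume t: "TP ?c x = 0"
      have "x \<notin> ?c v" for v using TP_le[OF sp, of x v] suppD[OF sp, of x v] t by auto
      then show "LF ?c x = 0" using LF_zero[OF sp, of x] by blast
    qed
    ultimately show ?thesis by simp
  qed
  show ?thesis
    unfolding leaves_def
  proof (rule wp_for_const[where I = I and L = 0 and H = m and K = 6])
    show "I 0 (setv ''e'' 0 s)" by (simp add: I_def)
  next
    fix s1 assume sm: "same (insert ''e'' (modv leaves_body)) (moda leaves_body) s s1"
    show "aval (Var ''m'') s1 = m" using same_var[OF sm, of "''m''"] D by simp
  next
    fix e s1 assume e: "e < m" and I1: "I e s1" and ve: "var s1 ''e'' = e" and sm: "same (insert ''e'' (modv leaves_body)) (moda leaves_body) s s1"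
    have fr: "arr s1 ''post'' = post" "arr s1 ''bs'' = arr s ''bs''" "arr s1 ''own'' e = ow e" "arr s1 ''lf'' = arr s ''lf''" "arr s1 ''tp'' = arr s ''tp''"
      "arr s1 ''rn'' = arr s ''rn''" "arr s1 ''dd'' = arr s ''dd''"
      using same_arr[OF sm, of "''post''"] same_arr[OF sm, of "''bs''"] same_arr[OF sm, of "''own''"] same_arr[OF sm, of "''lf''"]
        same_arr[OF sm, of "''tp''"] same_arr[OF sm, of "''rn''"] same_arr[OF sm, of "''dd''"] D ow[OF e] by auto
    have x: "arr s ''bs'' (post e) + ow e = X e" by (simp add: X_def)
    let ?s2 = "setv ''x'' (X e) (setv ''j'' (post e) s1)"
    let ?s3 = "if arr s ''lf'' (X e) = 0 then seta ''le'' e (arr s ''rn'' (post e)) ?s2 else seta ''pr'' (arr s ''tp'' (X e)) (arr s ''rn'' (post e)) (seta ''le'' e (arr s ''lf'' (X e)) ?s2)"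
    let ?s4 = "setv ''e'' (Suc e) (seta ''lv'' e (1 - arr s ''dd'' (X e)) ?s3)"
    have "I (Suc e) ?s4"
      unfolding I_def
    proof (intro conjI allI impI)
      fix e' assume e': "e' < Suc e"
      have "e' < e \<Longrightarrow> arr s1 ''le'' e' = (if arr s ''lf'' (X e') = 0 then arr s ''rn'' (post e') else arr s ''lf'' (X e')) \<and> arr s1 ''lv'' e' = 1 - arr s ''dd'' (X e')"
        using I1 unfolding I_def by blast
      with e' show "arr ?s4 ''le'' e' = (if arr s ''lf'' (X e') = 0 then arr s ''rn'' (post e') else arr s ''lf'' (X e'))"
        "arr ?s4 ''lv'' e' = 1 - arr s ''dd'' (X e')"
        by (cases "e' = e"; simp)+
    next
      fix v
      have old: "(\<exists>e'<e. v \<noteq> 0 \<and> arr s ''tp'' (X e') = v \<and> arr s1 ''pr'' v = arr s ''rn'' (post e')) \<or>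
        ((\<forall>e'<e. v = 0 \<or> arr s ''tp'' (X e') \<noteq> v) \<and> arr s1 ''pr'' v = arr s ''pr'' v)"
        by (rule I1[unfolded I_def, THEN conjunct2, THEN spec])
      show "(\<exists>e'<Suc e. v \<noteq> 0 \<and> arr s ''tp'' (X e') = v \<and> arr ?s4 ''pr'' v = arr s ''rn'' (post e')) \<or>
        ((\<forall>e'<Suc e. v = 0 \<or> arr s ''tp'' (X e') \<noteq> v) \<and> arr ?s4 ''pr'' v = arr s ''pr'' v)"
      proof (cases "arr s ''lf'' (X e) \<noteq> 0 \<and> v = arr s ''tp'' (X e)")
        case True
        then have "v \<noteq> 0" using z by simp
        then show ?thesis using True by (intro disjI1 exI[of _ e]) auto
      next
        case False
        then have p: "arr ?s4 ''pr'' v = arr s1 ''pr'' v" by auto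
        have "v = 0 \<or> arr s ''tp'' (X e) \<noteq> v" using False z[of "X e"] by auto
        then show ?thesis unfolding p using old by (auto simp: less_Suc_eq)
      qed
    qed
    then show "wp leaves_body (\<lambda>t s2. I (Suc e) (setv ''e'' (Suc e) s2) \<and> t \<le> 6) s1"
      unfolding leaves_body_def using fr ve x by (auto split: if_splits)
  next
    fix t s1 assume I1: "I m s1" and sm: "same (insert ''e'' (modv leaves_body)) (moda leaves_body) s s1" and t: "t \<le> (6 + 2) * (m - 0) + 2"
    have "forest_ok kd (var s ''nd'') (arr s1 ''pr'') (arr s1 ''le'') (arr s ''nc'') (arr s1 ''lv'')"
    proof (rule forest_okI[OF TI BS bs X_def])
      show "arr s1 ''le'' e = (if arr s ''lf'' (X e) = 0 then arr s ''rn'' (post e) else arr s ''lf'' (X e))"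
        "arr s1 ''lv'' e = 1 - arr s ''dd'' (X e)" if "e < m" for e
        using I1[unfolded I_def, THEN conjunct1, THEN spec, of e] that by blast+
      show "(\<exists>e<m. v \<noteq> 0 \<and> arr s ''tp'' (X e) = v \<and> arr s1 ''pr'' v = arr s ''rn'' (post e)) \<or>
        ((\<forall>e<m. v = 0 \<or> arr s ''tp'' (X e) \<noteq> v) \<and> arr s1 ''pr'' v = arr s ''pr'' v)" for v
        by (rule I1[unfolded I_def, THEN conjunct2, THEN spec])
    qed
    then show "forest_ok kd (var s1 ''nd'') (arr s1 ''pr'') (arr s1 ''le'') (arr s1 ''nc'') (arr s1 ''lv'') \<and> t \<le> 8 * m + 2"
      using same_var[OF sm, of "''nd''"] same_arr[OF sm, of "''nc''"] t by simp
  qed auto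
qed

end

lemma lastix_cong: "(\<And>j. j < k \<Longrightarrow> f j = g j) \<Longrightarrow> lastix f v k = lastix g v k"
  by (induction k) auto

section \<open>Building the network\<close>

text \<open>The residual capacity of the reverse arc is never written: fresh memory holds
  \<open>0\<close>, that is, the new pair carries no flow.\<close>

definition addarc :: com where
  "addarc =
    Seq (Store ''tl'' (Var ''c'') (Var ''u''))
    (Seq (Store ''hd'' (Var ''c'') (Var ''w''))
    (Seq (Store ''rs'' (Var ''c'') (Var ''y''))
    (Seq (Store ''en'' (Var ''c'') (Var ''f''))
    (Seq (Store ''pt'' (Var ''c'') (Plus (Var ''c'') (Const 1)))
    (Seq (Store ''nt'' (Var ''c'') (Read ''fs'' (Var ''w'')))
    (Seq (Store ''fs'' (Var ''w'') (Plus (Var ''c'') (Const 1)))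
    (Seq (Assign ''c'' (Plus (Var ''c'') (Const 1)))
    (Seq (Store ''tl'' (Var ''c'') (Var ''w''))
    (Seq (Store ''hd'' (Var ''c'') (Var ''u''))
    (Seq (Store ''en'' (Var ''c'') (Var ''f''))
    (Seq (Store ''pt'' (Var ''c'') (Minus (Var ''c'') (Const 1)))
    (Seq (Store ''nt'' (Var ''c'') (Read ''fs'' (Var ''u'')))
    (Seq (Store ''fs'' (Var ''u'') (Plus (Var ''c'') (Const 1)))
    (Assign ''c'' (Plus (Var ''c'') (Const 1))))))))))))))))"

lemma mod_addarc [simp]: "modv addarc = {''c''}" "moda addarc = {''tl'', ''hd'', ''rs'', ''en'', ''pt'', ''nt'', ''fs''}"
  by (auto simp: addarc_def)

definition arcs_ok :: "nat \<Rightarrow> (nat \<Rightarrow> nat) \<Rightarrow> (nat \<Rightarrow> nat) \<Rightarrow> (nat \<Rightarrow> nat) \<Rightarrow> (nat \<Rightarrow> nat) \<Rightarrow> state \<Rightarrow> bool" where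
  "arcs_ok n T H C E s \<longleftrightarrow> var s ''c'' = 2 * n \<and> pairs_ok n s \<and> lists_ok (2 * n) s \<and> (\<forall>i\<ge>2 * n. arr s ''rs'' i = 0) \<and>
     (\<forall>b<n. arr s ''tl'' (2 * b) = T b \<and> arr s ''hd'' (2 * b) = H b \<and> arr s ''rs'' (2 * b) = C b \<and> arr s ''rs'' (Suc (2 * b)) = 0 \<and> arr s ''en'' (2 * b) = E b)"

lemma arcs_ok_setv: "''c'' \<noteq> x \<Longrightarrow> arcs_ok n T H C E (setv x k s) = arcs_ok n T H C E s"
  unfolding arcs_ok_def pairs_ok_def lists_ok_def by simp

lemma addarc_wp:
  assumes A: "arcs_ok n T H C E s" and u: "var s ''u'' = T n" and w: "var s ''w'' = H n" and y: "var s ''y'' = C n" and f: "var s ''f'' = E n"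
  shows "wp addarc (\<lambda>t s'. arcs_ok (Suc n) T H C E s' \<and> t = 15) s"
proof -
  have c: "var s ''c'' = 2 * n" using A by (simp add: arcs_ok_def)
  \<comment> \<open>If tail and head coincide, the second insertion sees the list head just changed
    by the first; hence the case distinction in \<open>nt\<close>.\<close>
  define s' where "s' = setv ''c'' (Suc (Suc (2 * n)))
    (seta ''fs'' (T n) (Suc (Suc (2 * n))) (seta ''nt'' (Suc (2 * n)) (if T n = H n then Suc (2 * n) else arr s ''fs'' (T n))
    (seta ''pt'' (Suc (2 * n)) (2 * n) (seta ''en'' (Suc (2 * n)) (E n) (seta ''hd'' (Suc (2 * n)) (T n) (seta ''tl'' (Suc (2 * n)) (H n)
    (setv ''c'' (Suc (2 * n)) (seta ''fs'' (H n) (Suc (2 * n)) (seta ''nt'' (2 * n) (arr s ''fs'' (H n)) (seta ''pt'' (2 * n) (Suc (2 * n))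
    (seta ''en'' (2 * n) (E n) (seta ''rs'' (2 * n) (C n) (seta ''hd'' (2 * n) (H n) (seta ''tl'' (2 * n) (T n) s))))))))))))))"
  have hd: "arr s' ''hd'' = (arr s ''hd'')(2 * n := H n, Suc (2 * n) := T n)"
    and fs: "arr s' ''fs'' = (arr s ''fs'')(H n := Suc (2 * n), T n := Suc (Suc (2 * n)))"
    and nt: "arr s' ''nt'' = (arr s ''nt'')(2 * n := arr s ''fs'' (H n), Suc (2 * n) := (if T n = H n then Suc (2 * n) else arr s ''fs'' (T n)))"
    and oth: "arr s' ''tl'' = (arr s ''tl'')(2 * n := T n, Suc (2 * n) := H n)" "arr s' ''rs'' = (arr s ''rs'')(2 * n := C n)"
      "arr s' ''en'' = (arr s ''en'')(2 * n := E n, Suc (2 * n) := E n)" "arr s' ''pt'' = (arr s ''pt'')(2 * n := Suc (2 * n), Suc (2 * n) := 2 * n)"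
      "var s' ''c'' = 2 * Suc n"
    unfolding s'_def by simp_all
  have L: "arr s ''fs'' v = lastix (arr s ''hd'') v (2 * n)" "i < 2 * n \<Longrightarrow> arr s ''nt'' i = lastix (arr s ''hd'') (arr s ''hd'' i) i" for v i
    using A by (auto simp: arcs_ok_def lists_ok_def)
  have lc: "lastix (arr s' ''hd'') v k = lastix (arr s ''hd'') v k" if "k \<le> 2 * n" for v k
    using that unfolding hd by (intro lastix_cong) auto
  have lists: "lists_ok (2 * Suc n) s'"
    unfolding lists_ok_def
  proof (intro conjI allI impI)
    fix v
    show "arr s' ''fs'' v = lastix (arr s' ''hd'') v (2 * Suc n)" using lc[of "2 * n" v] L(1)[of v] by (simp add: fs hd)
  next
    fix i assume "i < 2 * Suc n"
    then have "i < 2 * n \<or> i = 2 * n \<or> i = Suc (2 * n)" by auto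
    then consider "i < 2 * n" | "i = 2 * n" | "i = Suc (2 * n)" by blast
    then show "arr s' ''nt'' i = lastix (arr s' ''hd'') (arr s' ''hd'' i) i"
    proof cases
      case 1
      then show ?thesis using lc[of i] L(2)[OF 1] by (simp add: nt hd)
    next
      case 2
      then show ?thesis using lc[of "2 * n"] L(1) by (simp add: nt hd)
    next
      case 3
      then show ?thesis using lc[of "2 * n"] L(1) by (simp add: nt hd)
    qed
  qed
  have ne: "2 * b \<noteq> Suc (2 * n)" "Suc (2 * b) \<noteq> 2 * n" for b by presburger+
  have "pairs_ok (Suc n) s'"
    using A ne unfolding arcs_ok_def pairs_ok_def by (auto simp: less_Suc_eq oth hd)
  moreover have "\<forall>b<Suc n. arr s' ''tl'' (2 * b) = T b \<and> arr s' ''hd'' (2 * b) = H b \<and> arr s' ''rs'' (2 * b) = C b \<and> arr s' ''rs'' (Suc (2 * b)) = 0 \<and> arr s' ''en'' (2 * b) = E b"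
    using A ne unfolding arcs_ok_def by (auto simp: less_Suc_eq oth hd)
  moreover have "\<forall>i\<ge>2 * Suc n. arr s' ''rs'' i = 0" using A by (auto simp: arcs_ok_def oth)
  ultimately have "arcs_ok (Suc n) T H C E s'" using lists oth(5) by (simp add: arcs_ok_def)
  then show ?thesis
    unfolding addarc_def s'_def using c u w y f by (simp add: fun_upd_apply cong: if_cong)
qed

text \<open>Forest arcs are enabled at once, whereas edges and last resorts wait for
  \<open>sel\<close>. The variables \<open>ce\<close> and \<open>cd\<close> keep the offsets of
  these two groups of arcs.\<close>

definition build :: com where
  "build = Seq (For ''v'' (Plus (Var ''nA'') (Const 1)) (Plus (Var ''nd'') (Const 1))
      (Seq (Assign ''u'' (Var ''v'')) (Seq (Assign ''w'' (Read ''pr'' (Var ''v''))) (Seq (Assign ''y'' (Read ''nc'' (Var ''v''))) (Seq (Assign ''f'' (Const 1)) addarc)))))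
    (Seq (Assign ''ce'' (Var ''c''))
    (Seq (For ''e'' (Const 0) (Var ''m'')
      (Seq (Assign ''u'' (Plus (Read ''own'' (Var ''e'')) (Const 1))) (Seq (Assign ''w'' (Read ''le'' (Var ''e''))) (Seq (Assign ''y'' (Const 2)) (Seq (Assign ''f'' (Const 0)) addarc)))))
    (Seq (Assign ''cd'' (Var ''c''))
    (For ''e'' (Const 0) (Var ''m'')
      (Seq (Assign ''u'' (Plus (Read ''own'' (Var ''e'')) (Const 1))) (Seq (Assign ''w'' (Const 0)) (Seq (Assign ''y'' (Const 2)) (Seq (Assign ''f'' (Const 0)) addarc))))))))"

lemma mod_build [simp]: "modv build = {''v'', ''e'', ''u'', ''w'', ''y'', ''f'', ''c'', ''ce'', ''cd''}" "moda build = {''tl'', ''hd'', ''rs'', ''en'', ''pt'', ''nt'', ''fs''}"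
  by (auto simp: build_def)

lemma excess_zero:
  assumes "\<forall>b<n. arr s ''rs'' (Suc (2 * b)) = 0" and "\<And>v. arr s ''mt'' v = 0"
  shows "excess_at n 0 s"
proof -
  have "flow_at n g (arr s ''rs'') v = 0" for g v using assms(1) unfolding flow_at_def by (intro sum.neutral) auto
  then show ?thesis using assms(2) by (simp add: excess_at_def outflow_def inflow_def)
qed

locale prob2 = prob +
  fixes kd nd pr le nc lv
  assumes fok: "forest_ok kd nd pr le nc lv" and m_pos: "0 < m"
begin

text \<open>
  The pairs of arcs are numbered: forest arcs first, then the edges, then one last resort per edge.
  Edge arcs have capacity \<open>2\<close>, so that one unit of flow never closes them, as in \<open>RT.asg\<close>.
\<close>

definition "NT = nd - nA"
definition "np = NT + 2 * m"
definition "Tf b = (if b < NT then nA + 1 + b else if b < NT + m then Suc (ow (b - NT)) else Suc (ow (b - NT - m)))"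
definition "Hf b = (if b < NT then pr (nA + 1 + b) else if b < NT + m then le (b - NT) else 0)"
definition "Cf b = (if b < NT then nc (nA + 1 + b) else 2)"

definition consts_ok :: "state \<Rightarrow> bool" where
  "consts_ok s \<longleftrightarrow> inp s \<and> var s ''nd'' = nd \<and> (\<forall>e<m. arr s ''own'' e = ow e) \<and> arr s ''le'' = le \<and> arr s ''lv'' = lv"

text \<open>\<open>B\<close> is the set of enabled pairs. How a capacity is divided between the two
  arcs of a pair is left open, for that is the current flow.\<close>

definition netst :: "nat set \<Rightarrow> state \<Rightarrow> bool" where
  "netst B s \<longleftrightarrow> consts_ok s \<and> var s ''ce'' = 2 * NT \<and> var s ''cd'' = 2 * (NT + m) \<and> flow_inv np s \<and>
     (\<forall>b<np. arr s ''tl'' (2 * b) = Tf b \<and> arr s ''hd'' (2 * b) = Hf b \<and> arr s ''rs'' (2 * b) + arr s ''rs'' (Suc (2 * b)) = Cf b \<and>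
        arr s ''en'' (2 * b) = of_bool (b \<in> B))"

lemma nA_le: "nA \<le> nd" using fok by (simp add: forest_ok_def)

lemma consts_same:
  "consts_ok s \<Longrightarrow> same X Y s s' \<Longrightarrow> {''nA'', ''m'', ''nd''} \<inter> X = {} \<Longrightarrow>
    {''off'', ''post'', ''rank'', ''quota'', ''coff'', ''cquota'', ''moff'', ''member'', ''own'', ''le'', ''lv''} \<inter> Y = {} \<Longrightarrow> consts_ok s'"
  unfolding consts_ok_def using inp_same[of s X Y s'] unfolding same_def by auto

lemma build_wp:
  assumes co: "consts_ok s" and pr: "arr s ''pr'' = pr" and nc: "arr s ''nc'' = nc"
    and z: "\<And>x i. x \<in> {''tl'', ''hd'', ''rs'', ''en'', ''pt'', ''nt'', ''fs'', ''mt'', ''vis''} \<Longrightarrow> arr s x i = 0" and c0: "var s ''c'' = 0"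
  shows "wp build (\<lambda>t s'. netst {..<NT} s' \<and> (\<forall>b<np. arr s' ''rs'' (Suc (2 * b)) = 0) \<and> t \<le> 21 * NT + 42 * m + 8) s"
proof -
  let ?E = "\<lambda>b. of_bool (b \<in> {..<NT}) :: nat"
  let ?A = "\<lambda>n. arcs_ok n Tf Hf Cf ?E"
  let ?b1 = "Seq (Assign ''u'' (Var ''v'')) (Seq (Assign ''w'' (Read ''pr'' (Var ''v''))) (Seq (Assign ''y'' (Read ''nc'' (Var ''v''))) (Seq (Assign ''f'' (Const 1)) addarc)))"
  let ?b2 = "Seq (Assign ''u'' (Plus (Read ''own'' (Var ''e'')) (Const 1))) (Seq (Assign ''w'' (Read ''le'' (Var ''e''))) (Seq (Assign ''y'' (Const 2)) (Seq (Assign ''f'' (Const 0)) addarc)))"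
  let ?b3 = "Seq (Assign ''u'' (Plus (Read ''own'' (Var ''e'')) (Const 1))) (Seq (Assign ''w'' (Const 0)) (Seq (Assign ''y'' (Const 2)) (Seq (Assign ''f'' (Const 0)) addarc)))"
  have inp: "inp s" using co by (simp add: consts_ok_def)
  note D = inpD[OF inp]
  have vnd: "var s ''nd'' = nd" using co by (simp add: consts_ok_def)
  have A0: "?A 0 s" using z c0 by (simp add: arcs_ok_def pairs_ok_def lists_ok_def)
  show ?thesis
    unfolding build_def wp_Seq[of "For ''v'' (Plus (Var ''nA'') (Const 1)) (Plus (Var ''nd'') (Const 1)) ?b1"]
  proof (rule wp_for_const[where I = "\<lambda>v s1. ?A (v - Suc nA) s1" and L = "Suc nA" and H = "Suc nd" and K = 19])
    show "Suc nA \<le> Suc nd" using nA_le by simp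
    show "?A (Suc nA - Suc nA) (setv ''v'' (Suc nA) s)" using A0 by (simp add: arcs_ok_setv)
  next
    fix s1 assume sm: "same (insert ''v'' (modv ?b1)) (moda ?b1) s s1"
    show "aval (Plus (Var ''nd'') (Const 1)) s1 = Suc nd" using same_var[OF sm, of "''nd''"] vnd by simp
  next
    fix v s1 assume v: "Suc nA \<le> v" "v < Suc nd" and A1: "?A (v - Suc nA) s1" and vv: "var s1 ''v'' = v" and sm: "same (insert ''v'' (modv ?b1)) (moda ?b1) s s1"
    have e: "arr s1 ''pr'' = pr" "arr s1 ''nc'' = nc" using same_arr[OF sm, of "''pr''"] same_arr[OF sm, of "''nc''"] pr nc by auto
    let ?s2 = "setv ''f'' 1 (setv ''y'' (nc v) (setv ''w'' (pr v) (setv ''u'' v s1)))"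
    have lt: "v - Suc nA < NT" using v by (auto simp: NT_def)
    have "wp addarc (\<lambda>t s'. ?A (Suc (v - Suc nA)) s' \<and> t = 15) ?s2"
      using A1 lt v by (intro addarc_wp) (auto simp: arcs_ok_setv Tf_def Hf_def Cf_def)
    then have "wp addarc (\<lambda>t s'. ?A (Suc v - Suc nA) (setv ''v'' (Suc v) s') \<and> 4 + t \<le> 19) ?s2"
      by (rule wp_mono) (use v in \<open>auto simp: arcs_ok_setv Suc_diff_Suc\<close>)
    then show "wp ?b1 (\<lambda>t s2. ?A (Suc v - Suc nA) (setv ''v'' (Suc v) s2) \<and> t \<le> 19) s1" using e vv by simp
  next
    fix t1 s1 assume "?A (Suc nd - Suc nA) s1" and sm1: "same (insert ''v'' (modv ?b1)) (moda ?b1) s s1" and t1: "t1 \<le> (19 + 2) * (Suc nd - Suc nA) + 2"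
    then have A1: "?A NT s1" by (simp add: NT_def)
    have co1: "consts_ok s1" using consts_same[OF co sm1] by simp
    let ?s1 = "setv ''ce'' (2 * NT) s1"
    have c1: "var s1 ''c'' = 2 * NT" using A1 by (simp add: arcs_ok_def)
    have co1': "consts_ok ?s1" using co1 by (simp add: consts_ok_def inp_def)
    have "wp (For ''e'' (Const 0) (Var ''m'') ?b2) (\<lambda>t2. wp (Seq (Assign ''cd'' (Var ''c'')) (For ''e'' (Const 0) (Var ''m'') ?b3))
        (\<lambda>t3 s'. netst {..<NT} s' \<and> (\<forall>b<np. arr s' ''rs'' (Suc (2 * b)) = 0) \<and> t1 + (1 + (t2 + t3)) \<le> 21 * NT + 42 * m + 8)) ?s1"
    proof (rule wp_for_const[where I = "\<lambda>e s2. ?A (NT + e) s2" and L = 0 and H = m and K = 19])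
      show "?A (NT + 0) (setv ''e'' 0 ?s1)" using A1 by (simp add: arcs_ok_setv)
    next
      fix s2 assume sm: "same (insert ''e'' (modv ?b2)) (moda ?b2) ?s1 s2"
      show "aval (Var ''m'') s2 = m" using same_var[OF sm, of "''m''"] co1 by (simp add: consts_ok_def inp_def)
    next
      fix e s2 assume e: "e < m" and A2: "?A (NT + e) s2" and ve: "var s2 ''e'' = e" and sm: "same (insert ''e'' (modv ?b2)) (moda ?b2) ?s1 s2"
      have "consts_ok s2" using consts_same[OF co1' sm] by simp
      then have d: "arr s2 ''own'' e = ow e" "arr s2 ''le'' = le" using e by (auto simp: consts_ok_def)
      let ?s3 = "setv ''f'' 0 (setv ''y'' 2 (setv ''w'' (le e) (setv ''u'' (Suc (ow e)) s2)))"
      have "wp addarc (\<lambda>t s'. ?A (Suc (NT + e)) s' \<and> t = 15) ?s3"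
        using A2 e by (intro addarc_wp) (auto simp: arcs_ok_setv Tf_def Hf_def Cf_def)
      then have "wp addarc (\<lambda>t s'. ?A (NT + Suc e) (setv ''e'' (Suc e) s') \<and> 4 + t \<le> 19) ?s3"
        by (rule wp_mono) (auto simp: arcs_ok_setv)
      then show "wp ?b2 (\<lambda>t s2. ?A (NT + Suc e) (setv ''e'' (Suc e) s2) \<and> t \<le> 19) s2" using d ve by simp
    next
      fix t2 s2 assume A2: "?A (NT + m) s2" and sm2: "same (insert ''e'' (modv ?b2)) (moda ?b2) ?s1 s2" and t2: "t2 \<le> (19 + 2) * (m - 0) + 2"
      have co2: "consts_ok s2" using consts_same[OF co1' sm2] by simp
      let ?s2 = "setv ''cd'' (2 * (NT + m)) s2"
      have c2: "var s2 ''c'' = 2 * (NT + m)" using A2 by (simp add: arcs_ok_def)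
      have ce2: "var s2 ''ce'' = 2 * NT" using same_var[OF sm2, of "''ce''"] by simp
      have co2': "consts_ok ?s2" using co2 by (simp add: consts_ok_def inp_def)
      have "wp (For ''e'' (Const 0) (Var ''m'') ?b3)
          (\<lambda>t3 s'. netst {..<NT} s' \<and> (\<forall>b<np. arr s' ''rs'' (Suc (2 * b)) = 0) \<and> t1 + (1 + (t2 + (1 + t3))) \<le> 21 * NT + 42 * m + 8) ?s2"
      proof (rule wp_for_const[where I = "\<lambda>e s3. ?A (NT + m + e) s3" and L = 0 and H = m and K = 19])
        show "?A (NT + m + 0) (setv ''e'' 0 ?s2)" using A2 by (simp add: arcs_ok_setv)
      next
        fix s3 assume sm: "same (insert ''e'' (modv ?b3)) (moda ?b3) ?s2 s3"
        show "aval (Var ''m'') s3 = m" using same_var[OF sm, of "''m''"] co2 by (simp add: consts_ok_def inp_def)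
      next
        fix e s3 assume e: "e < m" and A3: "?A (NT + m + e) s3" and ve: "var s3 ''e'' = e" and sm: "same (insert ''e'' (modv ?b3)) (moda ?b3) ?s2 s3"
        have "consts_ok s3" using consts_same[OF co2' sm] by simp
        then have d: "arr s3 ''own'' e = ow e" using e by (auto simp: consts_ok_def)
        let ?s4 = "setv ''f'' 0 (setv ''y'' 2 (setv ''w'' 0 (setv ''u'' (Suc (ow e)) s3)))"
        have "wp addarc (\<lambda>t s'. ?A (Suc (NT + m + e)) s' \<and> t = 15) ?s4"
          using A3 e by (intro addarc_wp) (auto simp: arcs_ok_setv Tf_def Hf_def Cf_def)
        then have "wp addarc (\<lambda>t s'. ?A (NT + m + Suc e) (setv ''e'' (Suc e) s') \<and> 4 + t \<le> 19) ?s4"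
          by (rule wp_mono) (auto simp: arcs_ok_setv)
        then show "wp ?b3 (\<lambda>t s2. ?A (NT + m + Suc e) (setv ''e'' (Suc e) s2) \<and> t \<le> 19) s3" using d ve by simp
      next
        fix t3 s3 assume "?A (NT + m + m) s3" and sm3: "same (insert ''e'' (modv ?b3)) (moda ?b3) ?s2 s3" and t3: "t3 \<le> (19 + 2) * (m - 0) + 2"
        then have A3: "?A np s3" by (simp add: np_def mult_2 add.assoc)
        have co3: "consts_ok s3" using consts_same[OF co2' sm3] by simp
        have v3: "var s3 ''ce'' = 2 * NT" "var s3 ''cd'' = 2 * (NT + m)" using same_var[OF sm3, of "''ce''"] same_var[OF sm3, of "''cd''"] ce2 by auto
        have z3: "arr s3 ''mt'' v = 0" "arr s3 ''vis'' v = 0" for v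
          using same_arr[OF sm3, of "''mt''"] same_arr[OF sm2, of "''mt''"] same_arr[OF sm1, of "''mt''"]
            same_arr[OF sm3, of "''vis''"] same_arr[OF sm2, of "''vis''"] same_arr[OF sm1, of "''vis''"] z by auto
        have "excess_at np 0 s3" using A3 z3 by (intro excess_zero) (auto simp: arcs_ok_def)
        then have "flow_inv np s3" using A3 z3 by (simp add: flow_inv_def arcs_ok_def)
        then have "netst {..<NT} s3" using A3 co3 v3 unfolding netst_def arcs_ok_def by simp
        moreover have "t1 + (1 + (t2 + (1 + t3))) \<le> 21 * NT + 42 * m + 8" using t1 t2 t3 by (simp add: NT_def)
        ultimately show "netst {..<NT} s3 \<and> (\<forall>b<np. arr s3 ''rs'' (Suc (2 * b)) = 0) \<and> t1 + (1 + (t2 + (1 + t3))) \<le> 21 * NT + 42 * m + 8"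
          using A3 by (simp add: arcs_ok_def)
      qed auto
      then show "wp (Seq (Assign ''cd'' (Var ''c'')) (For ''e'' (Const 0) (Var ''m'') ?b3))
        (\<lambda>t3 s'. netst {..<NT} s' \<and> (\<forall>b<np. arr s' ''rs'' (Suc (2 * b)) = 0) \<and> t1 + (1 + (t2 + t3)) \<le> 21 * NT + 42 * m + 8) s2"
        using c2 by simp
    qed auto
    then show "wp (Seq (Assign ''ce'' (Var ''c'')) (Seq (For ''e'' (Const 0) (Var ''m'') ?b2) (Seq (Assign ''cd'' (Var ''c'')) (For ''e'' (Const 0) (Var ''m'') ?b3))))
        (\<lambda>t2 s'. netst {..<NT} s' \<and> (\<forall>b<np. arr s' ''rs'' (Suc (2 * b)) = 0) \<and> t1 + t2 \<le> 21 * NT + 42 * m + 8) s1"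
      using c1 by simp (erule wp_mono, simp)
  qed (use D in auto)
qed

end

section \<open>The two flow phases\<close>

definition okinit :: com where
  "okinit = For ''e'' (Const 0) (Var ''m'') (Store ''ok'' (Var ''e'') (Read ''lv'' (Var ''e'')))"

lemma mod_okinit [simp]: "modv okinit = {''e''}" "moda okinit = {''ok''}" by (auto simp: okinit_def)

text \<open>\<open>mn\<close> is one plus the best rank found, so that \<open>0\<close> can stand
  for none.\<close>

definition scan_body :: com where
  "scan_body = If (Eq (Read ''ok'' (Var ''e'')) (Const 1))
     (If (Eq (Var ''mn'') (Const 0)) (Assign ''mn'' (Plus (Read ''rank'' (Var ''e'')) (Const 1)))
       (If (Less (Plus (Read ''rank'' (Var ''e'')) (Const 1)) (Var ''mn'')) (Assign ''mn'' (Plus (Read ''rank'' (Var ''e'')) (Const 1))) Skip))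
     Skip"

lemma mod_scan_body [simp]: "modv scan_body = {''mn''}" "moda scan_body = {}" by (auto simp: scan_body_def)

definition set_en :: "vname \<Rightarrow> nat \<Rightarrow> com" where
  "set_en x v = Seq (Store ''en'' (Plus (Var x) (Plus (Var ''e'') (Var ''e''))) (Const v))
     (Store ''en'' (Plus (Plus (Var x) (Plus (Var ''e'') (Var ''e''))) (Const 1)) (Const v))"

lemma mod_set_en [simp]: "modv (set_en x v) = {}" "moda (set_en x v) = {''en''}" by (auto simp: set_en_def)

text \<open>Last resorts are enabled only for an applicant without an admissible edge, since
  otherwise they are not best.\<close>

definition put_body :: com where
  "put_body = If (Eq (Var ''mn'') (Const 0)) (set_en ''cd'' 1)
     (If (And (Eq (Read ''ok'' (Var ''e'')) (Const 1)) (Eq (Plus (Read ''rank'' (Var ''e'')) (Const 1)) (Var ''mn''))) (set_en ''ce'' 1) Skip)"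

lemma mod_put_body [simp]: "modv put_body = {}" "moda put_body = {''en''}" by (auto simp: put_body_def)

definition sel_body :: com where
  "sel_body = Seq (Assign ''mn'' (Const 0))
     (Seq (For ''e'' (Read ''off'' (Var ''i'')) (Read ''off'' (Plus (Var ''i'') (Const 1))) scan_body)
       (For ''e'' (Read ''off'' (Var ''i'')) (Read ''off'' (Plus (Var ''i'') (Const 1))) put_body))"

lemma mod_sel_body [simp]: "modv sel_body = {''mn'', ''e''}" "moda sel_body = {''en''}" by (auto simp: sel_body_def)

definition sel :: com where "sel = For ''i'' (Const 0) (Var ''nA'') sel_body"

lemma mod_sel [simp]: "modv sel = {''i'', ''mn'', ''e''}" "moda sel = {''en''}" by (auto simp: sel_def)

text \<open>A node is in \<open>T\<close> if the last search stamped it. Edges that leave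
  \<open>T\<close> are dropped here; the live edges that end in \<open>T\<close> compete in the next
  \<open>sel\<close>.\<close>

definition prep1_body :: com where
  "prep1_body = Seq (If (And (Eq (Read ''lv'' (Var ''e'')) (Const 1)) (Eq (Read ''vis'' (Read ''le'' (Var ''e''))) (Var ''st'')))
       (Store ''ok'' (Var ''e'') (Const 1)) (Store ''ok'' (Var ''e'') (Const 0)))
     (If (And (Eq (Read ''vis'' (Plus (Read ''own'' (Var ''e'')) (Const 1))) (Var ''st'')) (Not (Eq (Read ''vis'' (Read ''le'' (Var ''e''))) (Var ''st''))))
       (set_en ''ce'' 0) Skip)"

lemma mod_prep1_body [simp]: "modv prep1_body = {}" "moda prep1_body = {''ok'', ''en''}" by (auto simp: prep1_body_def)

definition prep1 :: com where "prep1 = For ''e'' (Const 0) (Var ''m'') prep1_body"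

lemma mod_prep1 [simp]: "modv prep1 = {''e''}" "moda prep1 = {''ok'', ''en''}" by (auto simp: prep1_def)

text \<open>The variable \<open>zero\<close> is never assigned, and its value \<open>0\<close> is
  the offset of the forest arcs. The test holds when exactly one end of the arc lies in
  \<open>T\<close>.\<close>

definition prep2_body :: com where
  "prep2_body = If (And (Not (And (Eq (Read ''vis'' (Read ''tl'' (Plus (Var ''e'') (Var ''e'')))) (Var ''st'')) (Eq (Read ''vis'' (Read ''hd'' (Plus (Var ''e'') (Var ''e'')))) (Var ''st''))))
       (Not (And (Not (Eq (Read ''vis'' (Read ''tl'' (Plus (Var ''e'') (Var ''e'')))) (Var ''st''))) (Not (Eq (Read ''vis'' (Read ''hd'' (Plus (Var ''e'') (Var ''e'')))) (Var ''st''))))))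
     (set_en ''zero'' 0) Skip"

lemma mod_prep2_body [simp]: "modv prep2_body = {}" "moda prep2_body = {''en''}" by (auto simp: prep2_body_def)

definition prep2 :: com where "prep2 = For ''e'' (Const 0) (Minus (Var ''nd'') (Var ''nA'')) prep2_body"

lemma mod_prep2 [simp]: "modv prep2 = {''e''}" "moda prep2 = {''en''}" by (auto simp: prep2_def)

text \<open>An applicant without edges has no last resort arc either and cannot be served, so it is
  skipped.\<close>

definition out1_body :: com where
  "out1_body = If (And (Less (Read ''off'' (Var ''i'')) (Read ''off'' (Plus (Var ''i'') (Const 1)))) (Eq (Read ''mt'' (Plus (Var ''i'') (Const 1))) (Const 0)))
     (Assign ''found'' (Const 0)) Skip"

lemma mod_out1_body [simp]: "modv out1_body = {''found''}" "moda out1_body = {}" by (auto simp: out1_body_def)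

definition out1 :: com where "out1 = Seq (Assign ''found'' (Const 1)) (For ''i'' (Const 0) (Var ''nA'') out1_body)"

lemma mod_out1 [simp]: "modv out1 = {''i'', ''found''}" "moda out1 = {}" by (auto simp: out1_def)

definition out2_body :: com where
  "out2_body = If (Eq (Read ''rs'' (Plus (Plus (Var ''ce'') (Plus (Var ''e'') (Var ''e''))) (Const 1))) (Const 1))
     (Store ''mate'' (Read ''own'' (Var ''e'')) (Plus (Read ''post'' (Var ''e'')) (Const 1))) Skip"

lemma mod_out2_body [simp]: "modv out2_body = {}" "moda out2_body = {''mate''}" by (auto simp: out2_body_def)

definition out2 :: com where "out2 = For ''e'' (Const 0) (Var ''m'') out2_body"

lemma mod_out2 [simp]: "modv out2 = {''e''}" "moda out2 = {''mate''}" by (auto simp: out2_def)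

section \<open>Correctness of selection, preparation and output\<close>

context prob2
begin

lemma netst_same:
  assumes N: "netst B s" and sm: "same X Y s s'" and X: "{''nA'', ''m'', ''nd'', ''ce'', ''cd'', ''st''} \<inter> X = {}"
    and Y: "{''off'', ''post'', ''rank'', ''quota'', ''coff'', ''cquota'', ''moff'', ''member'', ''own'', ''le'', ''lv'', ''tl'', ''hd'', ''pt'', ''rs'', ''en'', ''fs'', ''nt'', ''mt'', ''vis''} \<inter> Y = {}"
  shows "netst B s'"
proof -
  have "consts_ok s" using N by (simp add: netst_def)
  moreover have "{''nA'', ''m'', ''nd''} \<inter> X = {}" using X by simp
  moreover have "{''off'', ''post'', ''rank'', ''quota'', ''coff'', ''cquota'', ''moff'', ''member'', ''own'', ''le'', ''lv''} \<inter> Y = {}" using Y by simp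
  ultimately have co: "consts_ok s'" using consts_same[OF _ sm] by metis
  have v: "var s' ''nA'' = var s ''nA''" "var s' ''ce'' = var s ''ce''" "var s' ''cd'' = var s ''cd''" "var s' ''st'' = var s ''st''"
    using X by (simp_all add: same_var[OF sm])
  have a: "arr s' ''tl'' = arr s ''tl''" "arr s' ''hd'' = arr s ''hd''" "arr s' ''pt'' = arr s ''pt''" "arr s' ''rs'' = arr s ''rs''" "arr s' ''en'' = arr s ''en''"
    "arr s' ''fs'' = arr s ''fs''" "arr s' ''nt'' = arr s ''nt''" "arr s' ''mt'' = arr s ''mt''" "arr s' ''vis'' = arr s ''vis''"
    using Y by (simp_all add: same_arr[OF sm])
  show ?thesis using N co unfolding netst_def flow_inv_def lists_ok_def pairs_ok_def excess_at_def outflow_def inflow_def by (simp add: v a)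
qed

lemma netst_setv: "x \<notin> {''nA'', ''m'', ''nd'', ''ce'', ''cd'', ''st''} \<Longrightarrow> netst B s \<Longrightarrow> netst B (setv x n s)"
  by (rule netst_same[where X = "{x}" and Y = "{}"]) (auto simp: same_def)

lemma netst_set_en:
  assumes N: "netst B s" and i: "i = 2 * b" "j = Suc (2 * b)" and b: "b < np" and v: "v = of_bool on"
  shows "netst (if on then insert b B else B - {b}) (seta ''en'' j v (seta ''en'' i v s))"
proof -
  let ?s = "seta ''en'' j v (seta ''en'' i v s)"
  have ne: "2 * c \<noteq> Suc (2 * b)" "Suc (2 * c) \<noteq> 2 * b" for c by presburger+
  have "flow_inv np ?s"
    using N ne unfolding i netst_def flow_inv_def lists_ok_def pairs_ok_def excess_at_def outflow_def inflow_def by auto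
  moreover have "consts_ok ?s" using N unfolding netst_def consts_ok_def inp_def by simp
  ultimately show ?thesis using N ne v unfolding i netst_def by auto
qed

lemma netstD:
  assumes "netst B s"
  shows "inp s" "var s ''nd'' = nd" "\<And>e. e < m \<Longrightarrow> arr s ''own'' e = ow e" "arr s ''le'' = le" "arr s ''lv'' = lv" "var s ''ce'' = 2 * NT" "var s ''cd'' = 2 * (NT + m)" "flow_inv np s"
    "\<And>b. b < np \<Longrightarrow> arr s ''tl'' (2 * b) = Tf b" "\<And>b. b < np \<Longrightarrow> arr s ''hd'' (2 * b) = Hf b"
    "\<And>b. b < np \<Longrightarrow> arr s ''rs'' (2 * b) + arr s ''rs'' (Suc (2 * b)) = Cf b" "\<And>b. b < np \<Longrightarrow> arr s ''en'' (2 * b) = of_bool (b \<in> B)"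
  using assms unfolding netst_def consts_ok_def by auto

lemma okinit_wp:
  assumes N: "netst B s"
  shows "wp okinit (\<lambda>t s'. netst B s' \<and> (\<forall>e<m. arr s' ''ok'' e = lv e) \<and> t \<le> 3 * m + 2) s"
  unfolding okinit_def
proof (rule wp_for_const[where I = "\<lambda>n s1. \<forall>e<n. arr s1 ''ok'' e = lv e" and L = 0 and H = m and K = 1])
  let ?c = "Store ''ok'' (Var ''e'') (Read ''lv'' (Var ''e''))"
  { fix s1 assume sm: "same (insert ''e'' (modv ?c)) (moda ?c) s s1"
    show "aval (Var ''m'') s1 = m" using same_var[OF sm, of "''m''"] inpD(2)[OF netstD(1)[OF N]] by simp }
  { fix e s1 assume I: "\<forall>e'<e. arr s1 ''ok'' e' = lv e'" and ve: "var s1 ''e'' = e" and sm: "same (insert ''e'' (modv ?c)) (moda ?c) s s1"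
    have "arr s1 ''lv'' = lv" using same_arr[OF sm, of "''lv''"] netstD(5)[OF N] by simp
    then show "wp ?c (\<lambda>t s2. (\<forall>e'<Suc e. arr (setv ''e'' (Suc e) s2) ''ok'' e' = lv e') \<and> t \<le> 1) s1"
      using I ve by (auto simp: less_Suc_eq) }
  { fix t s1 assume I: "\<forall>e<m. arr s1 ''ok'' e = lv e" and t: "t \<le> (1 + 2) * (m - 0) + 2" and sm: "same (insert ''e'' (modv ?c)) (moda ?c) s s1"
    have "netst B s1" using netst_same[OF N sm] by simp
    then show "netst B s1 \<and> (\<forall>e<m. arr s1 ''ok'' e = lv e) \<and> t \<le> 3 * m + 2" using I t by simp }
qed auto

text \<open>The pairs enabled by \<open>sel\<close> among the first \<open>n\<close> edges and their
  last resorts. The last resorts of one applicant are parallel and are treated alike.\<close>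

definition selset :: "(nat \<Rightarrow> nat) \<Rightarrow> nat \<Rightarrow> nat set" where
  "selset ok n = {NT + e | e. e < n \<and> ok e = 1 \<and> (\<forall>e'<m. ow e' = ow e \<longrightarrow> ok e' = 1 \<longrightarrow> rnk e \<le> rnk e')} \<union>
     {NT + m + e | e. e < n \<and> (\<forall>e'<m. ow e' = ow e \<longrightarrow> ok e' \<noteq> 1)}"

lemma blk_iff: "i < nA \<Longrightarrow> e < m \<and> ow e = i \<longleftrightarrow> off i \<le> e \<and> e < off (Suc i)"
  using ow ow_eq by metis

lemma sel_wp:
  assumes N: "netst B s"
  shows "wp sel (\<lambda>t s'. netst (B \<union> selset (arr s ''ok'') m) s' \<and> t \<le> 12 * m + 7 * nA + 2) s"
proof -
  let ?ok = "arr s ''ok''"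
  note D0 = inpD[OF netstD(1)[OF N]]
  show ?thesis
    unfolding sel_def
  proof (rule wp_for[where I = "\<lambda>i s1. netst (B \<union> selset ?ok (off i)) s1" and \<tau> = "\<lambda>i. 12 * (off (Suc i) - off i) + 5" and L = 0 and H = nA])
    have "selset ?ok (off 0) = {}" by (simp add: selset_def off_0)
    then show "netst (B \<union> selset ?ok (off 0)) (setv ''i'' 0 s)" using N netst_setv[of "''i''" B s 0] by simp
  next
    fix s1 assume sm: "same (insert ''i'' (modv sel_body)) (moda sel_body) s s1"
    show "aval (Var ''nA'') s1 = nA" using same_var[OF sm, of "''nA''"] D0 by simp
  next
    fix i s1 assume i: "i < nA" and N1: "netst (B \<union> selset ?ok (off i)) s1" and vi: "var s1 ''i'' = i" and sm: "same (insert ''i'' (modv sel_body)) (moda sel_body) s s1"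
    note D1 = inpD[OF netstD(1)[OF N1]]
    have ok1: "arr s1 ''ok'' = ?ok" using same_arr[OF sm, of "''ok''"] by simp
    let ?hi = "Read ''off'' (Plus (Var ''i'') (Const 1))" and ?lo = "Read ''off'' (Var ''i'')"
    let ?P = "\<lambda>mn n. (mn = 0 \<longleftrightarrow> (\<forall>e. off i \<le> e \<longrightarrow> e < n \<longrightarrow> ?ok e \<noteq> 1)) \<and>
      (mn \<noteq> 0 \<longrightarrow> (\<exists>e. off i \<le> e \<and> e < n \<and> ?ok e = 1 \<and> mn = Suc (rnk e)) \<and> (\<forall>e. off i \<le> e \<longrightarrow> e < n \<longrightarrow> ?ok e = 1 \<longrightarrow> mn \<le> Suc (rnk e)))"
    let ?s1 = "setv ''mn'' 0 s1"
    have N1': "netst (B \<union> selset ?ok (off i)) ?s1" using N1 by (rule netst_setv[rotated]) simp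
    have oi: "off i \<le> off (Suc i)" "off (Suc i) \<le> m" using off_step[OF i] off_mono[of "Suc i" nA] i by (auto simp: m_def)
    have "wp (For ''e'' ?lo ?hi scan_body) (\<lambda>t1. wp (For ''e'' ?lo ?hi put_body)
       (\<lambda>t2 s'. netst (B \<union> selset ?ok (off (Suc i))) (setv ''i'' (Suc i) s') \<and> 1 + (t1 + t2) \<le> 12 * (off (Suc i) - off i) + 5)) ?s1"
    proof (rule wp_for_const[where I = "\<lambda>n s2. ?P (var s2 ''mn'') n" and L = "off i" and H = "off (Suc i)" and K = 4])
      show "aval ?lo ?s1 = off i" using D1 vi by simp
      show "off i \<le> off (Suc i)" using oi by simp
      show "?P (var (setv ''e'' (off i) ?s1) ''mn'') (off i)" by simp
    next
      fix s2 assume sm2: "same (insert ''e'' (modv scan_body)) (moda scan_body) ?s1 s2"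
      show "aval ?hi s2 = off (Suc i)" using same_var[OF sm2, of "''i''"] same_arr[OF sm2, of "''off''"] D1 vi by simp
    next
      fix n s2 assume n: "off i \<le> n" "n < off (Suc i)" and P: "?P (var s2 ''mn'') n" and ve: "var s2 ''e'' = n"
        and sm2: "same (insert ''e'' (modv scan_body)) (moda scan_body) ?s1 s2"
      have e: "arr s2 ''ok'' = ?ok" "arr s2 ''rank'' = rnk" using same_arr[OF sm2, of "''ok''"] same_arr[OF sm2, of "''rank''"] ok1 D1 by auto
      have ext: "(\<forall>e. off i \<le> e \<longrightarrow> e < Suc n \<longrightarrow> Q e) \<longleftrightarrow> (\<forall>e. off i \<le> e \<longrightarrow> e < n \<longrightarrow> Q e) \<and> Q n" for Q
        using n by (auto simp: less_Suc_eq)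
      have ext2: "(\<exists>e. off i \<le> e \<and> e < Suc n \<and> Q e) \<longleftrightarrow> (\<exists>e. off i \<le> e \<and> e < n \<and> Q e) \<or> Q n" for Q
        using n by (auto simp: less_Suc_eq)
      have step: "?P mn' (Suc n)" if mn': "mn' = (if ?ok n = 1 then if var s2 ''mn'' = 0 then Suc (rnk n) else if Suc (rnk n) < var s2 ''mn'' then Suc (rnk n) else var s2 ''mn'' else var s2 ''mn'')" for mn'
      proof (cases "?ok n = 1")
        case False
        show ?thesis using P by (simp only: mn' ext ext2 False if_False simp_thms) blast
      next
        case ok: True
        show ?thesis
        proof (cases "var s2 ''mn'' = 0")
          case True
          then have "\<forall>e. off i \<le> e \<longrightarrow> e < n \<longrightarrow> ?ok e \<noteq> 1" using P by blast
          then show ?thesis unfolding mn' ext ext2 using ok True by auto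
        next
          case False
          then have f: "\<exists>e. off i \<le> e \<and> e < n \<and> ?ok e = 1 \<and> var s2 ''mn'' = Suc (rnk e)" "\<forall>e. off i \<le> e \<longrightarrow> e < n \<longrightarrow> ?ok e = 1 \<longrightarrow> var s2 ''mn'' \<le> Suc (rnk e)"
            using P by blast+
          show ?thesis
          proof (cases "Suc (rnk n) < var s2 ''mn''")
            case True
            then have "\<forall>e. off i \<le> e \<longrightarrow> e < n \<longrightarrow> ?ok e = 1 \<longrightarrow> Suc (rnk n) \<le> Suc (rnk e)" using f(2) by (meson less_imp_le_nat le_trans)
            then show ?thesis unfolding mn' ext ext2 using ok False True by simp
          next
            case ge: False
            have "\<not> (\<forall>e. off i \<le> e \<longrightarrow> e < n \<longrightarrow> ?ok e \<noteq> 1)" using f(1) by blast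
            then show ?thesis unfolding mn' ext ext2 using ok False ge f by auto
          qed
        qed
      qed
      show "wp scan_body (\<lambda>t s3. ?P (var (setv ''e'' (Suc n) s3) ''mn'') (Suc n) \<and> t \<le> 4) s2"
      proof -
        have "wp scan_body (\<lambda>t s3. var s3 ''mn'' = (if ?ok n = 1 then if var s2 ''mn'' = 0 then Suc (rnk n) else if Suc (rnk n) < var s2 ''mn'' then Suc (rnk n) else var s2 ''mn'' else var s2 ''mn'') \<and> t \<le> 4) s2"
          unfolding scan_body_def using e ve by simp
        then show ?thesis
        proof (rule wp_mono)
          fix t :: nat and s3 :: state assume h: "var s3 ''mn'' = (if ?ok n = 1 then if var s2 ''mn'' = 0 then Suc (rnk n) else if Suc (rnk n) < var s2 ''mn'' then Suc (rnk n) else var s2 ''mn'' else var s2 ''mn'') \<and> t \<le> 4"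
          have eq: "var (setv ''e'' (Suc n) s3) ''mn'' = var s3 ''mn''" by simp
          show "?P (var (setv ''e'' (Suc n) s3) ''mn'') (Suc n) \<and> t \<le> 4"
            unfolding eq by (rule conjI[OF step[OF conjunct1[OF h]] conjunct2[OF h]])
        qed
      qed
    next
      fix t1 s2 assume P: "?P (var s2 ''mn'') (off (Suc i))" and sm2: "same (insert ''e'' (modv scan_body)) (moda scan_body) ?s1 s2"
        and t1: "t1 \<le> (4 + 2) * (off (Suc i) - off i) + 2"
      let ?mn = "var s2 ''mn''"
      have N2: "netst (B \<union> selset ?ok (off i)) s2" using netst_same[OF N1' sm2] by simp
      note D2 = inpD[OF netstD(1)[OF N2]]
      have e2: "var s2 ''i'' = i" "arr s2 ''ok'' = ?ok" using same_var[OF sm2, of "''i''"] same_arr[OF sm2, of "''ok''"] vi ok1 by auto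
      have mn0: "?mn = 0 \<longleftrightarrow> (\<forall>e'<m. ow e' = i \<longrightarrow> ?ok e' \<noteq> 1)" using P blk_iff[OF i] by metis
      have mn1: "?mn = Suc (rnk e) \<longleftrightarrow> (\<forall>e'<m. ow e' = i \<longrightarrow> ?ok e' = 1 \<longrightarrow> rnk e \<le> rnk e')" if e: "e < m" "ow e = i" "?ok e = 1" for e
      proof -
        have nz: "?mn \<noteq> 0" using mn0 e by blast
        then obtain e0 where e0: "e0 < m" "ow e0 = i" "?ok e0 = 1" "?mn = Suc (rnk e0)" using P blk_iff[OF i] by metis
        have lb: "?mn \<le> Suc (rnk e')" if "e' < m" "ow e' = i" "?ok e' = 1" for e' using P nz blk_iff[OF i] that by metis
        show ?thesis
        proof
          assume "?mn = Suc (rnk e)"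
          then show "\<forall>e'<m. ow e' = i \<longrightarrow> ?ok e' = 1 \<longrightarrow> rnk e \<le> rnk e'" using lb by (metis Suc_le_mono)
        next
          assume "\<forall>e'<m. ow e' = i \<longrightarrow> ?ok e' = 1 \<longrightarrow> rnk e \<le> rnk e'"
          then have "rnk e \<le> rnk e0" using e0 by blast
          then show "?mn = Suc (rnk e)" using e0(4) lb[OF e] by simp
        qed
      qed
      show "wp (For ''e'' ?lo ?hi put_body)
        (\<lambda>t2 s'. netst (B \<union> selset ?ok (off (Suc i))) (setv ''i'' (Suc i) s') \<and> 1 + (t1 + t2) \<le> 12 * (off (Suc i) - off i) + 5) s2"
      proof (rule wp_for_const[where I = "\<lambda>n s3. netst (B \<union> selset ?ok n) s3" and L = "off i" and H = "off (Suc i)" and K = 4])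
        show "aval ?lo s2 = off i" using D2 e2 by simp
        show "off i \<le> off (Suc i)" using oi by simp
        show "netst (B \<union> selset ?ok (off i)) (setv ''e'' (off i) s2)" using N2 by (rule netst_setv[rotated]) simp
      next
        fix s3 assume sm3: "same (insert ''e'' (modv put_body)) (moda put_body) s2 s3"
        show "aval ?hi s3 = off (Suc i)" using same_var[OF sm3, of "''i''"] same_arr[OF sm3, of "''off''"] D2 e2 by simp
      next
        fix n s3 assume n: "off i \<le> n" "n < off (Suc i)" and N3: "netst (B \<union> selset ?ok n) s3" and ve: "var s3 ''e'' = n"
          and sm3: "same (insert ''e'' (modv put_body)) (moda put_body) s2 s3"
        have e3: "arr s3 ''ok'' = ?ok" "var s3 ''mn'' = ?mn" using same_arr[OF sm3, of "''ok''"] same_var[OF sm3, of "''mn''"] e2 by auto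
        note D3 = inpD[OF netstD(1)[OF N3]] and v3 = netstD(6,7)[OF N3]
        have nm: "n < m" "ow n = i" using n blk_iff[OF i] by blast+
        have fin: "netst (B \<union> selset ?ok (Suc n)) (setv ''e'' (Suc n) s4)" if "netst (B \<union> selset ?ok (Suc n)) s4" for s4
          using that by (rule netst_setv[rotated]) simp
        show "wp put_body (\<lambda>t s4. netst (B \<union> selset ?ok (Suc n)) (setv ''e'' (Suc n) s4) \<and> t \<le> 4) s3"
        proof (cases "?mn = 0")
          case True
          have "selset ?ok (Suc n) = insert (NT + m + n) (selset ?ok n)"
            using True mn0 nm unfolding selset_def by (auto simp: less_Suc_eq)
          then have "netst (B \<union> selset ?ok (Suc n)) (seta ''en'' (Suc (2 * (NT + m) + (n + n))) 1 (seta ''en'' (2 * (NT + m) + (n + n)) 1 s3))"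
            using netst_set_en[OF N3, of "2 * (NT + m) + (n + n)" "NT + m + n" "Suc (2 * (NT + m) + (n + n))" 1 True] nm by (simp add: np_def)
          from fin[OF this] show ?thesis unfolding put_body_def set_en_def using True e3 ve v3 by simp
        next
          case mn: False
          show ?thesis
          proof (cases "?ok n = 1 \<and> Suc (rnk n) = ?mn")
            case True
            have "\<forall>e'<m. ow e' = ow n \<longrightarrow> ?ok e' = 1 \<longrightarrow> rnk n \<le> rnk e'" using mn1[OF nm] True nm by auto
            moreover have "\<not> (\<forall>e'<m. ow e' = ow n \<longrightarrow> ?ok e' \<noteq> 1)" using True nm by blast
            ultimately have "selset ?ok (Suc n) = insert (NT + n) (selset ?ok n)"
              using True unfolding selset_def less_Suc_eq by blast
            then have "netst (B \<union> selset ?ok (Suc n)) (seta ''en'' (Suc (2 * NT + (n + n))) 1 (seta ''en'' (2 * NT + (n + n)) 1 s3))"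
              using netst_set_en[OF N3, of "2 * NT + (n + n)" "NT + n" "Suc (2 * NT + (n + n))" 1 True] nm by (simp add: np_def)
            from fin[OF this] show ?thesis unfolding put_body_def set_en_def using True mn e3 ve v3 D3 by simp
          next
            case False
            have "\<not> (?ok n = 1 \<and> (\<forall>e'<m. ow e' = ow n \<longrightarrow> ?ok e' = 1 \<longrightarrow> rnk n \<le> rnk e'))" using mn1[OF nm] False nm by auto
            moreover have "\<not> (\<forall>e'<m. ow e' = ow n \<longrightarrow> ?ok e' \<noteq> 1)" unfolding nm(2) mn0[symmetric] by (rule mn)
            ultimately have "selset ?ok (Suc n) = selset ?ok n" unfolding selset_def less_Suc_eq by blast
            then have "netst (B \<union> selset ?ok (Suc n)) s3" using N3 by simp
            from fin[OF this] show ?thesis unfolding put_body_def using False mn e3 ve v3 D3 by auto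
          qed
        qed
      next
        fix t2 s3 assume N3: "netst (B \<union> selset ?ok (off (Suc i))) s3" and t2: "t2 \<le> (4 + 2) * (off (Suc i) - off i) + 2"
        have "netst (B \<union> selset ?ok (off (Suc i))) (setv ''i'' (Suc i) s3)" using N3 by (rule netst_setv[rotated]) simp
        then show "netst (B \<union> selset ?ok (off (Suc i))) (setv ''i'' (Suc i) s3) \<and> 1 + (t1 + t2) \<le> 12 * (off (Suc i) - off i) + 5"
          using t1 t2 by simp
      qed auto
    qed auto
    then show "wp sel_body (\<lambda>t s2. netst (B \<union> selset ?ok (off (Suc i))) (setv ''i'' (Suc i) s2) \<and> t \<le> 12 * (off (Suc i) - off i) + 5) s1"
      unfolding sel_body_def by simp
  next
    fix t s1 assume N1: "netst (B \<union> selset ?ok (off nA)) s1" and t: "t \<le> (\<Sum>k=0..<nA. 12 * (off (Suc k) - off k) + 5 + 2) + 2"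
    have "(\<Sum>k=0..<nA. 12 * (off (Suc k) - off k) + 5 + 2) = 12 * (\<Sum>k=0..<nA. off (Suc k) - off k) + 7 * nA"
      by (simp only: sum.distrib sum_distrib_left sum_constant card_atLeastLessThan) simp
    then show "netst (B \<union> selset ?ok m) s1 \<and> t \<le> 12 * m + 7 * nA + 2" using N1 t sum_off[of nA] by (simp add: m_def)
  qed auto
qed


lemma prep1_wp:
  assumes N: "netst B s"
  shows "wp prep1 (\<lambda>t s'. netst (B - {NT + e | e. e < m \<and> Suc (ow e) \<in> reached s \<and> le e \<notin> reached s}) s' \<and>
     (\<forall>e<m. arr s' ''ok'' e = of_bool (lv e = 1 \<and> le e \<in> reached s)) \<and> t \<le> 7 * m + 2) s"
proof -
  define X where "X n = {NT + e | e. e < n \<and> Suc (ow e) \<in> reached s \<and> le e \<notin> reached s}" for n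
  note D0 = inpD[OF netstD(1)[OF N]]
  have "wp prep1 (\<lambda>t s'. netst (B - X m) s' \<and> (\<forall>e<m. arr s' ''ok'' e = of_bool (lv e = 1 \<and> le e \<in> reached s)) \<and> t \<le> 7 * m + 2) s"
    unfolding prep1_def
  proof (rule wp_for_const[where I = "\<lambda>n s1. netst (B - X n) s1 \<and> (\<forall>e<n. arr s1 ''ok'' e = of_bool (lv e = 1 \<and> le e \<in> reached s))" and L = 0 and H = m and K = 5])
    have "X 0 = {}" by (simp add: X_def)
    then show "netst (B - X 0) (setv ''e'' 0 s) \<and> (\<forall>e<0. arr (setv ''e'' 0 s) ''ok'' e = of_bool (lv e = 1 \<and> le e \<in> reached s))"
      using netst_setv[OF _ N, of "''e''" 0] by simp
  next
    fix s1 assume sm: "same (insert ''e'' (modv prep1_body)) (moda prep1_body) s s1"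
    show "aval (Var ''m'') s1 = m" using same_var[OF sm, of "''m''"] D0 by simp
  next
    fix n s1 assume n: "n < m" and I: "netst (B - X n) s1 \<and> (\<forall>e<n. arr s1 ''ok'' e = of_bool (lv e = 1 \<and> le e \<in> reached s))"
      and ve: "var s1 ''e'' = n" and sm: "same (insert ''e'' (modv prep1_body)) (moda prep1_body) s s1"
    have N1: "netst (B - X n) s1" and ok1: "\<And>e. e < n \<Longrightarrow> arr s1 ''ok'' e = of_bool (lv e = 1 \<and> le e \<in> reached s)" using I by auto
    note d = netstD(3)[OF N1 n] netstD(4,5,6)[OF N1]
    have r: "arr s1 ''vis'' v = var s1 ''st'' \<longleftrightarrow> v \<in> reached s" for v
      using same_arr[OF sm, of "''vis''"] same_var[OF sm, of "''st''"] by (simp add: reached_def)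
    let ?o = "of_bool (lv n = 1 \<and> le n \<in> reached s) :: nat"
    let ?s2 = "seta ''ok'' n ?o s1"
    have N2: "netst (B - X n) ?s2" by (rule netst_same[OF N1, where X = "{}" and Y = "{''ok''}"]) (auto simp: same_def)
    have Xs: "X (Suc n) = (if Suc (ow n) \<in> reached s \<and> le n \<notin> reached s then insert (NT + n) (X n) else X n)"
      unfolding X_def by (auto simp: less_Suc_eq)
    have ok2: "arr ?s2 ''ok'' e = of_bool (lv e = 1 \<and> le e \<in> reached s)" if "e < Suc n" for e
      using that ok1[of e] by (cases "e = n") auto
    have w1: "wp (If (And (Eq (Read ''lv'' (Var ''e'')) (Const 1)) (Eq (Read ''vis'' (Read ''le'' (Var ''e''))) (Var ''st'')))
       (Store ''ok'' (Var ''e'') (Const 1)) (Store ''ok'' (Var ''e'') (Const 0))) (\<lambda>t s'. t = 2 \<and> s' = ?s2) s1"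
      using d ve r by simp
    show "wp prep1_body (\<lambda>t s2. (netst (B - X (Suc n)) (setv ''e'' (Suc n) s2) \<and> (\<forall>e<Suc n. arr (setv ''e'' (Suc n) s2) ''ok'' e = of_bool (lv e = 1 \<and> le e \<in> reached s))) \<and> t \<le> 5) s1"
      unfolding prep1_body_def wp_Seq[of "If (And (Eq (Read ''lv'' (Var ''e'')) (Const 1)) (Eq (Read ''vis'' (Read ''le'' (Var ''e''))) (Var ''st''))) (Store ''ok'' (Var ''e'') (Const 1)) (Store ''ok'' (Var ''e'') (Const 0))"]
    proof (rule wp_mono[OF w1], elim conjE)
      fix t :: nat and s2 :: state assume t: "t = 2" and s2: "s2 = ?s2"
      show "wp (If (And (Eq (Read ''vis'' (Plus (Read ''own'' (Var ''e'')) (Const 1))) (Var ''st'')) (Not (Eq (Read ''vis'' (Read ''le'' (Var ''e''))) (Var ''st''))))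
          (set_en ''ce'' 0) Skip) (\<lambda>t2 s2. (netst (B - X (Suc n)) (setv ''e'' (Suc n) s2) \<and> (\<forall>e<Suc n. arr (setv ''e'' (Suc n) s2) ''ok'' e = of_bool (lv e = 1 \<and> le e \<in> reached s))) \<and> t + t2 \<le> 5) s2"
      proof (cases "Suc (ow n) \<in> reached s \<and> le n \<notin> reached s")
        case True
        let ?s3 = "seta ''en'' (Suc (2 * NT + (n + n))) 0 (seta ''en'' (2 * NT + (n + n)) 0 ?s2)"
        have "netst (B - X n - {NT + n}) ?s3"
          using netst_set_en[OF N2, of "2 * NT + (n + n)" "NT + n" "Suc (2 * NT + (n + n))" 0 False] n by (simp add: np_def)
        moreover have "B - X n - {NT + n} = B - X (Suc n)" using True Xs by auto
        ultimately have "netst (B - X (Suc n)) (setv ''e'' (Suc n) ?s3)" by (intro netst_setv) auto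
        then show ?thesis unfolding s2 set_en_def using True d ve r t ok2 by simp
      next
        case False
        then have "netst (B - X (Suc n)) (setv ''e'' (Suc n) ?s2)" using N2 Xs by (intro netst_setv) auto
        then show ?thesis unfolding s2 using False d ve r t ok2 by auto
      qed
    qed
  qed auto
  then show ?thesis unfolding X_def .
qed

lemma prep2_wp:
  assumes N: "netst B s" and z: "var s ''zero'' = 0"
  shows "wp prep2 (\<lambda>t s'. netst (B - {b. b < NT \<and> (Tf b \<in> reached s) \<noteq> (Hf b \<in> reached s)}) s' \<and> t \<le> 5 * NT + 2) s"
proof -
  define X where "X n = {b. b < n \<and> (Tf b \<in> reached s) \<noteq> (Hf b \<in> reached s)}" for n
  note D0 = inpD[OF netstD(1)[OF N]]
  have "wp prep2 (\<lambda>t s'. netst (B - X NT) s' \<and> t \<le> 5 * NT + 2) s"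
    unfolding prep2_def
  proof (rule wp_for_const[where I = "\<lambda>n s1. netst (B - X n) s1" and L = 0 and H = NT and K = 3])
    have "X 0 = {}" by (simp add: X_def)
    then show "netst (B - X 0) (setv ''e'' 0 s)" using netst_setv[OF _ N, of "''e''" 0] by simp
  next
    fix s1 assume sm: "same (insert ''e'' (modv prep2_body)) (moda prep2_body) s s1"
    show "aval (Minus (Var ''nd'') (Var ''nA'')) s1 = NT" using same_var[OF sm, of "''nd''"] same_var[OF sm, of "''nA''"] D0 netstD(2)[OF N] by (simp add: NT_def)
  next
    fix n s1 assume n: "n < NT" and N1: "netst (B - X n) s1" and ve: "var s1 ''e'' = n" and sm: "same (insert ''e'' (modv prep2_body)) (moda prep2_body) s s1"
    have nn: "n < np" using n by (simp add: np_def)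
    have d: "arr s1 ''tl'' (n + n) = Tf n" "arr s1 ''hd'' (n + n) = Hf n" using netstD(9,10)[OF N1 nn] by (simp_all add: mult_2)
    have z1: "var s1 ''zero'' = 0" using same_var[OF sm, of "''zero''"] z by simp
    have r: "arr s1 ''vis'' v = var s1 ''st'' \<longleftrightarrow> v \<in> reached s" for v
      using same_arr[OF sm, of "''vis''"] same_var[OF sm, of "''st''"] by (simp add: reached_def)
    have Xs: "X (Suc n) = (if (Tf n \<in> reached s) \<noteq> (Hf n \<in> reached s) then insert n (X n) else X n)"
      unfolding X_def by (auto simp: less_Suc_eq)
    show "wp prep2_body (\<lambda>t s2. netst (B - X (Suc n)) (setv ''e'' (Suc n) s2) \<and> t \<le> 3) s1"
    proof (cases "(Tf n \<in> reached s) \<noteq> (Hf n \<in> reached s)")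
      case True
      let ?s3 = "seta ''en'' (Suc (n + n)) 0 (seta ''en'' (n + n) 0 s1)"
      have "netst (B - X n - {n}) ?s3"
        using netst_set_en[OF N1, of "n + n" n "Suc (n + n)" 0 False] nn by simp
      moreover have "B - X n - {n} = B - X (Suc n)" using True Xs by auto
      ultimately have "netst (B - X (Suc n)) (setv ''e'' (Suc n) ?s3)" by (intro netst_setv) auto
      then show ?thesis unfolding prep2_body_def set_en_def using True d ve r z1 by auto
    next
      case False
      then have "netst (B - X (Suc n)) (setv ''e'' (Suc n) s1)" using N1 Xs by (intro netst_setv) auto
      then show ?thesis unfolding prep2_body_def using False d ve r by auto
    qed
  qed auto
  then show ?thesis unfolding X_def .
qed

lemma out1_wp:
  assumes N: "netst B s"
  shows "wp out1 (\<lambda>t s'. var s' ''found'' = of_bool (\<forall>i<nA. off i < off (Suc i) \<longrightarrow> arr s ''mt'' (Suc i) \<noteq> 0) \<and> t \<le> 4 * nA + 3) s"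
proof -
  note D0 = inpD[OF netstD(1)[OF N]]
  let ?s1 = "setv ''found'' 1 s"
  have "wp (For ''i'' (Const 0) (Var ''nA'') out1_body)
    (\<lambda>t s'. var s' ''found'' = of_bool (\<forall>i<nA. off i < off (Suc i) \<longrightarrow> arr s ''mt'' (Suc i) \<noteq> 0) \<and> 1 + t \<le> 4 * nA + 3) ?s1"
  proof (rule wp_for_const[where I = "\<lambda>n s1. var s1 ''found'' = of_bool (\<forall>i<n. off i < off (Suc i) \<longrightarrow> arr s ''mt'' (Suc i) \<noteq> 0)" and L = 0 and H = nA and K = 2])
    fix s1 assume sm: "same (insert ''i'' (modv out1_body)) (moda out1_body) ?s1 s1"
    show "aval (Var ''nA'') s1 = nA" using same_var[OF sm, of "''nA''"] D0 by simp
  next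
    fix n s1 assume f: "var s1 ''found'' = of_bool (\<forall>i<n. off i < off (Suc i) \<longrightarrow> arr s ''mt'' (Suc i) \<noteq> 0)" and vi: "var s1 ''i'' = n"
      and sm: "same (insert ''i'' (modv out1_body)) (moda out1_body) ?s1 s1"
    have e: "arr s1 ''off'' = off" "arr s1 ''mt'' = arr s ''mt''" using same_arr[OF sm, of "''off''"] same_arr[OF sm, of "''mt''"] D0 by auto
    show "wp out1_body (\<lambda>t s2. var (setv ''i'' (Suc n) s2) ''found'' = of_bool (\<forall>i<Suc n. off i < off (Suc i) \<longrightarrow> arr s ''mt'' (Suc i) \<noteq> 0) \<and> t \<le> 2) s1"
      unfolding out1_body_def using f vi e by (auto simp: less_Suc_eq)
  qed auto
  then show ?thesis unfolding out1_def by simp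
qed

lemma out2_wp:
  assumes N: "netst B s" and z: "\<And>i. arr s ''mate'' i = 0"
    and inj: "inj_on ow {e. e < m \<and> arr s ''rs'' (Suc (2 * (NT + e))) = 1}"
  shows "wp out2 (\<lambda>t s'. (\<forall>i j. arr s' ''mate'' i = Suc j \<longleftrightarrow> (\<exists>e<m. arr s ''rs'' (Suc (2 * (NT + e))) = 1 \<and> ow e = i \<and> post e = j)) \<and> t \<le> 4 * m + 2) s"
proof -
  note D0 = inpD[OF netstD(1)[OF N]]
  define Z where "Z e \<longleftrightarrow> arr s ''rs'' (Suc (2 * (NT + e))) = 1" for e
  have injZ: "e = e'" if "e < m" "e' < m" "Z e" "Z e'" "ow e = ow e'" for e e'
    using inj that unfolding Z_def inj_on_def by blast
  show ?thesis
    unfolding out2_def Z_def[symmetric]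
  proof (rule wp_for_const[where I = "\<lambda>n s1. \<forall>i j. arr s1 ''mate'' i = Suc j \<longleftrightarrow> (\<exists>e<n. Z e \<and> ow e = i \<and> post e = j)" and L = 0 and H = m and K = 2])
    fix s1 assume sm: "same (insert ''e'' (modv out2_body)) (moda out2_body) s s1"
    show "aval (Var ''m'') s1 = m" using same_var[OF sm, of "''m''"] D0 by simp
  next
    fix n s1 assume n: "n < m" and I: "\<forall>i j. arr s1 ''mate'' i = Suc j \<longleftrightarrow> (\<exists>e<n. Z e \<and> ow e = i \<and> post e = j)" and ve: "var s1 ''e'' = n"
      and sm: "same (insert ''e'' (modv out2_body)) (moda out2_body) s s1"
    have N1: "netst B s1" using netst_same[OF N sm] by simp
    note d = netstD(3)[OF N1 n] netstD(6)[OF N1] inpD(4)[OF netstD(1)[OF N1]]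
    have rs: "arr s1 ''rs'' (Suc (2 * NT + (n + n))) = 1 \<longleftrightarrow> Z n" using same_arr[OF sm, of "''rs''"] by (simp add: Z_def mult_2 add.assoc add.left_commute)
    have *: "\<forall>i j. ((arr s1 ''mate'')(ow n := Suc (post n))) i = Suc j \<longleftrightarrow> (\<exists>e<Suc n. Z e \<and> ow e = i \<and> post e = j)" if Zn: "Z n"
    proof (intro allI)
      fix i j
      show "((arr s1 ''mate'')(ow n := Suc (post n))) i = Suc j \<longleftrightarrow> (\<exists>e<Suc n. Z e \<and> ow e = i \<and> post e = j)"
      proof (cases "i = ow n")
        case True
        have "e = n" if "e < Suc n" "Z e" "ow e = i" for e using injZ[of e n] that True Zn n by auto
        then show ?thesis using True Zn by auto
      next
        case False
        then show ?thesis using I by (auto simp: less_Suc_eq)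
      qed
    qed
    have **: "\<forall>i j. arr s1 ''mate'' i = Suc j \<longleftrightarrow> (\<exists>e<Suc n. Z e \<and> ow e = i \<and> post e = j)" if "\<not> Z n"
      using I that by (auto simp: less_Suc_eq)
    show "wp out2_body (\<lambda>t s2. (\<forall>i j. arr (setv ''e'' (Suc n) s2) ''mate'' i = Suc j \<longleftrightarrow> (\<exists>e<Suc n. Z e \<and> ow e = i \<and> post e = j)) \<and> t \<le> 2) s1"
    proof (cases "Z n")
      case True
      then show ?thesis unfolding out2_body_def using rs d ve *[OF True] by simp
    next
      case False
      then show ?thesis unfolding out2_body_def using rs d ve **[OF False] by simp
    qed
  qed (use z in auto)
qed

end

section \<open>Forest flows are determined by the edges\<close>

context net
begin

text \<open>Conservation in a forest has a single solution. Weighting the equation at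
  \<open>u\<close> with the indicator of \<open>v \<in> anc u\<close> and summing telescopes along
  the paths and leaves only \<open>y v\<close>.\<close>

lemma load_unique:
  assumes F: "F \<subseteq> Ed" and y: "\<And>v. v \<in> V \<Longrightarrow> y v = card {e \<in> F. leaf e = v} + (\<Sum>w | w \<in> V \<and> par w = v. y w)" and v: "v \<in> V"
  shows "y v = load F v"
proof -
  define h where "h u = (of_bool (v \<in> anc u) :: int)" for u
  have h0: "h 0 = 0" using anc_notin_V zero_V by (simp add: h_def)
  have finF: "finite F" using F finE finite_subset by blast
  have "(\<Sum>u\<in>V. h u * int (y u)) = (\<Sum>u\<in>V. h u * int (card {e \<in> F. leaf e = u})) + (\<Sum>u\<in>V. h u * (\<Sum>w | w \<in> V \<and> par w = u. int (y w)))"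
    by (subst sum.distrib[symmetric], rule sum.cong[OF HOL.refl]) (subst y, simp_all add: distrib_left)
  also have "(\<Sum>u\<in>V. h u * int (card {e \<in> F. leaf e = u})) = (\<Sum>u\<in>V. \<Sum>e | e \<in> F \<and> leaf e = u. h (leaf e))"
    by (intro sum.cong[OF HOL.refl]) (simp add: mult.commute)
  also have "\<dots> = (\<Sum>u\<in>insert 0 V. \<Sum>e | e \<in> F \<and> leaf e = u. h (leaf e))"
    using finV h0 by (intro sum.mono_neutral_left) auto
  also have "\<dots> = (\<Sum>e\<in>F. h (leaf e))"
    using finF finV F leaf by (intro sum.group) auto
  also have "\<dots> = int (load F v)" by (simp add: load_sum[OF F] h_def)
  also have "(\<Sum>u\<in>V. h u * (\<Sum>w | w \<in> V \<and> par w = u. int (y w))) = (\<Sum>u\<in>V. \<Sum>w | w \<in> V \<and> par w = u. h (par w) * int (y w))"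
    by (intro sum.cong[OF HOL.refl]) (simp add: sum_distrib_left)
  also have "\<dots> = (\<Sum>u\<in>insert 0 V. \<Sum>w | w \<in> V \<and> par w = u. h (par w) * int (y w))"
    using finV h0 by (intro sum.mono_neutral_left) auto
  also have "\<dots> = (\<Sum>w\<in>V. h (par w) * int (y w))"
    using finV par by (intro sum.group) auto
  finally have "(\<Sum>u\<in>V. h u * int (y u)) - (\<Sum>w\<in>V. h (par w) * int (y w)) = int (load F v)" by simp
  moreover have "(\<Sum>u\<in>V. h u * int (y u)) - (\<Sum>w\<in>V. h (par w) * int (y w)) = (\<Sum>u\<in>V. (if u = v then int (y u) else 0))"
    unfolding sum_subtractf[symmetric]
  proof (rule sum.cong[OF HOL.refl])
    fix u assume "u \<in> V"
    then have "h u - h (par u) = of_bool (u = v)" using anc_step[of u v] by (simp add: h_def)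
    then have "(h u - h (par u)) * int (y u) = (if u = v then int (y u) else 0)" by simp
    then show "h u * int (y u) - h (par u) * int (y u) = (if u = v then int (y u) else 0)" by (simp add: left_diff_distrib)
  qed
  ultimately show ?thesis using v finV by (simp add: sum.delta)
qed

end

section \<open>The memory as an instance of the network\<close>

context prob2
begin

text \<open>Only applicants with an edge become nodes. The shift by one reserves \<open>0\<close>
  for the sink.\<close>

definition "An = Suc ` ow ` {..<m}"
definition "Vn = {nA<..nd}"
text \<open>The edge \<open>m + e\<close> is the last resort that belongs to the owner of
  \<open>e\<close>, as \<open>base\<close> expresses.\<close>

definition "Edn = {..<2 * m}"
definition "base e = (if e < m then e else e - m)"
definition "own2 e = Suc (ow (base e))"
definition "leaf2 e = (if e < m then le e else 0)"
text \<open>A last resort ranks strictly below every real edge, in accordance with being unmatched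
  as the worst outcome.\<close>

definition "rk2 e = (if e < m then rnk e else Suc (Max (rnk ` {..<m})))"

lemma base_less: "e \<in> Edn \<Longrightarrow> base e < m" by (auto simp: base_def Edn_def)

lemma fokD:
  "bij_betw kd Vn (KSof (post ` {..<m}))" "\<And>v. v \<in> Vn \<Longrightarrow> nc v = capk (kd v)" "\<And>v. v \<in> Vn \<Longrightarrow> pr v = 0 \<or> v < pr v \<and> pr v \<in> Vn"
  "\<And>e. e < m \<Longrightarrow> le e \<in> Vn" "\<And>e. e < m \<Longrightarrow> ES kd e (le e)" "\<And>e w. e < m \<Longrightarrow> w \<in> Vn \<Longrightarrow> ES kd e w \<Longrightarrow> le e \<le> w"
  "\<And>e. e < m \<Longrightarrow> lv e = of_bool (\<forall>w\<in>Vn. ES kd e w \<longrightarrow> 0 < nc w)"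
  "\<And>e v. e < m \<Longrightarrow> v \<in> Vn \<Longrightarrow> ES kd e v \<Longrightarrow> (pr v = 0 \<and> (\<forall>w\<in>Vn. v < w \<longrightarrow> \<not> ES kd e w)) \<or>
        (v < pr v \<and> pr v \<in> Vn \<and> ES kd e (pr v) \<and> (\<forall>w\<in>Vn. v < w \<longrightarrow> w < pr v \<longrightarrow> \<not> ES kd e w))"
proof -
  note f = fok[unfolded forest_ok_def, folded Vn_def]
  show "bij_betw kd Vn (KSof (post ` {..<m}))" "\<And>v. v \<in> Vn \<Longrightarrow> nc v = capk (kd v)"
    "\<And>e. e < m \<Longrightarrow> le e \<in> Vn" "\<And>e. e < m \<Longrightarrow> ES kd e (le e)" "\<And>e w. e < m \<Longrightarrow> w \<in> Vn \<Longrightarrow> ES kd e w \<Longrightarrow> le e \<le> w"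
    "\<And>e. e < m \<Longrightarrow> lv e = of_bool (\<forall>w\<in>Vn. ES kd e w \<longrightarrow> 0 < nc w)"
    using f by auto
  have up: "pr v \<in> Vn" if "v \<in> Vn" "v < pr v" "pr v \<le> nd" for v using that by (auto simp: Vn_def)
  show "pr v = 0 \<or> v < pr v \<and> pr v \<in> Vn" if "v \<in> Vn" for v using f that up by blast
  show "(pr v = 0 \<and> (\<forall>w\<in>Vn. v < w \<longrightarrow> \<not> ES kd e w)) \<or>
        (v < pr v \<and> pr v \<in> Vn \<and> ES kd e (pr v) \<and> (\<forall>w\<in>Vn. v < w \<longrightarrow> w < pr v \<longrightarrow> \<not> ES kd e w))" if "e < m" "v \<in> Vn" "ES kd e v" for e v
  proof -
    have "(pr v = 0 \<and> (\<forall>w\<in>Vn. v < w \<longrightarrow> \<not> ES kd e w)) \<or>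
        (v < pr v \<and> pr v \<le> nd \<and> ES kd e (pr v) \<and> (\<forall>w\<in>Vn. v < w \<longrightarrow> w < pr v \<longrightarrow> \<not> ES kd e w))"
      by (rule f[THEN conjunct2, THEN conjunct2, THEN conjunct2, THEN conjunct2, THEN conjunct2, rule_format, OF that])
    then show ?thesis using up[OF that(2)] by blast
  qed
qed

sublocale N: net An Vn Edn own2 rk2 leaf2 pr nc
proof
  show "finite An" "finite Vn" "finite Edn" by (auto simp: An_def Vn_def Edn_def)
  show "0 \<notin> An" "0 \<notin> Vn" by (auto simp: An_def Vn_def)
  show "An \<inter> Vn = {}" using ow(1) by (fastforce simp: An_def Vn_def)
  show "own2 e \<in> An" if "e \<in> Edn" for e using base_less[OF that] by (auto simp: own2_def An_def)
  show "leaf2 e \<in> insert 0 Vn" if "e \<in> Edn" for e using fokD(4) by (auto simp: leaf2_def)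
  show "pr v = 0 \<or> pr v \<in> Vn \<and> v < pr v" if "v \<in> Vn" for v using fokD(3)[OF that] by auto
  show "\<exists>e\<in>Edn. own2 e = a \<and> leaf2 e = 0" if a: "a \<in> An" for a
  proof -
    obtain e where "e < m" "a = Suc (ow e)" using a by (auto simp: An_def)
    then show ?thesis by (intro bexI[of _ "m + e"]) (auto simp: own2_def base_def leaf2_def Edn_def)
  qed
qed

text \<open>\<open>pr\<close> jumps from a node passed by \<open>e\<close> to the next one passed by
  \<open>e\<close>, so nothing else lies on the path upwards.\<close>

lemma anc_ES: "e < m \<Longrightarrow> v \<in> Vn \<Longrightarrow> ES kd e v \<Longrightarrow> N.anc v = {w \<in> Vn. v \<le> w \<and> ES kd e w}"
proof (induction "nd - v" arbitrary: v rule: less_induct)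
  case less
  have p: "N.anc v = insert v (N.anc (pr v))" using N.anc_par less.prems(2) by blast
  from fokD(8)[OF less.prems] show ?case
  proof
    assume h: "pr v = 0 \<and> (\<forall>w\<in>Vn. v < w \<longrightarrow> \<not> ES kd e w)"
    then have "N.anc (pr v) = {}" using N.anc_notin_V N.zero_V by auto
    moreover have "w = v" if "w \<in> Vn" "v \<le> w" "ES kd e w" for w using h that by (metis le_neq_implies_less)
    ultimately show ?thesis using p less.prems by auto
  next
    assume h: "v < pr v \<and> pr v \<in> Vn \<and> ES kd e (pr v) \<and> (\<forall>w\<in>Vn. v < w \<longrightarrow> w < pr v \<longrightarrow> \<not> ES kd e w)"
    then have "nd - pr v < nd - v" by (auto simp: Vn_def)
    from less.hyps[OF this less.prems(1)] h have IH: "N.anc (pr v) = {w \<in> Vn. pr v \<le> w \<and> ES kd e w}" by blast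
    have "w = v \<or> pr v \<le> w" if "w \<in> Vn" "v \<le> w" "ES kd e w" for w using h that by (metis le_neq_implies_less not_le)
    then show ?thesis unfolding p IH using h less.prems by auto
  qed
qed

lemma anc_leaf: "e < m \<Longrightarrow> N.anc (leaf2 e) = {w \<in> Vn. ES kd e w}"
  using anc_ES[of e "le e"] fokD(4,5,6)[of e] by (auto simp: leaf2_def)

lemma anc_dummy: "\<not> e < m \<Longrightarrow> N.anc (leaf2 e) = {}"
  using N.anc_notin_V N.zero_V by (simp add: leaf2_def)

lemma live_iff: "e < m \<Longrightarrow> N.live e \<longleftrightarrow> lv e = 1"
  unfolding N.live_def anc_leaf using fokD(7)[of e] by auto

lemma live_dummy: "\<not> e < m \<Longrightarrow> N.live e"
  unfolding N.live_def using anc_dummy by simp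

section \<open>Perfect edge sets and feasible matchings\<close>

definition Mof :: "nat set \<Rightarrow> ('a \<times> 'b) set" where
  "Mof P = (\<lambda>e. (av (ow e), pv (post e))) ` (P \<inter> {..<m})"

lemma Mof_iff: "(a, p) \<in> Mof P \<longleftrightarrow> (\<exists>e\<in>P. e < m \<and> a = av (ow e) \<and> p = pv (post e))"
  unfolding Mof_def by auto

lemma load_real: "P \<subseteq> Edn \<Longrightarrow> v \<in> Vn \<Longrightarrow> N.load P v = card {e \<in> P. e < m \<and> ES kd e v}"
proof -
  assume "v \<in> Vn"
  then have "{e \<in> P. v \<in> N.anc (leaf2 e)} = {e \<in> P. e < m \<and> ES kd e v}"
  proof (intro Collect_cong)
    fix e
    show "e \<in> P \<and> v \<in> N.anc (leaf2 e) \<longleftrightarrow> e \<in> P \<and> e < m \<and> ES kd e v"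
      using anc_leaf[of e] anc_dummy[of e] \<open>v \<in> Vn\<close> by (cases "e < m") auto
  qed
  then show ?thesis by (simp add: N.load_def)
qed

lemma post_card:
  assumes "P \<subseteq> Edn" "j < nP" "K \<subseteq> {..<nA}" "inj_on own2 P"
  shows "card ({a. (a, pv j) \<in> Mof P} \<inter> av ` K) = card {e \<in> P. e < m \<and> post e = j \<and> ow e \<in> K}"
proof (rule bij_betw_same_card[symmetric, of "\<lambda>e. av (ow e)"])
  show "bij_betw (\<lambda>e. av (ow e)) {e \<in> P. e < m \<and> post e = j \<and> ow e \<in> K} ({a. (a, pv j) \<in> Mof P} \<inter> av ` K)"
    unfolding bij_betw_def
  proof
    show "inj_on (\<lambda>e. av (ow e)) {e \<in> P. e < m \<and> post e = j \<and> ow e \<in> K}"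
    proof (rule inj_onI)
      fix e e' assume h: "e \<in> {e \<in> P. e < m \<and> post e = j \<and> ow e \<in> K}" "e' \<in> {e \<in> P. e < m \<and> post e = j \<and> ow e \<in> K}" "av (ow e) = av (ow e')"
      then have "ow e = ow e'" using av_inj[of "ow e" "ow e'"] ow(1)[of e] ow(1)[of e'] by simp
      then show "e = e'" using ow_post_inj[of e e'] h by simp
    qed
    show "(\<lambda>e. av (ow e)) ` {e \<in> P. e < m \<and> post e = j \<and> ow e \<in> K} = {a. (a, pv j) \<in> Mof P} \<inter> av ` K"
    proof (intro set_eqI iffI)
      fix a assume "a \<in> (\<lambda>e. av (ow e)) ` {e \<in> P. e < m \<and> post e = j \<and> ow e \<in> K}"
      then show "a \<in> {a. (a, pv j) \<in> Mof P} \<inter> av ` K" by (auto simp: Mof_iff)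
    next
      fix a assume "a \<in> {a. (a, pv j) \<in> Mof P} \<inter> av ` K"
      then obtain e i where e: "e \<in> P" "e < m" "a = av (ow e)" "pv j = pv (post e)" "i \<in> K" "a = av i" by (auto simp: Mof_iff)
      have "post e = j" using pv_inj[OF assms(2) post_less[OF e(2)]] e by simp
      moreover have "ow e = i" using av_inj[of "ow e" i] ow(1)[OF e(2)] e assms(3) by auto
      ultimately show "a \<in> (\<lambda>e. av (ow e)) ` {e \<in> P. e < m \<and> post e = j \<and> ow e \<in> K}" using e by auto
    qed
  qed
qed

lemma Mof_cards:
  assumes P: "P \<subseteq> Edn" "inj_on own2 P" and j: "j < nP"
  shows "card {a. (a, pv j) \<in> Mof P} = card {e \<in> P. e < m \<and> post e = j}"
    and "k \<in> cblk j \<Longrightarrow> card ({a. (a, pv j) \<in> Mof P} \<inter> av ` mems k) = card {e \<in> P. e < m \<and> post e = j \<and> ow e \<in> mems k}"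
proof -
  have "{a. (a, pv j) \<in> Mof P} \<inter> av ` {..<nA} = {a. (a, pv j) \<in> Mof P}" using ow(1) by (auto simp: Mof_iff)
  moreover have "{e \<in> P. e < m \<and> post e = j \<and> ow e \<in> {..<nA}} = {e \<in> P. e < m \<and> post e = j}" using ow(1) by auto
  ultimately show "card {a. (a, pv j) \<in> Mof P} = card {e \<in> P. e < m \<and> post e = j}" using post_card[OF P(1) j order.refl P(2)] by simp
  show "k \<in> cblk j \<Longrightarrow> card ({a. (a, pv j) \<in> Mof P} \<inter> av ` mems k) = card {e \<in> P. e < m \<and> post e = j \<and> ow e \<in> mems k}"
    using post_card[OF P(1) j mems_less[OF j] P(2)] by blast
qed

lemma kd_cases:
  assumes "v \<in> Vn"
  obtains (root) j where "kd v = (j, None)" "j \<in> post ` {..<m}" "j < nP" | (cls) j k where "kd v = (j, Some k)" "j \<in> post ` {..<m}" "j < nP" "k \<in> cblk j" "0 < csz k"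
proof -
  have "kd v \<in> KSof (post ` {..<m})" using fokD(1) assms by (auto simp: bij_betw_def)
  then show ?thesis using that post_less unfolding KSof_def by blast
qed

text \<open>The loads of roots and classes are the very cardinalities that the quotas bound. Posts
  without edges and empty classes have no node, but their bounds hold trivially.\<close>

lemma Mof_feasible:
  assumes P: "P \<subseteq> Edn" "inj_on own2 P"
  shows "feasible G (Mof P) \<longleftrightarrow> (\<forall>v\<in>Vn. N.load P v \<le> nc v)"
proof -
  have mat: "matching G (Mof P)"
    unfolding matching_def
  proof (intro conjI allI impI)
    show "Mof P \<subseteq> edges G" unfolding Mof_def edges_eq by auto
    fix a p p' assume "(a, p) \<in> Mof P" "(a, p') \<in> Mof P"
    then obtain e e' where e: "e \<in> P" "e < m" "a = av (ow e)" "p = pv (post e)" "e' \<in> P" "e' < m" "a = av (ow e')" "p' = pv (post e')" by (auto simp: Mof_iff)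
    then have "own2 e = own2 e'" using av_inj[of "ow e" "ow e'"] ow(1)[of e] ow(1)[of e'] by (simp add: own2_def base_def)
    then have "e = e'" using inj_onD[OF P(2)] e(1,5) by blast
    then show "p = p'" using e by simp
  qed
  show ?thesis
  proof
    assume f: "feasible G (Mof P)"
    show "\<forall>v\<in>Vn. N.load P v \<le> nc v"
    proof
      fix v assume v: "v \<in> Vn"
      from v show "N.load P v \<le> nc v"
      proof (cases rule: kd_cases)
        case (root j)
        have "pv j \<in> posts G" using pv_bij root by (auto simp: bij_betw_def)
        then have "card {a. (a, pv j) \<in> Mof P} \<le> quo j" using f quo_eq[OF root(3)] by (simp add: feasible_def)
        moreover have "{e \<in> P. e < m \<and> ES kd e v} = {e \<in> P. e < m \<and> post e = j}" using root by (auto simp: ES_def)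
        ultimately show ?thesis using Mof_cards(1)[OF P root(3)] fokD(2)[OF v] root load_real[OF P(1) v] by simp
      next
        case (cls j k)
        have "pv j \<in> posts G" using pv_bij cls by (auto simp: bij_betw_def)
        moreover have "av ` mems k \<in> classes G (pv j)" using cls_bij[OF cls(3)] cls(4) by (auto simp: bij_betw_def)
        ultimately have "card ({a. (a, pv j) \<in> Mof P} \<inter> av ` mems k) \<le> cquo k"
          using f cquo_eq[OF cls(3,4)] by (simp add: feasible_def)
        moreover have "{e \<in> P. e < m \<and> ES kd e v} = {e \<in> P. e < m \<and> post e = j \<and> ow e \<in> mems k}" using cls by (auto simp: ES_def)
        ultimately show ?thesis using Mof_cards(2)[OF P cls(3,4)] fokD(2)[OF v] cls load_real[OF P(1) v] by simp
      qed
    qed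
  next
    assume l: "\<forall>v\<in>Vn. N.load P v \<le> nc v"
    have node: "\<exists>v\<in>Vn. kd v = q" if "q \<in> KSof (post ` {..<m})" for q using fokD(1) that unfolding bij_betw_def by (metis imageE)
    show "feasible G (Mof P)"
      unfolding feasible_def
    proof (intro conjI mat ballI)
      fix p assume "p \<in> posts G"
      then obtain j where j: "j < nP" "p = pv j" using pv_bij unfolding bij_betw_def by (metis imageE lessThan_iff)
      show "card {a. (a, p) \<in> Mof P} \<le> quota G p"
      proof (cases "j \<in> post ` {..<m}")
        case True
        then obtain v where v: "v \<in> Vn" "kd v = (j, None)" using node[of "(j, None)"] by (auto simp: KSof_def)
        then have "{e \<in> P. e < m \<and> ES kd e v} = {e \<in> P. e < m \<and> post e = j}" by (auto simp: ES_def)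
        moreover have "N.load P v \<le> nc v" using l v(1) by blast
        ultimately show ?thesis using v Mof_cards(1)[OF P j(1)] fokD(2)[OF v(1)] load_real[OF P(1) v(1)] quo_eq[OF j(1)] j by simp
      next
        case False
        then have "{e \<in> P. e < m \<and> post e = j} = {}" by auto
        then show ?thesis using Mof_cards(1)[OF P j(1)] j by (metis card.empty le0)
      qed
      fix C assume "C \<in> classes G p"
      moreover have "classes G p = (\<lambda>k. av ` mems k) ` cblk j" unfolding j(2) by (rule bij_betw_imp_surj_on[OF cls_bij[OF j(1)], symmetric])
      ultimately have "C \<in> (\<lambda>k. av ` mems k) ` cblk j" by simp
      then obtain k where k: "k \<in> cblk j" "C = av ` mems k" by blast
      show "card ({a. (a, p) \<in> Mof P} \<inter> C) \<le> cquota G p C"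
      proof (cases "j \<in> post ` {..<m} \<and> 0 < csz k")
        case True
        then obtain v where v: "v \<in> Vn" "kd v = (j, Some k)" using node[of "(j, Some k)"] k by (auto simp: KSof_def)
        then have "{e \<in> P. e < m \<and> ES kd e v} = {e \<in> P. e < m \<and> post e = j \<and> ow e \<in> mems k}" by (auto simp: ES_def)
        moreover have "N.load P v \<le> nc v" using l v(1) by blast
        ultimately show ?thesis using v Mof_cards(2)[OF P j(1) k(1)] fokD(2)[OF v(1)] load_real[OF P(1) v(1)] cquo_eq[OF j(1) k(1)] j k by simp
      next
        case False
        have "{e \<in> P. e < m \<and> post e = j \<and> ow e \<in> mems k} = {}"
        proof (cases "j \<in> post ` {..<m}")
          case True
          then have "csz k = 0" using False by simp
          then have "mems k = {}" by (simp add: mems_def csz_def)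
          then show ?thesis by simp
        qed auto
        then show ?thesis using Mof_cards(2)[OF P j(1) k(1)] j k by (metis card.empty le0)
      qed
    qed
  qed
qed

lemma perf_feasible: "N.perf P \<Longrightarrow> feasible G (Mof P)"
  using Mof_feasible unfolding N.perf_def N.feas_def by blast

text \<open>Applicants with an edge that \<open>M\<close> leaves unmatched receive a last
  resort.\<close>

lemma feasible_perf:
  assumes M: "feasible G M" shows "\<exists>P. N.perf P \<and> Mof P = M"
proof -
  define P0 where "P0 = {e. e < m \<and> (av (ow e), pv (post e)) \<in> M}"
  have ME: "M \<subseteq> edges G" and fn: "\<And>a p p'. (a, p) \<in> M \<Longrightarrow> (a, p') \<in> M \<Longrightarrow> p = p'" using M unfolding feasible_def matching_def by blast+
  define g where "g a = (SOME e. e < m \<and> Suc (ow e) = a)" for a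
  have g: "g a < m \<and> Suc (ow (g a)) = a" if "a \<in> An" for a
    unfolding g_def using that by (intro someI_ex[of "\<lambda>e. e < m \<and> Suc (ow e) = a"]) (auto simp: An_def)
  define U where "U = An - own2 ` P0"
  define P where "P = P0 \<union> (\<lambda>a. m + g a) ` U"
  have P0m: "P0 \<subseteq> {..<m}" by (auto simp: P0_def)
  have PE: "P \<subseteq> Edn" using P0m g by (auto simp: P_def U_def Edn_def)
  have real: "P \<inter> {..<m} = P0" using P0m by (auto simp: P_def)
  have MP: "Mof P = M"
  proof -
    have "M \<subseteq> (\<lambda>e. (av (ow e), pv (post e))) ` P0" using ME unfolding edges_eq P0_def by auto
    then show ?thesis unfolding Mof_def real by (auto simp: P0_def)
  qed
  have ownd: "own2 (m + g a) = a" if "a \<in> U" for a using g[of a] that by (simp add: own2_def base_def U_def)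
  have inj0: "e = e'" if "e \<in> P0" "e' \<in> P0" "own2 e = own2 e'" for e e'
  proof -
    have "ow e = ow e'" using that by (simp add: own2_def base_def P0_def)
    then have "pv (post e) = pv (post e')" using that fn unfolding P0_def by auto
    then have "post e = post e'" using pv_inj post_less that by (simp add: P0_def)
    then show ?thesis using ow_post_inj \<open>ow e = ow e'\<close> that by (simp add: P0_def)
  qed
  have inj: "inj_on own2 P"
  proof (rule inj_onI)
    fix e e' assume h: "e \<in> P" "e' \<in> P" "own2 e = own2 e'"
    have d: "own2 x \<in> U" if "x \<in> (\<lambda>a. m + g a) ` U" for x using that ownd by auto
    have r: "own2 x \<notin> U" if "x \<in> P0" for x using that by (auto simp: U_def)
    show "e = e'"
    proof (cases "e \<in> P0")
      case True
      then have "e' \<in> P0" using h d r unfolding P_def by (metis UnE)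
      then show ?thesis using inj0 True h by blast
    next
      case False
      then obtain a where a: "a \<in> U" "e = m + g a" using h by (auto simp: P_def)
      then have "e' \<notin> P0" using h d r by (metis ownd)
      then obtain a' where a': "a' \<in> U" "e' = m + g a'" using h by (auto simp: P_def)
      then show ?thesis using h a ownd by simp
    qed
  qed
  have "own2 ` P = An"
  proof
    show "own2 ` P \<subseteq> An" using N.own PE by blast
    show "An \<subseteq> own2 ` P"
    proof
      fix a assume "a \<in> An"
      then consider "a \<in> own2 ` P0" | "a \<in> U" by (auto simp: U_def)
      then show "a \<in> own2 ` P"
      proof cases
        case 2
        then show ?thesis unfolding P_def using ownd[OF 2] by (intro image_eqI[of _ _ "m + g a"]) auto
      qed (auto simp: P_def)
    qed
  qed
  moreover have "\<forall>v\<in>Vn. N.load P v \<le> nc v" using Mof_feasible[OF PE inj] M MP by simp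
  ultimately have "N.perf P" using PE inj unfolding N.perf_def N.feas_def by blast
  then show ?thesis using MP by blast
qed

text \<open>Since last resorts rank last, leaving one for a post is a strict gain. Applicants
  without an edge prefer nothing, so they are missing on both sides.\<close>

lemma prefers_better:
  assumes P: "N.perf P" and P': "N.perf P'"
  shows "card {a \<in> appl G. prefers G a (Mof P) (Mof P')} = N.better P P'"
proof -
  have PE: "P \<subseteq> Edn" "P' \<subseteq> Edn" and inj: "inj_on own2 P" "inj_on own2 P'" and oP: "own2 ` P = An" "own2 ` P' = An"
    using P P' unfolding N.perf_def N.feas_def by auto
  let ?B = "{a \<in> An. \<exists>e\<in>P. \<exists>e'\<in>P'. own2 e = a \<and> own2 e' = a \<and> rk2 e < rk2 e'}"
  have rmax: "rnk e < Suc (Max (rnk ` {..<m}))" if "e < m" for e using that by (simp add: le_imp_less_Suc)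
  have iff: "prefers G (av i) (Mof P) (Mof P') \<longleftrightarrow> Suc i \<in> ?B" if i: "i < nA" for i
  proof
    assume "prefers G (av i) (Mof P) (Mof P')"
    then obtain p where p: "(av i, p) \<in> Mof P" "\<And>p'. (av i, p') \<in> Mof P' \<Longrightarrow> rank G (av i) p < rank G (av i) p'" unfolding prefers_def by blast
    then obtain e where e: "e \<in> P" "e < m" "av i = av (ow e)" "p = pv (post e)" by (auto simp: Mof_iff)
    have oe: "ow e = i" using av_inj[of i "ow e"] i ow(1)[OF e(2)] e by simp
    have "own2 e = Suc i" using oe e by (simp add: own2_def base_def)
    moreover from this have iA: "Suc i \<in> An" using oP(1) e(1) by (metis imageI)
    ultimately obtain e' where e': "e' \<in> P'" "own2 e' = Suc i" using oP(2) by (metis imageE)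
    have "rk2 e < rk2 e'"
    proof (cases "e' < m")
      case True
      then have oe': "ow e' = i" using e' by (simp add: own2_def base_def)
      then have "(av i, pv (post e')) \<in> Mof P'" using e' True by (auto simp: Mof_iff)
      then have "rank G (av i) (pv (post e)) < rank G (av i) (pv (post e'))" using p e by simp
      moreover have "rnk e = rank G (av i) (pv (post e))" using rnk_eq[OF i] ow[OF e(2)] oe by simp
      moreover have "rnk e' = rank G (av i) (pv (post e'))" using rnk_eq[OF i] ow[OF True] oe' by simp
      ultimately show ?thesis using e(2) True by (simp add: rk2_def)
    next
      case False
      then show ?thesis using rmax[OF e(2)] e by (simp add: rk2_def)
    qed
    then show "Suc i \<in> ?B" using iA e e' \<open>own2 e = Suc i\<close> by blast
  next
    assume "Suc i \<in> ?B"
    then obtain e e' where e: "e \<in> P" "e' \<in> P'" "own2 e = Suc i" "own2 e' = Suc i" "rk2 e < rk2 e'" by blast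
    have em: "e < m"
    proof (rule ccontr)
      assume "\<not> e < m"
      then have "rk2 e' < rk2 e \<or> rk2 e' = rk2 e" using rmax[of e'] by (cases "e' < m") (auto simp: rk2_def)
      then show False using e by simp
    qed
    have oe: "ow e = i" using e em by (simp add: own2_def base_def)
    have "rank G (av i) (pv (post e)) < rank G (av i) p'" if "(av i, p') \<in> Mof P'" for p'
    proof -
      obtain x where x: "x \<in> P'" "x < m" "av i = av (ow x)" "p' = pv (post x)" using \<open>(av i, p') \<in> Mof P'\<close> by (auto simp: Mof_iff)
      have ox: "ow x = i" using av_inj[of i "ow x"] i ow(1)[OF x(2)] x by simp
      then have "own2 x = own2 e'" using e x by (simp add: own2_def base_def)
      then have "x = e'" using inj_onD[OF inj(2)] x(1) e(2) by blast
      have "rnk e = rank G (av i) (pv (post e))" using rnk_eq[OF i] ow[OF em] oe by simp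
      moreover have "rnk x = rank G (av i) p'" using rnk_eq[OF i] ow[OF x(2)] ox x(4) by simp
      ultimately show ?thesis using e(5) \<open>x = e'\<close> x(2) em by (simp add: rk2_def)
    qed
    then show "prefers G (av i) (Mof P) (Mof P')" unfolding prefers_def using e em oe by (intro exI[of _ "pv (post e)"]) (auto simp: Mof_iff)
  qed
  have Bn: "?B \<subseteq> Suc ` {..<nA}" using ow(1) by (auto simp: An_def)
  have "bij_betw (\<lambda>a. av (a - 1)) ?B {a \<in> appl G. prefers G a (Mof P) (Mof P')}"
    unfolding bij_betw_def
  proof
    show "inj_on (\<lambda>a. av (a - 1)) ?B"
    proof (rule inj_onI)
      fix a a' assume h: "a \<in> ?B" "a' \<in> ?B" "av (a - 1) = av (a' - 1)"
      obtain i i' where "a = Suc i" "i < nA" "a' = Suc i'" "i' < nA" using Bn h(1,2) by blast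
      then show "a = a'" using av_inj[of i i'] h(3) by simp
    qed
    show "(\<lambda>a. av (a - 1)) ` ?B = {a \<in> appl G. prefers G a (Mof P) (Mof P')}"
    proof (intro set_eqI iffI)
      fix x assume "x \<in> (\<lambda>a. av (a - 1)) ` ?B"
      then obtain a where a: "a \<in> ?B" "x = av (a - 1)" by blast
      obtain i where i: "a = Suc i" "i < nA" using Bn a(1) by blast
      then have "x = av i" "av i \<in> appl G" using a av_bij by (auto simp: bij_betw_def)
      then show "x \<in> {a \<in> appl G. prefers G a (Mof P) (Mof P')}" using iff[OF i(2)] a(1) i(1) by simp
    next
      fix x assume x: "x \<in> {a \<in> appl G. prefers G a (Mof P) (Mof P')}"
      then obtain i where i: "i < nA" "x = av i" using av_bij unfolding bij_betw_def by (metis (no_types, lifting) imageE lessThan_iff mem_Collect_eq)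
      then have "Suc i \<in> ?B" using iff[OF i(1)] x by simp
      then show "x \<in> (\<lambda>a. av (a - 1)) ` ?B" using i by (intro image_eqI[of _ _ "Suc i"]) simp_all
    qed
  qed
  from bij_betw_same_card[OF this] show ?thesis unfolding N.better_def by (rule sym)
qed

lemma popular_iff: "N.perf P \<Longrightarrow> popular G (Mof P) \<longleftrightarrow> N.pop P"
proof
  assume P: "N.perf P" and pop: "popular G (Mof P)"
  show "N.pop P" unfolding N.pop_def
  proof (intro conjI P allI impI)
    fix F' assume F': "N.perf F'"
    then have "\<not> more_popular G (Mof F') (Mof P)" using pop perf_feasible unfolding popular_def by blast
    then show "N.better F' P \<le> N.better P F'" unfolding more_popular_def prefers_better[OF F' P] prefers_better[OF P F'] by simp
  qed
next
  assume P: "N.perf P" and pop: "N.pop P"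
  show "popular G (Mof P)" unfolding popular_def
  proof (intro conjI perf_feasible[OF P] notI)
    assume "\<exists>M'. feasible G M' \<and> more_popular G M' (Mof P)"
    then obtain M' where M': "feasible G M'" "more_popular G M' (Mof P)" by blast
    then obtain F' where F': "N.perf F'" "Mof F' = M'" using feasible_perf by blast
    then have "N.better P F' < N.better F' P" 
      using M'(2) unfolding more_popular_def F'(2)[symmetric] prefers_better[OF F'(1) P] prefers_better[OF P F'(1)] by simp
    then show False using pop F'(1) unfolding N.pop_def by (meson not_le)
  qed
qed

lemma popular_exists: "(\<exists>M. popular G M) \<longleftrightarrow> (\<exists>P. N.pop P)"
proof
  assume "\<exists>M. popular G M"
  then obtain M where M: "popular G M" by blast
  then obtain P where "N.perf P" "Mof P = M" using feasible_perf unfolding popular_def by blast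
  then show "\<exists>P. N.pop P" using popular_iff M by blast
next
  assume "\<exists>P. N.pop P"
  then obtain P where "N.pop P" by blast
  then show "\<exists>M. popular G M" using popular_iff[of P] unfolding N.pop_def by blast
qed

end

section \<open>Flows in memory as sets of edges\<close>

lemma sum_split_add: "(\<Sum>b<k + n. f b) = (\<Sum>b<k. f b) + (\<Sum>e<n. f (k + e))" for f :: "nat \<Rightarrow> nat"
  by (induction n) (auto simp: add.assoc)

context prob2
begin

definition Fs :: "state \<Rightarrow> nat set" where
  "Fs s = {e. e < 2 * m \<and> arr s ''rs'' (Suc (2 * (NT + e))) = 1}"

lemma Vn_img: "Vn = (\<lambda>b. nA + 1 + b) ` {..<NT}"
proof (intro set_eqI iffI)
  fix v assume "v \<in> Vn"
  then show "v \<in> (\<lambda>b. nA + 1 + b) ` {..<NT}" by (intro image_eqI[of _ _ "v - Suc nA"]) (auto simp: Vn_def NT_def)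
qed (auto simp: Vn_def NT_def)

lemma Vn_pair: "v \<in> Vn \<Longrightarrow> v - Suc nA < NT \<and> nA + 1 + (v - Suc nA) = v"
  by (auto simp: Vn_def NT_def)

lemma Tf_edge: "e < 2 * m \<Longrightarrow> Tf (NT + e) = own2 e" and Hf_edge: "e < 2 * m \<Longrightarrow> Hf (NT + e) = leaf2 e" and Cf_edge: "Cf (NT + e) = 2"
  by (auto simp: Tf_def Hf_def Cf_def own2_def base_def leaf2_def)

lemma Tf_tree: "b < NT \<Longrightarrow> Tf b = nA + 1 + b" and Hf_tree: "b < NT \<Longrightarrow> Hf b = pr (nA + 1 + b)" and Cf_tree: "b < NT \<Longrightarrow> Cf b = nc (nA + 1 + b)"
  by (auto simp: Tf_def Hf_def Cf_def)

lemma own2_le: "e < 2 * m \<Longrightarrow> own2 e \<le> nA \<and> 0 < own2 e"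
  using ow(1)[OF base_less[of e]] by (auto simp: own2_def Edn_def)

text \<open>Conservation read at the two kinds of nodes: an applicant has only its edges going out
  and nothing coming in, and a class collects edges and child classes into a single outgoing
  arc.\<close>

lemma netst_flows:
  assumes N: "netst B s"
  defines "x \<equiv> \<lambda>b. arr s ''rs'' (Suc (2 * b))"
  shows "\<And>a. 0 < a \<Longrightarrow> a \<le> nA \<Longrightarrow> (\<Sum>e<2 * m. if own2 e = a then x (NT + e) else 0) = arr s ''mt'' a"
    and "\<And>v. v \<in> Vn \<Longrightarrow> x (v - Suc nA) = (\<Sum>w | w \<in> Vn \<and> pr w = v. x (w - Suc nA)) + (\<Sum>e<2 * m. if leaf2 e = v then x (NT + e) else 0)"
    and "\<And>a. arr s ''mt'' a \<le> 1"
proof -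
  note fi = netstD(8)[OF N, unfolded flow_inv_def]
  have nA: "var s ''nA'' = nA" using inpD[OF netstD(1)[OF N]] by simp
  have ex: "outflow np s v = inflow np s v + arr s ''mt'' v" if "0 < v" for v using fi that by (auto simp: excess_at_def)
  have mt: "arr s ''mt'' v \<le> of_bool (0 < v \<and> v \<le> nA)" for v using fi nA by metis
  show "arr s ''mt'' a \<le> 1" for a using mt[of a] by (auto simp: of_bool_def split: if_splits)
  have o: "outflow np s v = (\<Sum>b<NT. if nA + 1 + b = v then x b else 0) + (\<Sum>e<2 * m. if own2 e = v then x (NT + e) else 0)" for v
  proof -
    have "outflow np s v = (\<Sum>b<np. if Tf b = v then x b else 0)"
      unfolding outflow_def flow_at_def x_def using netstD(9)[OF N] by (intro sum.cong) auto
    also have "\<dots> = (\<Sum>b<NT. if Tf b = v then x b else 0) + (\<Sum>e<2 * m. if Tf (NT + e) = v then x (NT + e) else 0)"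
      unfolding np_def by (rule sum_split_add)
    finally show ?thesis by (simp add: Tf_edge Tf_tree cong: sum.cong_simp)
  qed
  have n: "inflow np s v = (\<Sum>b<NT. if pr (nA + 1 + b) = v then x b else 0) + (\<Sum>e<2 * m. if leaf2 e = v then x (NT + e) else 0)" for v
  proof -
    have "inflow np s v = (\<Sum>b<np. if Hf b = v then x b else 0)"
      unfolding inflow_def flow_at_def x_def using netstD(10)[OF N] by (intro sum.cong) auto
    also have "\<dots> = (\<Sum>b<NT. if Hf b = v then x b else 0) + (\<Sum>e<2 * m. if Hf (NT + e) = v then x (NT + e) else 0)"
      unfolding np_def by (rule sum_split_add)
    finally show ?thesis by (simp add: Hf_edge Hf_tree cong: sum.cong_simp)
  qed
  have tree: "nA + 1 + b \<in> Vn" if "b < NT" for b using that Vn_img by blast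
  have leafV: "leaf2 e \<in> insert 0 Vn" if "e < 2 * m" for e using N.leaf[of e] that by (simp add: Edn_def)
  show "(\<Sum>e<2 * m. if own2 e = a then x (NT + e) else 0) = arr s ''mt'' a" if a: "0 < a" "a \<le> nA" for a
  proof -
    have aV: "a \<notin> Vn" using a by (simp add: Vn_def)
    have "(\<Sum>b<NT. if nA + 1 + b = a then x b else 0) = 0" using a by (intro sum.neutral) auto
    moreover have "(\<Sum>b<NT. if pr (nA + 1 + b) = a then x b else 0) = 0"
    proof (intro sum.neutral ballI)
      fix b assume "b \<in> {..<NT}"
      then have "pr (nA + 1 + b) \<noteq> a" using fokD(3)[OF tree[of b]] aV a by auto
      then show "(if pr (nA + 1 + b) = a then x b else 0) = 0" by simp
    qed
    moreover have "(\<Sum>e<2 * m. if leaf2 e = a then x (NT + e) else 0) = 0"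
    proof (intro sum.neutral ballI)
      fix e assume "e \<in> {..<2 * m}"
      then have "leaf2 e \<noteq> a" using leafV[of e] aV a by auto
      then show "(if leaf2 e = a then x (NT + e) else 0) = 0" by simp
    qed
    ultimately show ?thesis using ex[OF a(1)] o[of a] n[of a] by simp
  qed
  show "x (v - Suc nA) = (\<Sum>w | w \<in> Vn \<and> pr w = v. x (w - Suc nA)) + (\<Sum>e<2 * m. if leaf2 e = v then x (NT + e) else 0)" if v: "v \<in> Vn" for v
  proof -
    have vg: "nA < v" using v by (simp add: Vn_def)
    have "(\<Sum>e<2 * m. if own2 e = v then x (NT + e) else 0) = 0"
    proof (intro sum.neutral ballI)
      fix e assume "e \<in> {..<2 * m}"
      then have "own2 e \<noteq> v" using own2_le[of e] vg by auto
      then show "(if own2 e = v then x (NT + e) else 0) = 0" by simp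
    qed
    moreover have "(\<Sum>b<NT. if nA + 1 + b = v then x b else 0) = (\<Sum>b<NT. if b = v - Suc nA then x b else 0)"
      using vg by (intro sum.cong) auto
    moreover have "\<dots> = x (v - Suc nA)" using Vn_pair[OF v] by (simp add: sum.delta)
    moreover have "arr s ''mt'' v = 0" using mt[of v] vg by simp
    moreover have "(\<Sum>b<NT. if pr (nA + 1 + b) = v then x b else 0) = (\<Sum>w | w \<in> Vn \<and> pr w = v. x (w - Suc nA))"
    proof -
      have "(\<Sum>w\<in>Vn. if pr w = v then x (w - Suc nA) else 0) = (\<Sum>b<NT. if pr (nA + 1 + b) = v then x b else 0)"
        unfolding Vn_img by (subst sum.reindex) (auto simp: inj_on_def intro!: sum.cong)
      moreover have "(\<Sum>w\<in>Vn. if pr w = v then x (w - Suc nA) else 0) = (\<Sum>w | w \<in> Vn \<and> pr w = v. x (w - Suc nA))"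
        using N.finV by (simp add: sum.inter_filter)
      ultimately show ?thesis by simp
    qed
    ultimately show ?thesis using ex[of v] vg o[of v] n[of v] by simp
  qed
qed

text \<open>The supply of an applicant is at most one unit, so each edge carries 0 or 1 in spite of
  its capacity 2, and at most one edge per applicant carries a unit. The forest flow is then a load
  by \<open>N.load_unique\<close>.\<close>

lemma Fs_facts:
  assumes N: "netst B s"
  shows "Fs s \<subseteq> Edn" and "\<And>e. e < 2 * m \<Longrightarrow> arr s ''rs'' (Suc (2 * (NT + e))) = of_bool (e \<in> Fs s)"
    and "inj_on own2 (Fs s)" and "own2 ` Fs s = {a \<in> An. arr s ''mt'' a = 1}"
    and "\<And>v. v \<in> Vn \<Longrightarrow> arr s ''rs'' (Suc (2 * (v - Suc nA))) = N.load (Fs s) v" and "N.feas (Fs s)"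
proof -
  let ?x = "\<lambda>b. arr s ''rs'' (Suc (2 * b))"
  note fl = netst_flows[OF N]
  show sub: "Fs s \<subseteq> Edn" by (auto simp: Fs_def Edn_def)
  have le: "(\<Sum>e\<in>S. ?x (NT + e)) \<le> arr s ''mt'' a" if S: "S \<subseteq> {e. e < 2 * m \<and> own2 e = a}" and a: "0 < a" "a \<le> nA" for S a
  proof -
    have "(\<Sum>e\<in>S. ?x (NT + e)) = (\<Sum>e\<in>S. if own2 e = a then ?x (NT + e) else 0)" using S by (intro sum.cong) auto
    also have "\<dots> \<le> (\<Sum>e<2 * m. if own2 e = a then ?x (NT + e) else 0)" using S by (intro sum_mono2) auto
    finally show ?thesis using fl(1)[OF a] by simp
  qed
  show x01: "?x (NT + e) = of_bool (e \<in> Fs s)" if e: "e < 2 * m" for e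
  proof -
    have "?x (NT + e) \<le> 1" using le[of "{e}" "own2 e"] own2_le[OF e] e fl(3)[of "own2 e"] by simp
    then show ?thesis using e by (auto simp: Fs_def)
  qed
  show inj: "inj_on own2 (Fs s)"
  proof (rule inj_onI, rule ccontr)
    fix e e' assume h: "e \<in> Fs s" "e' \<in> Fs s" "own2 e = own2 e'" "e \<noteq> e'"
    then have em: "e < 2 * m" "e' < 2 * m" by (auto simp: Fs_def)
    have "(\<Sum>f\<in>{e, e'}. ?x (NT + f)) \<le> 1" using le[of "{e, e'}" "own2 e"] own2_le[OF em(1)] em h fl(3)[of "own2 e"] by simp
    then show False using h x01[OF em(1)] x01[OF em(2)] by simp
  qed
  show "own2 ` Fs s = {a \<in> An. arr s ''mt'' a = 1}"
  proof (intro set_eqI iffI)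
    fix a assume "a \<in> own2 ` Fs s"
    then obtain e where e: "e \<in> Fs s" "a = own2 e" by blast
    then have em: "e < 2 * m" by (simp add: Fs_def)
    have "1 \<le> arr s ''mt'' a" using le[of "{e}" a] own2_le[OF em] em e x01[OF em] by simp
    then show "a \<in> {a \<in> An. arr s ''mt'' a = 1}" using fl(3)[of a] N.own e sub by auto
  next
    fix a assume a: "a \<in> {a \<in> An. arr s ''mt'' a = 1}"
    then have ab: "0 < a" "a \<le> nA" using ow(1) by (auto simp: An_def Suc_le_eq)
    have "\<exists>e<2 * m. own2 e = a \<and> e \<in> Fs s"
    proof (rule ccontr)
      assume "\<not> ?thesis"
      then have "(\<Sum>e<2 * m. if own2 e = a then ?x (NT + e) else 0) = 0" using x01 by (intro sum.neutral) auto
      then show False using fl(1)[OF ab] a by simp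
    qed
    then show "a \<in> own2 ` Fs s" by blast
  qed
  show load: "?x (v - Suc nA) = N.load (Fs s) v" if v: "v \<in> Vn" for v
  proof (rule N.load_unique[OF sub _ v, where y = "\<lambda>v. ?x (v - Suc nA)"])
    fix v assume v: "v \<in> Vn"
    have "(\<Sum>e<2 * m. if leaf2 e = v then ?x (NT + e) else 0) = (\<Sum>e<2 * m. if leaf2 e = v \<and> e \<in> Fs s then 1 else 0)"
      using x01 by (intro sum.cong) auto
    also have "\<dots> = card {e \<in> {..<2 * m}. leaf2 e = v \<and> e \<in> Fs s}"
      by (simp add: sum.If_cases Int_def)
    also have "{e \<in> {..<2 * m}. leaf2 e = v \<and> e \<in> Fs s} = {e \<in> Fs s. leaf2 e = v}" by (auto simp: Fs_def)
    finally show "?x (v - Suc nA) = card {e \<in> Fs s. leaf2 e = v} + (\<Sum>w | w \<in> Vn \<and> pr w = v. ?x (w - Suc nA))"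
      using fl(2)[OF v] by simp
  qed
  have "N.load (Fs s) v \<le> nc v" if v: "v \<in> Vn" for v
  proof -
    have b: "v - Suc nA < np" using Vn_pair[OF v] by (simp add: np_def)
    have "arr s ''rs'' (2 * (v - Suc nA)) + ?x (v - Suc nA) = nc v"
      using netstD(11)[OF N b] Cf_tree Vn_pair[OF v] by simp
    then show ?thesis using load[OF v] by simp
  qed
  then show "N.feas (Fs s)" using sub inj by (simp add: N.feas_def)
qed

text \<open>The memory graph and \<open>RT\<close> have the same closed sets containing the sink.
  Edges of \<open>Fs s\<close> must be enabled because \<open>RT.una\<close> may cancel any of
  them.\<close>

lemma reached_RT:
  assumes N: "netst B s" and st: "stable np s" and FB: "\<And>e. e \<in> Fs s \<Longrightarrow> NT + e \<in> B"
  shows "reached s = N.RT {e \<in> Edn. NT + e \<in> B} {v \<in> Vn. v - Suc nA \<notin> B} (Fs s)"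
proof -
  let ?R = "N.RT {e \<in> Edn. NT + e \<in> B} {v \<in> Vn. v - Suc nA \<notin> B} (Fs s)"
  have pairs: "pairs_ok np s" using netstD(8)[OF N] by (simp add: flow_inv_def)
  have arc: "arr s ''tl'' (2 * b) = Tf b" "arr s ''hd'' (2 * b) = Hf b" "arr s ''tl'' (Suc (2 * b)) = Hf b" "arr s ''hd'' (Suc (2 * b)) = Tf b"
    "arr s ''en'' (2 * b) = of_bool (b \<in> B)" "arr s ''en'' (Suc (2 * b)) = of_bool (b \<in> B)" if "b < np" for b
    using pairs that netstD(9,10,12)[OF N that] by (auto simp: pairs_ok_def)
  have up: "0 < arr s ''rs'' (2 * (v - Suc nA)) \<longleftrightarrow> N.load (Fs s) v < nc v" if v: "v \<in> Vn" for v
  proof -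
    have b: "v - Suc nA < np" using Vn_pair[OF v] by (simp add: np_def)
    have "arr s ''rs'' (2 * (v - Suc nA)) + N.load (Fs s) v = nc v"
      using netstD(11)[OF N b] Cf_tree Vn_pair[OF v] Fs_facts(5)[OF N v] by simp
    then show ?thesis by linarith
  qed
  have fwd: "0 < arr s ''rs'' (2 * (NT + e))" if e: "e < 2 * m" for e
  proof -
    have "NT + e < np" using e by (simp add: np_def)
    then have "arr s ''rs'' (2 * (NT + e)) + arr s ''rs'' (Suc (2 * (NT + e))) = 2" using netstD(11)[OF N] Cf_edge by metis
    then show ?thesis using Fs_facts(2)[OF N e] by (cases "e \<in> Fs s") auto
  qed
  have split: "b < NT \<or> (\<exists>e<2 * m. b = NT + e)" if "b < np" for b
  proof (cases "b < NT")
    case False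
    then have "b = NT + (b - NT)" "b - NT < 2 * m" using that by (auto simp: np_def)
    then show ?thesis by blast
  qed simp
  show ?thesis
  proof
    have cls: "arr s ''tl'' i \<in> ?R" if i: "i < 2 * np" "arc_ok s i" "arr s ''hd'' i \<in> ?R" for i
    proof -
      obtain b where b: "b < np" and ib: "i = 2 * b \<or> i = Suc (2 * b)"
        using i(1) by (metis even_two_times_div_two less_mult_imp_div_less mult.commute odd_two_times_div_two_succ Suc_eq_plus1)
      have en: "arr s ''en'' i = 1" "0 < arr s ''rs'' i" using i(2) by (simp_all add: arc_ok_def)
      from ib show ?thesis
      proof
        assume ib: "i = 2 * b"
        have "b \<in> B" by (rule ccontr) (use en(1) arc(5)[OF b] ib in simp)
        moreover have "0 < arr s ''rs'' (2 * b)" using en(2) ib by simp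
        moreover have "Hf b \<in> ?R" using i(3) arc(2)[OF b] ib by simp
        ultimately have h: "b \<in> B" "0 < arr s ''rs'' (2 * b)" "Hf b \<in> ?R" by blast+
        from split[OF b] show ?thesis
        proof
          assume bN: "b < NT"
          let ?v = "nA + 1 + b"
          have v: "?v \<in> Vn" "?v - Suc nA = b" using bN Vn_img by auto
          have "?v \<in> ?R" by (rule N.RT.up[OF v(1)]) (use up[OF v(1)] v h Hf_tree[OF bN] in simp_all)
          then show ?thesis using ib arc[OF b] Tf_tree[OF bN] by simp
        next
          assume "\<exists>e<2 * m. b = NT + e"
          then obtain e where e: "e < 2 * m" "b = NT + e" by blast
          have "own2 e \<in> ?R" by (rule N.RT.asg) (use h e Hf_edge[OF e(1)] in \<open>simp_all add: Edn_def\<close>)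
          then show ?thesis using ib arc[OF b] Tf_edge[OF e(1)] e by simp
        qed
      next
        assume ib: "i = Suc (2 * b)"
        have "b \<in> B" by (rule ccontr) (use en(1) arc(6)[OF b] ib in simp)
        moreover have "0 < arr s ''rs'' (Suc (2 * b))" using en(2) ib by simp
        moreover have "Tf b \<in> ?R" using i(3) arc(4)[OF b] ib by simp
        ultimately have h: "b \<in> B" "0 < arr s ''rs'' (Suc (2 * b))" "Tf b \<in> ?R" by blast+
        from split[OF b] show ?thesis
        proof
          assume bN: "b < NT"
          let ?v = "nA + 1 + b"
          have v: "?v \<in> Vn" "?v - Suc nA = b" using bN Vn_img by auto
          have "pr ?v \<in> ?R" by (rule N.RT.down[OF v(1)]) (use Fs_facts(5)[OF N v(1)] v h Tf_tree[OF bN] in simp_all)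
          then show ?thesis using ib arc[OF b] Hf_tree[OF bN] by simp
        next
          assume "\<exists>e<2 * m. b = NT + e"
          then obtain e where e: "e < 2 * m" "b = NT + e" by blast
          have "e \<in> Fs s" by (rule ccontr) (use h(2) Fs_facts(2)[OF N e(1)] e(2) in simp)
          moreover have "own2 e \<in> ?R" using h(3) e(2) Tf_edge[OF e(1)] by simp
          ultimately have "leaf2 e \<in> ?R" by (rule N.RT.una)
          then show ?thesis using ib arc[OF b] Hf_edge[OF e(1)] e by simp
        qed
      qed
    qed
    show "reached s \<subseteq> ?R"
      by (rule st[unfolded stable_def, THEN conjunct2, THEN conjunct2, THEN conjunct1, THEN spec, THEN mp, THEN mp])
        (use cls in \<open>auto intro: N.RT.sink\<close>)
  next
    have cl: "arr s ''tl'' i \<in> reached s" if "i < 2 * np" "arc_ok s i" "arr s ''hd'' i \<in> reached s" for i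
      by (rule st[unfolded stable_def, THEN conjunct2, THEN conjunct1, rule_format, OF that])
    show "?R \<subseteq> reached s"
    proof
      fix u assume "u \<in> ?R"
      then show "u \<in> reached s"
      proof (induction rule: N.RT.induct)
        case sink
        then show ?case using st by (simp add: stable_def)
      next
        case (up v)
        let ?b = "v - Suc nA"
        have b: "?b < NT" "nA + 1 + ?b = v" using Vn_pair[OF up.hyps(1)] by auto
        then have bn: "?b < np" by (simp add: np_def)
        have "?b \<in> B" using up.hyps by blast
        then have "arc_ok s (2 * ?b)" using arc[OF bn] up.hyps \<open>\<And>v. v \<in> Vn \<Longrightarrow> (0 < arr s ''rs'' (2 * (v - Suc nA))) = (N.load (Fs s) v < nc v)\<close>[OF up.hyps(1)] by (simp add: arc_ok_def)
        then show ?case using cl[of "2 * ?b"] arc[OF bn] bn Tf_tree[OF b(1)] Hf_tree[OF b(1)] b(2) up.IH by simp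
      next
        case (down v)
        let ?b = "v - Suc nA"
        have b: "?b < NT" "nA + 1 + ?b = v" using Vn_pair[OF down.hyps(1)] by auto
        then have bn: "?b < np" by (simp add: np_def)
        have "?b \<in> B" using down.hyps by blast
        then have "arc_ok s (Suc (2 * ?b))" using arc[OF bn] down.hyps Fs_facts(5)[OF N down.hyps(1)] by (simp add: arc_ok_def)
        then show ?case using cl[of "Suc (2 * ?b)"] arc[OF bn] bn Tf_tree[OF b(1)] Hf_tree[OF b(1)] b(2) down.IH by simp
      next
        case (asg e)
        then have e: "e < 2 * m" "NT + e \<in> B" by (auto simp: Edn_def)
        then have bn: "NT + e < np" by (simp add: np_def)
        have "arc_ok s (2 * (NT + e))" using arc[OF bn] e fwd[OF e(1)] by (simp add: arc_ok_def)
        moreover have "2 * (NT + e) < 2 * np" using bn by simp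
        ultimately show ?case using cl[of "2 * (NT + e)"] arc(1,2)[OF bn] Tf_edge[OF e(1)] Hf_edge[OF e(1)] asg.IH by metis
      next
        case (una e)
        then have e: "e < 2 * m" "NT + e \<in> B" using FB by (auto simp: Fs_def)
        then have bn: "NT + e < np" by (simp add: np_def)
        have "arc_ok s (Suc (2 * (NT + e)))" using arc(6)[OF bn] e(2) Fs_facts(2)[OF N e(1)] una.hyps by (simp add: arc_ok_def)
        moreover have "Suc (2 * (NT + e)) < 2 * np" using bn by simp
        ultimately show ?case using cl[of "Suc (2 * (NT + e))"] arc(3,4)[OF bn] Tf_edge[OF e(1)] Hf_edge[OF e(1)] una.IH by metis
      qed
    qed
  qed
qed

end

section \<open>The two flow phases combined\<close>

definition phases :: com where
  "phases = Seq okinit (Seq sel (Seq maxflow (Seq prep1 (Seq prep2 (Seq sel (Seq maxflow (Seq out1 out2)))))))"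

context prob2
begin

lemma maxflow_netst:
  assumes N: "netst B s"
  shows "wp maxflow (\<lambda>t s'. netst B s' \<and> stable np s' \<and> same_caps np s s' \<and> arr s' ''en'' = arr s ''en'' \<and> t \<le> (42 * np + 23) * (nA + 1) + 2) s"
proof (rule wp_same[OF maxflow_wp[OF netstD(8)[OF N]]])
  fix t s' assume h: "t \<le> (42 * np + 23) * (var s ''nA'' + 1) + 2 \<and> flow_inv np s' \<and> stable np s' \<and> same_caps np s s'" and sm: "same (modv maxflow) (moda maxflow) s s'"
  note fr = same_arr[OF sm, simplified] same_var[OF sm, simplified]
  have "consts_ok s'" using consts_same[OF _ sm] N by (simp add: netst_def)
  moreover have "\<forall>b<np. arr s' ''rs'' (2 * b) + arr s' ''rs'' (Suc (2 * b)) = Cf b" using h netstD(11)[OF N] by (simp add: same_caps_def)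
  ultimately have "netst B s'" using N h unfolding netst_def by (simp add: fr)
  moreover have "var s ''nA'' = nA" using inpD[OF netstD(1)[OF N]] by simp
  ultimately show "netst B s' \<and> stable np s' \<and> same_caps np s s' \<and> arr s' ''en'' = arr s ''en'' \<and> t \<le> (42 * np + 23) * (nA + 1) + 2"
    using h by (simp add: fr)
qed

text \<open>Last resorts rank last and tie with each other, so they are best exactly for applicants
  without an admissible edge.\<close>

lemma selset_iff:
  assumes e: "e < 2 * m"
  shows "NT + e \<in> selset ok m \<longleftrightarrow> e \<in> N.best ({e. e < m \<and> ok e = 1} \<union> {m..<2 * m})"
proof -
  have rmax: "rnk e < Suc (Max (rnk ` {..<m}))" if "e < m" for e using that by (simp add: le_imp_less_Suc)
  have rr: "rk2 e = rnk e" if "e < m" for e using that by (simp add: rk2_def)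
  have rd: "rk2 e = Suc (Max (rnk ` {..<m}))" if "\<not> e < m" for e using that by (simp add: rk2_def)
  have ob: "own2 e = Suc (ow e)" if "e < m" for e using that by (simp add: own2_def base_def)
  show ?thesis
  proof (cases "e < m")
    case True
    have "NT + e \<in> selset ok m \<longleftrightarrow> ok e = 1 \<and> (\<forall>e'<m. ow e' = ow e \<longrightarrow> ok e' = 1 \<longrightarrow> rnk e \<le> rnk e')"
      using True unfolding selset_def by auto
    also have "\<dots> \<longleftrightarrow> e \<in> N.best ({e. e < m \<and> ok e = 1} \<union> {m..<2 * m})"
    proof
      assume h: "ok e = 1 \<and> (\<forall>e'<m. ow e' = ow e \<longrightarrow> ok e' = 1 \<longrightarrow> rnk e \<le> rnk e')"
      have "rk2 e \<le> rk2 e'" if e': "e' \<in> {e. e < m \<and> ok e = 1} \<union> {m..<2 * m}" "own2 e' = own2 e" for e'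
      proof (cases "e' < m")
        case True
        then show ?thesis using e' h \<open>e < m\<close> by (simp add: rr ob)
      next
        case False
        then show ?thesis using rmax[OF \<open>e < m\<close>] by (simp add: rr[OF \<open>e < m\<close>] rd[OF False])
      qed
      then show "e \<in> N.best ({e. e < m \<and> ok e = 1} \<union> {m..<2 * m})" using h True by (simp add: N.best_def)
    next
      assume b: "e \<in> N.best ({e. e < m \<and> ok e = 1} \<union> {m..<2 * m})"
      then have oke: "ok e = 1" using True by (auto simp: N.best_def)
      have "rnk e \<le> rnk e'" if "e' < m" "ow e' = ow e" "ok e' = 1" for e'
      proof -
        have "rk2 e \<le> rk2 e'" using b that ob True unfolding N.best_def by auto
        then show ?thesis using that True by (simp add: rr)
      qed
      then show "ok e = 1 \<and> (\<forall>e'<m. ow e' = ow e \<longrightarrow> ok e' = 1 \<longrightarrow> rnk e \<le> rnk e')" using oke by blast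
    qed
    finally show ?thesis .
  next
    case False
    then obtain e0 where e0: "e = m + e0" "e0 < m" using e by (metis add_diff_inverse_nat less_diff_conv mult_2 add.commute nat_add_left_cancel_less)
    have oe: "own2 e = Suc (ow e0)" using e0 by (simp add: own2_def base_def)
    have "NT + e \<in> selset ok m \<longleftrightarrow> (\<forall>e'<m. ow e' = ow e0 \<longrightarrow> ok e' \<noteq> 1)"
      using e0 unfolding selset_def by auto
    also have "\<dots> \<longleftrightarrow> e \<in> N.best ({e. e < m \<and> ok e = 1} \<union> {m..<2 * m})"
    proof
      assume h: "\<forall>e'<m. ow e' = ow e0 \<longrightarrow> ok e' \<noteq> 1"
      have "rk2 e \<le> rk2 e'" if e': "e' \<in> {e. e < m \<and> ok e = 1} \<union> {m..<2 * m}" "own2 e' = own2 e" for e'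
      proof -
        have "\<not> e' < m" using h e' oe ob by auto
        then show ?thesis using rd[OF False] rd by simp
      qed
      then show "e \<in> N.best ({e. e < m \<and> ok e = 1} \<union> {m..<2 * m})" using e0 by (simp add: N.best_def)
    next
      assume b: "e \<in> N.best ({e. e < m \<and> ok e = 1} \<union> {m..<2 * m})"
      show "\<forall>e'<m. ow e' = ow e0 \<longrightarrow> ok e' \<noteq> 1"
      proof (intro allI impI notI)
        fix e' assume e': "e' < m" "ow e' = ow e0" "ok e' = 1"
        then have "rk2 e \<le> rk2 e'" using b oe ob[OF e'(1)] unfolding N.best_def by auto
        then show False using rd[OF False] rr[OF e'(1)] rmax[OF e'(1)] by simp
      qed
    qed
    finally show ?thesis .
  qed
qed

lemma selset_ge: "b < NT \<Longrightarrow> b \<notin> selset ok k"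
  unfolding selset_def by auto

lemma live_set: "{e \<in> Edn. N.live e} = {e. e < m \<and> lv e = 1} \<union> {m..<2 * m}"
proof (intro set_eqI)
  fix e show "e \<in> {e \<in> Edn. N.live e} \<longleftrightarrow> e \<in> {e. e < m \<and> lv e = 1} \<union> {m..<2 * m}"
    using live_iff[of e] live_dummy[of e] by (cases "e < m") (auto simp: Edn_def)
qed

lemma selset_cong: "(\<And>e. e < m \<Longrightarrow> ok e = ok' e) \<Longrightarrow> selset ok m = selset ok' m"
  unfolding selset_def by (simp cong: conj_cong)

text \<open>A post with an edge contributes its root and at most two nonempty classes per
  neighbour.\<close>

lemma NT_le: "NT \<le> 3 * m"
proof -
  have J: "finite (post ` {..<m})" by simp
  have "NT = card Vn" by (simp add: Vn_def NT_def)
  also have "\<dots> = card (KSof (post ` {..<m}))" using bij_betw_same_card[OF fokD(1)] .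
  also have "KSof (post ` {..<m}) = (\<Union>j\<in>post ` {..<m}. KSof {j})" by (auto simp: KSof_def)
  also have "card \<dots> \<le> (\<Sum>j\<in>post ` {..<m}. card (KSof {j}))" using J by (rule card_UN_le)
  also have "\<dots> \<le> (\<Sum>j\<in>post ` {..<m}. 3 * deg j)"
  proof (rule sum_mono)
    fix j assume "j \<in> post ` {..<m}"
    then obtain e where e: "e < m" "j = post e" by auto
    have "KSof {j} = insert (j, None) ((\<lambda>k. (j, Some k)) ` {k \<in> cblk j. 0 < csz k})" by (auto simp: KSof_def)
    then have "card (KSof {j}) \<le> Suc (card ((\<lambda>k. (j, Some k)) ` {k \<in> cblk j. 0 < csz k}))" by (simp add: card_insert_le_m1 card_insert_if)
    also have "\<dots> \<le> Suc (card {k \<in> cblk j. 0 < csz k})" using card_image_le[of "{k \<in> cblk j. 0 < csz k}"] by (simp add: cblk_def)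
    also have "\<dots> \<le> Suc (2 * deg j)" using classes_card post_less[OF e(1)] e by simp
    also have "\<dots> \<le> 3 * deg j" using deg_pos[OF e(1)] e by simp
    finally show "card (KSof {j}) \<le> 3 * deg j" .
  qed
  also have "\<dots> = 3 * (\<Sum>j\<in>post ` {..<m}. deg j)" by (simp add: sum_distrib_left)
  also have "\<dots> \<le> 3 * m" using sum_deg[of m] by simp
  finally show ?thesis .
qed

definition result :: "state \<Rightarrow> bool" where
  "result s \<longleftrightarrow> (if \<exists>P. N.pop P then var s ''found'' = 1 \<and> (\<exists>P. N.pop P \<and> (\<forall>i j. arr s ''mate'' i = Suc j \<longleftrightarrow> (\<exists>e<m. e \<in> P \<and> ow e = i \<and> post e = j)))
     else var s ''found'' = 0)"

text \<open>The two final memories play the parts of \<open>F1\<close> and \<open>F2\<close>: the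
  enabled pairs are first \<open>E1\<close> with no arc frozen, then \<open>E2\<close> of the
  reached set with the crossing arcs frozen.\<close>

lemma result_of_flows:
  assumes N1: "netst ({..<NT} \<union> selset lv m) s1" and st1: "stable np s1" and F1: "\<And>e. e \<in> Fs s1 \<Longrightarrow> NT + e \<in> selset lv m"
    and B2: "B2 = ({..<NT} \<union> selset lv m) - {NT + e | e. e < m \<and> Suc (ow e) \<in> reached s1 \<and> le e \<notin> reached s1} -
        {b. b < NT \<and> (Tf b \<in> reached s1) \<noteq> (Hf b \<in> reached s1)} \<union> selset (\<lambda>e. of_bool (lv e = 1 \<and> le e \<in> reached s1)) m"
    and N2: "netst B2 s2"
    and st2: "stable np s2" and caps: "\<And>b. b < np \<Longrightarrow> b \<notin> B2 \<Longrightarrow> arr s2 ''rs'' (Suc (2 * b)) = arr s1 ''rs'' (Suc (2 * b))"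
  shows "(\<exists>P. N.pop P) \<longleftrightarrow> (\<forall>i<nA. off i < off (Suc i) \<longrightarrow> arr s2 ''mt'' (Suc i) \<noteq> 0)"
    and "(\<forall>i<nA. off i < off (Suc i) \<longrightarrow> arr s2 ''mt'' (Suc i) \<noteq> 0) \<Longrightarrow> N.pop (Fs s2)"
proof -
  let ?B1 = "{..<NT} \<union> selset lv m" and ?T = "reached s1"
  let ?B2 = "({..<NT} \<union> selset lv m) - {NT + e | e. e < m \<and> Suc (ow e) \<in> reached s1 \<and> le e \<notin> reached s1} -
        {b. b < NT \<and> (Tf b \<in> reached s1) \<noteq> (Hf b \<in> reached s1)} \<union> selset (\<lambda>e. of_bool (lv e = 1 \<and> le e \<in> reached s1)) m"
  note N2 = N2[unfolded B2] and caps = caps[unfolded B2]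
  have E1: "{e \<in> Edn. NT + e \<in> ?B1} = N.E1"
    unfolding N.E1_def live_set using selset_iff[of _ lv] by (auto simp: Edn_def N.best_def)
  have fz1: "{v \<in> Vn. v - Suc nA \<notin> ?B1} = {}" using Vn_pair by auto
  have "e \<in> Fs s1 \<Longrightarrow> NT + e \<in> ?B1" for e using F1 by blast
  from reached_RT[OF N1 st1 this] have T: "?T = N.RT N.E1 {} (Fs s1)" unfolding E1 fz1 .
  have z: "0 \<in> ?T" unfolding T by (rule N.RT.sink)
  have F1E: "Fs s1 \<subseteq> N.E1" using F1 Fs_facts(1)[OF N1] unfolding E1[symmetric] by blast
  have An_le: "a \<le> nA \<and> 0 < a" if "a \<in> An" for a using that ow(1) by (auto simp: An_def Suc_le_eq)
  have nA: "var s1 ''nA'' = nA" "var s2 ''nA'' = nA" using inpD[OF netstD(1)[OF N1]] inpD[OF netstD(1)[OF N2]] by auto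
  have c1: "An \<inter> ?T \<subseteq> own2 ` Fs s1" using st1 An_le nA unfolding Fs_facts(4)[OF N1] stable_def by auto
  have E2: "{e \<in> Edn. NT + e \<in> ?B2} = N.E2 ?T"
  proof (intro set_eqI)
    fix e
    have live2: "{e \<in> Edn. N.live e \<and> leaf2 e \<in> ?T} = {e. e < m \<and> (of_bool (lv e = 1 \<and> le e \<in> ?T) :: nat) = 1} \<union> {m..<2 * m}"
    proof (intro set_eqI)
      fix e show "e \<in> {e \<in> Edn. N.live e \<and> leaf2 e \<in> ?T} \<longleftrightarrow> e \<in> {e. e < m \<and> (of_bool (lv e = 1 \<and> le e \<in> ?T) :: nat) = 1} \<union> {m..<2 * m}"
        using live_iff[of e] live_dummy[of e] z by (cases "e < m") (auto simp: Edn_def leaf2_def)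
    qed
    show "e \<in> {e \<in> Edn. NT + e \<in> ?B2} \<longleftrightarrow> e \<in> N.E2 ?T"
    proof (cases "e \<in> Edn")
      case True
      then have e2: "e < 2 * m" by (simp add: Edn_def)
      have "NT + e \<in> ?B1 \<longleftrightarrow> e \<in> N.E1" using E1 True by blast
      moreover have "NT + e \<in> {NT + e | e. e < m \<and> Suc (ow e) \<in> ?T \<and> le e \<notin> ?T} \<longleftrightarrow> own2 e \<in> ?T \<and> leaf2 e \<notin> ?T"
        using z by (auto simp: own2_def base_def leaf2_def)
      moreover have "NT + e \<notin> {b. b < NT \<and> (Tf b \<in> ?T) \<noteq> (Hf b \<in> ?T)}" by simp
      moreover have "NT + e \<in> selset (\<lambda>e. of_bool (lv e = 1 \<and> le e \<in> ?T)) m \<longleftrightarrow> e \<in> N.best {e \<in> Edn. N.live e \<and> leaf2 e \<in> ?T}"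
        unfolding live2 by (rule selset_iff[OF e2])
      ultimately show ?thesis using True unfolding N.E2_def by blast
    next
      case False
      then show ?thesis using N.E1_subset unfolding N.E2_def by (auto simp: N.best_def)
    qed
  qed
  have fz2: "{v \<in> Vn. v - Suc nA \<notin> ?B2} = N.cross ?T"
  proof (intro set_eqI)
    fix v
    show "v \<in> {v \<in> Vn. v - Suc nA \<notin> ?B2} \<longleftrightarrow> v \<in> N.cross ?T"
    proof (cases "v \<in> Vn")
      case True
      have b: "v - Suc nA < NT" "nA + 1 + (v - Suc nA) = v" using Vn_pair[OF True] by auto
      have eq: "v - Suc nA \<in> ?B2 \<longleftrightarrow> (v \<in> ?T) = (pr v \<in> ?T)"
        using b selset_ge[OF b(1)] Tf_tree[OF b(1)] Hf_tree[OF b(1)] by auto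
      have "v \<in> {v \<in> Vn. v - Suc nA \<notin> X} \<longleftrightarrow> v \<in> N.cross ?T" if "v - Suc nA \<in> X \<longleftrightarrow> (v \<in> ?T) = (pr v \<in> ?T)" for X
        using that True unfolding N.cross_def by simp
      from this[OF eq] show ?thesis .
    qed (simp add: N.cross_def)
  qed
  have x2: "arr s2 ''rs'' (Suc (2 * (NT + e))) = arr s1 ''rs'' (Suc (2 * (NT + e)))" if "e \<in> Edn" "e \<notin> N.E2 ?T" for e
  proof (rule caps)
    show "NT + e < np" using that by (simp add: np_def Edn_def)
    show "NT + e \<notin> ?B2" using that E2 by blast
  qed
  \<comment> \<open>An edge of the first flow whose owner is in \<open>T\<close> ends in
    \<open>T\<close> by \<open>RT.una\<close>, so disabling the edges that leave \<open>T\<close>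
    strands no unit.\<close>
  have F1E2: "e \<in> N.E2 ?T" if "e \<in> Fs s1" for e
    using F1E that N.RT.una[of e "Fs s1" N.E1 "{}"] unfolding N.E2_def T by blast
  have F2E: "Fs s2 \<subseteq> N.E2 ?T"
  proof (rule subsetI, rule ccontr)
    fix e assume e: "e \<in> Fs s2" "e \<notin> N.E2 ?T"
    then have "e \<in> Fs s1" using x2[of e] Fs_facts(1)[OF N2] unfolding Fs_def by auto
    then show False using F1E2 e by blast
  qed
  have FB2: "NT + e \<in> ?B2" if "e \<in> Fs s2" for e using F2E that unfolding E2[symmetric] by blast
  from reached_RT[OF N2 st2 FB2] have T2: "reached s2 = N.RT (N.E2 ?T) (N.cross ?T) (Fs s2)" unfolding E2 fz2 .
  have c2: "An \<inter> N.RT (N.E2 ?T) (N.cross ?T) (Fs s2) \<subseteq> own2 ` Fs s2"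
    unfolding T2[symmetric] Fs_facts(4)[OF N2] using st2 An_le nA unfolding stable_def by auto
  have l2: "N.load (Fs s2) v = N.load (Fs s1) v" if v: "v \<in> N.cross ?T" for v
  proof -
    have vV: "v \<in> Vn" using v by (simp add: N.cross_def)
    have b: "v - Suc nA < np" using Vn_pair[OF vV] by (simp add: np_def)
    have "v - Suc nA \<notin> ?B2" using v unfolding fz2[symmetric] by blast
    then show ?thesis unfolding Fs_facts(5)[OF N1 vV, symmetric] Fs_facts(5)[OF N2 vV, symmetric] by (rule caps[OF b])
  qed
  have full: "own2 ` Fs s2 = An \<longleftrightarrow> (\<forall>i<nA. off i < off (Suc i) \<longrightarrow> arr s2 ''mt'' (Suc i) \<noteq> 0)"
  proof -
    have "own2 ` Fs s2 = An \<longleftrightarrow> (\<forall>a\<in>An. arr s2 ''mt'' a = 1)" unfolding Fs_facts(4)[OF N2] by auto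
    also have "\<dots> \<longleftrightarrow> (\<forall>a\<in>An. arr s2 ''mt'' a \<noteq> 0)" using netst_flows(3)[OF N2] by (metis One_nat_def le_0_eq le_SucE zero_neq_one)
    also have "\<dots> \<longleftrightarrow> (\<forall>i<nA. off i < off (Suc i) \<longrightarrow> arr s2 ''mt'' (Suc i) \<noteq> 0)"
    proof
      assume h: "\<forall>a\<in>An. arr s2 ''mt'' a \<noteq> 0"
      show "\<forall>i<nA. off i < off (Suc i) \<longrightarrow> arr s2 ''mt'' (Suc i) \<noteq> 0"
      proof (intro allI impI)
        fix i assume i: "i < nA" "off i < off (Suc i)"
        then have "ow (off i) = i" "off i < m" using ow_eq[OF i(1)] by auto
        then have "Suc i \<in> An" unfolding An_def by force
        then show "arr s2 ''mt'' (Suc i) \<noteq> 0" using h by blast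
      qed
    next
      assume h: "\<forall>i<nA. off i < off (Suc i) \<longrightarrow> arr s2 ''mt'' (Suc i) \<noteq> 0"
      show "\<forall>a\<in>An. arr s2 ''mt'' a \<noteq> 0"
      proof
        fix a assume "a \<in> An"
        then obtain e where e: "e < m" "a = Suc (ow e)" by (auto simp: An_def)
        then show "arr s2 ''mt'' a \<noteq> 0" using h ow[OF e(1)] by auto
      qed
    qed
    finally show ?thesis .
  qed
  note hyp = T Fs_facts(6)[OF N1] F1E c1 Fs_facts(6)[OF N2] F2E l2
  show "(\<forall>i<nA. off i < off (Suc i) \<longrightarrow> arr s2 ''mt'' (Suc i) \<noteq> 0) \<Longrightarrow> N.pop (Fs s2)"
    using N.popular_of_perfect[OF hyp] full by blast
  then show "(\<exists>P. N.pop P) \<longleftrightarrow> (\<forall>i<nA. off i < off (Suc i) \<longrightarrow> arr s2 ''mt'' (Suc i) \<noteq> 0)"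
    using N.perfect_of_popular[OF hyp _ c2] full by blast
qed

lemma phases_wp:
  assumes N: "netst {..<NT} s" and x0: "\<And>b. b < np \<Longrightarrow> arr s ''rs'' (Suc (2 * b)) = 0" and z: "var s ''zero'' = 0" and mate: "\<And>i. arr s ''mate'' i = 0"
  shows "wp phases (\<lambda>t s'. result s' \<and> t \<le> 38 * m + 18 * nA + 5 * NT + 2 * ((42 * np + 23) * (nA + 1)) + 21) s"
  unfolding phases_def wp_Seq
proof (rule wp_same[OF okinit_wp[OF N]], elim conjE)
  fix t1 s1 assume N1: "netst {..<NT} s1" and ok1: "\<forall>e<m. arr s1 ''ok'' e = lv e" and t1: "t1 \<le> 3 * m + 2" and sm1: "same (modv okinit) (moda okinit) s s1"
  have sel1: "selset (arr s1 ''ok'') m = selset lv m" using ok1 by (intro selset_cong) auto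
  show "wp sel (\<lambda>t2. wp maxflow (\<lambda>t3. wp prep1 (\<lambda>t4. wp prep2 (\<lambda>t5. wp sel (\<lambda>t6. wp maxflow (\<lambda>t7. wp out1 (\<lambda>t8. wp out2
    (\<lambda>t9 s'. result s' \<and> t1 + (t2 + (t3 + (t4 + (t5 + (t6 + (t7 + (t8 + t9))))))) \<le> 38 * m + 18 * nA + 5 * NT + 2 * ((42 * np + 23) * (nA + 1)) + 21)))))))) s1"
  proof (rule wp_same[OF sel_wp[OF N1]], unfold sel1, elim conjE)
    let ?B1 = "{..<NT} \<union> selset lv m"
    fix t2 s2 assume N2: "netst ?B1 s2" and t2: "t2 \<le> 12 * m + 7 * nA + 2" and sm2: "same (modv sel) (moda sel) s1 s2"
    have rs2: "arr s2 ''rs'' = arr s ''rs''" using same_arr[OF sm2, of "''rs''"] same_arr[OF sm1, of "''rs''"] by simp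
    show "wp maxflow (\<lambda>t3. wp prep1 (\<lambda>t4. wp prep2 (\<lambda>t5. wp sel (\<lambda>t6. wp maxflow (\<lambda>t7. wp out1 (\<lambda>t8. wp out2
      (\<lambda>t9 s'. result s' \<and> t1 + (t2 + (t3 + (t4 + (t5 + (t6 + (t7 + (t8 + t9))))))) \<le> 38 * m + 18 * nA + 5 * NT + 2 * ((42 * np + 23) * (nA + 1)) + 21))))))) s2"
    proof (rule wp_same[OF maxflow_netst[OF N2]], elim conjE)
      fix t3 s3 assume N3: "netst ?B1 s3" and st3: "stable np s3" and sc3: "same_caps np s2 s3" and t3: "t3 \<le> (42 * np + 23) * (nA + 1) + 2"
        and sm3: "same (modv maxflow) (moda maxflow) s2 s3"
      let ?T = "reached s3"
      \<comment> \<open>The flow starts at zero and disabled arcs keep their flow, so only selected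
        edges carry a unit.\<close>
      have F3: "NT + e \<in> selset lv m" if "e \<in> Fs s3" for e
      proof (rule ccontr)
        assume n: "NT + e \<notin> selset lv m"
        have e: "e < 2 * m" "arr s3 ''rs'' (Suc (2 * (NT + e))) = 1" using that by (auto simp: Fs_def)
        have b: "NT + e < np" using e by (simp add: np_def)
        have "arr s2 ''en'' (Suc (2 * b)) = 0" if b: "b < np" "b \<notin> ?B1" for b
        proof -
          have "arr s2 ''en'' (2 * b) = 0" using netstD(12)[OF N2 b(1)] b(2) by simp
          then show ?thesis using netstD(8)[OF N2] b(1) by (simp add: flow_inv_def pairs_ok_def)
        qed
        from this[OF b] n have "arr s2 ''en'' (Suc (2 * (NT + e))) = 0" by simp
        moreover have "Suc (2 * (NT + e)) < 2 * np" using b by simp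
        ultimately have "arr s3 ''rs'' (Suc (2 * (NT + e))) = arr s2 ''rs'' (Suc (2 * (NT + e)))" using sc3 unfolding same_caps_def by (metis zero_neq_one)
        then show False using e rs2 x0[OF b] by simp
      qed
      let ?X1 = "{NT + e | e. e < m \<and> Suc (ow e) \<in> ?T \<and> le e \<notin> ?T}"
      show "wp prep1 (\<lambda>t4. wp prep2 (\<lambda>t5. wp sel (\<lambda>t6. wp maxflow (\<lambda>t7. wp out1 (\<lambda>t8. wp out2
        (\<lambda>t9 s'. result s' \<and> t1 + (t2 + (t3 + (t4 + (t5 + (t6 + (t7 + (t8 + t9))))))) \<le> 38 * m + 18 * nA + 5 * NT + 2 * ((42 * np + 23) * (nA + 1)) + 21)))))) s3"
      proof (rule wp_same[OF prep1_wp[OF N3]], elim conjE)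
        fix t4 s4 assume N4: "netst (?B1 - ?X1) s4" and ok4: "\<forall>e<m. arr s4 ''ok'' e = of_bool (lv e = 1 \<and> le e \<in> ?T)" and t4: "t4 \<le> 7 * m + 2"
          and sm4: "same (modv prep1) (moda prep1) s3 s4"
        have T4: "reached s4 = ?T" using same_arr[OF sm4, of "''vis''"] same_var[OF sm4, of "''st''"] by (simp add: reached_def)
        have z4: "var s4 ''zero'' = 0"
          using same_var[OF sm4, of "''zero''"] same_var[OF sm3, of "''zero''"] same_var[OF sm2, of "''zero''"] same_var[OF sm1, of "''zero''"] z by simp
        let ?X2 = "{b. b < NT \<and> (Tf b \<in> ?T) \<noteq> (Hf b \<in> ?T)}"
        show "wp prep2 (\<lambda>t5. wp sel (\<lambda>t6. wp maxflow (\<lambda>t7. wp out1 (\<lambda>t8. wp out2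
          (\<lambda>t9 s'. result s' \<and> t1 + (t2 + (t3 + (t4 + (t5 + (t6 + (t7 + (t8 + t9))))))) \<le> 38 * m + 18 * nA + 5 * NT + 2 * ((42 * np + 23) * (nA + 1)) + 21))))) s4"
        proof (rule wp_same[OF prep2_wp[OF N4 z4]], unfold T4, elim conjE)
          fix t5 s5 assume N5: "netst (?B1 - ?X1 - ?X2) s5" and t5: "t5 \<le> 5 * NT + 2" and sm5: "same (modv prep2) (moda prep2) s4 s5"
          have ok5: "selset (arr s5 ''ok'') m = selset (\<lambda>e. of_bool (lv e = 1 \<and> le e \<in> ?T)) m"
            using ok4 same_arr[OF sm5, of "''ok''"] by (intro selset_cong) auto
          let ?B2 = "?B1 - ?X1 - ?X2 \<union> selset (\<lambda>e. of_bool (lv e = 1 \<and> le e \<in> ?T)) m"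
          show "wp sel (\<lambda>t6. wp maxflow (\<lambda>t7. wp out1 (\<lambda>t8. wp out2
            (\<lambda>t9 s'. result s' \<and> t1 + (t2 + (t3 + (t4 + (t5 + (t6 + (t7 + (t8 + t9))))))) \<le> 38 * m + 18 * nA + 5 * NT + 2 * ((42 * np + 23) * (nA + 1)) + 21)))) s5"
          proof (rule wp_same[OF sel_wp[OF N5]], unfold ok5, elim conjE)
            fix t6 s6 assume N6: "netst ?B2 s6" and t6: "t6 \<le> 12 * m + 7 * nA + 2" and sm6: "same (modv sel) (moda sel) s5 s6"
            have rs6: "arr s6 ''rs'' = arr s3 ''rs''"
              using same_arr[OF sm6, of "''rs''"] same_arr[OF sm5, of "''rs''"] same_arr[OF sm4, of "''rs''"] by simp
            show "wp maxflow (\<lambda>t7. wp out1 (\<lambda>t8. wp out2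
              (\<lambda>t9 s'. result s' \<and> t1 + (t2 + (t3 + (t4 + (t5 + (t6 + (t7 + (t8 + t9))))))) \<le> 38 * m + 18 * nA + 5 * NT + 2 * ((42 * np + 23) * (nA + 1)) + 21))) s6"
            proof (rule wp_same[OF maxflow_netst[OF N6]], elim conjE)
              fix t7 s7 assume N7: "netst ?B2 s7" and st7: "stable np s7" and sc7: "same_caps np s6 s7" and t7: "t7 \<le> (42 * np + 23) * (nA + 1) + 2"
                and sm7: "same (modv maxflow) (moda maxflow) s6 s7"
              have caps: "arr s7 ''rs'' (Suc (2 * b)) = arr s3 ''rs'' (Suc (2 * b))" if b: "b < np" "b \<notin> ?B2" for b
              proof -
                have "arr s6 ''en'' (2 * b) = 0" using netstD(12)[OF N6 b(1)] b(2) by simp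
                then have "arr s6 ''en'' (Suc (2 * b)) = 0"
                  using netstD(8)[OF N6] b(1) by (simp add: flow_inv_def pairs_ok_def)
                moreover have "Suc (2 * b) < 2 * np" using b by simp
                ultimately show ?thesis using sc7 rs6 unfolding same_caps_def by (metis zero_neq_one)
              qed
              note res = result_of_flows[OF N3 st3 F3 refl N7 st7 caps]
              have mate7: "arr s7 ''mate'' i = 0" for i
                using same_arr[OF sm7, of "''mate''"] same_arr[OF sm6, of "''mate''"] same_arr[OF sm5, of "''mate''"] same_arr[OF sm4, of "''mate''"]
                  same_arr[OF sm3, of "''mate''"] same_arr[OF sm2, of "''mate''"] same_arr[OF sm1, of "''mate''"] mate by simp
              show "wp out1 (\<lambda>t8. wp out2
                (\<lambda>t9 s'. result s' \<and> t1 + (t2 + (t3 + (t4 + (t5 + (t6 + (t7 + (t8 + t9))))))) \<le> 38 * m + 18 * nA + 5 * NT + 2 * ((42 * np + 23) * (nA + 1)) + 21)) s7"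
              proof (rule wp_same[OF out1_wp[OF N7]], elim conjE)
                fix t8 s8 assume found: "var s8 ''found'' = of_bool (\<forall>i<nA. off i < off (Suc i) \<longrightarrow> arr s7 ''mt'' (Suc i) \<noteq> 0)" and t8: "t8 \<le> 4 * nA + 3"
                  and sm8: "same (modv out1) (moda out1) s7 s8"
                have N8: "netst ?B2 s8" using netst_same[OF N7 sm8] by simp
                have rs8: "arr s8 ''rs'' = arr s7 ''rs''" "arr s8 ''mate'' = arr s7 ''mate''" using same_arr[OF sm8, of "''rs''"] same_arr[OF sm8, of "''mate''"] by auto
                have inj: "inj_on ow {e. e < m \<and> arr s8 ''rs'' (Suc (2 * (NT + e))) = 1}"
                proof (rule inj_onI)
                  fix e e' assume h: "e \<in> {e. e < m \<and> arr s8 ''rs'' (Suc (2 * (NT + e))) = 1}" "e' \<in> {e. e < m \<and> arr s8 ''rs'' (Suc (2 * (NT + e))) = 1}" "ow e = ow e'"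
                  then have "e \<in> Fs s7" "e' \<in> Fs s7" "own2 e = own2 e'" unfolding rs8 by (auto simp: Fs_def own2_def base_def)
                  then show "e = e'" using inj_onD[OF Fs_facts(3)[OF N7]] by blast
                qed
                show "wp out2 (\<lambda>t9 s'. result s' \<and> t1 + (t2 + (t3 + (t4 + (t5 + (t6 + (t7 + (t8 + t9))))))) \<le> 38 * m + 18 * nA + 5 * NT + 2 * ((42 * np + 23) * (nA + 1)) + 21) s8"
                proof (rule wp_same[OF out2_wp[OF N8 _ inj]])
                  show "arr s8 ''mate'' i = 0" for i using mate7 rs8 by simp
                  fix t9 s9 assume h: "(\<forall>i j. (arr s9 ''mate'' i = Suc j) = (\<exists>e<m. arr s8 ''rs'' (Suc (2 * (NT + e))) = 1 \<and> ow e = i \<and> post e = j)) \<and> t9 \<le> 4 * m + 2"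
                    and sm9: "same (modv out2) (moda out2) s8 s9"
                  have f9: "var s9 ''found'' = var s8 ''found''" using same_var[OF sm9, of "''found''"] by simp
                  have mem: "(arr s8 ''rs'' (Suc (2 * (NT + e))) = 1) = (e \<in> Fs s7)" if "e < m" for e using that rs8 by (simp add: Fs_def)
                  have m9: "\<forall>i j. arr s9 ''mate'' i = Suc j \<longleftrightarrow> (\<exists>e<m. e \<in> Fs s7 \<and> ow e = i \<and> post e = j)" using h mem by blast
                  have "result s9"
                  proof (cases "\<exists>P. N.pop P")
                    case True
                    then have c: "\<forall>i<nA. off i < off (Suc i) \<longrightarrow> arr s7 ''mt'' (Suc i) \<noteq> 0" using res(1) by blast
                    then have "N.pop (Fs s7)" using res(2) by blast
                    moreover have "var s9 ''found'' = 1" using f9 found c by simp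
                    ultimately show ?thesis unfolding result_def using True m9 by auto
                  next
                    case False
                    then have c: "\<not> (\<forall>i<nA. off i < off (Suc i) \<longrightarrow> arr s7 ''mt'' (Suc i) \<noteq> 0)" using res(1) by blast
                    then have "var s9 ''found'' = 0" using f9 found by simp
                    then show ?thesis unfolding result_def using False by simp
                  qed
                  moreover have "t1 + (t2 + (t3 + (t4 + (t5 + (t6 + (t7 + (t8 + t9))))))) \<le> 38 * m + 18 * nA + 5 * NT + 2 * ((42 * np + 23) * (nA + 1)) + 21"
                    using t1 t2 t3 t4 t5 t6 t7 t8 h by linarith
                  ultimately show "result s9 \<and> t1 + (t2 + (t3 + (t4 + (t5 + (t6 + (t7 + (t8 + t9))))))) \<le> 38 * m + 18 * nA + 5 * NT + 2 * ((42 * np + 23) * (nA + 1)) + 21"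
                    by blast
                qed
              qed
            qed
          qed
        qed
      qed
    qed
  qed
qed

end

text \<open>Without edges the empty matching is popular, and the untouched array \<open>mate\<close>
  encodes it. The early exit also keeps this case within constant time, as the bound demands for any
  number of applicants.\<close>

definition popular_prog :: com where
  "popular_prog = Seq (Assign ''m'' (Read ''off'' (Var ''nA'')))
    (If (Eq (Var ''m'') (Const 0)) (Assign ''found'' (Const 1))
      (Seq own_prog (Seq forest (Seq leaves (Seq build phases)))))"

lemma (in prob) empty_popular:
  assumes m: "m = 0" shows "popular G {}"
proof -
  have E: "edges G = {}" using edges_eq m by simp
  have f: "feasible G M \<longleftrightarrow> M = {}" for M
  proof
    assume "feasible G M"
    then show "M = {}" using E unfolding feasible_def matching_def by blast
  next
    assume "M = {}"
    then show "feasible G M" by (simp add: feasible_def matching_def)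
  qed
  show "popular G {}" unfolding popular_def using f by (auto simp: more_popular_def)
qed

lemma (in prob) popular_prog_wp:
  "wp popular_prog (\<lambda>t s'. t \<le> 2000 * max 1 (nA * m) \<and>
     (if \<exists>M. popular G M then var s' ''found'' = 1 \<and> popular G (output_matching G av pv s') else var s' ''found'' = 0)) s0"
proof (cases "m = 0")
  case True
  have off: "arr s0 ''off'' (var s0 ''nA'') = 0" using True by (simp add: m_def off_def nA_def)
  have "arr s0 ''mate'' i = 0" for i by (rule init_arr) simp
  then have "output_matching G av pv (setv ''found'' 1 (setv ''m'' 0 s0)) = {}" by (simp add: output_matching_def)
  then show ?thesis using empty_popular[OF True] off unfolding popular_prog_def by auto
next
  case False
  let ?s0 = "setv ''m'' m s0"
  have off: "arr s0 ''off'' (var s0 ''nA'') = m" by (simp add: m_def off_def nA_def)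
  have inp0: "inp ?s0" unfolding inp_def by (simp add: nA_def off_def post_def rnk_def quo_def coff_def cquo_def moff_def mem_def)
  have nA: "0 < nA" using ow(1)[of 0] False by simp
  define K where "K = 2000 * max 1 (nA * m)"
  have "wp (Seq own_prog (Seq forest (Seq leaves (Seq build phases)))) (\<lambda>t s'. 2 + t \<le> K \<and>
     (if \<exists>M. popular G M then var s' ''found'' = 1 \<and> popular G (output_matching G av pv s') else var s' ''found'' = 0)) ?s0"
    unfolding wp_Seq
  proof (rule wp_same[OF own_wp[OF inp0]], elim conjE)
    fix t1 s1 assume ow1: "\<forall>e<m. arr s1 ''own'' e = ow e" and t1: "t1 \<le> 3 * m + 4 * nA + 2" and sm1: "same (modv own_prog) (moda own_prog) ?s0 s1"
    have inp1: "inp s1" using inp_same[OF inp0 sm1] by simp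
    have z1: "arr s1 x i = 0" if "x \<notin> {''off'', ''post'', ''rank'', ''quota'', ''coff'', ''cquota'', ''moff'', ''member'', ''own''}" for x i
      using same_arr[OF sm1, of x] init_arr[of x i] that by simp
    have zv1: "var s1 x = 0" if "x \<notin> {''nA'', ''nP'', ''m'', ''i'', ''e''}" for x
      using same_var[OF sm1, of x] init_var[of x] that by simp
    have "arr s1 x i = 0" if "x \<in> {''bs'', ''lf'', ''tp'', ''pr'', ''dd''}" for x i using that by (intro z1) auto
    note fw = forest_wp[OF inp1 _ this]
    show "wp forest (\<lambda>t2. wp leaves (\<lambda>t3. wp build (\<lambda>t4. wp phases (\<lambda>t5 s'. 2 + (t1 + (t2 + (t3 + (t4 + t5)))) \<le> K \<and>
       (if \<exists>M. popular G M then var s' ''found'' = 1 \<and> popular G (output_matching G av pv s') else var s' ''found'' = 0))))) s1"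
    proof (rule wp_same[OF fw], use False in simp, assumption, elim conjE exE)
      fix t2 s2 kd assume TI: "TI (KSof (post ` {..<m})) kd s2" and BS: "BS s2" and bs: "\<forall>e<m. arr s2 ''bs'' (post e) \<noteq> 0"
        and t2: "t2 \<le> 70 * (nA * m) + 6 * m + 4" and sm2: "same (modv forest) (moda forest) s1 s2"
      have inp2: "inp s2" using inp_same[OF inp1 sm2] by simp
      have ow2: "arr s2 ''own'' e = ow e" if "e < m" for e using same_arr[OF sm2, of "''own''"] ow1 that by simp
      note lw = leaves_wp[OF inp2 TI BS bs[rule_format] ow2]
      show "wp leaves (\<lambda>t3. wp build (\<lambda>t4. wp phases (\<lambda>t5 s'. 2 + (t1 + (t2 + (t3 + (t4 + t5)))) \<le> K \<and>
         (if \<exists>M. popular G M then var s' ''found'' = 1 \<and> popular G (output_matching G av pv s') else var s' ''found'' = 0)))) s2"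
      proof (rule wp_same[OF lw], assumption, assumption, elim conjE)
        fix t3 s3 assume fok: "forest_ok kd (var s3 ''nd'') (arr s3 ''pr'') (arr s3 ''le'') (arr s3 ''nc'') (arr s3 ''lv'')" and t3: "t3 \<le> 8 * m + 2"
          and sm3: "same (modv leaves) (moda leaves) s2 s3"
        interpret Q: prob2 G av pv s0 kd "var s3 ''nd''" "arr s3 ''pr''" "arr s3 ''le''" "arr s3 ''nc''" "arr s3 ''lv''"
          using fok False by unfold_locales auto
        have inp3: "inp s3" using inp_same[OF inp2 sm3] by simp
        have co3: "Q.consts_ok s3" unfolding Q.consts_ok_def using inp3 ow2 same_arr[OF sm3, of "''own''"] by simp
        have z3: "arr s3 x i = 0" if x: "x \<in> {''tl'', ''hd'', ''rs'', ''en'', ''pt'', ''nt'', ''fs'', ''mt'', ''vis'', ''mate''}" for x i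
          using x same_arr[OF sm3, of x] same_arr[OF sm2, of x] z1[of x i] by auto
        have zv3: "var s3 x = 0" if x: "x \<in> {''c'', ''zero''}" for x
          using x same_var[OF sm3, of x] same_var[OF sm2, of x] zv1[of x] by auto
        have z3': "arr s3 x i = 0" if "x \<in> {''tl'', ''hd'', ''rs'', ''en'', ''pt'', ''nt'', ''fs'', ''mt'', ''vis''}" for x i using that by (intro z3) auto
        have c3: "var s3 ''c'' = 0" by (rule zv3) simp
        note bw = Q.build_wp[OF co3 refl refl z3' c3]
        show "wp build (\<lambda>t4. wp phases (\<lambda>t5 s'. 2 + (t1 + (t2 + (t3 + (t4 + t5)))) \<le> K \<and>
          (if \<exists>M. popular G M then var s' ''found'' = 1 \<and> popular G (output_matching G av pv s') else var s' ''found'' = 0))) s3"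
        proof (rule wp_same[OF bw], assumption, elim conjE)
          fix t4 s4 assume N4: "Q.netst {..<Q.NT} s4" and x4: "\<forall>b<Q.np. arr s4 ''rs'' (Suc (2 * b)) = 0" and t4: "t4 \<le> 21 * Q.NT + 42 * m + 8"
            and sm4: "same (modv build) (moda build) s3 s4"
          have mate4: "arr s4 ''mate'' i = 0" for i using same_arr[OF sm4, of "''mate''"] z3[of "''mate''" i] by simp
          have zero4: "var s4 ''zero'' = 0" using same_var[OF sm4, of "''zero''"] zv3[of "''zero''"] by simp
          note pw = Q.phases_wp[OF N4 x4[rule_format] zero4 mate4]
          show "wp phases (\<lambda>t5 s'. 2 + (t1 + (t2 + (t3 + (t4 + t5)))) \<le> K \<and>
            (if \<exists>M. popular G M then var s' ''found'' = 1 \<and> popular G (output_matching G av pv s') else var s' ''found'' = 0)) s4"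
          proof (rule wp_mono[OF pw], assumption, elim conjE)
            fix t5 s5 assume res: "Q.result s5" and t5: "t5 \<le> 38 * m + 18 * nA + 5 * Q.NT + 2 * ((42 * Q.np + 23) * (nA + 1)) + 21"
            have np: "Q.np \<le> 5 * m" using Q.NT_le unfolding Q.np_def by simp
            \<comment> \<open>\<open>42 * 5 + 23 = 233\<close>, and
              \<open>nA + 1 \<le> 2 * nA\<close>.\<close>
            have "(42 * Q.np + 23) * (nA + 1) \<le> (233 * m) * (2 * nA)"
              using np nA False by (intro mult_le_mono) linarith+
            then have a: "(42 * Q.np + 23) * (nA + 1) \<le> 466 * (nA * m)" by (simp add: mult.commute mult.left_commute)
            have b: "m \<le> nA * m" "nA \<le> nA * m" using nA False by simp_all
            \<comment> \<open>With \<open>Q.NT \<le> 3 * m\<close> the coefficients add up to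
              \<open>97 + 22 + 78 + 70 + 932 + 39 = 1238\<close>, well below 2000.\<close>
            have "2 + (t1 + (t2 + (t3 + (t4 + t5)))) \<le> K"
            proof -
              have "2 + (t1 + (t2 + (t3 + (t4 + t5)))) \<le> 97 * m + 22 * nA + 26 * Q.NT + 70 * (nA * m) + 2 * (466 * (nA * m)) + 39"
                using t1 t2 t3 t4 t5 a by linarith
              moreover have "1 \<le> nA * m" using nA False by simp
              moreover from this have "K = 2000 * (nA * m)" unfolding K_def by (simp add: max_def)
              ultimately show ?thesis using b Q.NT_le by linarith
            qed
            moreover have "if \<exists>M. popular G M then var s5 ''found'' = 1 \<and> popular G (output_matching G av pv s5) else var s5 ''found'' = 0"
            proof (cases "\<exists>P. Q.N.pop P")
              case True
              then obtain P where P: "Q.N.pop P" "var s5 ''found'' = 1" "\<And>i j. arr s5 ''mate'' i = Suc j \<longleftrightarrow> (\<exists>e<m. e \<in> P \<and> ow e = i \<and> post e = j)"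
                using res unfolding Q.result_def by auto
              have "output_matching G av pv s5 = Q.Mof P"
              proof (intro set_eqI)
                fix y :: "'a \<times> 'p"
                obtain a p where y: "y = (a, p)" by (cases y)
                show "y \<in> output_matching G av pv s5 \<longleftrightarrow> y \<in> Q.Mof P"
                  unfolding y Q.Mof_iff output_matching_def card_appl using P(3) ow(1) by simp blast
              qed
              moreover have "popular G (Q.Mof P)" using Q.popular_iff[of P] P(1) by (simp add: Q.N.pop_def)
              moreover have "\<exists>M. popular G M" using Q.popular_exists True by blast
              ultimately show ?thesis using P(2) by simp
            next
              case nopop: False
              then have "var s5 ''found'' = 0" using res unfolding Q.result_def by simp
              moreover have "\<not> (\<exists>M. popular G M)" using Q.popular_exists nopop by blast
              ultimately show ?thesis by simp
            qed
            ultimately show "2 + (t1 + (t2 + (t3 + (t4 + t5)))) \<le> K \<and>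
              (if \<exists>M. popular G M then var s5 ''found'' = 1 \<and> popular G (output_matching G av pv s5) else var s5 ''found'' = 0)" by blast
          qed
        qed
      qed
    qed
  qed
  then show ?thesis unfolding popular_prog_def K_def wp_Seq[of "Assign ''m'' (Read ''off'' (Var ''nA''))"] wp_Assign wp_If using off False by simp
qed

theorem theorem2:
  shows "\<exists>(prog :: com) (c :: nat).
    \<forall>(G :: ('a, 'p) inst) av pv s. well_formed G \<and> encodes G av pv s \<longrightarrow>
      (\<exists>t s'. exec prog s t s' \<and> t \<le> c * max 1 (card (appl G) * card (edges G)) \<and>
        (if \<exists>M. popular G M
         then var s' ''found'' = 1 \<and> popular G (output_matching G av pv s')
         else var s' ''found'' = 0))"
proof (rule exI[of _ popular_prog], rule exI[of _ 2000], intro allI impI)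
  fix G :: "('a, 'p) inst" and av pv s
  assume h: "well_formed G \<and> encodes G av pv s"
  interpret prob G av pv s using h by unfold_locales auto
  show "\<exists>t s'. exec popular_prog s t s' \<and> t \<le> 2000 * max 1 (card (appl G) * card (edges G)) \<and>
        (if \<exists>M. popular G M
         then var s' ''found'' = 1 \<and> popular G (output_matching G av pv s')
         else var s' ''found'' = 0)"
    using popular_prog_wp unfolding wp_def card_appl card_edges .
qed

end
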